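(* Let $d\ge 1$ be an integer, $R>0$, $X:=\overline{B(0,R)}\subset\mathbb{R}^d$, $1-\frac1d<\alpha<1$ and $C>0$. Let $\pi$ and $\pi_n$ ($n\in\mathbb{N}$) be Borel probability measures on $X\times X$ such that $\pi_n\to\pi$ weakly$^*$ in the sense of measures. For every $n\in\mathbb{N}$ let $\mathbf{P}_n\in\mathbf{OTP}(\pi_n)$ be an optimal traffic plan for the mailing problem with coupling $\pi_n$. Assume that $\mathbf{P}_n\in\mathbf{TP}_C$ for every $n$, and that there exists a traffic plan $\mathbf{P}$ (a probability measure on $\mathrm{Lip}_1$) such that $\mathbf{P}_n\to\mathbf{P}$ weakly$^*$ as $n\to\infty$. Then $\mathbf{P}$ is optimal, namely $\mathbf{P}\in\mathbf{OTP}(\pi)$, and moreover $\mathcal{E}^\alpha(\mathbf{P}_n)\to\mathcal{E}^\alpha(\mathbf{P})$.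
   Context: $\mathrm{Lip}_1$ is the space of $1$-Lipschitz curves $\gamma:[0,\infty)\to X$, with the topology of uniform convergence on compact subsets of $[0,\infty)$. The stopping time of $\gamma$ is $T(\gamma):=\inf\{t\ge0:\dot\gamma(s)=0\text{ for a.e. }s\ge t\}\in[0,\infty]$. A traffic plan here is a Borel probability measure $\mathbf{P}$ on $\mathrm{Lip}_1$ supported on (i.e. giving full measure to) the eventually constant curves, $\{\gamma: T(\gamma)<\infty\}$. On such curves $e_0(\gamma):=\gamma(0)$ and $e_\infty(\gamma):=\lim_{t\to\infty}\gamma(t)$. $\mathbf{P}$ has coupling $\pi$ if $(e_0,e_\infty)_\sharp\mathbf{P}=\pi$. The multiplicity of $\mathbf{P}$ at $x$ is $|x|_{\mathbf{P}}:=\mathbf{P}(\{\gamma\in\mathrm{Lip}_1:\gamma(t)=x\text{ for some }t\ge 0\})$, and the $\alpha$-energy is $$\mathcal{E}^\alpha(\mathbf{P}):=\int_{\mathrm{Lip}_1}\int_0^\infty|\gamma(t)|_{\mathbf{P}}^{\alpha-1}|\dot\gamma(t)|\,dt\,d\mathbf{P}(\gamma)\in[0,\infty],$$ with the convention $0^{\alpha-1}=+\infty$. $\mathbf{P}\in\mathbf{OTP}(\pi)$ means that $\mathbf{P}$ is a traffic plan with coupling $\pi$ and $\mathcal{E}^\alpha(\mathbf{P})\le\mathcal{E}^\alpha(\mathbf{P}')$ for every traffic plan $\mathbf{P}'$ with coupling $\pi$. $\mathbf{P}\in\mathbf{TP}_C$ means $\int_{\mathrm{Lip}_1}T(\gamma)\,d\mathbf{P}(\gamma)\le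 C$. Weak$^*$ convergence of traffic plans is the usual weak$^*$ convergence of Radon measures on $\mathrm{Lip}_1$. *)

theory Defs
  imports "HOL-Probability.Probability"
begin

section \<open>The space of 1-Lipschitz curves\<close>

text \<open>
  A curve on \<open>[0,\<infinity>)\<close> is a function on \<^typ>\<open>real\<close> that is \<^const>\<open>undefined\<close> at negative times
  (the extensional function space), so that equality of functions is equality of curves.
\<close>

definition Lip1 :: "'a::euclidean_space set \<Rightarrow> (real \<Rightarrow> 'a) set" where
  "Lip1 X = {\<gamma> \<in> {0..} \<rightarrow>\<^sub>E X. 1-lipschitz_on {0..} \<gamma>}"

definition Lip1_topology :: "'a::euclidean_space set \<Rightarrow> (real \<Rightarrow> 'a) topology" where
  "Lip1_topology X = topology (\<lambda>U. U \<subseteq> Lip1 X \<and>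
     (\<forall>\<gamma>\<in>U. \<exists>K \<epsilon>. compact K \<and> K \<subseteq> {0..} \<and> \<epsilon> > 0 \<and>
        {\<eta> \<in> Lip1 X. \<forall>t\<in>K. dist (\<eta> t) (\<gamma> t) < \<epsilon>} \<subseteq> U))"

lemma istopology_Lip1:
  "istopology (\<lambda>U. U \<subseteq> Lip1 X \<and>
     (\<forall>\<gamma>\<in>U. \<exists>K \<epsilon>. compact K \<and> K \<subseteq> {0..} \<and> \<epsilon> > 0 \<and>
        {\<eta> \<in> Lip1 X. \<forall>t\<in>K. dist (\<eta> t) (\<gamma> t) < \<epsilon>} \<subseteq> U))"
proof -
  define N where "N U \<gamma> \<longleftrightarrow> (\<exists>K \<epsilon>. compact K \<and> K \<subseteq> {0..} \<and> \<epsilon> > 0 \<and>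
    {\<eta> \<in> Lip1 X. \<forall>t\<in>K. dist (\<eta> t) (\<gamma> t) < \<epsilon>} \<subseteq> U)" for U and \<gamma> :: "real \<Rightarrow> 'a"
  have 1: "N (U \<inter> V) \<gamma>" if U: "N U \<gamma>" and V: "N V \<gamma>" for U V \<gamma>
  proof -
    obtain K \<epsilon> where K: "compact K" "K \<subseteq> {0..}" "\<epsilon> > 0"
      "{\<eta> \<in> Lip1 X. \<forall>t\<in>K. dist (\<eta> t) (\<gamma> t) < \<epsilon>} \<subseteq> U"
      using U unfolding N_def by (elim exE conjE)
    obtain K' \<epsilon>' where K': "compact K'" "K' \<subseteq> {0..}" "\<epsilon>' > 0"
      "{\<eta> \<in> Lip1 X. \<forall>t\<in>K'. dist (\<eta> t) (\<gamma> t) < \<epsilon>'} \<subseteq> V"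
      using V unfolding N_def by (elim exE conjE)
    have "{\<eta> \<in> Lip1 X. \<forall>t\<in>K \<union> K'. dist (\<eta> t) (\<gamma> t) < min \<epsilon> \<epsilon>'} \<subseteq> U \<inter> V"
      using K(4) K'(4) by auto
    moreover have "compact (K \<union> K')" "K \<union> K' \<subseteq> {0..}" "min \<epsilon> \<epsilon>' > 0"
      using K K' by auto
    ultimately show ?thesis unfolding N_def by blast
  qed
  have 2: "N V \<gamma>" if "N U \<gamma>" "U \<subseteq> V" for U V \<gamma>
    using that unfolding N_def by (meson subset_trans)
  have "istopology (\<lambda>U. U \<subseteq> Lip1 X \<and> (\<forall>\<gamma>\<in>U. N U \<gamma>))"
    unfolding istopology_def
  proof (intro conjI allI impI)
    fix \<U> assume "\<forall>U\<in>\<U>. U \<subseteq> Lip1 X \<and> (\<forall>\<gamma>\<in>U. N U \<gamma>)"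
    then show "\<forall>\<gamma>\<in>\<Union>\<U>. N (\<Union>\<U>) \<gamma>" by (meson 2 UnionE Union_upper)
  qed (use 1 in auto)
  then show ?thesis unfolding N_def .
qed

lemma openin_Lip1_topology:
  "openin (Lip1_topology X) U \<longleftrightarrow> U \<subseteq> Lip1 X \<and>
     (\<forall>\<gamma>\<in>U. \<exists>K \<epsilon>. compact K \<and> K \<subseteq> {0..} \<and> \<epsilon> > 0 \<and>
        {\<eta> \<in> Lip1 X. \<forall>t\<in>K. dist (\<eta> t) (\<gamma> t) < \<epsilon>} \<subseteq> U)"
  unfolding Lip1_topology_def using istopology_Lip1[of X] by (simp only: topology_inverse')

lemma topspace_Lip1_topology [simp]: "topspace (Lip1_topology X) = Lip1 X"
proof -
  have "openin (Lip1_topology X) (Lip1 X)"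
    unfolding openin_Lip1_topology by (auto intro!: exI[of _ "{}"] exI[of _ "1::real"])
  then show ?thesis
    by (metis openin_Lip1_topology openin_subset openin_topspace subset_antisym)
qed

lemma limitin_Lip1_topology:
  assumes "\<And>n. \<gamma> n \<in> Lip1 X" "\<eta> \<in> Lip1 X"
  shows "limitin (Lip1_topology X) \<gamma> \<eta> sequentially \<longleftrightarrow>
    (\<forall>K. compact K \<and> K \<subseteq> {0..} \<longrightarrow> uniform_limit K \<gamma> \<eta> sequentially)"
proof
  assume L: "limitin (Lip1_topology X) \<gamma> \<eta> sequentially"
  show "\<forall>K. compact K \<and> K \<subseteq> {0..} \<longrightarrow> uniform_limit K \<gamma> \<eta> sequentially"
  proof (intro allI impI uniform_limitI)
    fix K :: "real set" and e :: real assume K: "compact K \<and> K \<subseteq> {0..}" and e: "e > 0"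
    define U where "U = {\<xi> \<in> Lip1 X. \<exists>\<delta>>0. \<forall>t\<in>K. dist (\<xi> t) (\<eta> t) < e - \<delta>}"
    have nbhd: "\<exists>K' \<epsilon>. compact K' \<and> K' \<subseteq> {0..} \<and> \<epsilon> > 0 \<and>
        {\<zeta> \<in> Lip1 X. \<forall>t\<in>K'. dist (\<zeta> t) (\<xi> t) < \<epsilon>} \<subseteq> U" if "\<xi> \<in> U" for \<xi>
    proof -
      have "\<exists>\<delta>>0. \<forall>t\<in>K. dist (\<xi> t) (\<eta> t) < e - \<delta>" using that by (simp add: U_def)
      then obtain \<delta> where d: "\<delta> > 0" "\<And>t. t \<in> K \<Longrightarrow> dist (\<xi> t) (\<eta> t) < e - \<delta>" by blast
      have "\<zeta> \<in> U" if z: "\<zeta> \<in> Lip1 X" "\<And>t. t \<in> K \<Longrightarrow> dist (\<zeta> t) (\<xi> t) < \<delta>/2" for \<zeta>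
      proof -
        have "dist (\<zeta> t) (\<eta> t) < e - \<delta>/2" if "t \<in> K" for t
          using d(2)[OF that] z(2)[OF that] dist_triangle[of "\<zeta> t" "\<eta> t" "\<xi> t"] by linarith
        then show ?thesis unfolding U_def using z(1) d(1) by (auto intro!: exI[of _ "\<delta>/2"])
      qed
      then have "{\<zeta> \<in> Lip1 X. \<forall>t\<in>K. dist (\<zeta> t) (\<xi> t) < \<delta>/2} \<subseteq> U" by blast
      then show ?thesis
        using K d(1) by (intro exI[of _ K] exI[of _ "\<delta>/2"]) simp
    qed
    have "U \<subseteq> Lip1 X" by (simp add: U_def)
    then have "openin (Lip1_topology X) U"
      unfolding openin_Lip1_topology by (intro conjI ballI nbhd)
    moreover have "\<eta> \<in> U" unfolding U_def using assms(2) e by (auto intro!: exI[of _ "e/2"])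
    ultimately have "\<forall>\<^sub>F n in sequentially. \<gamma> n \<in> U" using L by (simp add: limitin_def)
    moreover have "dist (\<gamma> n t) (\<eta> t) < e" if n: "\<gamma> n \<in> U" and t: "t \<in> K" for n t
    proof -
      have "\<exists>\<delta>>0. \<forall>t\<in>K. dist (\<gamma> n t) (\<eta> t) < e - \<delta>" using n by (simp add: U_def)
      then obtain \<delta> where "\<delta> > 0" "dist (\<gamma> n t) (\<eta> t) < e - \<delta>" using t by blast
      then show ?thesis by linarith
    qed
    ultimately show "\<forall>\<^sub>F n in sequentially. \<forall>t\<in>K. dist (\<gamma> n t) (\<eta> t) < e"
      by (simp add: eventually_mono)
  qed
next
  assume R: "\<forall>K. compact K \<and> K \<subseteq> {0..} \<longrightarrow> uniform_limit K \<gamma> \<eta> sequentially"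
  show "limitin (Lip1_topology X) \<gamma> \<eta> sequentially"
    unfolding limitin_def
  proof (intro conjI allI impI)
    fix U assume U: "openin (Lip1_topology X) U \<and> \<eta> \<in> U"
    then have "\<exists>K \<epsilon>. compact K \<and> K \<subseteq> {0..} \<and> \<epsilon> > 0 \<and>
        {\<xi> \<in> Lip1 X. \<forall>t\<in>K. dist (\<xi> t) (\<eta> t) < \<epsilon>} \<subseteq> U"
      by (simp add: openin_Lip1_topology)
    then obtain K \<epsilon> where K: "compact K" "K \<subseteq> {0..}" "\<epsilon> > 0"
      "{\<xi> \<in> Lip1 X. \<forall>t\<in>K. dist (\<xi> t) (\<eta> t) < \<epsilon>} \<subseteq> U"
      by (elim exE conjE)
    then have "\<forall>\<^sub>F n in sequentially. \<forall>t\<in>K. dist (\<gamma> n t) (\<eta> t) < \<epsilon>"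
      by (intro uniform_limitD R[rule_format] conjI)
    then show "\<forall>\<^sub>F n in sequentially. \<gamma> n \<in> U"
      by eventually_elim (use K(4) assms(1) in blast)
  qed (use assms in simp)
qed

section \<open>Borel probability measures and weak* convergence\<close>

definition borel_of :: "'b topology \<Rightarrow> 'b measure" where
  "borel_of T = sigma (topspace T) {U. openin T U}"

lemma sets_borel_of_top_of_set: "sets (borel_of (top_of_set S)) = sets (restrict_space borel S)"
proof -
  have open_eq: "{U. openin (top_of_set S) U} = {(\<lambda>x. x) -` A \<inter> S | A. A \<in> {U. open U}}"
    by (auto simp: openin_open)
  have "sets (borel_of (top_of_set S)) = sigma_sets S {U. openin (top_of_set S) U}"
    unfolding borel_of_def by (subst sets_measure_of) (auto simp: openin_open)
  also have "\<dots> = {(\<lambda>x. x) -` A \<inter> S | A. A \<in> sigma_sets UNIV {U. open U}}"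
    unfolding open_eq
    using sigma_sets_vimage_commute[of "\<lambda>x. x" S UNIV "{U. open U}"] by simp
  also have "\<dots> = (\<inter>) S ` sets borel"
    by (simp add: borel_def Setcompr_eq_image Int_commute)
  finally show ?thesis by (simp add: sets_restrict_space)
qed

definition borel_prob :: "'b topology \<Rightarrow> 'b measure \<Rightarrow> bool" where
  "borel_prob T M \<longleftrightarrow> prob_space M \<and> sets M = sets (borel_of T)"

text \<open>
  Weak* convergence is tested against the bounded continuous functions. It is used below only for
  the compact spaces \<open>X \<times> X\<close> and \<open>Lip1 X\<close> (with \<open>X\<close> compact), where these are all the continuous
  functions and also the compactly supported ones.
\<close>

definition weak_star_conv :: "'b topology \<Rightarrow> (nat \<Rightarrow> 'b measure) \<Rightarrow> 'b measure \<Rightarrow> bool" where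
  "weak_star_conv T M L \<longleftrightarrow>
     (\<forall>f :: 'b \<Rightarrow> real. continuous_map T euclideanreal f \<and> bounded (f ` topspace T) \<longrightarrow>
        (\<lambda>n. \<integral>x. f x \<partial>M n) \<longlonglongrightarrow> (\<integral>x. f x \<partial>L))"

section \<open>Traffic plans\<close>

text \<open>
  A Lipschitz curve is differentiable at almost every time. The value of \<^const>\<open>vector_derivative\<close>
  at the other times is unspecified, but it only enters up to Lebesgue-null sets of times.
  The infimum of the empty set is \<open>\<infinity>\<close>.
\<close>

definition stopping_time :: "(real \<Rightarrow> 'a::euclidean_space) \<Rightarrow> ennreal" where
  "stopping_time \<gamma> = (INF t \<in> {t. 0 \<le> t \<and>
     (AE s in lborel. t \<le> s \<longrightarrow> vector_derivative \<gamma> (at s) = 0)}. ennreal t)"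

definition traffic_plan :: "'a::euclidean_space set \<Rightarrow> (real \<Rightarrow> 'a) measure \<Rightarrow> bool" where
  "traffic_plan X P \<longleftrightarrow>
     borel_prob (Lip1_topology X) P \<and> (AE \<gamma> in P. stopping_time \<gamma> < \<infinity>)"

definition e_0 :: "(real \<Rightarrow> 'a::euclidean_space) \<Rightarrow> 'a" where
  "e_0 \<gamma> = \<gamma> 0"

text \<open>
  Traffic plans give measure zero to the curves that are not eventually constant. There the value
  \<open>\<gamma> 0\<close> is a dummy that keeps \<open>e_infty\<close> a map into \<open>X\<close> on all of \<open>Lip1 X\<close>.
\<close>

definition e_infty :: "(real \<Rightarrow> 'a::euclidean_space) \<Rightarrow> 'a" where
  "e_infty \<gamma> = (if stopping_time \<gamma> < \<infinity> then Lim at_top \<gamma> else \<gamma> 0)"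

definition has_coupling ::
    "'a::euclidean_space set \<Rightarrow> (real \<Rightarrow> 'a) measure \<Rightarrow> ('a \<times> 'a) measure \<Rightarrow> bool" where
  "has_coupling X P \<pi> \<longleftrightarrow>
     distr P (borel_of (top_of_set (X \<times> X))) (\<lambda>\<gamma>. (e_0 \<gamma>, e_infty \<gamma>)) = \<pi>"

definition multiplicity_at :: "(real \<Rightarrow> 'a::euclidean_space) measure \<Rightarrow> 'a \<Rightarrow> real" where
  "multiplicity_at P x = measure P {\<gamma> \<in> space P. \<exists>t\<ge>0. \<gamma> t = x}"

text \<open>
  The power \<open>m\<^bsup>\<alpha>-1\<^esup>\<close> with the convention \<open>0\<^bsup>\<alpha>-1\<^esup> = \<infinity>\<close> (whereas \<open>0 powr a = 0\<close> in the library).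
  In the energy, \<open>\<infinity> * 0 = 0\<close>, as usual in integration theory.
\<close>

definition mult_power :: "real \<Rightarrow> real \<Rightarrow> ennreal" where
  "mult_power \<alpha> m = (if m = 0 then \<infinity> else ennreal (m powr (\<alpha> - 1)))"

definition energy :: "real \<Rightarrow> (real \<Rightarrow> 'a::euclidean_space) measure \<Rightarrow> ennreal" where
  "energy \<alpha> P = (\<integral>\<^sup>+\<gamma>. (\<integral>\<^sup>+t\<in>{0..}. mult_power \<alpha> (multiplicity_at P (\<gamma> t)) *
     ennreal (norm (vector_derivative \<gamma> (at t))) \<partial>lborel) \<partial>P)"

definition OTP ::
    "'a::euclidean_space set \<Rightarrow> real \<Rightarrow> ('a \<times> 'a) measure \<Rightarrow> (real \<Rightarrow> 'a) measure set" where
  "OTP X \<alpha> \<pi> = {P. traffic_plan X P \<and> has_coupling X P \<pi> \<and>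
     (\<forall>P'. traffic_plan X P' \<and> has_coupling X P' \<pi> \<longrightarrow> energy \<alpha> P \<le> energy \<alpha> P')}"

definition TP :: "'a::euclidean_space set \<Rightarrow> real \<Rightarrow> (real \<Rightarrow> 'a) measure set" where
  "TP X C = {P. traffic_plan X P \<and> (\<integral>\<^sup>+\<gamma>. stopping_time \<gamma> \<partial>P) \<le> ennreal C}"

end

theory Submission
  imports Defs
begin

text \<open>
  The argument is the direct method. Lower semicontinuity (\<open>energy_lsc\<close>) bounds the energy of \<open>P\<close> by
  the lower limit of the energies of \<open>Pn n\<close>. A recovery sequence (\<open>recovery_sequence\<close>) bounds the upper
  limit: a plan \<open>P'\<close> with coupling \<open>\<pi>\<close> can be modified, for large \<open>n\<close>, into a plan with coupling \<open>\<pi>n n\<close>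
  at an arbitrarily small additional cost, and \<open>Pn n\<close> does not cost more than this modification. As \<open>P\<close>
  itself has coupling \<open>\<pi>\<close> (\<open>coupling_of_limit\<close>), comparing with all \<open>P'\<close> gives optimality, and the case
  \<open>P' = P\<close> gives convergence of the energies.

  Lower semicontinuity. Hitting a point is a closed condition up to the curves that still move at a
  late time \<open>M\<close>, and these have mass at most \<open>C / M\<close>. So the multiplicities of \<open>Pn n\<close> are eventually
  below a Lipschitz function of the point which is only slightly larger than the multiplicity of \<open>P\<close>.
  Since the exponent \<open>\<alpha> - 1\<close> is negative, the energies are bounded from below by weighted lengths with
  a fixed Lipschitz weight; these are limits of continuous functionals of the curve
  (\<open>weighted_length_lsc\<close>). Passing from functionals of increments to the derivative in the definition
  of the energy requires that Lipschitz functions on the line be differentiable almost everywhere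
  (\<open>lipschitz_differentiable_AE\<close>), which is deduced from the Vitali covering theorem.

  Recovery sequence. The curves of \<open>P'\<close> are kept, and their end points are moved by bridges: from the
  prescribed starting point to the start of the curve, and from its end to the prescribed final point.
  All bridges from \<open>x\<close> to \<open>y\<close> follow one rule: leave \<open>x\<close> along a path which, once it has reached the
  scale \<open>2^-k\<close>, depends only on the dyadic cell of \<open>x\<close> of that scale, cross over to the path of \<open>y\<close>,
  and follow it backwards. Thus masses of the same cell travel together, whatever their destinations are,
  and the concavity of the power bounds the cost of scale \<open>2^-k\<close> by a multiple of
  \<open>2^-k * (2^(k * d))^(1 - \<alpha>)\<close> (\<open>branching_cost\<close>). This is summable exactly because
  \<open>\<alpha> > 1 - 1 / d\<close>, so that bridges over short distances are cheap even though they respect an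
  arbitrary coupling (\<open>short_bridge_cost\<close>).
  To decide which end points are assigned to which curve of \<open>P'\<close>, a fine partition of unity of
  \<open>X \<times> X\<close> is used: within the support of one of its functions, curves and end points are paired
  independently. Weak convergence makes the masses of \<open>\<pi>n n\<close> and \<open>\<pi>\<close> on these supports nearly equal; the
  small excess of \<open>\<pi>n n\<close> is sent over long bridges, whose cost tends to zero with the mass.
\<close>

section \<open>Lipschitz functions on the line are differentiable almost everywhere\<close>

text \<open>
  On the line the closed balls of the Vitali covering theorem are the closed intervals, and
  sufficiently short ones stay inside the open set \<open>U\<close>.
\<close>

lemma Vitali_covering_intervals:
  fixes E U :: "real set"
  assumes "open U" "E \<subseteq> U"
    and small: "\<And>x d. x \<in> E \<Longrightarrow> d > 0 \<Longrightarrow> \<exists>u v. u < v \<and> u \<le> x \<and> x \<le> v \<and> v - u < d \<and> Q u v"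
  obtains D where "countable D" "\<And>u v. (u, v) \<in> D \<Longrightarrow> u < v \<and> Q u v \<and> {u..v} \<subseteq> U"
    "disjoint_family_on (\<lambda>(u, v). {u..v}) D" "negligible (E - (\<Union>(u, v)\<in>D. {u..v}))"
proof -
  let ?K = "{(u, v). u < v \<and> Q u v \<and> {u..v} \<subseteq> U}"
  let ?a = "\<lambda>(u, v). (u + v) / 2 :: real" and ?r = "\<lambda>(u, v). (v - u) / 2 :: real"
  have cb: "cball (?a i) (?r i) = (\<lambda>(u, v). {u..v}) i" for i
    by (cases i) (simp add: cball_eq_atLeastAtMost field_simps)
  have "\<exists>i. i \<in> ?K \<and> x \<in> cball (?a i) (?r i) \<and> ?r i < d" if x: "x \<in> E" and d: "0 < d" for x d
  proof -
    obtain e where e: "e > 0" "ball x e \<subseteq> U" using assms x by (meson openE subsetD)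
    obtain u v where uv: "u < v" "u \<le> x" "x \<le> v" "v - u < min d e" "Q u v"
      using small[OF x, of "min d e"] d e by auto
    have "{u..v} \<subseteq> ball x e" using uv by (auto simp: dist_real_def)
    then have "(u, v) \<in> ?K" using uv e by auto
    moreover have "x \<in> cball (?a (u, v)) (?r (u, v))" unfolding cb using uv by simp
    moreover have "?r (u, v) < d" using uv by simp
    ultimately show ?thesis by blast
  qed
  note ex = this
  obtain C where C: "countable C" "C \<subseteq> ?K"
     "pairwise (\<lambda>i j. disjnt (cball (?a i) (?r i)) (cball (?a j) (?r j))) C"
     "negligible (E - (\<Union>i \<in> C. cball (?a i) (?r i)))"
  proof (rule Vitali_covering_theorem_cballs[of ?K ?r E ?a])
    show "0 < ?r i" if "i \<in> ?K" for i using that by auto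
  qed (rule ex)
  show thesis
  proof (rule that[of C])
    show "countable C" by fact
    show "\<And>u v. (u, v) \<in> C \<Longrightarrow> u < v \<and> Q u v \<and> {u..v} \<subseteq> U" using C(2) by auto
    show "disjoint_family_on (\<lambda>(u, v). {u..v}) C"
      using C(3) unfolding cb disjoint_family_on_def pairwise_def disjnt_def by auto
    show "negligible (E - (\<Union>(u, v)\<in>C. {u..v}))" using C(4) unfolding cb by simp
  qed
qed

lemma emeasure_le_of_negligible_diff:
  fixes E S :: "real set"
  assumes [measurable]: "E \<in> sets borel" "S \<in> sets borel" and "negligible (E - S)"
  shows "emeasure lborel E \<le> emeasure lborel (E \<inter> S)"
proof -
  have "E - S \<in> null_sets lborel"
  proof -
    have "E - S \<in> sets lborel" by measurable
    moreover have "emeasure lebesgue (E - S) = 0" using assms(3) by (simp add: negligible_iff_null_sets null_setsD1)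
    ultimately show ?thesis by (simp add: null_sets_def)
  qed
  have "emeasure lborel E \<le> emeasure lborel ((E \<inter> S) \<union> (E - S))"
    by (intro emeasure_mono) auto
  also have "\<dots> = emeasure lborel (E \<inter> S)"
    by (rule emeasure_Un_null_set) (use \<open>E - S \<in> null_sets lborel\<close> in auto)
  finally show ?thesis .
qed

text \<open>
  Disjoint steep intervals cover almost all of \<open>E\<close>, and their increments add up to at most the total
  increment. The measure with distribution function \<open>f\<close> keeps track of the increments.
\<close>

lemma emeasure_le_increment_steep:
  fixes f :: "real \<Rightarrow> real"
  assumes f: "mono f" "continuous_on UNIV f" and E: "E \<in> sets borel" "E \<subseteq> {a<..<b}" and "a < b" "q \<ge> 0"
    and steep: "\<And>x d. x \<in> E \<Longrightarrow> d > 0 \<Longrightarrow>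
      \<exists>u v. u < v \<and> u \<le> x \<and> x \<le> v \<and> v - u < d \<and> f v - f u > q * (v - u)"
  shows "ennreal q * emeasure lborel E \<le> ennreal (f b - f a)"
proof -
  obtain D where D: "countable D" "\<And>u v. (u, v) \<in> D \<Longrightarrow> u < v \<and> f v - f u > q * (v - u) \<and> {u..v} \<subseteq> {a<..<b}"
    "disjoint_family_on (\<lambda>(u, v). {u..v}) D" "negligible (E - (\<Union>(u, v)\<in>D. {u..v}))"
    using Vitali_covering_intervals[OF _ E(2) steep] by (metis open_greaterThanLessThan)
  let ?I = "\<lambda>(u::real, v). {u..v}"
  let ?m = "interval_measure f"
  have sets: "?I i \<in> sets borel" for i by (cases i) auto
  have cont: "continuous (at_right x) f" "continuous (at x) f" for x
    using f(2) by (auto simp: continuous_on_eq_continuous_within continuous_at_imp_continuous_at_within)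
  have mono: "x \<le> y \<Longrightarrow> f x \<le> f y" for x y using f(1) by (simp add: monoD)
  have em: "emeasure ?m {u..v} = ennreal (f v - f u)" if "u \<le> v" for u v
    using emeasure_interval_measure_Icc[of u v f] that mono f(2) continuous_on_subset by auto
  have "ennreal q * emeasure lborel E \<le> ennreal q * emeasure lborel (E \<inter> (\<Union>i\<in>D. ?I i))"
    using D(1,4) E sets by (intro mult_left_mono emeasure_le_of_negligible_diff sets.countable_UN') auto
  also have "\<dots> \<le> ennreal q * emeasure lborel (\<Union>i\<in>D. ?I i)"
    using D(1) E sets by (intro mult_left_mono emeasure_mono) (auto intro!: sets.countable_UN')
  also have "\<dots> = ennreal q * (\<integral>\<^sup>+i. emeasure lborel (?I i) \<partial>count_space D)"
    using D sets by (subst emeasure_UN_countable) auto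
  also have "\<dots> = (\<integral>\<^sup>+i. ennreal q * emeasure lborel (?I i) \<partial>count_space D)"
    by (simp add: nn_integral_cmult)
  also have "\<dots> \<le> (\<integral>\<^sup>+i. emeasure ?m (?I i) \<partial>count_space D)"
  proof (rule nn_integral_mono)
    fix i assume "i \<in> space (count_space D)"
    then obtain u v where i: "i = (u, v)" "(u, v) \<in> D" by (cases i) auto
    show "ennreal q * emeasure lborel (?I i) \<le> emeasure ?m (?I i)"
      using D(2)[OF i(2)] i(1) \<open>q \<ge> 0\<close> em[of u v] by (simp add: ennreal_mult[symmetric] ennreal_leI)
  qed
  also have "\<dots> = emeasure ?m (\<Union>i\<in>D. ?I i)"
    using D sets by (subst emeasure_UN_countable) auto
  also have "\<dots> \<le> emeasure ?m {a..b}"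
    using D(2) by (intro emeasure_mono) (fastforce, simp)
  finally show ?thesis using em[of a b] \<open>a < b\<close> by simp
qed

text \<open>
  Disjoint flat intervals, inside an open set \<open>U\<close> that is hardly larger than \<open>E\<close>, cover almost all of
  \<open>E\<close>. In each of them the part of \<open>E\<close> is bounded by the increment, because \<open>E\<close> is also steep. Hence
  \<open>q\<close> times the measure of \<open>E\<close> is at most \<open>p\<close> times that of \<open>U\<close>, which forces \<open>E\<close> to be null.
\<close>

lemma flat_and_steep_null:
  fixes f :: "real \<Rightarrow> real"
  assumes f: "mono f" "continuous_on UNIV f" and E: "E \<in> sets borel" "bounded E" and pq: "0 \<le> p" "p < q"
    and flat: "\<And>x d. x \<in> E \<Longrightarrow> d > 0 \<Longrightarrow>
      \<exists>u v. u < v \<and> u \<le> x \<and> x \<le> v \<and> v - u < d \<and> f v - f u < p * (v - u)"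
    and steep: "\<And>x d. x \<in> E \<Longrightarrow> d > 0 \<Longrightarrow>
      \<exists>u v. u < v \<and> u \<le> x \<and> x \<le> v \<and> v - u < d \<and> f v - f u > q * (v - u)"
  shows "emeasure lborel E = 0"
proof -
  have fin: "emeasure lborel E < \<infinity>" by (rule emeasure_bounded_finite[OF E(2)])
  have *: "ennreal q * emeasure lborel E \<le> ennreal p * emeasure lborel U" if U: "open U" "E \<subseteq> U" for U
  proof -
    obtain D where D: "countable D" "\<And>u v. (u, v) \<in> D \<Longrightarrow> u < v \<and> f v - f u < p * (v - u) \<and> {u..v} \<subseteq> U"
      "disjoint_family_on (\<lambda>(u, v). {u..v}) D" "negligible (E - (\<Union>(u, v)\<in>D. {u..v}))"
      using Vitali_covering_intervals[OF U flat] by metis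
    let ?I = "\<lambda>(u::real, v). {u..v}"
    have sets: "?I i \<in> sets borel" for i by (cases i) auto
    have "ennreal q * emeasure lborel E \<le> ennreal q * emeasure lborel (E \<inter> (\<Union>i\<in>D. ?I i))"
      using D(1,4) E sets by (intro mult_left_mono emeasure_le_of_negligible_diff sets.countable_UN') auto
    also have "E \<inter> (\<Union>i\<in>D. ?I i) = (\<Union>i\<in>D. E \<inter> ?I i)" by auto
    also have "ennreal q * emeasure lborel (\<Union>i\<in>D. E \<inter> ?I i)
        = ennreal q * (\<integral>\<^sup>+i. emeasure lborel (E \<inter> ?I i) \<partial>count_space D)"
    proof (subst emeasure_UN_countable)
      show "disjoint_family_on (\<lambda>i. E \<inter> ?I i) D"
        using D(3) unfolding disjoint_family_on_def by blast
    qed (use D sets E in auto)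
    also have "\<dots> = (\<integral>\<^sup>+i. ennreal q * emeasure lborel (E \<inter> ?I i) \<partial>count_space D)"
      by (simp add: nn_integral_cmult)
    also have "\<dots> \<le> (\<integral>\<^sup>+i. ennreal p * emeasure lborel (?I i) \<partial>count_space D)"
    proof (rule nn_integral_mono)
      fix i assume "i \<in> space (count_space D)"
      then obtain u v where i: "i = (u, v)" "(u, v) \<in> D" by (cases i) auto
      note uv = D(2)[OF i(2)]
      (* The bound for steep sets concerns open intervals. *)
      have "negligible (E \<inter> {u..v} - {u<..<v})"
        by (rule negligible_subset[of "{u, v}"]) auto
      then have "ennreal q * emeasure lborel (E \<inter> {u..v}) \<le> ennreal q * emeasure lborel (E \<inter> {u..v} \<inter> {u<..<v})"
        using E by (intro mult_left_mono emeasure_le_of_negligible_diff) auto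
      also have "\<dots> \<le> ennreal (f v - f u)"
        using uv f E pq steep by (intro emeasure_le_increment_steep) auto
      also have "\<dots> \<le> ennreal (p * (v - u))" using uv by (simp add: ennreal_leI)
      finally show "ennreal q * emeasure lborel (E \<inter> ?I i) \<le> ennreal p * emeasure lborel (?I i)"
        using i(1) uv pq by (simp add: ennreal_mult)
    qed
    also have "\<dots> = ennreal p * (\<integral>\<^sup>+i. emeasure lborel (?I i) \<partial>count_space D)"
      by (simp add: nn_integral_cmult)
    also have "\<dots> = ennreal p * emeasure lborel (\<Union>i\<in>D. ?I i)"
      using D sets by (subst emeasure_UN_countable) auto
    also have "\<dots> \<le> ennreal p * emeasure lborel U"
      using D(2) U(1) by (intro mult_left_mono emeasure_mono) auto
    finally show ?thesis .
  qed
  obtain x where x: "x \<ge> 0" "emeasure lborel E = ennreal x" using fin by (cases "emeasure lborel E") auto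
  have "q * x \<le> p * x + p * e" if "e > 0" for e
  proof -
    obtain U where U: "open U" "E \<subseteq> U" "emeasure lborel (U - E) < ennreal e"
      using outer_regular_lborel[of E e] E \<open>e > 0\<close> by auto
    have "emeasure lborel U \<le> emeasure lborel E + emeasure lborel (U - E)"
      using U E by (subst plus_emeasure) (auto simp: Un_absorb1 intro!: emeasure_mono)
    also have "\<dots> \<le> ennreal (x + e)" using x U(3) that by (auto simp: ennreal_plus intro!: add_mono)
    finally have "ennreal q * ennreal x \<le> ennreal p * ennreal (x + e)"
      using *[OF U(1,2)] x(2) by (metis (no_types) mult_left_mono order_trans zero_le)
    then have "ennreal (q * x) \<le> ennreal (p * (x + e))" using x pq that by (simp add: ennreal_mult)
    then show ?thesis using x pq that by (subst (asm) ennreal_le_iff) (auto simp: distrib_left)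
  qed
  note le = this
  have "q * x \<le> p * x"
  proof (rule field_le_epsilon)
    fix e :: real assume "e > 0"
    then have "p * (e / (p + 1)) \<le> e" using pq by (simp add: field_simps)
    moreover have "q * x \<le> p * x + p * (e / (p + 1))" using \<open>e > 0\<close> pq by (intro le) simp
    ultimately show "q * x \<le> p * x + e" by linarith
  qed
  then have "x = 0" using pq x by (smt (verit) mult_strict_right_mono)
  then show ?thesis using x by simp
qed

text \<open>
  Enlarging the interval slightly keeps the slope below \<open>p\<close> and makes its points interior points.
\<close>

lemma slope_perturb:
  fixes f :: "real \<Rightarrow> real"
  assumes "continuous_on UNIV f" "u < v" "v - u < d" "f v - f u < p * (v - u)"
  shows "\<exists>e>0. (v + e) - (u - e) < d \<and> f (v + e) - f (u - e) < p * ((v + e) - (u - e))"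
proof -
  let ?g = "\<lambda>e. p * ((v + e) - (u - e)) - (f (v + e) - f (u - e))"
  have f: "isCont f x" for x using assms(1) by (simp add: continuous_on_eq_continuous_at)
  have "(?g \<longlongrightarrow> ?g 0) (at 0)"
    by (intro tendsto_intros isCont_tendsto_compose[of _ f, OF f])
  then have "((\<lambda>e. ?g e) \<longlongrightarrow> ?g 0) (at_right 0)"
    by (rule filterlim_mono) (auto simp: at_within_le_at)
  moreover have "?g 0 > 0" using assms by simp
  ultimately have "\<forall>\<^sub>F e in at_right 0. ?g e > 0" by (rule order_tendstoD(1))
  moreover have "\<forall>\<^sub>F e in at_right 0. e < (d - (v - u)) / 2"
    using assms by (intro eventually_at_rightI[of 0 "(d - (v - u)) / 2"]) auto
  moreover have "\<forall>\<^sub>F e in at_right (0::real). e > 0" by (simp add: eventually_at_right_less)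
  ultimately have "\<forall>\<^sub>F e in at_right 0. e > 0 \<and> (v + e) - (u - e) < d \<and> ?g e > 0"
    by eventually_elim (auto simp: field_simps)
  then have "\<exists>e. e > 0 \<and> (v + e) - (u - e) < d \<and> ?g e > 0"
    by (rule eventually_happens'[rotated]) simp
  then show ?thesis by auto
qed

text \<open>
  Points in arbitrarily short open intervals with slope below \<open>p\<close>. Open intervals make this set a
  countable intersection of open sets. The points in short intervals with slope above \<open>q\<close> are
  \<open>flat_points (\<lambda>x. - f x) (- q)\<close>.
\<close>

definition flat_points :: "(real \<Rightarrow> real) \<Rightarrow> real \<Rightarrow> real set" where
  "flat_points f p = (\<Inter>n::nat. \<Union>{{u<..<v} | u v.
     u < v \<and> v - u < 1 / real (Suc n) \<and> f v - f u < p * (v - u)})"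

lemma flat_points_borel [measurable]: "flat_points f p \<in> sets borel"
proof -
  have "\<Union>{{u<..<v} | u v. u < v \<and> v - u < 1 / real (Suc n) \<and> f v - f u < p * (v - u)} \<in> sets borel" for n
    by (rule borel_open, rule open_Union) auto
  then show ?thesis unfolding flat_points_def by (intro sets.countable_INT) auto
qed

lemma flat_pointsD:
  assumes "x \<in> flat_points f p" "d > 0"
  shows "\<exists>u v. u < v \<and> u \<le> x \<and> x \<le> v \<and> v - u < d \<and> f v - f u < p * (v - u)"
proof -
  obtain n where "1 / real (Suc n) < d" using assms(2) nat_approx_posE by blast
  moreover have "x \<in> \<Union>{{u<..<v} | u v. u < v \<and> v - u < 1 / real (Suc n) \<and> f v - f u < p * (v - u)}"
    using assms(1) unfolding flat_points_def by blast
  then obtain u v where "u < v" "v - u < 1 / real (Suc n)" "f v - f u < p * (v - u)" "x \<in> {u<..<v}"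
    by blast
  ultimately show ?thesis by (intro exI[of _ u] exI[of _ v]) auto
qed

lemma flat_pointsI:
  assumes "continuous_on UNIV f"
    and *: "\<exists>\<^sub>F h in at 0. (f (x + h) - f x) / h < p"
  shows "x \<in> flat_points f p"
  unfolding flat_points_def
proof (intro INT_I)
  fix n :: nat
  have "\<forall>\<^sub>F h in at (0::real). h \<noteq> 0 \<and> \<bar>h\<bar> < 1 / real (Suc n)"
    using eventually_at[of "\<lambda>h. h \<noteq> 0 \<and> \<bar>h\<bar> < 1 / real (Suc n)" "0::real" UNIV] by (auto simp: dist_real_def intro!: exI[of _ "1 / real (Suc n)"])
  then have "\<exists>\<^sub>F h in at 0. (f (x + h) - f x) / h < p \<and> (h \<noteq> 0 \<and> \<bar>h\<bar> < 1 / real (Suc n))"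
    using * by (rule frequently_eventually_frequently[rotated])
  then obtain h where h: "(f (x + h) - f x) / h < p" "h \<noteq> 0" "\<bar>h\<bar> < 1 / real (Suc n)"
    using frequently_ex by blast
  define u v where "u = min x (x + h)" and "v = max x (x + h)"
  have uv: "u < v" "v - u < 1 / real (Suc n)" "f v - f u < p * (v - u)" "u \<le> x" "x \<le> v"
    using h by (auto simp: u_def v_def min_def max_def field_simps split: if_splits)
  obtain e where e: "e > 0" "(v + e) - (u - e) < 1 / real (Suc n)" "f (v + e) - f (u - e) < p * ((v + e) - (u - e))"
    using slope_perturb[OF assms(1) uv(1-3)] by auto
  have "x \<in> {u - e<..<v + e}" using uv e by auto
  then show "x \<in> \<Union>{{u<..<v} | u v. u < v \<and> v - u < 1 / real (Suc n) \<and> f v - f u < p * (v - u)}"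
    using e uv by (intro UnionI[of "{u - e<..<v + e}"] CollectI exI[of _ "u - e"] exI[of _ "v + e"]) auto
qed

text \<open>
  If the lower and the upper limit of the difference quotients at a point are different, then two
  rational numbers separate them, and the point is flat for the one and steep for the other. Such
  points form a null set for each of the countably many pairs. The Lipschitz condition is what
  makes the common limit finite.
\<close>

lemma mono_lipschitz_differentiable_AE:
  fixes f :: "real \<Rightarrow> real"
  assumes f: "mono f" "L-lipschitz_on UNIV f"
  shows "AE x in lborel. f differentiable at x"
proof -
  have cont: "continuous_on UNIV f" using f(2) lipschitz_on_continuous_on by blast
  have contm: "continuous_on UNIV (\<lambda>x. - f x)" using cont by (intro continuous_intros)
  define B where "B = (\<Union>(p, q)\<in>{(p, q). p \<in> \<rat> \<and> q \<in> \<rat> \<and> 0 \<le> p \<and> p < q}.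
     \<Union>n::nat. flat_points f p \<inter> flat_points (\<lambda>x. - f x) (- q) \<inter> {- real n..real n})"
  have 1: "flat_points f p \<inter> flat_points (\<lambda>x. - f x) (- q) \<inter> {- real n..real n} \<in> null_sets lborel" (is "?E \<in> _")
    if pq: "0 \<le> p" "p < q" for p q n
  proof -
    have "emeasure lborel ?E = 0"
    proof (rule flat_and_steep_null[OF f(1) cont _ _ pq])
      show "bounded ?E" by (rule bounded_subset[of "{- real n..real n}"]) auto
    next
      fix x d :: real assume "x \<in> ?E" "d > 0"
      then show "\<exists>u v. u < v \<and> u \<le> x \<and> x \<le> v \<and> v - u < d \<and> f v - f u < p * (v - u)"
        by (intro flat_pointsD) auto
    next
      fix x d :: real assume "x \<in> ?E" "d > 0"
      then have "\<exists>u v. u < v \<and> u \<le> x \<and> x \<le> v \<and> v - u < d \<and> - f v - - f u < - q * (v - u)"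
        by (intro flat_pointsD) auto
      then show "\<exists>u v. u < v \<and> u \<le> x \<and> x \<le> v \<and> v - u < d \<and> f v - f u > q * (v - u)"
        by (auto simp: field_simps)
    qed measurable
    then show ?thesis by (intro null_setsI) measurable
  qed
  have "countable {(p, q). p \<in> \<rat> \<and> q \<in> \<rat> \<and> 0 \<le> p \<and> p < (q::real)}"
    by (rule countable_subset[of _ "\<rat> \<times> \<rat>"]) (auto intro: countable_rat)
  then have B: "B \<in> null_sets lborel"
    unfolding B_def
  proof (rule null_sets_UN')
    fix i :: "real \<times> real" assume "i \<in> {(p, q). p \<in> \<rat> \<and> q \<in> \<rat> \<and> 0 \<le> p \<and> p < q}"
    then show "(case i of (p, q) \<Rightarrow> \<Union>n::nat. flat_points f p \<inter> flat_points (\<lambda>x. - f x) (- q) \<inter> {- real n..real n}) \<in> null_sets lborel"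
      by (cases i) (simp only: prod.case, rule null_sets_UN, rule 1, auto)
  qed
  have "f differentiable at x" if x: "x \<notin> B" for x
  proof -
    define s where "s h = (f (x + h) - f x) / h" for h
    have s: "0 \<le> s h" "s h \<le> L" if "h \<noteq> 0" for h
    proof -
      show "0 \<le> s h" using f(1) that unfolding s_def
        by (cases "h > 0") (auto simp: mono_def zero_le_divide_iff)
      have "\<bar>f (x + h) - f x\<bar> \<le> L * \<bar>h\<bar>" using lipschitz_onD[OF f(2), of "x + h" x] by (simp add: dist_real_def)
      then have "\<bar>s h\<bar> \<le> L" using that by (simp add: s_def abs_divide field_simps)
      then show "s h \<le> L" by simp
    qed
    have ev: "\<forall>\<^sub>F h in at 0. ereal (s h) \<in> {0..ereal L}"
      using s by (auto simp: eventually_at intro!: exI[of _ 1])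
    let ?l = "Liminf (at 0) (\<lambda>h. ereal (s h))" and ?u = "Limsup (at 0) (\<lambda>h. ereal (s h))"
    have l0: "0 \<le> ?l" by (rule Liminf_bounded) (use ev in \<open>auto elim: eventually_mono\<close>)
    have uL: "?u \<le> ereal L" by (rule Limsup_bounded) (use ev in \<open>auto elim: eventually_mono\<close>)
    have lu: "?l \<le> ?u" by (rule Liminf_le_Limsup) simp
    (* Two rationals between the limits would make x both flat and steep. *)
    have "\<not> ?l < ?u"
    proof
      assume "?l < ?u"
      then obtain r where r: "?l < ereal r" "ereal r < ?u" using ereal_dense2 by blast
      then obtain q where q: "r < real_of_rat q" "ereal (real_of_rat q) < ?u"
      proof -
        obtain r' where r': "ereal r < ereal r'" "ereal r' < ?u" using ereal_dense2[OF r(2)] by blast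
        then obtain q where "r < real_of_rat q" "real_of_rat q < r'" using of_rat_dense[of r r'] by auto
        then show ?thesis using that r' by (meson ereal_less_eq(3) le_less_trans less_imp_le)
      qed
      obtain p where p: "?l < ereal (real_of_rat p)" "real_of_rat p < r"
      proof -
        obtain r' where r': "?l < ereal r'" "ereal r' < ereal r" using ereal_dense2[OF r(1)] by blast
        then obtain q where "r' < real_of_rat q" "real_of_rat q < r" using of_rat_dense[of r' r] by auto
        then show ?thesis using that r' by (meson ereal_less_eq(3) less_le_trans less_imp_le)
      qed
      let ?p = "real_of_rat p" and ?q = "real_of_rat q"
      have "0 \<le> ?p" using l0 p(1) by (metis ereal_less_eq(5) le_less_trans less_imp_le)
      moreover have "?p < ?q" using p q by simp
      moreover have "x \<in> flat_points f ?p"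
      proof (rule flat_pointsI[OF cont])
        show "\<exists>\<^sub>F h in at 0. (f (x + h) - f x) / h < ?p"
        proof (rule ccontr)
          assume "\<not> ?thesis"
          then have "\<forall>\<^sub>F h in at 0. ereal ?p \<le> ereal (s h)" by (simp add: not_frequently s_def not_less)
          then have "ereal ?p \<le> ?l" by (rule Liminf_bounded)
          then show False using p by simp
        qed
      qed
      moreover have "x \<in> flat_points (\<lambda>x. - f x) (- ?q)"
      proof (rule flat_pointsI[OF contm])
        show "\<exists>\<^sub>F h in at 0. (- f (x + h) - - f x) / h < - ?q"
        proof (rule ccontr)
          assume "\<not> ?thesis"
          then have "\<forall>\<^sub>F h in at 0. \<not> (- f (x + h) - - f x) / h < - ?q" by (simp add: not_frequently)
          moreover have "(- f (x + h) - - f x) / h = - s h" for h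
            by (simp add: s_def minus_divide_left)
          ultimately have "\<forall>\<^sub>F h in at 0. ereal (s h) \<le> ereal ?q" by (simp add: not_less)
          then have "?u \<le> ereal ?q" by (rule Limsup_bounded)
          then show False using q by simp
        qed
      qed
      moreover obtain n :: nat where "\<bar>x\<bar> \<le> real n" using real_arch_simple by blast
      ultimately have "x \<in> B" unfolding B_def
        by (intro UN_I[of "(?p, ?q)"]) (auto intro!: exI[of _ n])
      then show False using x by simp
    qed
    then have eq: "?l = ?u" using lu by simp
    have "\<exists>D. l = ereal D" if "0 \<le> l" "l \<le> ereal L" for l using that by (cases l) auto
    then obtain D where D: "?l = ereal D" using l0 order_trans[OF lu uL] by blast
    have "((\<lambda>h. ereal (s h)) \<longlongrightarrow> ereal D) (at 0)"
      using eq D by (subst tendsto_iff_Liminf_eq_Limsup) auto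
    then have "(s \<longlongrightarrow> D) (at 0)" by simp
    then have "DERIV f x :> D" unfolding DERIV_def s_def .
    then show ?thesis using differentiableI real_differentiable_def by blast
  qed
  then show ?thesis using B by (intro AE_I'[of B]) auto
qed

text \<open>
  Rademacher's theorem on the line: adding the linear function \<open>L * t\<close> makes every coordinate monotone.
\<close>

theorem lipschitz_differentiable_AE:
  fixes f :: "real \<Rightarrow> 'a::euclidean_space"
  assumes "L-lipschitz_on UNIV f"
  shows "AE x in lborel. f differentiable at x"
proof -
  have "AE x in lborel. \<forall>b\<in>Basis. (\<lambda>t. f t \<bullet> b) differentiable at x"
  proof (rule AE_finite_allI)
    fix b :: 'a assume b: "b \<in> Basis"
    have L: "0 \<le> L" using assms lipschitz_on_nonneg by blast
    have lip: "\<bar>f x \<bullet> b - f y \<bullet> b\<bar> \<le> L * \<bar>x - y\<bar>" for x y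
      using lipschitz_onD[OF assms, of x y] Basis_le_norm[OF b, of "f x - f y"]
      by (simp add: dist_norm inner_diff_left)
    let ?g = "\<lambda>t. f t \<bullet> b + L * t"
    have "mono ?g"
    proof (rule monoI)
      fix x y :: real assume "x \<le> y"
      then show "?g x \<le> ?g y" using lip[of x y] by (simp add: abs_if algebra_simps split: if_splits)
    qed
    moreover have "(L + L)-lipschitz_on UNIV ?g"
    proof (rule lipschitz_onI)
      fix x y :: real
      have "L * x - L * y = L * (x - y)" by (simp add: algebra_simps)
      then have "\<bar>L * x - L * y\<bar> = L * \<bar>x - y\<bar>" using L by (simp add: abs_mult)
      then show "dist (?g x) (?g y) \<le> (L + L) * dist x y"
        using lip[of x y] by (simp add: dist_real_def algebra_simps)
    qed (use L in simp)
    ultimately have "AE x in lborel. ?g differentiable at x" by (rule mono_lipschitz_differentiable_AE)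
    then show "AE x in lborel. (\<lambda>t. f t \<bullet> b) differentiable at x"
    proof eventually_elim
      case (elim x)
      have "(\<lambda>t. L * t) differentiable at x" by (auto intro!: derivative_intros)
      from differentiable_diff[OF elim this] show ?case by simp
    qed
  qed simp
  then show ?thesis
    by eventually_elim (use differentiable_componentwise_within[of f _ UNIV] in blast)
qed

section \<open>Speed of 1-Lipschitz curves\<close>

lemma Lip1_lipschitz: "\<gamma> \<in> Lip1 X \<Longrightarrow> 0 \<le> s \<Longrightarrow> 0 \<le> t \<Longrightarrow> dist (\<gamma> s) (\<gamma> t) \<le> \<bar>s - t\<bar>"
  by (auto simp: Lip1_def dist_real_def dest: lipschitz_onD)

lemma Lip1_in: "\<gamma> \<in> Lip1 X \<Longrightarrow> 0 \<le> t \<Longrightarrow> \<gamma> t \<in> X"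
  by (auto simp: Lip1_def)

lemma Lip1_continuous_on: "\<gamma> \<in> Lip1 X \<Longrightarrow> A \<subseteq> {0..} \<Longrightarrow> continuous_on A \<gamma>"
  by (rule continuous_on_subset[of "{0..}"]) (auto simp: Lip1_def intro: lipschitz_on_continuous_on)

lemma Lip1_extend: "\<gamma> \<in> Lip1 X \<Longrightarrow> 1-lipschitz_on UNIV (\<lambda>t. \<gamma> (max 0 t))"
  by (rule lipschitz_onI) (auto simp: dist_real_def intro!: order_trans[OF Lip1_lipschitz])

text \<open>
  The norm of the derivative, expressed by countably many evaluations of the curve. In this form it is
  jointly measurable in the curve and the time, and it is defined at every time.
\<close>

definition speed :: "(real \<Rightarrow> 'a::metric_space) \<Rightarrow> real \<Rightarrow> ennreal" where
  "speed \<gamma> t = liminf (\<lambda>n. ennreal (real (Suc n) * dist (\<gamma> (t + 1 / real (Suc n))) (\<gamma> t)))"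

text \<open>
  The intervals need only contain \<open>t\<close>, as do the intervals of a grid that is refined.
\<close>

lemma straddling_slopes_tendsto:
  fixes \<gamma> :: "real \<Rightarrow> 'a::real_normed_vector"
  assumes v: "(\<gamma> has_vector_derivative v) (at t)"
    and ab: "\<And>n. a n \<le> t" "\<And>n. t \<le> b n" "\<And>n. a n < b n" "(\<lambda>n. b n - a n) \<longlonglongrightarrow> 0"
  shows "(\<lambda>n. dist (\<gamma> (b n)) (\<gamma> (a n)) / (b n - a n)) \<longlonglongrightarrow> norm v"
proof (rule LIMSEQ_I)
  fix r :: real assume "r > 0"
  have "\<forall>e>0. \<exists>d>0. \<forall>y. norm (y - t) < d \<longrightarrow> norm (\<gamma> y - \<gamma> t - (y - t) *\<^sub>R v) \<le> e * norm (y - t)"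
    using v unfolding has_vector_derivative_def has_derivative_at_alt by blast
  then obtain d where d: "d > 0"
    "\<And>y. \<bar>y - t\<bar> < d \<Longrightarrow> norm (\<gamma> y - \<gamma> t - (y - t) *\<^sub>R v) \<le> r / 2 * \<bar>y - t\<bar>"
    using \<open>r > 0\<close> by (metis half_gt_zero real_norm_def)
  obtain N where N: "\<And>n. n \<ge> N \<Longrightarrow> \<bar>b n - a n\<bar> < d"
    using LIMSEQ_D[OF ab(4) d(1)] by auto
  show "\<exists>no. \<forall>n\<ge>no. norm (dist (\<gamma> (b n)) (\<gamma> (a n)) / (b n - a n) - norm v) < r"
  proof (intro exI[of _ N] allI impI)
    fix n assume "n \<ge> N"
    note ab' = ab(1-3)[of n] N[OF this]
    let ?B = "\<gamma> (b n) - \<gamma> t - (b n - t) *\<^sub>R v" and ?A = "\<gamma> (a n) - \<gamma> t - (a n - t) *\<^sub>R v"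
    have "norm ?B \<le> r / 2 * \<bar>b n - t\<bar>" "norm ?A \<le> r / 2 * \<bar>a n - t\<bar>"
      using ab' d(2)[of "b n"] d(2)[of "a n"] by auto
    then have "norm (?B - ?A) \<le> r / 2 * (b n - a n)"
      using norm_triangle_ineq4[of ?B ?A] ab' by (simp add: algebra_simps abs_if split: if_splits)
    moreover have "?B - ?A = (\<gamma> (b n) - \<gamma> (a n)) - (b n - a n) *\<^sub>R v"
      by (simp add: algebra_simps)
    ultimately have "\<bar>norm (\<gamma> (b n) - \<gamma> (a n)) - norm ((b n - a n) *\<^sub>R v)\<bar> \<le> r / 2 * (b n - a n)"
      by (metis norm_triangle_ineq3 order_trans)
    then have "\<bar>(dist (\<gamma> (b n)) (\<gamma> (a n)) / (b n - a n) - norm v) * (b n - a n)\<bar> \<le> r / 2 * (b n - a n)"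
      using ab' by (simp only: dist_norm norm_scaleR left_diff_distrib) (simp add: mult.commute)
    then have "\<bar>dist (\<gamma> (b n)) (\<gamma> (a n)) / (b n - a n) - norm v\<bar> \<le> r / 2"
      using ab' by (simp add: abs_mult)
    then show "norm (dist (\<gamma> (b n)) (\<gamma> (a n)) / (b n - a n) - norm v) < r"
      using \<open>r > 0\<close> by simp
  qed
qed

lemma slopes_tendsto_speed:
  fixes \<gamma> :: "real \<Rightarrow> 'a::real_normed_vector"
  assumes "\<gamma> differentiable at t"
  shows "(\<lambda>n. real (Suc n) * dist (\<gamma> (t + 1 / real (Suc n))) (\<gamma> t)) \<longlonglongrightarrow> norm (vector_derivative \<gamma> (at t))"
    and "speed \<gamma> t = ennreal (norm (vector_derivative \<gamma> (at t)))"
proof -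
  show 1: "(\<lambda>n. real (Suc n) * dist (\<gamma> (t + 1 / real (Suc n))) (\<gamma> t)) \<longlonglongrightarrow> norm (vector_derivative \<gamma> (at t))"
    using straddling_slopes_tendsto[of \<gamma> "vector_derivative \<gamma> (at t)" t "\<lambda>n. t" "\<lambda>n. t + 1 / real (Suc n)"]
      assms LIMSEQ_inverse_real_of_nat
    by (simp add: vector_derivative_works inverse_eq_divide mult.commute)
  then have "(\<lambda>n. ennreal (real (Suc n) * dist (\<gamma> (t + 1 / real (Suc n))) (\<gamma> t))) \<longlonglongrightarrow> ennreal (norm (vector_derivative \<gamma> (at t)))"
    by (rule tendsto_ennrealI)
  then show "speed \<gamma> t = ennreal (norm (vector_derivative \<gamma> (at t)))"
    unfolding speed_def by (rule lim_imp_Liminf[rotated]) simp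
qed

lemma Lip1_differentiable_AE:
  fixes \<gamma> :: "real \<Rightarrow> 'a::euclidean_space"
  assumes "\<gamma> \<in> Lip1 X"
  shows "AE t in lborel. 0 \<le> t \<longrightarrow> \<gamma> differentiable at t"
proof -
  have "AE t in lborel. (\<lambda>t. \<gamma> (max 0 t)) differentiable at t"
    using Lip1_extend[OF assms] by (rule lipschitz_differentiable_AE)
  moreover have "AE t in lborel. t \<noteq> (0::real)" by (rule AE_lborel_singleton)
  ultimately show ?thesis
  proof eventually_elim
    case (elim t)
    show ?case
    proof
      assume "0 \<le> t"
      then have "t > 0" using elim by simp
      obtain D where "((\<lambda>t. \<gamma> (max 0 t)) has_derivative D) (at t)"
        using elim(1) unfolding differentiable_def by blast
      then have "(\<gamma> has_derivative D) (at t)"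
        by (rule has_derivative_transform_within_open[of _ _ _ _ "{0<..}"]) (use \<open>t > 0\<close> in auto)
      then show "\<gamma> differentiable at t" unfolding differentiable_def by blast
    qed
  qed
qed

lemma Lip1_speed_AE:
  fixes \<gamma> :: "real \<Rightarrow> 'a::euclidean_space"
  assumes "\<gamma> \<in> Lip1 X"
  shows "AE t in lborel. 0 \<le> t \<longrightarrow> speed \<gamma> t = ennreal (norm (vector_derivative \<gamma> (at t)))"
  using Lip1_differentiable_AE[OF assms] by eventually_elim (auto simp: slopes_tendsto_speed(2))

lemma Lip1_slope_le_1:
  assumes "\<gamma> \<in> Lip1 X" "0 \<le> t"
  shows "real (Suc n) * dist (\<gamma> (t + 1 / real (Suc n))) (\<gamma> t) \<le> 1"
proof -
  have "dist (\<gamma> (t + 1 / real (Suc n))) (\<gamma> t) \<le> 1 / real (Suc n)"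
    using Lip1_lipschitz[OF assms(1), of "t + 1 / real (Suc n)" t] assms(2) by simp
  then have "real (Suc n) * dist (\<gamma> (t + 1 / real (Suc n))) (\<gamma> t) \<le> real (Suc n) * (1 / real (Suc n))"
    by (rule mult_left_mono) simp
  then show ?thesis by simp
qed

lemma Lip1_speed_le_1:
  assumes "\<gamma> \<in> Lip1 X" "0 \<le> t"
  shows "speed \<gamma> t \<le> 1"
proof -
  have "speed \<gamma> t \<le> limsup (\<lambda>n. ennreal (real (Suc n) * dist (\<gamma> (t + 1 / real (Suc n))) (\<gamma> t)))"
    unfolding speed_def by (rule Liminf_le_Limsup) simp
  also have "\<dots> \<le> 1"
    by (rule Limsup_bounded) (use Lip1_slope_le_1[OF assms] in \<open>simp only: ennreal_le_1 always_eventually simp_thms\<close>)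
  finally show ?thesis .
qed

text \<open>
  The integral of the difference quotient of \<open>h t = dist (g t) (g a)\<close> telescopes to the mean of \<open>h\<close> over
  \<open>{b..b + c}\<close> minus its mean over \<open>{a..a + c}\<close>, and these means differ from \<open>h b\<close> and \<open>h a = 0\<close> by at
  most \<open>c\<close>.
\<close>

lemma lipschitz_increment_le_integral_slopes:
  fixes g :: "real \<Rightarrow> 'a::metric_space"
  assumes g: "1-lipschitz_on UNIV g" and "a \<le> b" "c > 0"
  shows "dist (g b) (g a) - 2 * c \<le> integral {a..b} (\<lambda>t. dist (g (t + c)) (g t) / c)"
proof -
  define h where "h t = dist (g t) (g a)" for t
  have g1: "dist (g s) (g t) \<le> \<bar>s - t\<bar>" for s t using lipschitz_onD[OF g, of s t] by (simp add: dist_real_def)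
  have contg: "continuous_on A g" for A using g lipschitz_on_continuous_on continuous_on_subset by blast
  have conth: "continuous_on A h" for A unfolding h_def by (intro continuous_intros contg)
  have inth: "h integrable_on {x..y}" for x y by (rule integrable_continuous_interval[OF conth])
  have shift: "integral {a..b} (\<lambda>t. h (t + c)) = integral {a+c..b+c} h"
    using integral_shift_Icc_real[of a b h c] by (simp add: o_def add.commute)
  have ints: "(\<lambda>t. h (t + c)) integrable_on {a..b}"
    unfolding h_def by (intro integrable_continuous_interval continuous_intros continuous_on_compose2[OF contg]) auto
  have "integral {a..a+c} h + integral {a+c..b+c} h = integral {a..b} h + integral {b..b+c} h"
    using assms inth Henstock_Kurzweil_Integration.integral_combine[of a "a+c" "b+c" h]
      Henstock_Kurzweil_Integration.integral_combine[of a "b" "b+c" h] by simp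
  then have eq: "integral {a..b} (\<lambda>t. h (t + c) - h t) = integral {b..b+c} h - integral {a..a+c} h"
    by (subst Henstock_Kurzweil_Integration.integral_diff[OF ints inth]) (simp add: shift)
  have "integral {b..b+c} (\<lambda>t. h b - c) \<le> integral {b..b+c} h"
  proof (rule integral_le)
    fix t assume t: "t \<in> {b..b+c}"
    have "h b \<le> h t + dist (g t) (g b)" unfolding h_def by metric
    then show "h b - c \<le> h t" using g1[of t b] t by auto
  qed (use inth in auto)
  moreover have "integral {a..a+c} h \<le> integral {a..a+c} (\<lambda>t. c)"
  proof (rule integral_le)
    fix t assume t: "t \<in> {a..a+c}"
    show "h t \<le> c" using g1[of t a] t by (auto simp: h_def)
  qed (use inth in auto)
  ultimately have 1: "c * (h b - 2 * c) \<le> integral {a..b} (\<lambda>t. h (t + c) - h t)"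
    unfolding eq using assms by (simp add: algebra_simps)
  have intd: "(\<lambda>t. dist (g (t + c)) (g t)) integrable_on {a..b}"
    by (intro integrable_continuous_interval continuous_intros continuous_on_compose2[OF contg]) auto
  have "integral {a..b} (\<lambda>t. h (t + c) - h t) \<le> integral {a..b} (\<lambda>t. dist (g (t + c)) (g t))"
  proof (rule integral_le)
    show "(\<lambda>t. h (t + c) - h t) integrable_on {a..b}" using ints inth by (rule integrable_diff)
    fix t
    have "h (t + c) \<le> h t + dist (g (t + c)) (g t)" unfolding h_def by metric
    then show "h (t + c) - h t \<le> dist (g (t + c)) (g t)" by simp
  qed (rule intd)
  then have "c * (h b - 2 * c) \<le> integral {a..b} (\<lambda>t. dist (g (t + c)) (g t))" using 1 by simp
  then show ?thesis using assms by (simp add: h_def field_simps)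
qed

text \<open>
  The previous estimate in the limit of vanishing \<open>c\<close>: the difference quotients converge almost
  everywhere to the speed and are dominated by 1.
\<close>

lemma Lip1_dist_le_integral_speed:
  fixes \<gamma> :: "real \<Rightarrow> 'a::euclidean_space"
  assumes \<gamma>: "\<gamma> \<in> Lip1 X" and ab: "0 \<le> a" "a \<le> b"
  shows "ennreal (dist (\<gamma> b) (\<gamma> a)) \<le> (\<integral>\<^sup>+t\<in>{a..b}. speed \<gamma> t \<partial>lborel)"
proof -
  let ?g = "\<lambda>t. \<gamma> (max 0 t)"
  note lip = Lip1_extend[OF \<gamma>]
  have contg: "continuous_on A ?g" for A using lip lipschitz_on_continuous_on continuous_on_subset by blast
  define k where "k n t = real (Suc n) * dist (?g (t + 1 / real (Suc n))) (?g t)" for n t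
  have k_cont: "continuous_on A (k n)" for n A
    unfolding k_def by (intro continuous_intros continuous_on_compose2[OF contg[of UNIV]]) auto
  have [measurable]: "k n \<in> borel_measurable borel" for n by (rule borel_measurable_continuous_onI[OF k_cont])
  have k_nonneg: "k n t \<ge> 0" for n t by (simp add: k_def)
  have k_le: "k n t \<le> 1" if "t \<in> {a..b}" for n t
    using Lip1_slope_le_1[OF \<gamma>, of t n] that ab by (simp add: k_def)
  have k_int: "(\<integral>\<^sup>+t. ennreal (k n t * indicator {a..b} t) \<partial>lborel) = ennreal (integral {a..b} (k n))" for n
  proof -
    have "(k n has_integral integral {a..b} (k n)) {a..b}"
      by (rule integrable_integral[OF integrable_continuous_interval[OF k_cont]])
    then have hi: "((\<lambda>t. k n t * indicator {a..b} t) has_integral integral {a..b} (k n)) UNIV"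
      by (subst (asm) has_integral_restrict_UNIV[symmetric]) (simp add: indicator_def of_bool_def if_distrib cong: if_cong)
    show ?thesis
      by (rule nn_integral_has_integral_lborel[OF _ _ hi]) (auto simp: k_nonneg)
  qed
  have lower: "ennreal (dist (\<gamma> b) (\<gamma> a) - 2 / real (Suc n)) \<le> (\<integral>\<^sup>+t. ennreal (k n t * indicator {a..b} t) \<partial>lborel)" for n
  proof -
    have "dist (?g b) (?g a) - 2 * (1 / real (Suc n))
        \<le> integral {a..b} (\<lambda>t. dist (?g (t + 1 / real (Suc n))) (?g t) / (1 / real (Suc n)))"
      by (rule lipschitz_increment_le_integral_slopes[OF lip ab(2)]) simp
    moreover have "(\<lambda>t. dist (?g (t + 1 / real (Suc n))) (?g t) / (1 / real (Suc n))) = k n"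
      by (auto simp: k_def fun_eq_iff)
    ultimately show ?thesis
      using ab by (simp only: k_int) (intro ennreal_leI, simp add: max_absorb2)
  qed
  have sp: "AE t in lborel. (\<lambda>n. ennreal (k n t * indicator {a..b} t)) \<longlonglongrightarrow> liminf (\<lambda>n. ennreal (k n t * indicator {a..b} t))
     \<and> liminf (\<lambda>n. ennreal (k n t * indicator {a..b} t)) = speed \<gamma> t * indicator {a..b} t"
    using Lip1_differentiable_AE[OF \<gamma>]
  proof eventually_elim
    case (elim t)
    show ?case
    proof (cases "t \<in> {a..b}")
      case True
      then have t: "0 \<le> t" "\<gamma> differentiable at t" using elim ab by auto
      then have keq: "k n t = real (Suc n) * dist (\<gamma> (t + 1 / real (Suc n))) (\<gamma> t)" for n by (simp add: k_def)
      have lim: "(\<lambda>n. ennreal (k n t)) \<longlonglongrightarrow> speed \<gamma> t"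
        unfolding slopes_tendsto_speed(2)[OF t(2)] keq by (intro tendsto_ennrealI slopes_tendsto_speed(1)[OF t(2)])
      show ?thesis using True lim lim_imp_Liminf[of sequentially, OF _ lim] by simp
    qed (simp add: Liminf_const)
  qed
  have "(\<lambda>n. \<integral>\<^sup>+t. ennreal (k n t * indicator {a..b} t) \<partial>lborel) \<longlonglongrightarrow> (\<integral>\<^sup>+t. liminf (\<lambda>n. ennreal (k n t * indicator {a..b} t)) \<partial>lborel)"
  proof (rule nn_integral_dominated_convergence[where w="indicator {a..b}"])
    show "AE t in lborel. ennreal (k n t * indicator {a..b} t) \<le> indicator {a..b} t" for n
      using k_le by (auto split: split_indicator)
    show "AE t in lborel. (\<lambda>n. ennreal (k n t * indicator {a..b} t)) \<longlonglongrightarrow> liminf (\<lambda>n. ennreal (k n t * indicator {a..b} t))"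
      using sp by auto
  qed (use ab in \<open>auto simp: emeasure_lborel_Icc_eq\<close>)
  also have "(\<integral>\<^sup>+t. liminf (\<lambda>n. ennreal (k n t * indicator {a..b} t)) \<partial>lborel) = (\<integral>\<^sup>+t\<in>{a..b}. speed \<gamma> t \<partial>lborel)"
    by (rule nn_integral_cong_AE) (use sp in auto)
  finally have lim: "(\<lambda>n. \<integral>\<^sup>+t. ennreal (k n t * indicator {a..b} t) \<partial>lborel) \<longlonglongrightarrow> (\<integral>\<^sup>+t\<in>{a..b}. speed \<gamma> t \<partial>lborel)" .
  have "(\<lambda>n. dist (\<gamma> b) (\<gamma> a) - 2 * inverse (real (Suc n))) \<longlonglongrightarrow> dist (\<gamma> b) (\<gamma> a) - 2 * 0"
    by (intro tendsto_intros LIMSEQ_inverse_real_of_nat)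
  then have "(\<lambda>n. ennreal (dist (\<gamma> b) (\<gamma> a) - 2 / real (Suc n))) \<longlonglongrightarrow> ennreal (dist (\<gamma> b) (\<gamma> a))"
    by (intro tendsto_ennrealI) (simp add: divide_inverse)
  then show ?thesis by (rule LIMSEQ_le[OF _ lim]) (use lower in auto)
qed

section \<open>Curves that become constant\<close>

definition constant_from :: "real \<Rightarrow> (real \<Rightarrow> 'a) \<Rightarrow> bool" where
  "constant_from c \<gamma> \<longleftrightarrow> (\<forall>t\<ge>c. \<gamma> t = \<gamma> c)"

lemma constant_from_mono: "constant_from c \<gamma> \<Longrightarrow> c \<le> d \<Longrightarrow> constant_from d \<gamma>"
  unfolding constant_from_def by (metis order_trans)

text \<open>
  The stopping time is defined by the vanishing of a derivative. The following lemmas express it by the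
  values of the curve, first of all because a curve of speed zero does not move.
\<close>

lemma zero_derivative_imp_constant_from:
  fixes \<gamma> :: "real \<Rightarrow> 'a::euclidean_space"
  assumes \<gamma>: "\<gamma> \<in> Lip1 X" and "0 \<le> c" and "AE s in lborel. c \<le> s \<longrightarrow> vector_derivative \<gamma> (at s) = 0"
  shows "constant_from c \<gamma>"
  unfolding constant_from_def
proof (intro allI impI)
  fix t assume "c \<le> t"
  have "AE s in lborel. speed \<gamma> s * indicator {c..t} s = 0"
    using Lip1_speed_AE[OF \<gamma>] assms(3) by eventually_elim (use assms(2) in \<open>auto split: split_indicator\<close>)
  then have "(\<integral>\<^sup>+s\<in>{c..t}. speed \<gamma> s \<partial>lborel) = (\<integral>\<^sup>+s. 0 \<partial>(lborel :: real measure))"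
    by (intro nn_integral_cong_AE) auto
  then have "ennreal (dist (\<gamma> t) (\<gamma> c)) \<le> 0"
    using Lip1_dist_le_integral_speed[OF \<gamma> assms(2) \<open>c \<le> t\<close>] by simp
  then show "\<gamma> t = \<gamma> c" by (simp add: ennreal_eq_0_iff)
qed

lemma constant_from_derivative:
  assumes "constant_from c \<gamma>" "c < s"
  shows "vector_derivative \<gamma> (at s) = 0"
proof -
  have eq: "\<gamma> c = \<gamma> x" if "x \<in> {c<..}" for x
    using assms(1)[unfolded constant_from_def, rule_format, of x] that by simp
  have "((\<lambda>_. \<gamma> c) has_vector_derivative 0) (at s)" by simp
  then have "(\<gamma> has_vector_derivative 0) (at s)"
    by (rule has_vector_derivative_transform_within_open[of _ _ _ "{c<..}"]) (use assms(2) eq in simp_all)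
  then show ?thesis by (rule vector_derivative_at)
qed

lemma stopping_time_le:
  assumes "constant_from c \<gamma>" "0 \<le> c"
  shows "stopping_time \<gamma> \<le> ennreal c"
  unfolding stopping_time_def
proof (rule INF_lower)
  have "AE s in lborel. s \<noteq> c" by (rule AE_lborel_singleton)
  then have "AE s in lborel. c \<le> s \<longrightarrow> vector_derivative \<gamma> (at s) = 0"
    by eventually_elim (use constant_from_derivative[OF assms(1)] in force)
  then show "c \<in> {t. 0 \<le> t \<and> (AE s in lborel. t \<le> s \<longrightarrow> vector_derivative \<gamma> (at s) = 0)}"
    using assms by simp
qed

lemma stopping_time_lessD:
  fixes \<gamma> :: "real \<Rightarrow> 'a::euclidean_space"
  assumes "\<gamma> \<in> Lip1 X" "stopping_time \<gamma> < ennreal c"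
  shows "constant_from c \<gamma>"
proof -
  obtain t where t: "0 \<le> t" "AE s in lborel. t \<le> s \<longrightarrow> vector_derivative \<gamma> (at s) = 0" "ennreal t < ennreal c"
    using assms(2) unfolding stopping_time_def Inf_less_iff by auto
  then have "t \<le> c" by (meson ennreal_leI not_less less_imp_le)
  then show ?thesis using zero_derivative_imp_constant_from[OF assms(1) t(1,2)] constant_from_mono by blast
qed

text \<open>
  Integer times are enough, so that the condition is a countable one.
\<close>

lemma stopping_time_finite_iff:
  fixes \<gamma> :: "real \<Rightarrow> 'a::euclidean_space"
  assumes "\<gamma> \<in> Lip1 X"
  shows "stopping_time \<gamma> < \<infinity> \<longleftrightarrow> (\<exists>n::nat. constant_from (real n) \<gamma>)"
proof
  assume "stopping_time \<gamma> < \<infinity>"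
  then obtain n where "stopping_time \<gamma> < of_nat n" by (metis ennreal_Ex_less_of_nat infinity_ennreal_def)
  then have "constant_from (real n) \<gamma>" using assms by (intro stopping_time_lessD) (auto simp: ennreal_of_nat_eq_real_of_nat)
  then show "\<exists>n::nat. constant_from (real n) \<gamma>" ..
next
  assume "\<exists>n::nat. constant_from (real n) \<gamma>"
  then obtain n :: nat where "constant_from (real n) \<gamma>" ..
  then have "stopping_time \<gamma> \<le> ennreal (real n)" by (rule stopping_time_le) simp
  then show "stopping_time \<gamma> < \<infinity>" by (simp add: le_less_trans)
qed

lemma e_infty_eq:
  assumes "constant_from c \<gamma>" "0 \<le> c"
  shows "e_infty \<gamma> = \<gamma> c"
proof -
  have "stopping_time \<gamma> < \<infinity>" using stopping_time_le[OF assms] by (simp add: le_less_trans)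
  moreover have "(\<gamma> \<longlongrightarrow> \<gamma> c) at_top"
  proof (rule tendsto_eventually)
    show "\<forall>\<^sub>F x in at_top. \<gamma> x = \<gamma> c"
      using eventually_ge_at_top[of c] by eventually_elim (use assms in \<open>unfold constant_from_def, blast\<close>)
  qed
  ultimately show ?thesis by (simp add: e_infty_def tendsto_Lim)
qed

section \<open>Measurability on the space of curves\<close>

lemma space_borel_of [simp]: "space (borel_of T) = topspace T"
  unfolding borel_of_def by (rule space_measure_of) (auto dest: openin_subset)

lemma sets_borel_of: "sets (borel_of T) = sigma_sets (topspace T) {U. openin T U}"
  unfolding borel_of_def by (rule sets_measure_of) (auto dest: openin_subset)

lemma openin_Lip1_eval:
  assumes "0 \<le> t" "open V"
  shows "openin (Lip1_topology X) {\<gamma> \<in> Lip1 X. \<gamma> t \<in> V}"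
  unfolding openin_Lip1_topology
proof (intro conjI ballI)
  fix \<gamma> assume g: "\<gamma> \<in> {\<gamma> \<in> Lip1 X. \<gamma> t \<in> V}"
  then obtain e where e: "e > 0" "ball (\<gamma> t) e \<subseteq> V" using assms(2) open_contains_ball by blast
  show "\<exists>K \<epsilon>. compact K \<and> K \<subseteq> {0..} \<and> \<epsilon> > 0 \<and>
        {\<eta> \<in> Lip1 X. \<forall>t\<in>K. dist (\<eta> t) (\<gamma> t) < \<epsilon>} \<subseteq> {\<gamma> \<in> Lip1 X. \<gamma> t \<in> V}"
    using e assms(1) by (intro exI[of _ "{t}"] exI[of _ e]) (auto simp: dist_commute subset_iff)
qed auto

lemma eval_measurable:
  assumes "0 \<le> t"
  shows "(\<lambda>\<gamma>. \<gamma> t) \<in> borel_measurable (borel_of (Lip1_topology X))"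
proof (rule borel_measurableI)
  fix S :: "'a set" assume "open S"
  then have "openin (Lip1_topology X) {\<gamma> \<in> Lip1 X. \<gamma> t \<in> S}" using assms by (rule openin_Lip1_eval[rotated])
  moreover have "(\<lambda>\<gamma>. \<gamma> t) -` S \<inter> space (borel_of (Lip1_topology X)) = {\<gamma> \<in> Lip1 X. \<gamma> t \<in> S}" by auto
  ultimately show "(\<lambda>\<gamma>. \<gamma> t) -` S \<inter> space (borel_of (Lip1_topology X)) \<in> sets (borel_of (Lip1_topology X))"
    by (simp add: sets_borel_of)
qed

lemma dist_grid_point_le:
  assumes "0 \<le> t"
  shows "\<bar>t - real (nat \<lfloor>real (Suc n) * t\<rfloor>) / real (Suc n)\<bar> \<le> 1 / real (Suc n)"
proof -
  let ?j = "real (nat \<lfloor>real (Suc n) * t\<rfloor>)"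
  have "?j = of_int \<lfloor>real (Suc n) * t\<rfloor>" using assms by simp
  then have "\<bar>real (Suc n) * t - ?j\<bar> \<le> 1" by linarith
  moreover have "t - ?j / real (Suc n) = (real (Suc n) * t - ?j) / real (Suc n)"
    by (simp add: diff_divide_distrib)
  ultimately show ?thesis by (simp only: abs_divide abs_of_nat) (rule divide_right_mono, auto)
qed

text \<open>
  A 1-Lipschitz curve is known up to an error of order \<open>1 / Suc n\<close> on a bounded interval once it is
  known up to \<open>1 / Suc n\<close> on the grid of this mesh. With values \<open>qs\<close> from a countable dense set there
  are only countably many such sets.
\<close>

definition cylinder :: "'a::euclidean_space set \<Rightarrow> nat \<Rightarrow> 'a list \<Rightarrow> (real \<Rightarrow> 'a) set" where
  "cylinder X n qs = {\<eta> \<in> Lip1 X. \<forall>j<length qs. dist (\<eta> (real j / real (Suc n))) (qs ! j) < 1 / real (Suc n)}"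

lemma cylinder_neighbourhood:
  fixes D :: "'a::euclidean_space set"
  assumes D: "\<And>U. open U \<Longrightarrow> U \<noteq> {} \<Longrightarrow> \<exists>d\<in>D. d \<in> U"
    and g: "\<gamma> \<in> Lip1 X" and K: "compact K" "K \<subseteq> {0..}" "\<epsilon> > 0"
  shows "\<exists>n qs. qs \<in> lists D \<and> \<gamma> \<in> cylinder X n qs \<and>
    cylinder X n qs \<subseteq> {\<eta> \<in> Lip1 X. \<forall>t\<in>K. dist (\<eta> t) (\<gamma> t) < \<epsilon>}"
proof -
  (* Four errors of size 1 / Suc n occur: each of the two curves is moved to a grid point, and is
     compared there with the prescribed value. *)
  obtain n where n: "1 / real (Suc n) < \<epsilon> / 4" using K(3) nat_approx_posE[of "\<epsilon> / 4"] by auto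
  obtain B where B: "\<And>t. t \<in> K \<Longrightarrow> \<bar>t\<bar> \<le> B" using compact_imp_bounded[OF K(1)] bounded_iff by (metis real_norm_def)
  obtain L :: nat where L: "real (Suc n) * B < real L" using reals_Archimedean2 by blast
  have "\<exists>d\<in>D. dist (\<gamma> (real j / real (Suc n))) d < 1 / real (Suc n)" for j
    using D[of "ball (\<gamma> (real j / real (Suc n))) (1 / real (Suc n))"] by auto
  then obtain q where q: "\<And>j. q j \<in> D" "\<And>j. dist (\<gamma> (real j / real (Suc n))) (q j) < 1 / real (Suc n)"
    by metis
  let ?qs = "map q [0..<L]"
  have "cylinder X n ?qs \<subseteq> {\<eta> \<in> Lip1 X. \<forall>t\<in>K. dist (\<eta> t) (\<gamma> t) < \<epsilon>}"
  proof (intro subsetI CollectI conjI ballI)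
    fix \<eta> assume e: "\<eta> \<in> cylinder X n ?qs"
    then show eL: "\<eta> \<in> Lip1 X" by (simp add: cylinder_def)
    fix t assume "t \<in> K"
    then have t: "0 \<le> t" "t \<le> B" using K(2) B by (auto simp: abs_le_iff)
    define j where "j = nat \<lfloor>real (Suc n) * t\<rfloor>"
    have j0: "real j = of_int \<lfloor>real (Suc n) * t\<rfloor>" unfolding j_def using t by simp
    have j1: "real j \<le> real (Suc n) * t" "real (Suc n) * t < real j + 1" unfolding j0 by linarith+
    have "real (Suc n) * t \<le> real (Suc n) * B" by (rule mult_left_mono[OF t(2)]) simp
    then have "j < L" using j1 L by linarith
    then have d: "dist (\<eta> (real j / real (Suc n))) (q j) < 1 / real (Suc n)"
      using e by (auto simp: cylinder_def)
    have s: "\<bar>t - real j / real (Suc n)\<bar> \<le> 1 / real (Suc n)"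
      unfolding j_def by (rule dist_grid_point_le[OF t(1)])
    let ?s = "real j / real (Suc n)"
    have "dist (\<eta> t) (\<eta> ?s) \<le> 1 / real (Suc n)" "dist (\<gamma> t) (\<gamma> ?s) \<le> 1 / real (Suc n)"
      using Lip1_lipschitz[OF eL t(1), of ?s] Lip1_lipschitz[OF g t(1), of ?s] s by auto
    moreover have "dist (\<eta> t) (\<gamma> t) \<le> dist (\<eta> t) (\<eta> ?s) + dist (\<eta> ?s) (q j) + dist (\<gamma> ?s) (q j) + dist (\<gamma> t) (\<gamma> ?s)"
      by metric
    ultimately show "dist (\<eta> t) (\<gamma> t) < \<epsilon>" using d q(2)[of j] n by linarith
  qed
  moreover have "\<gamma> \<in> cylinder X n ?qs" using g q(2) by (auto simp: cylinder_def)
  moreover have "?qs \<in> lists D" using q(1) by auto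
  ultimately show ?thesis by blast
qed

text \<open>
  The cylinders with values in a countable dense set form a basis of the topology, so the Borel sets
  are generated by the evaluations at fixed times.
\<close>

lemma measurable_into_Lip1:
  fixes f :: "'w \<Rightarrow> real \<Rightarrow> 'a::euclidean_space"
  assumes f: "\<And>\<omega>. \<omega> \<in> space N \<Longrightarrow> f \<omega> \<in> Lip1 X"
    and [measurable]: "\<And>t. 0 \<le> t \<Longrightarrow> (\<lambda>\<omega>. f \<omega> t) \<in> borel_measurable N"
  shows "f \<in> measurable N (borel_of (Lip1_topology X))"
proof (rule measurable_sigma_sets[of _ "topspace (Lip1_topology X)" "{U. openin (Lip1_topology X) U}"])
  show "f \<in> space N \<rightarrow> topspace (Lip1_topology X)" using f by auto
  fix U assume "U \<in> {U. openin (Lip1_topology X) U}"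
  then have U: "openin (Lip1_topology X) U" by simp
  obtain D :: "'a set" where D: "countable D" "\<And>U. open U \<Longrightarrow> U \<noteq> {} \<Longrightarrow> \<exists>d\<in>D. d \<in> U"
    by (rule countable_dense_setE) (rule that, assumption, blast)
  define I where "I = {(n, qs). qs \<in> lists D \<and> cylinder X n qs \<subseteq> U}"
  have "countable ((UNIV :: nat set) \<times> lists D)" using D(1) by (intro countable_SIGMA) auto
  then have I: "countable I" by (rule countable_subset[rotated]) (auto simp: I_def)
  have "U \<subseteq> (\<Union>i\<in>I. cylinder X (fst i) (snd i))"
  proof
    fix \<gamma> assume g: "\<gamma> \<in> U"
    have gL: "\<gamma> \<in> Lip1 X" using openin_subset[OF U] g by auto
    have "\<exists>K \<epsilon>. compact K \<and> K \<subseteq> {0..} \<and> \<epsilon> > 0 \<and> {\<eta> \<in> Lip1 X. \<forall>t\<in>K. dist (\<eta> t) (\<gamma> t) < \<epsilon>} \<subseteq> U"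
      using U g by (simp add: openin_Lip1_topology)
    then obtain K \<epsilon> where K: "compact K" "K \<subseteq> {0..}" "\<epsilon> > 0" "{\<eta> \<in> Lip1 X. \<forall>t\<in>K. dist (\<eta> t) (\<gamma> t) < \<epsilon>} \<subseteq> U"
      by (elim exE conjE)
    have "\<exists>n qs. qs \<in> lists D \<and> \<gamma> \<in> cylinder X n qs \<and>
      cylinder X n qs \<subseteq> {\<eta> \<in> Lip1 X. \<forall>t\<in>K. dist (\<eta> t) (\<gamma> t) < \<epsilon>}"
      by (rule cylinder_neighbourhood[OF _ gL K(1-3)]) (rule D(2))
    then obtain n qs where "qs \<in> lists D" "\<gamma> \<in> cylinder X n qs"
      "cylinder X n qs \<subseteq> {\<eta> \<in> Lip1 X. \<forall>t\<in>K. dist (\<eta> t) (\<gamma> t) < \<epsilon>}"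
      by (elim exE conjE)
    then have "(n, qs) \<in> I" "\<gamma> \<in> cylinder X n qs" using K(4) by (auto simp: I_def)
    then show "\<gamma> \<in> (\<Union>i\<in>I. cylinder X (fst i) (snd i))" by (intro UN_I[of "(n, qs)"]) auto
  qed
  moreover have "(\<Union>i\<in>I. cylinder X (fst i) (snd i)) \<subseteq> U" by (auto simp: I_def)
  ultimately have Ueq: "U = (\<Union>i\<in>I. cylinder X (fst i) (snd i))" by blast
  have cyl: "f -` cylinder X n qs \<inter> space N \<in> sets N" for n qs
  proof -
    have "f -` cylinder X n qs \<inter> space N = {\<omega> \<in> space N. \<forall>j<length qs. dist (f \<omega> (real j / real (Suc n))) (qs ! j) < 1 / real (Suc n)}"
      using f by (auto simp: cylinder_def)
    also have "\<dots> \<in> sets N" by measurable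
    finally show ?thesis .
  qed
  have "f -` U \<inter> space N = (\<Union>i\<in>I. f -` cylinder X (fst i) (snd i) \<inter> space N)" unfolding Ueq by auto
  also have "\<dots> \<in> sets N" using I cyl by (intro sets.countable_UN') auto
  finally show "f -` U \<inter> space N \<in> sets N" .
next
  show "{U. openin (Lip1_topology X) U} \<subseteq> Pow (topspace (Lip1_topology X))"
    using openin_subset by blast
qed (simp add: sets_borel_of)

lemma measurable_Lip1_in:
  "f \<in> measurable N (borel_of (Lip1_topology X)) \<Longrightarrow> \<omega> \<in> space N \<Longrightarrow> f \<omega> \<in> Lip1 X"
  by (drule measurable_space) auto

text \<open>
  Rounding the time down to a grid gives countably many cases, and the rounded evaluations converge.
\<close>

lemma eval_at_random_time_measurable:
  fixes f :: "'w \<Rightarrow> real \<Rightarrow> 'a::euclidean_space"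
  assumes f: "f \<in> measurable N (borel_of (Lip1_topology X))"
    and s[measurable]: "s \<in> borel_measurable N" and s0: "\<And>\<omega>. \<omega> \<in> space N \<Longrightarrow> 0 \<le> s \<omega>"
  shows "(\<lambda>\<omega>. f \<omega> (s \<omega>)) \<in> borel_measurable N"
proof (rule borel_measurable_LIMSEQ_metric)
  fix n :: nat
  have [measurable]: "(\<lambda>\<omega>. f \<omega> (real j / real (Suc n))) \<in> borel_measurable N" for j :: nat
    by (rule measurable_compose[OF f eval_measurable]) simp
  show "(\<lambda>\<omega>. f \<omega> (real (nat \<lfloor>real (Suc n) * s \<omega>\<rfloor>) / real (Suc n))) \<in> borel_measurable N"
    by (rule measurable_compose_countable[where f="\<lambda>j \<omega>. f \<omega> (real j / real (Suc n))"]) measurable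
next
  fix \<omega> assume w: "\<omega> \<in> space N"
  note fL = measurable_Lip1_in[OF f w] and s0 = s0[OF w]
  show "(\<lambda>n. f \<omega> (real (nat \<lfloor>real (Suc n) * s \<omega>\<rfloor>) / real (Suc n))) \<longlonglongrightarrow> f \<omega> (s \<omega>)"
  proof (rule metric_tendsto_imp_tendsto[OF LIMSEQ_inverse_real_of_nat], rule always_eventually, rule allI)
    fix n
    let ?j = "real (nat \<lfloor>real (Suc n) * s \<omega>\<rfloor>)"
    have "\<bar>?j / real (Suc n) - s \<omega>\<bar> \<le> 1 / real (Suc n)"
      using dist_grid_point_le[OF s0, of n] by (simp only: abs_minus_commute)
    then show "dist (f \<omega> (?j / real (Suc n))) (f \<omega> (s \<omega>)) \<le> dist (inverse (real (Suc n))) 0"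
      using Lip1_lipschitz[OF fL, of "?j / real (Suc n)" "s \<omega>"] s0 by (simp add: inverse_eq_divide)
  qed
qed

lemma speed_measurable:
  fixes f :: "'w \<Rightarrow> real \<Rightarrow> 'a::euclidean_space"
  assumes f: "f \<in> measurable N (borel_of (Lip1_topology X))"
    and s[measurable]: "s \<in> borel_measurable N" and s0: "\<And>\<omega>. \<omega> \<in> space N \<Longrightarrow> 0 \<le> s \<omega>"
  shows "(\<lambda>\<omega>. speed (f \<omega>) (s \<omega>)) \<in> borel_measurable N"
proof -
  have [measurable]: "(\<lambda>\<omega>. f \<omega> (s \<omega>)) \<in> borel_measurable N"
    "(\<lambda>\<omega>. f \<omega> (s \<omega> + 1 / real (Suc n))) \<in> borel_measurable N" for n
    using s0 by (auto intro!: eval_at_random_time_measurable[OF f])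
  show ?thesis unfolding speed_def by measurable
qed

definition path_cost :: "('a::metric_space \<Rightarrow> ennreal) \<Rightarrow> (real \<Rightarrow> 'a) \<Rightarrow> ennreal" where
  "path_cost w \<gamma> = (\<integral>\<^sup>+t\<in>{0..}. w (\<gamma> t) * speed \<gamma> t \<partial>lborel)"

lemma integrand_measurable:
  fixes f :: "'w \<Rightarrow> real \<Rightarrow> 'a::euclidean_space"
  assumes f: "f \<in> measurable N (borel_of (Lip1_topology X))" and w[measurable]: "w \<in> borel_measurable borel"
    and [measurable]: "A \<in> sets borel" and A: "A \<subseteq> {0..}"
  shows "(\<lambda>(\<omega>, t). w (f \<omega> t) * speed (f \<omega>) t * indicator A t) \<in> borel_measurable (N \<Otimes>\<^sub>M lborel)"
proof -
  have [measurable]: "(\<lambda>x. f (fst x)) \<in> measurable (N \<Otimes>\<^sub>M lborel) (borel_of (Lip1_topology X))"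
    by (rule measurable_compose[OF measurable_fst f])
  have [measurable]: "(\<lambda>x. f (fst x) (max 0 (snd x))) \<in> borel_measurable (N \<Otimes>\<^sub>M lborel)"
    "(\<lambda>x. speed (f (fst x)) (max 0 (snd x))) \<in> borel_measurable (N \<Otimes>\<^sub>M lborel)"
    by (rule eval_at_random_time_measurable speed_measurable, measurable)+
  have "(\<lambda>x. w (f (fst x) (max 0 (snd x))) * speed (f (fst x)) (max 0 (snd x)) * indicator A (snd x))
      \<in> borel_measurable (N \<Otimes>\<^sub>M lborel)"
    by measurable
  moreover have "(\<lambda>x. w (f (fst x) (max 0 (snd x))) * speed (f (fst x)) (max 0 (snd x)) * indicator A (snd x))
     = (\<lambda>(\<omega>, t). w (f \<omega> t) * speed (f \<omega>) t * indicator A t)"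
    using A by (auto simp: fun_eq_iff max_absorb2 split: split_indicator)
  ultimately show ?thesis by simp
qed

lemma set_cost_measurable:
  fixes f :: "'w \<Rightarrow> real \<Rightarrow> 'a::euclidean_space"
  assumes "f \<in> measurable N (borel_of (Lip1_topology X))" "w \<in> borel_measurable borel"
    "A \<in> sets borel" "A \<subseteq> {0..}"
  shows "(\<lambda>\<omega>. \<integral>\<^sup>+t\<in>A. w (f \<omega> t) * speed (f \<omega>) t \<partial>lborel) \<in> borel_measurable N"
  using lborel.borel_measurable_nn_integral[OF integrand_measurable[OF assms]] .

lemma path_cost_measurable:
  fixes f :: "'w \<Rightarrow> real \<Rightarrow> 'a::euclidean_space"
  assumes "f \<in> measurable N (borel_of (Lip1_topology X))" "w \<in> borel_measurable borel"
  shows "(\<lambda>\<omega>. path_cost w (f \<omega>)) \<in> borel_measurable N"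
  unfolding path_cost_def by (rule set_cost_measurable[OF assms]) auto

lemma integrand_measurable_fixed:
  fixes \<gamma> :: "real \<Rightarrow> 'a::euclidean_space"
  assumes \<gamma>: "\<gamma> \<in> Lip1 X" and "w \<in> borel_measurable borel" "A \<in> sets borel" "A \<subseteq> {0..}"
  shows "(\<lambda>t. w (\<gamma> t) * speed \<gamma> t * indicator A t) \<in> borel_measurable lborel"
proof -
  have "(\<lambda>_::unit. \<gamma>) \<in> measurable (count_space UNIV) (borel_of (Lip1_topology X))" using \<gamma> by simp
  from measurable_compose[OF measurable_Pair1' integrand_measurable[OF this assms(2-4)], of "()"]
  show ?thesis by simp
qed

text \<open>
  By continuity it is enough to compare the values at the rational times.
\<close>

lemma constant_from_measurable:
  fixes f :: "'w \<Rightarrow> real \<Rightarrow> 'a::euclidean_space"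
  assumes f: "f \<in> measurable N (borel_of (Lip1_topology X))" and c: "0 \<le> c"
  shows "Measurable.pred N (\<lambda>\<omega>. constant_from c (f \<omega>))"
proof -
  have [measurable]: "(\<lambda>\<omega>. f \<omega> (max c q)) \<in> borel_measurable N" for q
    using c by (intro measurable_compose[OF f eval_measurable]) simp
  have eq: "constant_from c \<gamma> \<longleftrightarrow> (\<forall>q::rat. dist (\<gamma> (max c (of_rat q))) (\<gamma> (max c c)) \<le> 0)" if g: "\<gamma> \<in> Lip1 X" for \<gamma>
  proof
    assume c: "constant_from c \<gamma>"
    have "\<gamma> (max c (of_rat q)) = \<gamma> c" for q
      using c[unfolded constant_from_def, rule_format, of "max c (of_rat q)"] by simp
    then show "\<forall>q::rat. dist (\<gamma> (max c (of_rat q))) (\<gamma> (max c c)) \<le> 0" by simp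
  next
    assume R: "\<forall>q::rat. dist (\<gamma> (max c (of_rat q))) (\<gamma> (max c c)) \<le> 0"
    show "constant_from c \<gamma>" unfolding constant_from_def
    proof (intro allI impI)
      fix t assume t: "c \<le> t"
      have "dist (\<gamma> t) (\<gamma> c) \<le> 0 + e" if "e > 0" for e
      proof -
        obtain q where q: "t < of_rat q" "of_rat q < t + e" using of_rat_dense[of t "t + e"] \<open>e > 0\<close> by auto
        then have "\<gamma> (of_rat q) = \<gamma> c" using R[rule_format, of q] t by (simp add: max_absorb2)
        moreover have "dist (\<gamma> t) (\<gamma> (of_rat q)) \<le> \<bar>t - of_rat q\<bar>"
          by (rule Lip1_lipschitz[OF g]) (use q t c in linarith)+
        ultimately show ?thesis using q by simp
      qed
      then have "dist (\<gamma> t) (\<gamma> c) \<le> 0" by (rule field_le_epsilon)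
      then show "\<gamma> t = \<gamma> c" by simp
    qed
  qed
  have "Measurable.pred N (\<lambda>\<omega>. \<forall>q::rat. dist (f \<omega> (max c (of_rat q))) (f \<omega> (max c c)) \<le> 0)" by measurable
  then show ?thesis
    by (rule measurable_cong[THEN iffD1, rotated]) (simp add: eq measurable_Lip1_in[OF f])
qed

text \<open>
  A natural number from which on the curve rests; it exceeds the stopping time by less than 1. For a curve that never rests it is an arbitrary natural number, so that the
  value of the curve at this time is always a point of \<open>X\<close>.
\<close>

definition settling_time :: "(real \<Rightarrow> 'a) \<Rightarrow> real" where
  "settling_time \<gamma> = real (LEAST n. constant_from (real n) \<gamma>)"

lemma settling_time_nonneg [simp]: "0 \<le> settling_time \<gamma>"
  by (simp add: settling_time_def)

lemma constant_from_settling_time: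
  "constant_from c \<gamma> \<Longrightarrow> constant_from (settling_time \<gamma>) \<gamma>"
proof -
  assume "constant_from c \<gamma>"
  moreover obtain n :: nat where "c \<le> real n" using real_arch_simple by blast
  ultimately have "constant_from (real n) \<gamma>" by (rule constant_from_mono)
  then show ?thesis unfolding settling_time_def by (rule LeastI)
qed

lemma settling_time_measurable:
  fixes f :: "'w \<Rightarrow> real \<Rightarrow> 'a::euclidean_space"
  assumes f: "f \<in> measurable N (borel_of (Lip1_topology X))"
  shows "(\<lambda>\<omega>. settling_time (f \<omega>)) \<in> borel_measurable N"
proof -
  have [measurable]: "Measurable.pred N (\<lambda>\<omega>. constant_from (real n) (f \<omega>))" for n
    by (rule constant_from_measurable[OF f]) simp
  show ?thesis unfolding settling_time_def by measurable
qed

lemma finite_stopping_time_measurable: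
  fixes f :: "'w \<Rightarrow> real \<Rightarrow> 'a::euclidean_space"
  assumes f: "f \<in> measurable N (borel_of (Lip1_topology X))"
  shows "Measurable.pred N (\<lambda>\<omega>. stopping_time (f \<omega>) < \<infinity>)"
proof -
  have [measurable]: "Measurable.pred N (\<lambda>\<omega>. constant_from (real n) (f \<omega>))" for n
    by (rule constant_from_measurable[OF f]) simp
  have "Measurable.pred N (\<lambda>\<omega>. \<exists>n. constant_from (real n) (f \<omega>))" by measurable
  then show ?thesis
    by (rule measurable_cong[THEN iffD1, rotated]) (use measurable_Lip1_in[OF f] stopping_time_finite_iff in blast)
qed

lemma finite_stopping_time_settles:
  fixes \<gamma> :: "real \<Rightarrow> 'a::euclidean_space"
  assumes "\<gamma> \<in> Lip1 X" "stopping_time \<gamma> < \<infinity>"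
  shows "constant_from (settling_time \<gamma>) \<gamma>" "e_infty \<gamma> = \<gamma> (settling_time \<gamma>)"
proof -
  show "constant_from (settling_time \<gamma>) \<gamma>"
    using assms stopping_time_finite_iff constant_from_settling_time by blast
  then show "e_infty \<gamma> = \<gamma> (settling_time \<gamma>)" by (rule e_infty_eq) simp
qed

lemma e_infty_measurable:
  fixes f :: "'w \<Rightarrow> real \<Rightarrow> 'a::euclidean_space"
  assumes f: "f \<in> measurable N (borel_of (Lip1_topology X))"
  shows "(\<lambda>\<omega>. e_infty (f \<omega>)) \<in> borel_measurable N"
proof -
  note [measurable] = finite_stopping_time_measurable[OF f]
  have [measurable]: "(\<lambda>\<omega>. f \<omega> (settling_time (f \<omega>))) \<in> borel_measurable N" "(\<lambda>\<omega>. f \<omega> 0) \<in> borel_measurable N"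
    by (auto intro!: eval_at_random_time_measurable[OF f] settling_time_measurable[OF f])
  have "(\<lambda>\<omega>. if stopping_time (f \<omega>) < \<infinity> then f \<omega> (settling_time (f \<omega>)) else f \<omega> 0) \<in> borel_measurable N"
    by measurable
  then show ?thesis
    by (rule measurable_cong[THEN iffD1, rotated])
       (use finite_stopping_time_settles(2)[OF measurable_Lip1_in[OF f]] in \<open>auto simp: e_infty_def\<close>)
qed

lemma e_infty_in:
  fixes \<gamma> :: "real \<Rightarrow> 'a::euclidean_space"
  assumes "\<gamma> \<in> Lip1 X" shows "e_infty \<gamma> \<in> X"
  using finite_stopping_time_settles(2)[OF assms] Lip1_in[OF assms, of "settling_time \<gamma>"] Lip1_in[OF assms, of 0]
  by (cases "stopping_time \<gamma> < \<infinity>") (auto simp: e_infty_def)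

definition hits :: "(real \<Rightarrow> 'a) \<Rightarrow> 'a \<Rightarrow> bool" where
  "hits \<gamma> x \<longleftrightarrow> (\<exists>t\<ge>0. \<gamma> t = x)"

text \<open>
  On a compact interval of times, meeting a point is the same as coming arbitrarily close to it, and the
  latter can be tested at rational times.
\<close>

lemma hits_iff_rational:
  fixes \<gamma> :: "real \<Rightarrow> 'a::euclidean_space"
  assumes g: "\<gamma> \<in> Lip1 X"
  shows "hits \<gamma> x \<longleftrightarrow> (\<exists>M::nat. \<forall>k::nat. \<exists>q::rat. dist (\<gamma> (max 0 (min (real M) (of_rat q)))) x < 1 / real (Suc k))"
proof
  assume "hits \<gamma> x"
  then obtain t where t: "t \<ge> 0" "\<gamma> t = x" by (auto simp: hits_def)
  obtain M :: nat where M: "t + 1 \<le> real M" using real_arch_simple by blast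
  show "\<exists>M::nat. \<forall>k::nat. \<exists>q::rat. dist (\<gamma> (max 0 (min (real M) (of_rat q)))) x < 1 / real (Suc k)"
  proof (intro exI[of _ M] allI)
    fix k :: nat
    obtain q where q: "t < of_rat q" "of_rat q < t + 1 / real (Suc k)"
      using of_rat_dense[of t "t + 1 / real (Suc k)"] by auto
    have "1 / real (Suc k) \<le> 1" by simp
    then have "of_rat q < t + 1" using q by linarith
    then have eq: "max 0 (min (real M) (of_rat q)) = of_rat q" using q M t by linarith
    have "dist (\<gamma> (of_rat q)) (\<gamma> t) \<le> \<bar>of_rat q - t\<bar>"
      by (rule Lip1_lipschitz[OF g]) (use q t in linarith)+
    then have "dist (\<gamma> (max 0 (min (real M) (of_rat q)))) x \<le> of_rat q - t"
      unfolding eq t(2) using q by simp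
    then show "\<exists>q::rat. dist (\<gamma> (max 0 (min (real M) (of_rat q)))) x < 1 / real (Suc k)"
      using q by (intro exI[of _ q]) linarith
  qed
next
  assume "\<exists>M::nat. \<forall>k::nat. \<exists>q::rat. dist (\<gamma> (max 0 (min (real M) (of_rat q)))) x < 1 / real (Suc k)"
  then obtain M :: nat where M: "\<And>k::nat. \<exists>q::rat. dist (\<gamma> (max 0 (min (real M) (of_rat q)))) x < 1 / real (Suc k)" by blast
  have "continuous_on {0..real M} (\<lambda>t. dist (\<gamma> t) x)"
    by (intro continuous_intros Lip1_continuous_on[OF g]) auto
  then obtain t where t: "t \<in> {0..real M}" "\<And>s. s \<in> {0..real M} \<Longrightarrow> dist (\<gamma> t) x \<le> dist (\<gamma> s) x"
    using continuous_attains_inf[of "{0..real M}" "\<lambda>t. dist (\<gamma> t) x"] by auto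
  have "dist (\<gamma> t) x \<le> 0"
  proof (rule ccontr)
    assume "\<not> ?thesis"
    then obtain k where "1 / real (Suc k) < dist (\<gamma> t) x" using nat_approx_posE[of "dist (\<gamma> t) x"] by auto
    moreover obtain q :: rat where "dist (\<gamma> (max 0 (min (real M) (of_rat q)))) x < 1 / real (Suc k)" using M by blast
    moreover have "dist (\<gamma> t) x \<le> dist (\<gamma> (max 0 (min (real M) (of_rat q)))) x" by (rule t(2)) auto
    ultimately show False by linarith
  qed
  then show "hits \<gamma> x" using t(1) by (auto simp: hits_def)
qed

lemma hits_measurable:
  fixes f :: "'w \<Rightarrow> real \<Rightarrow> 'a::euclidean_space"
  assumes f: "f \<in> measurable N (borel_of (Lip1_topology X))" and [measurable]: "g \<in> borel_measurable N"
  shows "Measurable.pred N (\<lambda>\<omega>. hits (f \<omega>) (g \<omega>))"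
proof -
  have [measurable]: "(\<lambda>\<omega>. f \<omega> (max 0 q)) \<in> borel_measurable N" for q
    by (intro measurable_compose[OF f eval_measurable]) simp
  have "Measurable.pred N (\<lambda>\<omega>. \<exists>M::nat. \<forall>k::nat. \<exists>q::rat. dist (f \<omega> (max 0 (min (real M) (of_rat q)))) (g \<omega>) < 1 / real (Suc k))"
    by measurable
  then show ?thesis
    by (rule measurable_cong[THEN iffD1, rotated]) (use hits_iff_rational[OF measurable_Lip1_in[OF f]] in blast)
qed

lemma mult_power_measurable [measurable]: "mult_power \<alpha> \<in> borel_measurable borel"
  unfolding mult_power_def by measurable

text \<open>
  The pairs of a curve and a point on it form a measurable set, and the multiplicity is the measure of
  its sections.
\<close>

lemma measure_hits_measurable:
  assumes P: "finite_measure P" "sets P = sets (borel_of (Lip1_topology X))"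
  shows "(\<lambda>x. measure P {\<gamma> \<in> space P. hits \<gamma> x}) \<in> borel_measurable (borel :: 'a::euclidean_space measure)"
proof -
  interpret finite_measure P by fact
  have 1: "(\<lambda>z. snd z) \<in> measurable (borel \<Otimes>\<^sub>M P) (borel_of (Lip1_topology X))"
    using measurable_snd[of borel P] measurable_cong_sets[OF refl P(2), of "borel \<Otimes>\<^sub>M P"] by blast
  have "Measurable.pred ((borel :: 'a measure) \<Otimes>\<^sub>M P) (\<lambda>z. hits (snd z) (fst z))"
    by (rule hits_measurable[OF 1]) measurable
  then have Q: "{z \<in> space ((borel :: 'a measure) \<Otimes>\<^sub>M P). hits (snd z) (fst z)} \<in> sets (borel \<Otimes>\<^sub>M P)"
    by (rule predE)
  have "(\<lambda>x::'a. emeasure P (Pair x -` {z \<in> space ((borel :: 'a measure) \<Otimes>\<^sub>M P). hits (snd z) (fst z)})) \<in> borel_measurable borel"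
    by (rule measurable_emeasure_Pair[OF Q])
  moreover have "Pair x -` {z \<in> space ((borel :: 'a measure) \<Otimes>\<^sub>M P). hits (snd z) (fst z)} = {\<gamma> \<in> space P. hits \<gamma> x}" for x
    by (auto simp: space_pair_measure)
  ultimately have "(\<lambda>x::'a. enn2real (emeasure P {\<gamma> \<in> space P. hits \<gamma> x})) \<in> borel_measurable borel" by simp
  then show ?thesis by (simp add: measure_def)
qed

lemma multiplicity_at_measurable:
  assumes "finite_measure P" "sets P = sets (borel_of (Lip1_topology X))"
  shows "multiplicity_at P \<in> borel_measurable (borel :: 'a::euclidean_space measure)"
  using measure_hits_measurable[OF assms] by (simp add: hits_def multiplicity_at_def[abs_def])

lemma energy_eq_path_cost:
  fixes P :: "(real \<Rightarrow> 'a::euclidean_space) measure"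
  assumes "space P = Lip1 X"
  shows "energy \<alpha> P = (\<integral>\<^sup>+\<gamma>. path_cost (\<lambda>x. mult_power \<alpha> (multiplicity_at P x)) \<gamma> \<partial>P)"
  unfolding energy_def path_cost_def
proof (rule nn_integral_cong, rule nn_integral_cong_AE)
  fix \<gamma> assume "\<gamma> \<in> space P"
  then have "\<gamma> \<in> Lip1 X" using assms by simp
  then show "AE t in lborel. mult_power \<alpha> (multiplicity_at P (\<gamma> t)) * ennreal (norm (vector_derivative \<gamma> (at t))) * indicator {0..} t
    = mult_power \<alpha> (multiplicity_at P (\<gamma> t)) * speed \<gamma> t * indicator {0..} t"
    using Lip1_speed_AE[of \<gamma> X] by (auto elim!: eventually_mono split: split_indicator)
qed

section \<open>Lower semicontinuity of weighted length\<close>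

lemma continuous_map_Lip1I:
  fixes f :: "(real \<Rightarrow> 'a::euclidean_space) \<Rightarrow> real"
  assumes "\<And>\<gamma> e. \<gamma> \<in> Lip1 X \<Longrightarrow> e > 0 \<Longrightarrow> \<exists>K d. compact K \<and> K \<subseteq> {0..} \<and> d > 0 \<and>
     (\<forall>\<eta>\<in>Lip1 X. (\<forall>t\<in>K. dist (\<eta> t) (\<gamma> t) < d) \<longrightarrow> \<bar>f \<eta> - f \<gamma>\<bar> < e)"
  shows "continuous_map (Lip1_topology X) euclideanreal f"
  unfolding continuous_map_def
proof (intro conjI allI impI)
  fix V :: "real set" assume "openin euclideanreal V"
  then have V: "open V" by simp
  have "\<exists>K \<epsilon>. compact K \<and> K \<subseteq> {0..} \<and> \<epsilon> > 0 \<and> {\<eta> \<in> Lip1 X. \<forall>t\<in>K. dist (\<eta> t) (\<gamma> t) < \<epsilon>} \<subseteq> {\<gamma> \<in> Lip1 X. f \<gamma> \<in> V}"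
    if g: "\<gamma> \<in> {\<gamma> \<in> Lip1 X. f \<gamma> \<in> V}" for \<gamma>
  proof -
    obtain e where e: "e > 0" "\<And>y. \<bar>y - f \<gamma>\<bar> < e \<Longrightarrow> y \<in> V"
      using V g unfolding open_dist dist_real_def by blast
    have "\<exists>K d. compact K \<and> K \<subseteq> {0..} \<and> d > 0 \<and>
     (\<forall>\<eta>\<in>Lip1 X. (\<forall>t\<in>K. dist (\<eta> t) (\<gamma> t) < d) \<longrightarrow> \<bar>f \<eta> - f \<gamma>\<bar> < e)"
      using g e(1) by (intro assms) auto
    then obtain K d where K: "compact K" "K \<subseteq> {0..}" "d > 0"
      "\<forall>\<eta>\<in>Lip1 X. (\<forall>t\<in>K. dist (\<eta> t) (\<gamma> t) < d) \<longrightarrow> \<bar>f \<eta> - f \<gamma>\<bar> < e" by (elim exE conjE)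
    have "{\<eta> \<in> Lip1 X. \<forall>t\<in>K. dist (\<eta> t) (\<gamma> t) < d} \<subseteq> {\<gamma> \<in> Lip1 X. f \<gamma> \<in> V}"
      using K(4) e(2) by auto
    then show ?thesis using K by (intro exI conjI)
  qed
  moreover have "{x \<in> topspace (Lip1_topology X). f x \<in> V} = {\<gamma> \<in> Lip1 X. f \<gamma> \<in> V}" by simp
  ultimately show "openin (Lip1_topology X) {x \<in> topspace (Lip1_topology X). f x \<in> V}"
    by (simp only: openin_Lip1_topology) (intro conjI ballI, auto)
qed simp

lemma continuous_map_Lip1_eval:
  assumes "0 \<le> t"
  shows "continuous_map (Lip1_topology X) euclidean (\<lambda>\<gamma>::real \<Rightarrow> 'a::euclidean_space. \<gamma> t)"
  unfolding continuous_map_def using openin_Lip1_eval[OF assms] by auto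

lemma continuous_map_measurable:
  fixes f :: "'b \<Rightarrow> real"
  assumes "continuous_map T euclideanreal f"
  shows "f \<in> borel_measurable (borel_of T)"
proof (rule borel_measurableI)
  fix S :: "real set" assume "open S"
  then have "openin T {x \<in> topspace T. f x \<in> S}" using assms by (auto simp: continuous_map_def)
  moreover have "f -` S \<inter> space (borel_of T) = {x \<in> topspace T. f x \<in> S}" by auto
  ultimately show "f -` S \<inter> space (borel_of T) \<in> sets (borel_of T)" by (simp add: sets_borel_of)
qed

lemma borel_probD:
  assumes "borel_prob T M"
  shows "prob_space M" "sets M = sets (borel_of T)" "space M = topspace T"
  using assms sets_eq_imp_space_eq[of M "borel_of T"] by (auto simp: borel_prob_def)

lemma traffic_planD:
  assumes "traffic_plan X P"
  shows "prob_space P" "sets P = sets (borel_of (Lip1_topology X))" "space P = Lip1 X"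
    "AE \<gamma> in P. stopping_time \<gamma> < \<infinity>" "id \<in> measurable P (borel_of (Lip1_topology X))"
    "(\<lambda>\<gamma>. \<gamma>) \<in> measurable P (borel_of (Lip1_topology X))"
  using assms borel_probD[of "Lip1_topology X" P] measurable_ident_sets[of P "borel_of (Lip1_topology X)"]
  by (auto simp: traffic_plan_def id_def)

text \<open>
  The grid of mesh \<open>1 / Suc n\<close> has \<open>Suc n * Suc n\<close> intervals in \<open>{0..<Suc n}\<close>, and exactly
  one of them contains a given time in this range.
\<close>

lemma sum_grid_indicator:
  fixes f :: "nat \<Rightarrow> ennreal"
  assumes "0 \<le> t"
  shows "(\<Sum>i<Suc n * Suc n. f i * indicator {real i / real (Suc n)..<real (Suc i) / real (Suc n)} t)
    = (if t < real (Suc n) then f (nat \<lfloor>real (Suc n) * t\<rfloor>) else 0)"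
proof -
  let ?N = "real (Suc n)"
  have eq: "t \<in> {real i / ?N..<real (Suc i) / ?N} \<longleftrightarrow> i = nat \<lfloor>?N * t\<rfloor>" for i
  proof -
    have "t \<in> {real i / ?N..<real (Suc i) / ?N} \<longleftrightarrow> real i \<le> ?N * t \<and> ?N * t < real i + 1"
      by (simp add: pos_divide_le_eq pos_less_divide_eq mult.commute add.commute)
    also have "\<dots> \<longleftrightarrow> \<lfloor>?N * t\<rfloor> = int i" by (simp add: floor_eq_iff)
    also have "\<dots> \<longleftrightarrow> i = nat \<lfloor>?N * t\<rfloor>" using assms by auto
    finally show ?thesis .
  qed
  have lt: "nat \<lfloor>?N * t\<rfloor> < Suc n * Suc n \<longleftrightarrow> t < ?N"
  proof -
    have "nat \<lfloor>?N * t\<rfloor> < Suc n * Suc n \<longleftrightarrow> \<lfloor>?N * t\<rfloor> < int (Suc n * Suc n)"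
      using assms by (simp add: nat_less_iff)
    also have "\<dots> \<longleftrightarrow> ?N * t < ?N * ?N" by (simp only: floor_less_iff) (simp add: algebra_simps)
    finally show ?thesis by simp
  qed
  have "(\<Sum>i<Suc n * Suc n. f i * indicator {real i / ?N..<real (Suc i) / ?N} t)
     = (\<Sum>i<Suc n * Suc n. if i = nat \<lfloor>?N * t\<rfloor> then f i else 0)"
  proof (rule sum.cong[OF refl])
    fix i
    have "indicator {real i / ?N..<real (Suc i) / ?N} t = (if i = nat \<lfloor>?N * t\<rfloor> then 1 else 0 :: ennreal)"
      by (simp only: indicator_def eq of_bool_def)
    then show "f i * indicator {real i / ?N..<real (Suc i) / ?N} t = (if i = nat \<lfloor>?N * t\<rfloor> then f i else 0)"
      by simp
  qed
  then show ?thesis by (simp only: sum.delta finite_lessThan lessThan_iff lt)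
qed

text \<open>
  Riemann sums of the weighted length over a grid of mesh \<open>1 / Suc n\<close>. A weight with Lipschitz constant
  \<open>G\<close> varies by at most \<open>G / Suc n\<close> along an interval of the grid. Subtracting this variation
  makes the sum a lower bound of the weighted length, while it depends continuously on the curve.
\<close>

definition polygonal_cost :: "('a::euclidean_space \<Rightarrow> real) \<Rightarrow> real \<Rightarrow> nat \<Rightarrow> (real \<Rightarrow> 'a) \<Rightarrow> real" where
  "polygonal_cost g G n \<gamma> = (\<Sum>i<Suc n * Suc n. max 0 (g (\<gamma> (real i / real (Suc n))) - G / real (Suc n)) *
      dist (\<gamma> (real (Suc i) / real (Suc n))) (\<gamma> (real i / real (Suc n))))"

lemma polygonal_cost_nonneg: "0 \<le> polygonal_cost g G n \<gamma>"
  unfolding polygonal_cost_def by (intro sum_nonneg mult_nonneg_nonneg) auto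

lemma polygonal_cost_continuous:
  assumes "G-lipschitz_on UNIV g"
  shows "continuous_map (Lip1_topology X) euclideanreal (polygonal_cost g G n)"
proof -
  have g: "continuous_map euclidean euclideanreal g"
    using lipschitz_on_continuous_on[OF assms] by simp
  have e: "continuous_map (Lip1_topology X) euclidean (\<lambda>\<gamma>. \<gamma> (real i / real (Suc n)))" for i
    by (rule continuous_map_Lip1_eval) simp
  have "continuous_map (Lip1_topology X) euclideanreal (\<lambda>\<gamma>. g (\<gamma> (real i / real (Suc n))))" for i
    using continuous_map_compose[OF e g] by (simp add: o_def)
  moreover have "continuous_map (Lip1_topology X) euclideanreal
      (\<lambda>\<gamma>. dist (\<gamma> (real (Suc i) / real (Suc n))) (\<gamma> (real i / real (Suc n))))" for i
  proof -
    have "continuous_map (Lip1_topology X) (prod_topology euclidean euclidean)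
      (\<lambda>\<gamma>. (\<gamma> (real (Suc i) / real (Suc n)), \<gamma> (real i / real (Suc n))))"
      by (intro continuous_map_pairedI e)
    moreover have "continuous_map (prod_topology euclidean euclidean) euclideanreal (\<lambda>(x, y). dist x (y::'a))"
      by (simp add: euclidean_product_topology case_prod_beta) (intro continuous_intros)
    ultimately have "continuous_map (Lip1_topology X) euclideanreal
      ((\<lambda>(x, y). dist x (y::'a)) \<circ> (\<lambda>\<gamma>. (\<gamma> (real (Suc i) / real (Suc n)), \<gamma> (real i / real (Suc n)))))"
      by (rule continuous_map_compose)
    then show ?thesis by (simp add: o_def)
  qed
  ultimately show ?thesis
    unfolding polygonal_cost_def by (intro continuous_intros) auto
qed

lemma polygonal_cost_le:
  assumes g: "\<And>x. 0 \<le> g x" "\<And>x. g x \<le> B" and G: "0 \<le> G" and gam: "\<gamma> \<in> Lip1 X"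
  shows "polygonal_cost g G n \<gamma> \<le> real (Suc n * Suc n) * B"
proof -
  have "polygonal_cost g G n \<gamma> \<le> (\<Sum>i<Suc n * Suc n. B * 1)"
    unfolding polygonal_cost_def
  proof (intro sum_mono mult_mono)
    fix i
    have "0 \<le> B" using g order_trans by blast
    then show "0 \<le> B" .
    have "0 \<le> G / real (Suc n)" using G by simp
    then show "max 0 (g (\<gamma> (real i / real (Suc n))) - G / real (Suc n)) \<le> B"
      using g(2)[of "\<gamma> (real i / real (Suc n))"] \<open>0 \<le> B\<close> by linarith
    have "dist (\<gamma> (real (Suc i) / real (Suc n))) (\<gamma> (real i / real (Suc n))) \<le> \<bar>real (Suc i) / real (Suc n) - real i / real (Suc n)\<bar>"
      by (rule Lip1_lipschitz[OF gam]) auto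
    also have "real (Suc i) / real (Suc n) - real i / real (Suc n) = 1 / real (Suc n)"
      by (simp add: diff_divide_distrib[symmetric])
    finally show "dist (\<gamma> (real (Suc i) / real (Suc n))) (\<gamma> (real i / real (Suc n))) \<le> 1"
      by (rule order_trans) simp
  qed auto
  then show ?thesis by simp
qed

lemma polygonal_cost_le_path_cost:
  fixes \<gamma> :: "real \<Rightarrow> 'a::euclidean_space"
  assumes lip: "G-lipschitz_on UNIV g" and gam: "\<gamma> \<in> Lip1 X"
  shows "ennreal (polygonal_cost g G n \<gamma>) \<le> path_cost (\<lambda>x. ennreal (g x)) \<gamma>"
proof -
  let ?N = "real (Suc n)"
  let ?I = "\<lambda>i. {real i / ?N..<real (Suc i) / ?N}"
  let ?c = "\<lambda>i. max 0 (g (\<gamma> (real i / ?N)) - G / ?N)"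
  have gm: "(\<lambda>x. ennreal (g x)) \<in> borel_measurable borel"
    using lipschitz_on_continuous_on[OF lip] by (intro measurable_compose[OF borel_measurable_continuous_onI measurable_ennreal])
  have piece: "ennreal (?c i * dist (\<gamma> (real (Suc i) / ?N)) (\<gamma> (real i / ?N)))
      \<le> (\<integral>\<^sup>+t. ennreal (g (\<gamma> t)) * speed \<gamma> t * indicator (?I i) t \<partial>lborel)" for i
  proof -
    have pos: "0 \<le> real i / ?N" "real i / ?N \<le> real (Suc i) / ?N" by (auto simp: divide_right_mono)
    have sub: "?I i \<subseteq> {0..}"
      by (rule subsetI) (use pos(1) in \<open>simp only: atLeastLessThan_iff atLeast_iff, linarith\<close>)
    have ms: "(\<lambda>t. 1 * speed \<gamma> t * indicator (?I i) t) \<in> borel_measurable lborel"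
      by (rule integrand_measurable_fixed[OF gam, of "\<lambda>_. 1"]) (use sub in simp_all)
    have "ennreal (dist (\<gamma> (real (Suc i) / ?N)) (\<gamma> (real i / ?N)))
      \<le> (\<integral>\<^sup>+t\<in>{real i / ?N..real (Suc i) / ?N}. speed \<gamma> t \<partial>lborel)"
      by (rule Lip1_dist_le_integral_speed[OF gam pos])
    also have "\<dots> = (\<integral>\<^sup>+t\<in>?I i. speed \<gamma> t \<partial>lborel)"
    proof (rule nn_integral_cong_AE)
      have "AE t in lborel. t \<noteq> real (Suc i) / ?N" by (rule AE_lborel_singleton)
      then show "AE t in lborel. speed \<gamma> t * indicator {real i / ?N..real (Suc i) / ?N} t = speed \<gamma> t * indicator (?I i) t"
        by eventually_elim (auto split: split_indicator)
    qed
    finally have "ennreal (?c i) * ennreal (dist (\<gamma> (real (Suc i) / ?N)) (\<gamma> (real i / ?N)))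
        \<le> ennreal (?c i) * (\<integral>\<^sup>+t\<in>?I i. speed \<gamma> t \<partial>lborel)"
      by (rule mult_left_mono) simp
    also have "\<dots> = (\<integral>\<^sup>+t. ennreal (?c i) * (speed \<gamma> t * indicator (?I i) t) \<partial>lborel)"
      by (rule nn_integral_cmult[symmetric]) (use ms in simp)
    also have "\<dots> \<le> (\<integral>\<^sup>+t. ennreal (g (\<gamma> t)) * speed \<gamma> t * indicator (?I i) t \<partial>lborel)"
    proof (rule nn_integral_mono)
      fix t
      show "ennreal (?c i) * (speed \<gamma> t * indicator (?I i) t) \<le> ennreal (g (\<gamma> t)) * speed \<gamma> t * indicator (?I i) t"
      proof (cases "t \<in> ?I i")
        case True
        then have t: "real i / ?N \<le> t" "t < real (Suc i) / ?N" by auto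
        have "dist (\<gamma> (real i / ?N)) (\<gamma> t) \<le> \<bar>real i / ?N - t\<bar>"
          by (rule Lip1_lipschitz[OF gam pos(1)]) (use t pos in linarith)
        also have "\<dots> \<le> 1 / ?N" using t by (simp add: add_divide_distrib)
        finally have d: "dist (\<gamma> (real i / ?N)) (\<gamma> t) \<le> 1 / ?N" .
        have "\<bar>g (\<gamma> (real i / ?N)) - g (\<gamma> t)\<bar> \<le> G * dist (\<gamma> (real i / ?N)) (\<gamma> t)"
          using lipschitz_onD[OF lip, of "\<gamma> (real i / ?N)" "\<gamma> t"] by (simp add: dist_real_def)
        also have "\<dots> \<le> G * (1 / ?N)" using d lipschitz_on_nonneg[OF lip] by (rule mult_left_mono)
        finally have "g (\<gamma> (real i / ?N)) - G / ?N \<le> g (\<gamma> t)" by simp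
        then have "ennreal (?c i) \<le> ennreal (g (\<gamma> t))"
          by (cases "g (\<gamma> t) \<ge> 0") (auto intro!: ennreal_leI simp: max_def ennreal_neg)
        then show ?thesis by (auto simp: mult.assoc intro!: mult_right_mono)
      qed simp
    qed
    finally show ?thesis by (simp add: ennreal_mult')
  qed
  have "ennreal (polygonal_cost g G n \<gamma>) = (\<Sum>i<Suc n * Suc n. ennreal (?c i * dist (\<gamma> (real (Suc i) / ?N)) (\<gamma> (real i / ?N))))"
    unfolding polygonal_cost_def by (rule sum_ennreal[symmetric]) simp
  also have "\<dots> \<le> (\<Sum>i<Suc n * Suc n. \<integral>\<^sup>+t. ennreal (g (\<gamma> t)) * speed \<gamma> t * indicator (?I i) t \<partial>lborel)"
    by (rule sum_mono) (rule piece)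
  also have "\<dots> = (\<integral>\<^sup>+t. (\<Sum>i<Suc n * Suc n. ennreal (g (\<gamma> t)) * speed \<gamma> t * indicator (?I i) t) \<partial>lborel)"
  proof (rule nn_integral_sum[symmetric])
    fix i
    have "0 \<le> real i / ?N" by simp
    then have "?I i \<subseteq> {0..}"
      by (intro subsetI) (simp only: atLeastLessThan_iff atLeast_iff, linarith)
    then show "(\<lambda>t. ennreal (g (\<gamma> t)) * speed \<gamma> t * indicator (?I i) t) \<in> borel_measurable lborel"
      by (intro integrand_measurable_fixed[OF gam gm]) simp_all
  qed
  also have "\<dots> \<le> path_cost (\<lambda>x. ennreal (g x)) \<gamma>"
    unfolding path_cost_def
  proof (rule nn_integral_mono)
    fix t
    show "(\<Sum>i<Suc n * Suc n. ennreal (g (\<gamma> t)) * speed \<gamma> t * indicator (?I i) t)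
      \<le> ennreal (g (\<gamma> t)) * speed \<gamma> t * indicator {0..} t"
    proof (cases "0 \<le> t")
      case True
      then show ?thesis by (subst sum_grid_indicator) auto
    next
      case False
      have "t \<notin> ?I i" for i
      proof
        assume "t \<in> ?I i"
        then have "real i / ?N \<le> t" by simp
        moreover have "0 \<le> real i / ?N" by simp
        ultimately show False using False by linarith
      qed
      then have "indicator (?I i) t = (0::ennreal)" for i by (intro indicator_simps(2))
      then show ?thesis by (simp only: mult_zero_right sum.neutral_const zero_le)
    qed
  qed
  finally show ?thesis .
qed

text \<open>
  The sums are integrals of step functions whose values at time \<open>t\<close> converge to the weighted speed wherever
  the curve is differentiable, so Fatou's lemma applies.
\<close>

lemma path_cost_le_liminf_polygonal:
  fixes \<gamma> :: "real \<Rightarrow> 'a::euclidean_space"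
  assumes lip: "G-lipschitz_on UNIV g" and g0: "\<And>x. 0 \<le> g x" and gam: "\<gamma> \<in> Lip1 X"
  shows "path_cost (\<lambda>x. ennreal (g x)) \<gamma> \<le> liminf (\<lambda>n. ennreal (polygonal_cost g G n \<gamma>))"
proof -
  let ?N = "\<lambda>n. real (Suc n)"
  let ?I = "\<lambda>n i. {real i / ?N n..<real (Suc i) / ?N n}"
  let ?c = "\<lambda>n i. max 0 (g (\<gamma> (real i / ?N n)) - G / ?N n) * (?N n * dist (\<gamma> (real (Suc i) / ?N n)) (\<gamma> (real i / ?N n)))"
  define q where "q n t = (\<Sum>i<Suc n * Suc n. ennreal (?c n i) * indicator (?I n i) t)" for n t
  have qm[measurable]: "q n \<in> borel_measurable lborel" for n unfolding q_def by measurable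
  have q_int: "(\<integral>\<^sup>+t. q n t \<partial>lborel) = ennreal (polygonal_cost g G n \<gamma>)" for n
  proof -
    have "(\<integral>\<^sup>+t. q n t \<partial>lborel) = (\<Sum>i<Suc n * Suc n. ennreal (?c n i) * emeasure lborel (?I n i))"
      unfolding q_def by (subst nn_integral_sum) (auto simp: nn_integral_cmult)
    also have "\<dots> = (\<Sum>i<Suc n * Suc n. ennreal (max 0 (g (\<gamma> (real i / ?N n)) - G / ?N n) * dist (\<gamma> (real (Suc i) / ?N n)) (\<gamma> (real i / ?N n))))"
    proof (rule sum.cong[OF refl])
      fix i
      have le: "real i / ?N n \<le> real (Suc i) / ?N n" by (simp add: divide_right_mono)
      have "emeasure lborel (?I n i) = ennreal (1 / ?N n)"
        using le by (simp add: emeasure_lborel_Ico diff_divide_distrib[symmetric])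
      then have "ennreal (?c n i) * emeasure lborel (?I n i) = ennreal (?c n i * (1 / ?N n))"
        by (simp only:) (rule ennreal_mult[symmetric], auto)
      then show "ennreal (?c n i) * emeasure lborel (?I n i) = ennreal (max 0 (g (\<gamma> (real i / ?N n)) - G / ?N n) * dist (\<gamma> (real (Suc i) / ?N n)) (\<gamma> (real i / ?N n)))"
        by simp
    qed
    also have "\<dots> = ennreal (polygonal_cost g G n \<gamma>)" unfolding polygonal_cost_def by (rule sum_ennreal) simp
    finally show ?thesis .
  qed
  have "path_cost (\<lambda>x. ennreal (g x)) \<gamma> \<le> (\<integral>\<^sup>+t. liminf (\<lambda>n. q n t) \<partial>lborel)"
    unfolding path_cost_def
  proof (rule nn_integral_mono_AE)
    show "AE t in lborel. ennreal (g (\<gamma> t)) * speed \<gamma> t * indicator {0..} t \<le> liminf (\<lambda>n. q n t)"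
      using Lip1_differentiable_AE[OF gam]
    proof eventually_elim
      case (elim t)
      show ?case
      proof (cases "0 \<le> t")
        case True
        let ?v = "vector_derivative \<gamma> (at t)"
        let ?i = "\<lambda>n. nat \<lfloor>?N n * t\<rfloor>"
        have diff: "\<gamma> differentiable at t" using elim True by simp
        have hv: "(\<gamma> has_vector_derivative ?v) (at t)" using diff vector_derivative_works by blast
        have i0: "real (?i n) = of_int \<lfloor>?N n * t\<rfloor>" for n using True by simp
        have i1: "real (?i n) / ?N n \<le> t" "t \<le> real (Suc (?i n)) / ?N n" for n
          using i0[of n] by (simp_all add: pos_divide_le_eq pos_le_divide_eq mult.commute) linarith+
        have len: "real (Suc (?i n)) / ?N n - real (?i n) / ?N n = 1 / ?N n" for n
          by (simp only: diff_divide_distrib[symmetric]) simp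
        have slopes: "(\<lambda>n. dist (\<gamma> (real (Suc (?i n)) / ?N n)) (\<gamma> (real (?i n) / ?N n)) / (real (Suc (?i n)) / ?N n - real (?i n) / ?N n)) \<longlonglongrightarrow> norm ?v"
        proof (rule straddling_slopes_tendsto[OF hv])
          show "(\<lambda>n. real (Suc (?i n)) / ?N n - real (?i n) / ?N n) \<longlonglongrightarrow> 0"
            unfolding len using LIMSEQ_inverse_real_of_nat by (simp add: inverse_eq_divide)
          show "real (?i n) / ?N n < real (Suc (?i n)) / ?N n" for n by (simp add: divide_strict_right_mono)
        qed (rule i1)+
        then have slopes: "(\<lambda>n. ?N n * dist (\<gamma> (real (Suc (?i n)) / ?N n)) (\<gamma> (real (?i n) / ?N n))) \<longlonglongrightarrow> norm ?v"
          unfolding len by (simp add: mult.commute)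
        have inv0: "(\<lambda>n. 1 / ?N n) \<longlonglongrightarrow> 0" using LIMSEQ_inverse_real_of_nat by (simp add: inverse_eq_divide)
        have "(\<lambda>n. g (\<gamma> (real (?i n) / ?N n))) \<longlonglongrightarrow> g (\<gamma> t)"
        proof (rule metric_tendsto_imp_tendsto)
          show "(\<lambda>n. G * (1 / ?N n)) \<longlonglongrightarrow> 0" using tendsto_mult_right_zero[OF inv0] by simp
          show "\<forall>\<^sub>F n in sequentially. dist (g (\<gamma> (real (?i n) / ?N n))) (g (\<gamma> t)) \<le> dist (G * (1 / ?N n)) 0"
          proof (rule always_eventually, rule allI)
            fix n
            have "dist (\<gamma> (real (?i n) / ?N n)) (\<gamma> t) \<le> 1 / ?N n"
              using Lip1_lipschitz[OF gam, of "real (?i n) / ?N n" t] True dist_grid_point_le[OF True, of n] by simp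
            then have "G * dist (\<gamma> (real (?i n) / ?N n)) (\<gamma> t) \<le> G * (1 / ?N n)"
              using lipschitz_on_nonneg[OF lip] by (rule mult_left_mono)
            then show "dist (g (\<gamma> (real (?i n) / ?N n))) (g (\<gamma> t)) \<le> dist (G * (1 / ?N n)) 0"
              using lipschitz_onD[OF lip, of "\<gamma> (real (?i n) / ?N n)" "\<gamma> t"] lipschitz_on_nonneg[OF lip] by simp
          qed
        qed
        then have "(\<lambda>n. ?c n (?i n)) \<longlonglongrightarrow> max 0 (g (\<gamma> t) - G * 0) * norm ?v"
          using tendsto_mult_left[OF inv0, of G]
          by (intro tendsto_intros slopes) simp_all
        then have "(\<lambda>n. ennreal (?c n (?i n))) \<longlonglongrightarrow> ennreal (g (\<gamma> t) * norm ?v)"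
          using g0[of "\<gamma> t"] by (intro tendsto_ennrealI) (simp add: max_absorb2)
        moreover have "\<forall>\<^sub>F n in sequentially. ennreal (?c n (?i n)) = q n t"
        proof -
          obtain n0 :: nat where n0: "t < real n0" using reals_Archimedean2 by blast
          show ?thesis
          proof (rule eventually_sequentiallyI[of n0])
            fix n assume "n0 \<le> n"
            then have "t < ?N n" using n0 by simp
            then show "ennreal (?c n (?i n)) = q n t" unfolding q_def by (subst sum_grid_indicator[OF True]) simp
          qed
        qed
        ultimately have "(\<lambda>n. q n t) \<longlonglongrightarrow> ennreal (g (\<gamma> t) * norm ?v)" by (rule Lim_transform_eventually)
        then have "liminf (\<lambda>n. q n t) = ennreal (g (\<gamma> t) * norm ?v)" by (rule lim_imp_Liminf[rotated]) simp
        then show ?thesis using True g0[of "\<gamma> t"] by (simp add: slopes_tendsto_speed(2)[OF diff] ennreal_mult)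
      qed simp
    qed
  qed
  also have "\<dots> \<le> liminf (\<lambda>n. \<integral>\<^sup>+t. q n t \<partial>lborel)" by (rule nn_integral_liminf) simp
  finally show ?thesis by (simp add: q_int)
qed

lemma weak_star_convD:
  assumes "weak_star_conv T M L" "continuous_map T euclideanreal f" "\<And>x. x \<in> topspace T \<Longrightarrow> \<bar>f x\<bar> \<le> B"
  shows "(\<lambda>n. \<integral>x. f x \<partial>M n) \<longlonglongrightarrow> (\<integral>x. f x \<partial>L)"
proof -
  have "bounded (f ` topspace T)" using assms(3) by (intro boundedI[of _ B]) auto
  then show ?thesis using assms unfolding weak_star_conv_def by blast
qed

lemma borel_prob_integrable:
  fixes f :: "'b \<Rightarrow> real"
  assumes "borel_prob T M" "continuous_map T euclideanreal f" "\<And>x. x \<in> topspace T \<Longrightarrow> \<bar>f x\<bar> \<le> B"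
  shows "integrable M f"
proof -
  interpret prob_space M using borel_probD(1)[OF assms(1)] .
  show ?thesis
    using assms(3) borel_probD(3)[OF assms(1)] continuous_map_measurable[OF assms(2)] measurable_cong_sets[OF borel_probD(2)[OF assms(1)] refl]
    by (intro integrable_const_bound[of _ B]) (auto intro!: AE_I2)
qed

text \<open>
  Each polygonal cost is a continuous bounded functional below the weighted length, and passes to the
  limit in \<open>n\<close>; afterwards the grid is refined, again with Fatou's lemma.
\<close>

proposition weighted_length_lsc:
  fixes P :: "(real \<Rightarrow> 'a::euclidean_space) measure"
  assumes lip: "G-lipschitz_on UNIV g" and g: "\<And>x. 0 \<le> g x" "\<And>x. g x \<le> B"
    and P: "borel_prob (Lip1_topology X) P" and Pn: "\<And>n. borel_prob (Lip1_topology X) (Pn n)"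
    and conv: "weak_star_conv (Lip1_topology X) Pn P"
  shows "(\<integral>\<^sup>+\<gamma>. path_cost (\<lambda>x. ennreal (g x)) \<gamma> \<partial>P) \<le> liminf (\<lambda>n. \<integral>\<^sup>+\<gamma>. path_cost (\<lambda>x. ennreal (g x)) \<gamma> \<partial>Pn n)"
proof -
  let ?S = "polygonal_cost g G"
  have bd: "\<gamma> \<in> topspace (Lip1_topology X) \<Longrightarrow> \<bar>?S j \<gamma>\<bar> \<le> real (Suc j * Suc j) * B" for j \<gamma>
    using polygonal_cost_le[OF g lipschitz_on_nonneg[OF lip], where \<gamma>=\<gamma> and X=X and n=j] polygonal_cost_nonneg[of g G j \<gamma>] by simp
  note cont = polygonal_cost_continuous[OF lip, of X]
  have nn: "(\<integral>\<^sup>+\<gamma>. ennreal (?S j \<gamma>) \<partial>M) = ennreal (\<integral>\<gamma>. ?S j \<gamma> \<partial>M)" if "borel_prob (Lip1_topology X) M" for M j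
    by (rule nn_integral_eq_integral[OF borel_prob_integrable[OF that cont bd]]) (simp_all add: polygonal_cost_nonneg)
  have Sm: "(\<lambda>\<gamma>. ennreal (?S j \<gamma>)) \<in> borel_measurable P" for j
    using continuous_map_measurable[OF cont] measurable_cong_sets[OF borel_probD(2)[OF P] refl]
    by (intro measurable_compose[OF _ measurable_ennreal]) auto
  have "(\<integral>\<^sup>+\<gamma>. path_cost (\<lambda>x. ennreal (g x)) \<gamma> \<partial>P) \<le> (\<integral>\<^sup>+\<gamma>. liminf (\<lambda>j. ennreal (?S j \<gamma>)) \<partial>P)"
    using borel_probD(3)[OF P] by (intro nn_integral_mono path_cost_le_liminf_polygonal[OF lip g(1)]) auto
  also have "\<dots> \<le> liminf (\<lambda>j. \<integral>\<^sup>+\<gamma>. ennreal (?S j \<gamma>) \<partial>P)" by (rule nn_integral_liminf[OF Sm])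
  also have "\<dots> \<le> liminf (\<lambda>n. \<integral>\<^sup>+\<gamma>. path_cost (\<lambda>x. ennreal (g x)) \<gamma> \<partial>Pn n)"
  proof -
    have *: "(\<integral>\<^sup>+\<gamma>. ennreal (?S j \<gamma>) \<partial>P) \<le> liminf (\<lambda>n. \<integral>\<^sup>+\<gamma>. path_cost (\<lambda>x. ennreal (g x)) \<gamma> \<partial>Pn n)" for j
    proof -
      have "(\<lambda>n. ennreal (\<integral>\<gamma>. ?S j \<gamma> \<partial>Pn n)) \<longlonglongrightarrow> ennreal (\<integral>\<gamma>. ?S j \<gamma> \<partial>P)"
        by (intro tendsto_ennrealI weak_star_convD[OF conv cont bd])
      then have "(\<lambda>n. \<integral>\<^sup>+\<gamma>. ennreal (?S j \<gamma>) \<partial>Pn n) \<longlonglongrightarrow> (\<integral>\<^sup>+\<gamma>. ennreal (?S j \<gamma>) \<partial>P)"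
        by (simp add: nn[OF P] nn[OF Pn])
      then have "(\<integral>\<^sup>+\<gamma>. ennreal (?S j \<gamma>) \<partial>P) = liminf (\<lambda>n. \<integral>\<^sup>+\<gamma>. ennreal (?S j \<gamma>) \<partial>Pn n)"
        by (intro lim_imp_Liminf[symmetric]) simp_all
      also have "\<dots> \<le> liminf (\<lambda>n. \<integral>\<^sup>+\<gamma>. path_cost (\<lambda>x. ennreal (g x)) \<gamma> \<partial>Pn n)"
        using borel_probD(3)[OF Pn]
        by (intro Liminf_mono always_eventually allI nn_integral_mono polygonal_cost_le_path_cost[OF lip]) auto
      finally show ?thesis .
    qed
    show ?thesis
      by (rule Liminf_le) (use * in \<open>auto intro: always_eventually\<close>)
  qed
  finally show ?thesis .
qed

section \<open>Lower semicontinuity of the energy\<close>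

text \<open>
  A continuous function of the curve that is 1 if the curve comes within distance \<open>r\<close> of \<open>x\<close> up to time
  \<open>M\<close>, and 0 if it stays at distance at least \<open>2 * r\<close>.
\<close>

definition near_hit :: "real \<Rightarrow> real \<Rightarrow> 'a::euclidean_space \<Rightarrow> (real \<Rightarrow> 'a) \<Rightarrow> real" where
  "near_hit M r x \<gamma> = max 0 (min 1 (2 - infdist x (\<gamma> ` {0..M}) / r))"

lemma near_hit_bounds: "0 \<le> near_hit M r x \<gamma>" "near_hit M r x \<gamma> \<le> 1"
  by (auto simp: near_hit_def)

lemma near_hit_abs_le: "\<bar>near_hit M r x \<gamma>\<bar> \<le> 1"
  using near_hit_bounds[of M r x \<gamma>] by simp

lemma clamp_lipschitz: "\<bar>max 0 (min 1 a) - max 0 (min 1 b)\<bar> \<le> \<bar>a - b\<bar>" for a b :: real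
  by linarith

lemma near_hit_lipschitz:
  assumes "r > 0"
  shows "\<bar>near_hit M r x \<gamma> - near_hit M r y \<gamma>\<bar> \<le> dist x y / r"
proof -
  let ?A = "\<gamma> ` {0..M}"
  have "\<bar>infdist x ?A - infdist y ?A\<bar> \<le> dist x y"
    using infdist_triangle[of x ?A y] infdist_triangle[of y ?A x] by (simp add: dist_commute abs_le_iff)
  then have "\<bar>infdist x ?A - infdist y ?A\<bar> / r \<le> dist x y / r" using assms by (simp add: divide_right_mono)
  then have "\<bar>(2 - infdist x ?A / r) - (2 - infdist y ?A / r)\<bar> \<le> dist x y / r"
    using assms by (simp add: abs_divide diff_divide_distrib[symmetric] abs_minus_commute)
  then show ?thesis unfolding near_hit_def using clamp_lipschitz order_trans by blast
qed

lemma infdist_image_le: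
  assumes "A \<noteq> {}" "\<And>t. t \<in> A \<Longrightarrow> dist (\<eta> t) (\<gamma> t) \<le> d"
  shows "infdist x (\<eta> ` A) \<le> infdist x (\<gamma> ` A) + d"
proof -
  have "infdist x (\<eta> ` A) - d \<le> dist x (\<gamma> t)" if "t \<in> A" for t
  proof -
    have "infdist x (\<eta> ` A) \<le> dist x (\<eta> t)" using that by (intro infdist_le) auto
    also have "\<dots> \<le> dist x (\<gamma> t) + dist (\<eta> t) (\<gamma> t)" by metric
    finally show ?thesis using assms(2)[OF that] by linarith
  qed
  then have "infdist x (\<eta> ` A) - d \<le> infdist x (\<gamma> ` A)"
    unfolding infdist_notempty[of "\<gamma> ` A", simplified, OF assms(1)]
    using assms(1) by (auto intro!: cINF_greatest)
  then show ?thesis by simp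
qed

lemma near_hit_continuous:
  assumes "r > 0" "M \<ge> 0"
  shows "continuous_map (Lip1_topology X) euclideanreal (near_hit M r x)"
proof (rule continuous_map_Lip1I)
  fix \<gamma> :: "real \<Rightarrow> 'a" and e :: real assume e: "e > 0"
  show "\<exists>K d. compact K \<and> K \<subseteq> {0..} \<and> d > 0 \<and>
     (\<forall>\<eta>\<in>Lip1 X. (\<forall>t\<in>K. dist (\<eta> t) (\<gamma> t) < d) \<longrightarrow> \<bar>near_hit M r x \<eta> - near_hit M r x \<gamma>\<bar> < e)"
  proof (intro exI[of _ "{0..M}"] exI[of _ "e * r / 2"] conjI ballI impI)
    fix \<eta> assume d: "\<forall>t\<in>{0..M}. dist (\<eta> t) (\<gamma> t) < e * r / 2"
    let ?a = "infdist x (\<eta> ` {0..M})" and ?b = "infdist x (\<gamma> ` {0..M})"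
    have "?a \<le> ?b + e * r / 2" "?b \<le> ?a + e * r / 2"
      using assms d by (intro infdist_image_le; force simp: dist_commute)+
    then have "\<bar>?a - ?b\<bar> \<le> e * r / 2" by linarith
    then have "\<bar>?a - ?b\<bar> / r \<le> (e * r / 2) / r" by (rule divide_right_mono) (use assms in simp)
    then have "\<bar>(2 - ?a / r) - (2 - ?b / r)\<bar> \<le> e / 2"
      using assms by (simp add: abs_divide diff_divide_distrib[symmetric] abs_minus_commute)
    moreover have "\<bar>near_hit M r x \<eta> - near_hit M r x \<gamma>\<bar> \<le> \<bar>(2 - ?a / r) - (2 - ?b / r)\<bar>"
      unfolding near_hit_def by (rule clamp_lipschitz)
    ultimately show "\<bar>near_hit M r x \<eta> - near_hit M r x \<gamma>\<bar> < e" using e by linarith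
  qed (use e assms in auto)
qed

lemma near_hit_measurable:
  assumes "borel_prob (Lip1_topology X) P" "r > 0" "M \<ge> 0"
  shows "near_hit M r x \<in> borel_measurable P"
  using continuous_map_measurable[OF near_hit_continuous[OF assms(2,3)]]
    measurable_cong_sets[OF borel_probD(2)[OF assms(1)] refl] by blast

lemma near_hit_integrable:
  assumes "borel_prob (Lip1_topology X) P" "r > 0" "M \<ge> 0"
  shows "integrable P (near_hit M r x)"
  by (rule borel_prob_integrable[OF assms(1) near_hit_continuous[OF assms(2,3)], where B=1]) (rule near_hit_abs_le)

definition near_multiplicity :: "(real \<Rightarrow> 'a::euclidean_space) measure \<Rightarrow> real \<Rightarrow> real \<Rightarrow> 'a \<Rightarrow> real" where
  "near_multiplicity P M r x = (\<integral>\<gamma>. near_hit M r x \<gamma> \<partial>P)"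

lemma near_multiplicity_nonneg: "0 \<le> near_multiplicity P M r x"
  unfolding near_multiplicity_def by (rule Bochner_Integration.integral_nonneg) (rule near_hit_bounds)

lemma near_multiplicity_lipschitz:
  assumes P: "borel_prob (Lip1_topology X) P" and r: "r > 0" and M: "M \<ge> 0"
  shows "\<bar>near_multiplicity P M r x - near_multiplicity P M r y\<bar> \<le> dist x y / r"
proof -
  interpret prob_space P using borel_probD(1)[OF P] .
  note int = near_hit_integrable[OF P r M]
  have "near_multiplicity P M r x - near_multiplicity P M r y = (\<integral>\<gamma>. near_hit M r x \<gamma> - near_hit M r y \<gamma> \<partial>P)"
    unfolding near_multiplicity_def by (rule Bochner_Integration.integral_diff[symmetric, OF int int])
  also have "\<bar>\<dots>\<bar> \<le> (\<integral>\<gamma>. \<bar>near_hit M r x \<gamma> - near_hit M r y \<gamma>\<bar> \<partial>P)" by (rule integral_abs_bound)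
  also have "\<dots> \<le> (\<integral>\<gamma>. dist x y / r \<partial>P)"
    using int by (intro integral_mono near_hit_lipschitz r) auto
  finally show ?thesis by (simp add: prob_space)
qed

lemma hits_le_near_hit:
  assumes "hits \<gamma> x" "constant_from M \<gamma>" "M \<ge> 0" "r > 0"
  shows "near_hit M r x \<gamma> = 1"
proof -
  obtain t where t: "t \<ge> 0" "\<gamma> t = x" using assms(1) by (auto simp: hits_def)
  have "\<gamma> (min t M) = x"
  proof (cases "t \<le> M")
    case False
    then have "\<gamma> t = \<gamma> M" using assms(2)[unfolded constant_from_def, rule_format, of t] by simp
    then show ?thesis using False t by simp
  qed (use t in simp)
  then have "x \<in> \<gamma> ` {0..M}" using t assms(3) by (intro image_eqI[of _ _ "min t M"]) auto
  then show ?thesis by (simp add: near_hit_def)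
qed

text \<open>
  Markov's inequality for the stopping time.
\<close>

lemma late_curves_measure:
  fixes Q :: "(real \<Rightarrow> 'a::euclidean_space) measure"
  assumes Q: "Q \<in> TP X C" and M: "M > 0" and C: "C > 0"
  shows "measure Q {\<gamma> \<in> space Q. \<not> constant_from M \<gamma>} \<le> C / M"
proof -
  have tp: "traffic_plan X Q" and T: "(\<integral>\<^sup>+\<gamma>. stopping_time \<gamma> \<partial>Q) \<le> ennreal C" using Q by (auto simp: TP_def)
  interpret prob_space Q using traffic_planD(1)[OF tp] .
  let ?A = "{\<gamma> \<in> space Q. \<not> constant_from M \<gamma>}"
  have [measurable]: "Measurable.pred Q (constant_from M)"
    using constant_from_measurable[OF traffic_planD(6)[OF tp], of M] M by simp
  have "ennreal M * emeasure Q ?A = (\<integral>\<^sup>+\<gamma>. ennreal M * indicator ?A \<gamma> \<partial>Q)"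
    by (simp add: nn_integral_cmult)
  also have "\<dots> \<le> (\<integral>\<^sup>+\<gamma>. stopping_time \<gamma> \<partial>Q)"
  proof (rule nn_integral_mono)
    fix \<gamma> assume "\<gamma> \<in> space Q"
    then have "\<gamma> \<in> Lip1 X" using traffic_planD(3)[OF tp] by simp
    then show "ennreal M * indicator ?A \<gamma> \<le> stopping_time \<gamma>"
      using stopping_time_lessD[of \<gamma> X M] by (auto split: split_indicator simp: not_less[symmetric])
  qed
  also have "\<dots> \<le> ennreal C" by (rule T)
  finally have "M * measure Q ?A \<le> C" using M C by (simp add: emeasure_eq_measure ennreal_mult[symmetric])
  then show ?thesis using M by (simp add: field_simps)
qed

text \<open>
  A curve that rests from time \<open>M\<close> on meets all its points before; the others are late.
\<close>

lemma multiplicity_le_near_multiplicity: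
  fixes Q :: "(real \<Rightarrow> 'a::euclidean_space) measure"
  assumes Q: "Q \<in> TP X C" and M: "M > 0" and C: "C > 0" and r: "r > 0"
  shows "multiplicity_at Q x \<le> near_multiplicity Q M r x + C / M"
proof -
  have tp: "traffic_plan X Q" using Q by (auto simp: TP_def)
  interpret prob_space Q using traffic_planD(1)[OF tp] .
  let ?A = "{\<gamma> \<in> space Q. \<not> constant_from M \<gamma>}" and ?H = "{\<gamma> \<in> space Q. hits \<gamma> x}"
  have [measurable]: "Measurable.pred Q (constant_from M)"
    using constant_from_measurable[OF traffic_planD(6)[OF tp], of M] M by simp
  have [measurable]: "Measurable.pred Q (\<lambda>\<gamma>. hits \<gamma> x)"
    by (rule hits_measurable[OF traffic_planD(6)[OF tp]]) simp
  have bp: "borel_prob (Lip1_topology X) Q" using tp by (simp add: traffic_plan_def)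
  have int: "integrable Q (near_hit M r x)" using near_hit_integrable[OF bp r] M by simp
  have ind: "integrable Q (indicat_real A)" if "A \<in> sets Q" for A
    using that by (intro integrable_real_indicator) (simp_all add: emeasure_eq_measure)
  have "?A \<in> sets Q" "?H \<in> sets Q" by measurable
  note ind = this[THEN ind]
  have A: "?A \<inter> space Q = ?A" by auto
  have "multiplicity_at Q x = (\<integral>\<gamma>. indicator ?H \<gamma> \<partial>Q)"
    by (simp add: multiplicity_at_def hits_def) (rule arg_cong[where f=prob], auto)
  also have "\<dots> \<le> (\<integral>\<gamma>. near_hit M r x \<gamma> + indicator ?A \<gamma> \<partial>Q)"
  proof (rule integral_mono)
    fix \<gamma> assume "\<gamma> \<in> space Q"
    then show "indicator ?H \<gamma> \<le> near_hit M r x \<gamma> + (indicator ?A \<gamma> :: real)"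
      using near_hit_bounds(1)[of M r x \<gamma>] hits_le_near_hit[of \<gamma> x M r] M r by (auto split: split_indicator)
  qed (intro ind Bochner_Integration.integrable_add int)+
  also have "\<dots> = near_multiplicity Q M r x + measure Q ?A"
    unfolding near_multiplicity_def by (subst Bochner_Integration.integral_add[OF int ind(1)]) (simp add: A)
  also have "\<dots> \<le> near_multiplicity Q M r x + C / M" using late_curves_measure[OF Q M C] by simp
  finally show ?thesis .
qed

text \<open>
  Weak convergence gives the estimate at the points of a finite net, and all functions involved have
  the Lipschitz constant \<open>1 / r\<close>.
\<close>

lemma near_multiplicity_uniform:
  fixes P :: "(real \<Rightarrow> 'a::euclidean_space) measure"
  assumes P: "borel_prob (Lip1_topology X) P" and Pn: "\<And>n. borel_prob (Lip1_topology X) (Pn n)"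
    and conv: "weak_star_conv (Lip1_topology X) Pn P" and X: "compact X" and r: "r > 0" and M: "M \<ge> 0" and e: "e > 0"
  shows "\<forall>\<^sub>F n in sequentially. \<forall>x\<in>X. near_multiplicity (Pn n) M r x \<le> near_multiplicity P M r x + e"
proof -
  have pos: "e * r / 4 > 0" using e r by simp
  then obtain S where S: "finite S" "X \<subseteq> (\<Union>s\<in>S. ball s (e * r / 4))"
    using X unfolding compact_eq_totally_bounded by blast
  have "\<forall>\<^sub>F n in sequentially. \<forall>s\<in>S. \<bar>near_multiplicity (Pn n) M r s - near_multiplicity P M r s\<bar> < e / 2"
  proof (rule eventually_ball_finite[OF S(1)], rule ballI)
    fix s
    have "(\<lambda>n. near_multiplicity (Pn n) M r s) \<longlonglongrightarrow> near_multiplicity P M r s"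
      unfolding near_multiplicity_def
      by (rule weak_star_convD[OF conv near_hit_continuous[OF r M], where B=1]) (rule near_hit_abs_le)
    then show "\<forall>\<^sub>F n in sequentially. \<bar>near_multiplicity (Pn n) M r s - near_multiplicity P M r s\<bar> < e / 2"
      using tendstoD[of _ _ _ "e / 2"] e by (force simp: dist_real_def)
  qed
  then show ?thesis
  proof eventually_elim
    case (elim n)
    show ?case
    proof
      fix x assume "x \<in> X"
      then obtain s where s: "s \<in> S" "dist s x < e * r / 4" using S(2) by auto
      have "dist s x / r \<le> e / 4" using s(2) r by (simp add: field_simps)
      moreover have "\<bar>near_multiplicity (Pn n) M r s - near_multiplicity P M r s\<bar> < e / 2"
        using elim s(1) by blast
      ultimately show "near_multiplicity (Pn n) M r x \<le> near_multiplicity P M r x + e"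
        using near_multiplicity_lipschitz[OF P r M, of s x] near_multiplicity_lipschitz[OF Pn r M, of n s x]
        by linarith
    qed
  qed
qed

lemma powr_shift_lipschitz:
  fixes v :: "'a::metric_space \<Rightarrow> real"
  assumes v: "\<And>x. 0 \<le> v x" "\<And>x y. \<bar>v x - v y\<bar> \<le> K * dist x y" and c: "c > 0" and b: "b \<le> 0" and K: "0 \<le> K"
  shows "(- b * c powr (b - 1) * K)-lipschitz_on UNIV (\<lambda>x. (v x + c) powr b)"
proof (rule lipschitz_onI)
  have key: "\<bar>s powr b - t powr b\<bar> \<le> - b * c powr (b - 1) * \<bar>s - t\<bar>" if "c \<le> s" "s < t" for s t
  proof -
    have "\<exists>z>s. z < t \<and> t powr b - s powr b = (t - s) * (b * z powr (b - 1))"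
      using that c by (intro MVT2) (auto intro!: derivative_eq_intros)
    then obtain z where z: "s < z" "z < t" "t powr b - s powr b = (t - s) * (b * z powr (b - 1))" by blast
    have "z powr (b - 1) \<le> c powr (b - 1)" using z that c b by (intro powr_mono2') auto
    then have "(t - s) * (- b * z powr (b - 1)) \<le> (t - s) * (- b * c powr (b - 1))"
      using that b by (intro mult_left_mono) (auto intro: mult_left_mono)
    moreover have "\<bar>s powr b - t powr b\<bar> = (t - s) * (- b * z powr (b - 1))"
    proof -
      have "0 \<le> (t - s) * (- b * z powr (b - 1))" using that b by (intro mult_nonneg_nonneg) auto
      then show ?thesis using z(3) by simp
    qed
    ultimately show ?thesis using that by (simp add: mult.commute)
  qed
  have nn: "0 \<le> - b * c powr (b - 1)" using b by (simp add: mult_nonpos_nonneg)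
  show "0 \<le> - b * c powr (b - 1) * K" by (rule mult_nonneg_nonneg[OF nn K])
  fix x y
  have "\<bar>(v x + c) powr b - (v y + c) powr b\<bar> \<le> - b * c powr (b - 1) * \<bar>v x - v y\<bar>"
    using key[of "v x + c" "v y + c"] key[of "v y + c" "v x + c"] v(1)[of x] v(1)[of y]
    by (cases "v x" "v y" rule: linorder_cases) (auto simp: abs_minus_commute)
  also have "\<dots> \<le> - b * c powr (b - 1) * (K * dist x y)" using v(2) nn by (rule mult_left_mono)
  finally show "dist ((v x + c) powr b) ((v y + c) powr b) \<le> - b * c powr (b - 1) * K * dist x y"
    by (simp add: dist_real_def mult.assoc)
qed

text \<open>
  The image of a curve that settles is compact, hence at positive distance from a point not on it.
\<close>

lemma near_hit_vanishes:
  fixes \<gamma> :: "real \<Rightarrow> 'a::euclidean_space"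
  assumes g: "\<gamma> \<in> Lip1 X" "stopping_time \<gamma> < \<infinity>" and "\<not> hits \<gamma> x"
  shows "\<forall>\<^sub>F k in sequentially. near_hit (real (Suc k)) (1 / real (Suc k)) x \<gamma> = 0"
proof -
  define T where "T = settling_time \<gamma>"
  have T: "0 \<le> T" "constant_from T \<gamma>" using finite_stopping_time_settles(1)[OF g] by (auto simp: T_def)
  have comp: "compact (\<gamma> ` {0..T})"
    by (intro compact_continuous_image Lip1_continuous_on[OF g(1)]) auto
  have img: "\<gamma> ` {0..M} \<subseteq> \<gamma> ` {0..T}" for M
  proof
    fix y assume "y \<in> \<gamma> ` {0..M}"
    then obtain t where t: "0 \<le> t" "y = \<gamma> t" by auto
    show "y \<in> \<gamma> ` {0..T}"
    proof (cases "t \<le> T")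
      case False
      then have "\<gamma> t = \<gamma> T" using T(2)[unfolded constant_from_def, rule_format, of t] by simp
      then show ?thesis using t T by auto
    qed (use t in auto)
  qed
  define \<delta> where "\<delta> = infdist x (\<gamma> ` {0..T})"
  have "x \<notin> \<gamma> ` {0..T}" using assms(3) by (auto simp: hits_def)
  then have d: "\<delta> > 0"
    unfolding \<delta>_def using comp T(1) by (intro infdist_pos_not_in_closed) (auto simp: compact_imp_closed)
  obtain k0 :: nat where k0: "2 / \<delta> < real k0" using reals_Archimedean2 by blast
  show ?thesis
  proof (rule eventually_sequentiallyI[of k0])
    fix k assume "k0 \<le> k"
    then have "2 / \<delta> < real (Suc k)" using k0 by simp
    then have "2 \<le> \<delta> * real (Suc k)" using d by (simp add: field_simps)
    also have "\<dots> \<le> infdist x (\<gamma> ` {0..real (Suc k)}) * real (Suc k)"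
      unfolding \<delta>_def using img by (intro mult_right_mono infdist_mono) auto
    finally show "near_hit (real (Suc k)) (1 / real (Suc k)) x \<gamma> = 0" by (simp add: near_hit_def)
  qed
qed

lemma near_multiplicity_limit:
  fixes P :: "(real \<Rightarrow> 'a::euclidean_space) measure"
  assumes tp: "traffic_plan X P"
  obtains \<epsilon> where "\<epsilon> \<longlonglongrightarrow> 0"
    "\<And>k. near_multiplicity P (real (Suc k)) (1 / real (Suc k)) x \<le> multiplicity_at P x + \<epsilon> k"
proof -
  interpret prob_space P using traffic_planD(1)[OF tp] .
  have bp: "borel_prob (Lip1_topology X) P" using tp by (simp add: traffic_plan_def)
  let ?H = "{\<gamma> \<in> space P. hits \<gamma> x}"
  let ?f = "\<lambda>k. near_hit (real (Suc k)) (1 / real (Suc k)) x"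
  have [measurable]: "Measurable.pred P (\<lambda>\<gamma>. hits \<gamma> x)"
    by (rule hits_measurable[OF traffic_planD(6)[OF tp]]) simp
  have fm[measurable]: "?f k \<in> borel_measurable P" for k by (rule near_hit_measurable[OF bp]) auto
  have int: "integrable P (?f k)" for k by (rule near_hit_integrable[OF bp]) auto
  have fi[measurable]: "(\<lambda>\<gamma>. ?f k \<gamma> * indicator (space P - ?H) \<gamma>) \<in> borel_measurable P" for k
    by measurable
  define \<epsilon> where "\<epsilon> k = (\<integral>\<gamma>. ?f k \<gamma> * indicator (space P - ?H) \<gamma> \<partial>P)" for k
  have "(\<lambda>k. \<integral>\<gamma>. ?f k \<gamma> * indicator (space P - ?H) \<gamma> \<partial>P) \<longlonglongrightarrow> (\<integral>\<gamma>. 0 \<partial>P)"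
  proof (rule integral_dominated_convergence[where w="\<lambda>_. 1"])
    show "AE \<gamma> in P. (\<lambda>k. ?f k \<gamma> * indicator (space P - ?H) \<gamma>) \<longlonglongrightarrow> 0"
      using traffic_planD(4)[OF tp] AE_space
    proof eventually_elim
      case (elim \<gamma>)
      show ?case
      proof (cases "hits \<gamma> x")
        case False
        have "\<forall>\<^sub>F k in sequentially. ?f k \<gamma> = 0"
          using elim False traffic_planD(3)[OF tp] by (intro near_hit_vanishes) auto
        then show ?thesis by (intro tendsto_eventually) (auto elim: eventually_mono)
      qed (use elim in simp)
    qed
    show "AE \<gamma> in P. norm (?f k \<gamma> * indicator (space P - ?H) \<gamma>) \<le> 1" for k
      by (intro AE_I2) (simp add: abs_mult near_hit_bounds abs_of_nonneg split: split_indicator)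
  qed (use fi in simp_all)
  then have "\<epsilon> \<longlonglongrightarrow> 0" unfolding \<epsilon>_def[abs_def] by (simp only: Bochner_Integration.integral_zero)
  moreover have "near_multiplicity P (real (Suc k)) (1 / real (Suc k)) x \<le> multiplicity_at P x + \<epsilon> k" for k
  proof -
    have int2: "integrable P (\<lambda>\<gamma>. ?f k \<gamma> * indicator (space P - ?H) \<gamma>)"
    proof (rule integrable_const_bound[of _ 1, OF _ fi], rule AE_I2)
      show "norm (?f k \<gamma> * indicator (space P - ?H) \<gamma>) \<le> 1" for \<gamma>
        by (simp add: abs_mult near_hit_abs_le split: split_indicator)
    qed
    have "?H \<in> sets P" by measurable
    then have indH: "integrable P (indicat_real ?H)"
      by (rule integrable_real_indicator) (simp add: emeasure_eq_measure)
    have HP: "?H \<inter> space P = ?H" by auto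
    have "near_multiplicity P (real (Suc k)) (1 / real (Suc k)) x \<le> (\<integral>\<gamma>. indicator ?H \<gamma> + ?f k \<gamma> * indicator (space P - ?H) \<gamma> \<partial>P)"
      unfolding near_multiplicity_def
    proof (rule integral_mono)
      show "integrable P (\<lambda>\<gamma>. indicator ?H \<gamma> + ?f k \<gamma> * indicator (space P - ?H) \<gamma>)"
        by (rule Bochner_Integration.integrable_add[OF indH int2])
      fix \<gamma> assume "\<gamma> \<in> space P"
      then show "?f k \<gamma> \<le> indicator ?H \<gamma> + ?f k \<gamma> * indicator (space P - ?H) \<gamma>"
        using near_hit_bounds(2) by (auto split: split_indicator)
    qed (rule int)
    also have "\<dots> = multiplicity_at P x + \<epsilon> k"
      unfolding \<epsilon>_def multiplicity_at_def hits_def[symmetric]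
      by (subst Bochner_Integration.integral_add[OF indH int2]) (simp add: HP)
    finally show ?thesis .
  qed
  ultimately show thesis by (rule that)
qed

lemma mult_power_antimono:
  assumes "0 \<le> m" "m \<le> m'" "\<alpha> < 1"
  shows "mult_power \<alpha> m' \<le> mult_power \<alpha> m"
  using assms by (auto simp: mult_power_def intro!: ennreal_leI powr_mono2')

text \<open>
  The value \<open>\<infinity>\<close> at multiplicity 0 is the limit from the right.
\<close>

lemma mult_power_tendsto:
  assumes "\<And>k. u k > 0" "u \<longlonglongrightarrow> m" "m \<ge> 0" "\<alpha> < 1"
  shows "(\<lambda>k. ennreal (u k powr (\<alpha> - 1))) \<longlonglongrightarrow> mult_power \<alpha> m"
proof (cases "m = 0")
  case False
  then show ?thesis using assms by (auto simp: mult_power_def intro!: tendsto_intros)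
next
  case True
  have "filterlim u (at_right 0) sequentially"
    using assms(1,2) True by (intro tendsto_imp_filterlim_at_right) auto
  moreover have "LIM x at_right 0. x powr (\<alpha> - 1) :> at_top" using assms(4) by real_asymp
  ultimately have "LIM k sequentially. u k powr (\<alpha> - 1) :> at_top" by (rule filterlim_compose[rotated])
  then show ?thesis using True by (simp add: mult_power_def ennreal_tendsto_top_eq_at_top)
qed

text \<open>
  The weights \<open>g k\<close> are Lipschitz and eventually below the power of the multiplicity of \<open>Pn n\<close>, while
  their lower limit in \<open>k\<close> is above the power of the multiplicity of \<open>P\<close>.
\<close>

theorem energy_lsc:
  fixes P :: "(real \<Rightarrow> 'a::euclidean_space) measure"
  assumes X: "compact X" and \<alpha>: "\<alpha> < 1" and C: "C > 0"
    and tp: "traffic_plan X P" and Pn: "\<And>n. Pn n \<in> TP X C" and conv: "weak_star_conv (Lip1_topology X) Pn P"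
  shows "energy \<alpha> P \<le> liminf (\<lambda>n. energy \<alpha> (Pn n))"
proof -
  have bp: "borel_prob (Lip1_topology X) P" using tp by (simp add: traffic_plan_def)
  have tpn: "traffic_plan X (Pn n)" for n using Pn by (simp add: TP_def)
  then have bpn: "borel_prob (Lip1_topology X) (Pn n)" for n by (simp add: traffic_plan_def)
  define v where "v k = near_multiplicity P (real (Suc k)) (1 / real (Suc k))" for k :: nat
  (* C / Suc k pays for the curves that move after time Suc k, and 1 / Suc k for the uniform
     approximation of the near multiplicity; c k > 0 also makes the weight g k Lipschitz. *)
  define c where "c k = (C + 1) / real (Suc k)" for k :: nat
  define g where "g k x = (v k x + c k) powr (\<alpha> - 1)" for k x
  have c: "c k > 0" for k using C by (simp add: c_def)
  have v0: "0 \<le> v k x" for k x unfolding v_def by (rule near_multiplicity_nonneg)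
  define G where "G k = - (\<alpha> - 1) * c k powr (\<alpha> - 1 - 1) * real (Suc k)" for k
  have lip: "(G k)-lipschitz_on UNIV (g k)" for k
    unfolding G_def g_def
  proof (rule powr_shift_lipschitz)
    fix x y
    show "\<bar>v k x - v k y\<bar> \<le> real (Suc k) * dist x y"
      unfolding v_def using near_multiplicity_lipschitz[OF bp, of "1 / real (Suc k)" "real (Suc k)" x y] by (simp add: mult.commute)
  qed (use v0 c \<alpha> in auto)
  have g0: "0 \<le> g k x" for k x by (simp add: g_def)
  have gB: "g k x \<le> c k powr (\<alpha> - 1)" for k x
    unfolding g_def using v0[of k x] c[of k] \<alpha> by (intro powr_mono2') auto
  have gm: "(\<lambda>x. ennreal (g k x)) \<in> borel_measurable borel" for k
    using lipschitz_on_continuous_on[OF lip] by (intro measurable_compose[OF borel_measurable_continuous_onI measurable_ennreal])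
  let ?L = "\<lambda>k \<gamma>. path_cost (\<lambda>x. ennreal (g k x)) \<gamma>"
  have upper: "(\<integral>\<^sup>+\<gamma>. ?L k \<gamma> \<partial>P) \<le> liminf (\<lambda>n. energy \<alpha> (Pn n))" for k
  proof -
    have "(\<integral>\<^sup>+\<gamma>. ?L k \<gamma> \<partial>P) \<le> liminf (\<lambda>n. \<integral>\<^sup>+\<gamma>. ?L k \<gamma> \<partial>Pn n)"
      by (rule weighted_length_lsc[OF lip g0 gB bp bpn conv])
    also have "\<dots> \<le> liminf (\<lambda>n. energy \<alpha> (Pn n))"
    proof (rule Liminf_mono)
      have "\<forall>\<^sub>F n in sequentially. \<forall>x\<in>X. near_multiplicity (Pn n) (real (Suc k)) (1 / real (Suc k)) x \<le> v k x + 1 / real (Suc k)"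
        unfolding v_def by (rule near_multiplicity_uniform[OF bp bpn conv X]) auto
      then show "\<forall>\<^sub>F n in sequentially. (\<integral>\<^sup>+\<gamma>. ?L k \<gamma> \<partial>Pn n) \<le> energy \<alpha> (Pn n)"
      proof eventually_elim
        case (elim n)
        have m: "multiplicity_at (Pn n) x \<le> v k x + c k" if "x \<in> X" for x
        proof -
          have "multiplicity_at (Pn n) x \<le> near_multiplicity (Pn n) (real (Suc k)) (1 / real (Suc k)) x + C / real (Suc k)"
            by (rule multiplicity_le_near_multiplicity[OF Pn _ C]) auto
          then show ?thesis using elim that by (force simp: c_def add_divide_distrib)
        qed
        have w: "ennreal (g k x) \<le> mult_power \<alpha> (multiplicity_at (Pn n) x)" if "x \<in> X" for x
        proof -
          have "v k x + c k > 0" using v0[of k x] c[of k] by linarith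
          then have "ennreal (g k x) = mult_power \<alpha> (v k x + c k)" by (auto simp: mult_power_def g_def)
          also have "\<dots> \<le> mult_power \<alpha> (multiplicity_at (Pn n) x)"
            using m[OF that] \<alpha> by (intro mult_power_antimono) (auto simp: multiplicity_at_def)
          finally show ?thesis .
        qed
        show ?case
          unfolding energy_eq_path_cost[OF traffic_planD(3)[OF tpn]] path_cost_def
        proof (intro nn_integral_mono)
          fix \<gamma> t assume "\<gamma> \<in> space (Pn n)"
          then have "\<gamma> \<in> Lip1 X" using traffic_planD(3)[OF tpn] by simp
          then show "ennreal (g k (\<gamma> t)) * speed \<gamma> t * indicator {0..} t
             \<le> mult_power \<alpha> (multiplicity_at (Pn n) (\<gamma> t)) * speed \<gamma> t * indicator {0..} t"
            using w[of "\<gamma> t"] Lip1_in[of \<gamma> X t] by (auto intro!: mult_right_mono split: split_indicator)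
        qed
      qed
    qed
    finally show ?thesis .
  qed
  have lower: "mult_power \<alpha> (multiplicity_at P x) \<le> liminf (\<lambda>k. ennreal (g k x))" for x
  proof -
    obtain \<epsilon> where e: "\<epsilon> \<longlonglongrightarrow> 0" "\<And>k. v k x \<le> multiplicity_at P x + \<epsilon> k"
      unfolding v_def by (rule near_multiplicity_limit[OF tp, of x]) (blast intro: that)
    let ?u = "\<lambda>k. multiplicity_at P x + \<epsilon> k + c k"
    have c0: "c \<longlonglongrightarrow> 0"
      using tendsto_mult_right_zero[OF LIMSEQ_inverse_real_of_nat, of "C + 1"] by (simp add: c_def[abs_def] divide_inverse)
    have upos: "?u k > 0" for k using e(2)[of k] v0[of k x] c[of k] by linarith
    have ulim: "?u \<longlonglongrightarrow> multiplicity_at P x"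
      using tendsto_add[OF tendsto_add[OF tendsto_const e(1)] c0, of "multiplicity_at P x"] by simp
    have "(\<lambda>k. ennreal (?u k powr (\<alpha> - 1))) \<longlonglongrightarrow> mult_power \<alpha> (multiplicity_at P x)"
      by (rule mult_power_tendsto[OF upos ulim _ \<alpha>]) (simp add: multiplicity_at_def)
    then have "mult_power \<alpha> (multiplicity_at P x) = liminf (\<lambda>k. ennreal (?u k powr (\<alpha> - 1)))"
      by (intro lim_imp_Liminf[symmetric]) simp_all
    also have "\<dots> \<le> liminf (\<lambda>k. ennreal (g k x))"
    proof (intro Liminf_mono always_eventually allI ennreal_leI)
      fix k
      show "?u k powr (\<alpha> - 1) \<le> g k x"
        unfolding g_def using e(2)[of k] v0[of k x] c[of k] \<alpha> by (intro powr_mono2') auto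
    qed
    finally show ?thesis .
  qed
  have "energy \<alpha> P = (\<integral>\<^sup>+\<gamma>. path_cost (\<lambda>x. mult_power \<alpha> (multiplicity_at P x)) \<gamma> \<partial>P)"
    by (rule energy_eq_path_cost[OF traffic_planD(3)[OF tp]])
  also have "\<dots> \<le> (\<integral>\<^sup>+\<gamma>. liminf (\<lambda>k. ?L k \<gamma>) \<partial>P)"
  proof (rule nn_integral_mono)
    fix \<gamma> assume "\<gamma> \<in> space P"
    then have gam: "\<gamma> \<in> Lip1 X" using traffic_planD(3)[OF tp] by simp
    have "path_cost (\<lambda>x. mult_power \<alpha> (multiplicity_at P x)) \<gamma>
      \<le> (\<integral>\<^sup>+t. liminf (\<lambda>k. ennreal (g k (\<gamma> t)) * speed \<gamma> t * indicator {0..} t) \<partial>lborel)"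
      unfolding path_cost_def
    proof (rule nn_integral_mono)
      fix t
      show "mult_power \<alpha> (multiplicity_at P (\<gamma> t)) * speed \<gamma> t * indicator {0..} t
         \<le> liminf (\<lambda>k. ennreal (g k (\<gamma> t)) * speed \<gamma> t * indicator {0..} t)"
      proof (cases "0 \<le> t")
        case True
        then have "speed \<gamma> t \<noteq> \<top>" using Lip1_speed_le_1[OF gam True] by (auto simp: top_unique)
        then obtain s where s: "s \<ge> 0" "speed \<gamma> t = ennreal s" by (cases "speed \<gamma> t") auto
        have "mult_power \<alpha> (multiplicity_at P (\<gamma> t)) * ennreal s \<le> liminf (\<lambda>k. ennreal (g k (\<gamma> t))) * ennreal s"
          by (intro mult_right_mono lower) simp
        also have "\<dots> = liminf (\<lambda>k. ennreal (g k (\<gamma> t)) * ennreal s)"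
        proof -
          have "mono (\<lambda>y. ennreal s * y)" by (auto simp: mono_def intro: mult_left_mono)
          moreover have "continuous_on UNIV (\<lambda>y. ennreal s * y)"
            by (intro ennreal_continuous_on_cmult) auto
          ultimately show ?thesis
            using Liminf_compose_continuous_mono[of "\<lambda>y. ennreal s * y" sequentially "\<lambda>k. ennreal (g k (\<gamma> t))"]
            by (simp only: mult.commute[of _ "ennreal s"] trivial_limit_sequentially not_False_eq_True)
        qed
        finally show ?thesis using True s by simp
      qed simp
    qed
    also have "\<dots> \<le> liminf (\<lambda>k. ?L k \<gamma>)"
      unfolding path_cost_def by (intro nn_integral_liminf integrand_measurable_fixed[OF gam gm]) auto
    finally show "path_cost (\<lambda>x. mult_power \<alpha> (multiplicity_at P x)) \<gamma> \<le> liminf (\<lambda>k. ?L k \<gamma>)" .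
  qed
  also have "\<dots> \<le> liminf (\<lambda>k. \<integral>\<^sup>+\<gamma>. ?L k \<gamma> \<partial>P)"
    by (intro nn_integral_liminf path_cost_measurable[OF traffic_planD(6)[OF tp] gm])
  also have "\<dots> \<le> liminf (\<lambda>n. energy \<alpha> (Pn n))"
    by (rule Liminf_le) (use upper in \<open>auto intro: always_eventually\<close>)
  finally show ?thesis .
qed

section \<open>The coupling of a limit plan\<close>

text \<open>
  The indicator of a relatively open set is the increasing limit of \<open>min 1 (n * d)\<close>, where \<open>d\<close> is the
  distance to the complement.
\<close>

lemma borel_prob_eqI:
  fixes \<mu> \<nu> :: "'b::euclidean_space measure"
  assumes \<mu>: "borel_prob (top_of_set S) \<mu>" and \<nu>: "borel_prob (top_of_set S) \<nu>"
    and eq: "\<And>f :: 'b \<Rightarrow> real. continuous_on UNIV f \<Longrightarrow> (\<And>x. 0 \<le> f x \<and> f x \<le> 1) \<Longrightarrow> (\<integral>x. f x \<partial>\<mu>) = (\<integral>x. f x \<partial>\<nu>)"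
  shows "\<mu> = \<nu>"
proof -
  let ?E = "{U. openin (top_of_set S) U}"
  have emeq: "emeasure \<mu> U = emeasure \<nu> U" if U: "openin (top_of_set S) U" for U
  proof (cases "S - U = {}")
    case True
    then have "U = S" using openin_subset[OF U] by auto
    then show ?thesis
      using prob_space.emeasure_space_1[OF borel_probD(1)[OF \<mu>]] prob_space.emeasure_space_1[OF borel_probD(1)[OF \<nu>]]
        borel_probD(3)[OF \<mu>] borel_probD(3)[OF \<nu>] by simp
  next
    case False
    let ?F = "S - U"
    let ?f = "\<lambda>n x. min 1 (real n * infdist x ?F)"
    have lim: "(\<lambda>n. \<integral>x. ?f n x \<partial>M) \<longlonglongrightarrow> measure M U" if M: "borel_prob (top_of_set S) M" for M
    proof -
      interpret prob_space M using borel_probD(1)[OF M] .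
      have UM: "U \<in> sets M" using U by (simp add: borel_probD(2)[OF M] sets_borel_of)
      have sp: "space M = S" using borel_probD(3)[OF M] by simp
      have fm: "?f n \<in> borel_measurable M" for n
      proof -
        have "continuous_map (top_of_set S) euclideanreal (?f n)"
          by (simp add: continuous_map_iff_continuous) (intro continuous_intros)
        then show ?thesis using continuous_map_measurable measurable_cong_sets[OF borel_probD(2)[OF M] refl] by blast
      qed
      have "(\<lambda>n. \<integral>x. ?f n x \<partial>M) \<longlonglongrightarrow> (\<integral>x. indicator U x \<partial>M)"
      proof (rule integral_dominated_convergence[where w="\<lambda>_. 1"])
        show "AE x in M. (\<lambda>n. ?f n x) \<longlonglongrightarrow> indicator U x"
        proof (rule AE_I2)
          fix x assume x: "x \<in> space M"
          show "(\<lambda>n. ?f n x) \<longlonglongrightarrow> indicator U x"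
          proof (cases "x \<in> U")
            case True
            have "closedin (top_of_set S) ?F" by (rule closedin_diff[OF closedin_subtopology_refl[THEN iffD2] U]) simp
            then obtain T where T: "closed T" "?F = S \<inter> T" unfolding closedin_closed by blast
            have "x \<notin> closure ?F"
            proof
              assume "x \<in> closure ?F"
              then have "x \<in> T" using T closure_minimal[of ?F T] by auto
              then show False using T x True sp by auto
            qed
            then have pos: "infdist x ?F > 0"
              using False in_closure_iff_infdist_zero[of ?F x] infdist_nonneg[of x ?F] by auto
            obtain n0 :: nat where n0: "1 / infdist x ?F < real n0" using reals_Archimedean2 by blast
            have "\<forall>\<^sub>F n in sequentially. ?f n x = 1"
            proof (rule eventually_sequentiallyI[of n0])
              fix n assume "n0 \<le> n"
              then have "1 / infdist x ?F < real n" using n0 by simp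
              then show "?f n x = 1" using pos by (simp add: field_simps)
            qed
            then show ?thesis using True by (simp add: tendsto_eventually)
          next
            case F: False
            then have "infdist x ?F = 0" using x sp by (simp add: infdist_zero)
            then show ?thesis using F by simp
          qed
        qed
        show "AE x in M. norm (?f n x) \<le> 1" for n
          by (rule AE_I2) (simp add: infdist_nonneg)
      qed (use fm UM in simp_all)
      also have "(\<integral>x. indicator U x \<partial>M) = measure M U" using sets.sets_into_space[OF UM] by (simp add: Int_absorb2)
      finally show ?thesis .
    qed
    have "(\<integral>x. ?f n x \<partial>\<mu>) = (\<integral>x. ?f n x \<partial>\<nu>)" for n
      by (rule eq) (auto intro!: continuous_intros simp: infdist_nonneg)
    then have "measure \<mu> U = measure \<nu> U" using lim[OF \<mu>] lim[OF \<nu>] LIMSEQ_unique by auto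
    then show ?thesis
      using borel_probD(1)[OF \<mu>] borel_probD(1)[OF \<nu>]
      by (simp add: finite_measure.emeasure_eq_measure prob_space.finite_measure)
  qed
  show ?thesis
  proof (rule measure_eqI_generator_eq[of ?E S \<mu> \<nu> "\<lambda>_. S"])
    show "Int_stable ?E" by (auto simp: Int_stable_def)
    show "?E \<subseteq> Pow S" using openin_subset by fastforce
    show "\<And>X. X \<in> ?E \<Longrightarrow> emeasure \<mu> X = emeasure \<nu> X" using emeq by blast
    show "sets \<mu> = sigma_sets S ?E" "sets \<nu> = sigma_sets S ?E"
      using borel_probD(2)[OF \<mu>] borel_probD(2)[OF \<nu>] by (simp_all add: sets_borel_of)
    show "range (\<lambda>_::nat. S) \<subseteq> ?E" by auto
    show "emeasure \<mu> S \<noteq> \<infinity>" for i :: nat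
      using prob_space.emeasure_space_1[OF borel_probD(1)[OF \<mu>]] borel_probD(3)[OF \<mu>] by simp
  qed auto
qed

lemma endpoints_measurable:
  fixes f :: "'w \<Rightarrow> real \<Rightarrow> 'a::euclidean_space"
  assumes f: "f \<in> measurable N (borel_of (Lip1_topology X))"
  shows "(\<lambda>\<omega>. (e_0 (f \<omega>), e_infty (f \<omega>))) \<in> measurable N (borel_of (top_of_set (X \<times> X)))"
proof -
  have "(\<lambda>\<omega>. e_0 (f \<omega>)) \<in> borel_measurable N"
    unfolding e_0_def by (rule measurable_compose[OF f eval_measurable]) simp
  then have "(\<lambda>\<omega>. (e_0 (f \<omega>), e_infty (f \<omega>))) \<in> borel_measurable N"
    using e_infty_measurable[OF f] by (rule borel_measurable_Pair)
  moreover have "(e_0 (f \<omega>), e_infty (f \<omega>)) \<in> X \<times> X" if "\<omega> \<in> space N" for \<omega>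
    using measurable_Lip1_in[OF f that] Lip1_in[of "f \<omega>" X 0] e_infty_in[of "f \<omega>" X] by (simp add: e_0_def)
  ultimately have "(\<lambda>\<omega>. (e_0 (f \<omega>), e_infty (f \<omega>))) \<in> measurable N (restrict_space borel (X \<times> X))"
    by (intro measurable_restrict_space2) auto
  then show ?thesis using measurable_cong_sets[OF refl sets_borel_of_top_of_set] by blast
qed

lemma coupling_integral:
  fixes P :: "(real \<Rightarrow> 'a::euclidean_space) measure" and f :: "'a \<times> 'a \<Rightarrow> real"
  assumes tp: "traffic_plan X P" and c: "has_coupling X P \<pi>" and f: "continuous_on (X \<times> X) f"
  shows "(\<integral>\<gamma>. f (e_0 \<gamma>, e_infty \<gamma>) \<partial>P) = (\<integral>z. f z \<partial>\<pi>)"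
proof -
  have "continuous_map (top_of_set (X \<times> X)) euclideanreal f" using f by (simp add: continuous_map_iff_continuous)
  then have "f \<in> borel_measurable (borel_of (top_of_set (X \<times> X)))" by (rule continuous_map_measurable)
  then show ?thesis
    using c unfolding has_coupling_def
    by (subst integral_distr[OF endpoints_measurable[OF traffic_planD(6)[OF tp]], symmetric]) simp_all
qed

text \<open>
  The final point is not a continuous function of the curve. The position at time \<open>M\<close> is, and it is the
  final point except on a set of curves of mass at most \<open>C / M\<close>, uniformly in \<open>n\<close>.
\<close>

theorem coupling_of_limit:
  fixes P :: "(real \<Rightarrow> 'a::euclidean_space) measure"
  assumes X: "compact X" and C: "C > 0" and \<pi>: "borel_prob (top_of_set (X \<times> X)) \<pi>"
    and \<pi>n: "weak_star_conv (top_of_set (X \<times> X)) \<pi>n \<pi>"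
    and tp: "traffic_plan X P" and Pn: "\<And>n. Pn n \<in> TP X C" and coup: "\<And>n. has_coupling X (Pn n) (\<pi>n n)"
    and conv: "weak_star_conv (Lip1_topology X) Pn P"
  shows "has_coupling X P \<pi>"
proof -
  interpret P: prob_space P using traffic_planD(1)[OF tp] .
  have tpn: "traffic_plan X (Pn n)" for n using Pn by (simp add: TP_def)
  let ?N = "borel_of (top_of_set (X \<times> X))" and ?e = "\<lambda>\<gamma>. (e_0 \<gamma>, e_infty \<gamma>)"
  have em: "?e \<in> measurable Q ?N" if "traffic_plan X Q" for Q
    by (rule endpoints_measurable[OF traffic_planD(6)[OF that]])
  have "distr P ?N ?e = \<pi>"
  proof (rule borel_prob_eqI[OF _ \<pi>])
    show "borel_prob (top_of_set (X \<times> X)) (distr P ?N ?e)"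
      using P.prob_space_distr[OF em[OF tp]] by (simp add: borel_prob_def)
  next
    fix f :: "'a \<times> 'a \<Rightarrow> real" assume f: "continuous_on UNIV f" and fb: "\<And>x. 0 \<le> f x \<and> f x \<le> 1"
    then have fX: "continuous_on A f" for A using continuous_on_subset by blast
    have fm: "f \<in> borel_measurable ?N"
      by (rule continuous_map_measurable) (simp add: continuous_map_iff_continuous fX)
    let ?h = "\<lambda>M \<gamma>. f (\<gamma> 0, \<gamma> M)"
    have hc: "continuous_map (Lip1_topology X) euclideanreal (?h M)" if "M \<ge> 0" for M
    proof -
      have "continuous_map (Lip1_topology X) (prod_topology euclidean euclidean) (\<lambda>\<gamma>. (\<gamma> 0, \<gamma> M))"
        using that by (intro continuous_map_pairedI continuous_map_Lip1_eval) auto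
      moreover have "continuous_map (prod_topology euclidean euclidean) euclideanreal f"
        using f by (simp add: euclidean_product_topology)
      ultimately have "continuous_map (Lip1_topology X) euclideanreal (f \<circ> (\<lambda>\<gamma>. (\<gamma> 0, \<gamma> M)))"
        by (rule continuous_map_compose)
      then show ?thesis by (simp add: o_def)
    qed
    have fabs: "\<bar>f x\<bar> \<le> 1" for x using fb[of x] by simp
    have bp: "borel_prob (Lip1_topology X) Q" if "traffic_plan X Q" for Q using that by (simp add: traffic_plan_def)
    have hi: "integrable Q (?h M)" if "traffic_plan X Q" "M \<ge> 0" for Q M
      by (rule borel_prob_integrable[OF bp[OF that(1)] hc[OF that(2)], where B=1]) (rule fabs)
    have fe: "(\<lambda>\<gamma>. f (?e \<gamma>)) \<in> borel_measurable Q" if "traffic_plan X Q" for Q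
      using measurable_compose[OF em[OF that] fm] .
    have fei: "integrable Q (\<lambda>\<gamma>. f (?e \<gamma>))" if "traffic_plan X Q" for Q
    proof -
      interpret prob_space Q using traffic_planD(1)[OF that] .
      show ?thesis by (rule integrable_const_bound[of _ 1, OF _ fe[OF that]]) (simp add: fabs)
    qed
    have close: "\<bar>(\<integral>z. f z \<partial>\<pi>n n) - (\<integral>\<gamma>. ?h M \<gamma> \<partial>Pn n)\<bar> \<le> C / M" if M: "M > 0" for M n
    proof -
      interpret prob_space "Pn n" using traffic_planD(1)[OF tpn] .
      let ?A = "{\<gamma> \<in> space (Pn n). \<not> constant_from M \<gamma>}"
      have [measurable]: "Measurable.pred (Pn n) (constant_from M)"
        using constant_from_measurable[OF traffic_planD(6)[OF tpn], of M] M by simp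
      have A: "?A \<in> sets (Pn n)" by measurable
      have hi': "integrable (Pn n) (?h M)" using hi[OF tpn] M by simp
      have "(\<integral>z. f z \<partial>\<pi>n n) - (\<integral>\<gamma>. ?h M \<gamma> \<partial>Pn n) = (\<integral>\<gamma>. f (?e \<gamma>) - ?h M \<gamma> \<partial>Pn n)"
        unfolding coupling_integral[OF tpn coup fX, symmetric]
        by (rule Bochner_Integration.integral_diff[symmetric, OF fei[OF tpn] hi'])
      also have "\<bar>\<dots>\<bar> \<le> (\<integral>\<gamma>. \<bar>f (?e \<gamma>) - ?h M \<gamma>\<bar> \<partial>Pn n)" by (rule integral_abs_bound)
      also have "\<dots> \<le> (\<integral>\<gamma>. indicator ?A \<gamma> \<partial>Pn n)"
      proof (rule integral_mono)
        show "integrable (Pn n) (\<lambda>\<gamma>. \<bar>f (?e \<gamma>) - ?h M \<gamma>\<bar>)"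
          by (intro Bochner_Integration.integrable_abs Bochner_Integration.integrable_diff fei[OF tpn] hi')
        show "integrable (Pn n) (indicat_real ?A)"
          by (rule integrable_real_indicator[OF A]) (simp add: emeasure_eq_measure)
        fix \<gamma> assume g: "\<gamma> \<in> space (Pn n)"
        show "\<bar>f (?e \<gamma>) - ?h M \<gamma>\<bar> \<le> indicat_real ?A \<gamma>"
        proof (cases "constant_from M \<gamma>")
          case True
          then show ?thesis using e_infty_eq[OF True] M by (simp add: e_0_def)
        next
          case False
          then show ?thesis using g fb[of "?e \<gamma>"] fb[of "(\<gamma> 0, \<gamma> M)"] by (simp add: abs_le_iff)
        qed
      qed
      also have "\<dots> \<le> C / M"
      proof -
        have "?A \<inter> space (Pn n) = ?A" by auto
        then show ?thesis using late_curves_measure[OF Pn M C, of n] by simp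
      qed
      finally show ?thesis .
    qed
    have close': "\<bar>(\<integral>z. f z \<partial>\<pi>) - (\<integral>\<gamma>. ?h M \<gamma> \<partial>P)\<bar> \<le> C / M" if M: "M > 0" for M
    proof (rule LIMSEQ_le_const2)
      have 1: "(\<lambda>n. \<integral>z. f z \<partial>\<pi>n n) \<longlonglongrightarrow> (\<integral>z. f z \<partial>\<pi>)"
        by (rule weak_star_convD[OF \<pi>n _ fabs]) (simp add: continuous_map_iff_continuous fX)
      have 2: "(\<lambda>n. \<integral>\<gamma>. ?h M \<gamma> \<partial>Pn n) \<longlonglongrightarrow> (\<integral>\<gamma>. ?h M \<gamma> \<partial>P)"
        by (rule weak_star_convD[OF conv hc fabs]) (use M in simp)
      show "(\<lambda>n. \<bar>(\<integral>z. f z \<partial>\<pi>n n) - (\<integral>\<gamma>. ?h M \<gamma> \<partial>Pn n)\<bar>) \<longlonglongrightarrow> \<bar>(\<integral>z. f z \<partial>\<pi>) - (\<integral>\<gamma>. ?h M \<gamma> \<partial>P)\<bar>"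
        by (intro tendsto_intros 1 2)
    qed (use close[OF M] in auto)
    have lim: "(\<lambda>M. \<integral>\<gamma>. ?h (real (Suc M)) \<gamma> \<partial>P) \<longlonglongrightarrow> (\<integral>\<gamma>. f (?e \<gamma>) \<partial>P)"
    proof (rule integral_dominated_convergence[where w="\<lambda>_. 1"])
      show "AE \<gamma> in P. (\<lambda>M. ?h (real (Suc M)) \<gamma>) \<longlonglongrightarrow> f (?e \<gamma>)"
        using traffic_planD(4)[OF tp] AE_space
      proof eventually_elim
        case (elim \<gamma>)
        then have "\<gamma> \<in> Lip1 X" using traffic_planD(3)[OF tp] by simp
        then obtain n where n: "constant_from (real n) \<gamma>" using elim(1) stopping_time_finite_iff by blast
        show ?case
        proof (rule tendsto_eventually, rule eventually_sequentiallyI[of n])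
          fix M assume "n \<le> M"
          then have "constant_from (real (Suc M)) \<gamma>" using n by (elim constant_from_mono) simp
          then show "?h (real (Suc M)) \<gamma> = f (?e \<gamma>)" by (simp add: e_infty_eq e_0_def)
        qed
      qed
      show "?h (real (Suc M)) \<in> borel_measurable P" for M
        using hi[OF tp, of "real (Suc M)"] borel_measurable_integrable by fastforce
      show "AE \<gamma> in P. norm (?h (real (Suc M)) \<gamma>) \<le> 1" for M using fabs by simp
    qed (use fe[OF tp] in auto)
    have "\<bar>(\<integral>z. f z \<partial>\<pi>) - (\<integral>\<gamma>. f (?e \<gamma>) \<partial>P)\<bar> \<le> 0"
    proof (rule LIMSEQ_le)
      show "(\<lambda>M. \<bar>(\<integral>z. f z \<partial>\<pi>) - (\<integral>\<gamma>. ?h (real (Suc M)) \<gamma> \<partial>P)\<bar>) \<longlonglongrightarrow> \<bar>(\<integral>z. f z \<partial>\<pi>) - (\<integral>\<gamma>. f (?e \<gamma>) \<partial>P)\<bar>"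
        by (intro tendsto_intros lim)
      show "(\<lambda>M. C * inverse (real (Suc M))) \<longlonglongrightarrow> 0"
        by (rule tendsto_mult_right_zero[OF LIMSEQ_inverse_real_of_nat])
      show "\<exists>N. \<forall>M\<ge>N. \<bar>(\<integral>z. f z \<partial>\<pi>) - (\<integral>\<gamma>. ?h (real (Suc M)) \<gamma> \<partial>P)\<bar> \<le> C * inverse (real (Suc M))"
      proof (intro exI allI impI)
        fix M
        show "\<bar>(\<integral>z. f z \<partial>\<pi>) - (\<integral>\<gamma>. ?h (real (Suc M)) \<gamma> \<partial>P)\<bar> \<le> C * inverse (real (Suc M))"
          using close'[of "real (Suc M)"] by (simp add: divide_inverse)
      qed
    qed
    then have "(\<integral>\<gamma>. f (?e \<gamma>) \<partial>P) = (\<integral>z. f z \<partial>\<pi>)" by simp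
    then show "(\<integral>z. f z \<partial>distr P ?N ?e) = (\<integral>z. f z \<partial>\<pi>)"
      by (simp add: integral_distr[OF em[OF tp] fm])
  qed
  then show ?thesis by (simp add: has_coupling_def)
qed

section \<open>Concatenation and the cost of branching\<close>

lemma Lip1I:
  assumes "\<And>t. t < 0 \<Longrightarrow> \<gamma> t = undefined" "\<And>t. 0 \<le> t \<Longrightarrow> \<gamma> t \<in> X"
    and "\<And>s t. 0 \<le> s \<Longrightarrow> s \<le> t \<Longrightarrow> dist (\<gamma> s) (\<gamma> t) \<le> t - s"
  shows "\<gamma> \<in> Lip1 X"
proof -
  have "1-lipschitz_on {0..} \<gamma>"
  proof (rule lipschitz_onI)
    fix s t :: real assume "s \<in> {0..}" "t \<in> {0..}"
    then show "dist (\<gamma> s) (\<gamma> t) \<le> 1 * dist s t"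
      using assms(3)[of s t] assms(3)[of t s] by (cases "s \<le> t") (auto simp: dist_real_def dist_commute)
  qed simp
  then show ?thesis using assms(1,2) by (auto simp: Lip1_def PiE_def extensional_def not_le)
qed

text \<open>
  At negative times the value is that of \<open>\<gamma>\<close>, which keeps the curve in the extensional function space.
\<close>

definition join_curves :: "(real \<Rightarrow> 'a) \<Rightarrow> real \<Rightarrow> (real \<Rightarrow> 'a) \<Rightarrow> real \<Rightarrow> 'a" where
  "join_curves \<gamma> \<tau> \<eta> t = (if t \<le> \<tau> then \<gamma> t else \<eta> (t - \<tau>))"

lemma join_after: "\<gamma> \<tau> = \<eta> 0 \<Longrightarrow> \<tau> \<le> t \<Longrightarrow> join_curves \<gamma> \<tau> \<eta> t = \<eta> (t - \<tau>)"
  by (cases "t = \<tau>") (auto simp: join_curves_def)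

lemma join_in_Lip1:
  fixes \<gamma> :: "real \<Rightarrow> 'a::euclidean_space"
  assumes g: "\<gamma> \<in> Lip1 X" and e: "\<eta> \<in> Lip1 X" and "0 \<le> \<tau>" and eq: "\<gamma> \<tau> = \<eta> 0"
  shows "join_curves \<gamma> \<tau> \<eta> \<in> Lip1 X"
proof (rule Lip1I)
  show "join_curves \<gamma> \<tau> \<eta> t = undefined" if "t < 0" for t
    using that g \<open>0 \<le> \<tau>\<close> by (auto simp: join_curves_def Lip1_def PiE_def extensional_def)
  show "join_curves \<gamma> \<tau> \<eta> t \<in> X" if "0 \<le> t" for t
    using that Lip1_in[OF g] Lip1_in[OF e] by (auto simp: join_curves_def)
  fix s t :: real assume st: "0 \<le> s" "s \<le> t"
  consider "t \<le> \<tau>" | "\<tau> \<le> s" | "s < \<tau>" "\<tau> < t" by linarith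
  then show "dist (join_curves \<gamma> \<tau> \<eta> s) (join_curves \<gamma> \<tau> \<eta> t) \<le> t - s"
  proof cases
    case 1
    then show ?thesis using Lip1_lipschitz[OF g, of s t] st by (simp add: join_curves_def)
  next
    case 2
    then show ?thesis using Lip1_lipschitz[OF e, of "s - \<tau>" "t - \<tau>"] st by (simp add: join_after[of \<gamma> \<tau> \<eta>, OF eq])
  next
    case 3
    have "dist (\<gamma> s) (\<gamma> \<tau>) \<le> \<tau> - s" using Lip1_lipschitz[OF g, of s \<tau>] st 3 by simp
    moreover have "dist (\<eta> 0) (\<eta> (t - \<tau>)) \<le> t - \<tau>" using Lip1_lipschitz[OF e, of 0 "t - \<tau>"] 3 by simp
    ultimately show ?thesis
      using dist_triangle[of "\<gamma> s" "\<eta> (t - \<tau>)" "\<gamma> \<tau>"] 3 eq by (simp add: join_curves_def)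
  qed
qed

lemma join_start: "0 \<le> \<tau> \<Longrightarrow> join_curves \<gamma> \<tau> \<eta> 0 = \<gamma> 0"
  by (simp add: join_curves_def)

lemma join_constant_from:
  assumes "constant_from c \<eta>" "0 \<le> c" "\<gamma> \<tau> = \<eta> 0"
  shows "constant_from (\<tau> + c) (join_curves \<gamma> \<tau> \<eta>)"
  unfolding constant_from_def
proof (intro allI impI)
  fix t assume t: "\<tau> + c \<le> t"
  have "\<eta> (t - \<tau>) = \<eta> c" using assms(1)[unfolded constant_from_def, rule_format, of "t - \<tau>"] t by simp
  then show "join_curves \<gamma> \<tau> \<eta> t = join_curves \<gamma> \<tau> \<eta> (\<tau> + c)"
    using t assms(2) by (simp add: join_after[of \<gamma> \<tau> \<eta>, OF assms(3)])
qed

lemma join_hits_right: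
  assumes "hits \<eta> x" "0 \<le> \<tau>" "\<gamma> \<tau> = \<eta> 0"
  shows "hits (join_curves \<gamma> \<tau> \<eta>) x"
proof -
  obtain t where "0 \<le> t" "\<eta> t = x" using assms(1) by (auto simp: hits_def)
  then show ?thesis using assms by (auto simp: hits_def join_after[of \<gamma> \<tau> \<eta>, OF assms(3)] intro!: exI[of _ "\<tau> + t"])
qed

lemma join_hits_left:
  assumes "hits \<gamma> x" "0 \<le> \<tau>" "constant_from \<tau> \<gamma>"
  shows "hits (join_curves \<gamma> \<tau> \<eta>) x"
proof -
  obtain t where t: "0 \<le> t" "\<gamma> t = x" using assms(1) by (auto simp: hits_def)
  show ?thesis
  proof (cases "t \<le> \<tau>")
    case True
    then show ?thesis using t by (auto simp: hits_def join_curves_def intro!: exI[of _ t])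
  next
    case False
    then have "\<gamma> \<tau> = x" using assms(3)[unfolded constant_from_def, rule_format, of t] t by simp
    then show ?thesis using assms(2) by (auto simp: hits_def join_curves_def intro!: exI[of _ \<tau>])
  qed
qed

lemma join_measurable:
  fixes f g :: "'w \<Rightarrow> real \<Rightarrow> 'a::euclidean_space"
  assumes f: "f \<in> measurable N (borel_of (Lip1_topology X))" and g: "g \<in> measurable N (borel_of (Lip1_topology X))"
    and [measurable]: "\<tau> \<in> borel_measurable N" and \<tau>: "\<And>\<omega>. \<omega> \<in> space N \<Longrightarrow> 0 \<le> \<tau> \<omega>"
    and eq: "\<And>\<omega>. \<omega> \<in> space N \<Longrightarrow> f \<omega> (\<tau> \<omega>) = g \<omega> 0"
  shows "(\<lambda>\<omega>. join_curves (f \<omega>) (\<tau> \<omega>) (g \<omega>)) \<in> measurable N (borel_of (Lip1_topology X))"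
proof (rule measurable_into_Lip1)
  fix t :: real assume t: "0 \<le> t"
  have [measurable]: "(\<lambda>\<omega>. f \<omega> t) \<in> borel_measurable N" by (rule measurable_compose[OF f eval_measurable[OF t]])
  have [measurable]: "(\<lambda>\<omega>. g \<omega> (max 0 (t - \<tau> \<omega>))) \<in> borel_measurable N"
    by (rule eval_at_random_time_measurable[OF g]) auto
  have "(\<lambda>\<omega>. if t \<le> \<tau> \<omega> then f \<omega> t else g \<omega> (max 0 (t - \<tau> \<omega>))) \<in> borel_measurable N" by measurable
  moreover have "(if t \<le> \<tau> \<omega> then f \<omega> t else g \<omega> (max 0 (t - \<tau> \<omega>))) = join_curves (f \<omega>) (\<tau> \<omega>) (g \<omega>) t" for \<omega>
    by (simp add: join_curves_def)
  ultimately show "(\<lambda>\<omega>. join_curves (f \<omega>) (\<tau> \<omega>) (g \<omega>) t) \<in> borel_measurable N" by simp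
qed (use join_in_Lip1 measurable_Lip1_in[OF f] measurable_Lip1_in[OF g] \<tau> eq in blast)

lemma speed_cong:
  assumes "\<And>s. t \<le> s \<Longrightarrow> s < u \<Longrightarrow> \<gamma> s = \<eta> s" "t < u"
  shows "speed \<gamma> t = speed \<eta> t"
  unfolding speed_def
proof (rule Liminf_eq)
  obtain n where n: "1 / real (Suc n) < u - t" using assms(2) nat_approx_posE[of "u - t"] by auto
  show "\<forall>\<^sub>F k in sequentially. ennreal (real (Suc k) * dist (\<gamma> (t + 1 / real (Suc k))) (\<gamma> t))
     = ennreal (real (Suc k) * dist (\<eta> (t + 1 / real (Suc k))) (\<eta> t))"
  proof (rule eventually_sequentiallyI[of n])
    fix k assume "n \<le> k"
    then have "1 / real (Suc k) \<le> 1 / real (Suc n)" by (intro divide_left_mono) auto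
    then have "t + 1 / real (Suc k) < u" using n by linarith
    moreover have "t \<le> t + 1 / real (Suc k)" by simp
    ultimately show "ennreal (real (Suc k) * dist (\<gamma> (t + 1 / real (Suc k))) (\<gamma> t))
     = ennreal (real (Suc k) * dist (\<eta> (t + 1 / real (Suc k))) (\<eta> t))" using assms by simp
  qed
qed

lemma speed_constant:
  assumes "constant_from c \<gamma>" "c \<le> t"
  shows "speed \<gamma> t = 0"
proof -
  have *: "\<gamma> s = \<gamma> c" if "c \<le> s" for s using assms(1)[unfolded constant_from_def, rule_format, OF that] .
  have "\<gamma> (t + 1 / real (Suc n)) = \<gamma> c" for n
    by (rule *) (use assms(2) in \<open>simp add: add_increasing2\<close>)
  moreover have "\<gamma> t = \<gamma> c" by (rule *[OF assms(2)])
  ultimately show ?thesis by (simp add: speed_def Liminf_const)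
qed

text \<open>
  The speed of the joined curve only involves later times and thus agrees with that of \<open>\<gamma>\<close> before \<open>\<tau>\<close>
  and with that of \<open>\<eta>\<close> from \<open>\<tau>\<close> on. What \<open>\<gamma>\<close> would have done after \<open>\<tau>\<close> is dropped.
\<close>

lemma path_cost_join_le:
  fixes \<gamma> :: "real \<Rightarrow> 'a::euclidean_space"
  assumes g: "\<gamma> \<in> Lip1 X" and e: "\<eta> \<in> Lip1 X" and \<tau>: "0 \<le> \<tau>" and eq: "\<gamma> \<tau> = \<eta> 0"
    and w: "w \<in> borel_measurable borel"
  shows "path_cost w (join_curves \<gamma> \<tau> \<eta>) \<le> path_cost w \<gamma> + path_cost w \<eta>"
proof -
  let ?j = "join_curves \<gamma> \<tau> \<eta>"
  note j = join_in_Lip1[OF g e \<tau> eq]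
  note m = integrand_measurable_fixed[OF j w]
  have "path_cost w ?j = (\<integral>\<^sup>+t. w (?j t) * speed ?j t * indicator {0..<\<tau>} t + w (?j t) * speed ?j t * indicator {\<tau>..} t \<partial>lborel)"
    unfolding path_cost_def using \<tau> by (intro nn_integral_cong) (auto split: split_indicator)
  also have "\<dots> = (\<integral>\<^sup>+t. w (?j t) * speed ?j t * indicator {0..<\<tau>} t \<partial>lborel) + (\<integral>\<^sup>+t. w (?j t) * speed ?j t * indicator {\<tau>..} t \<partial>lborel)"
    by (rule nn_integral_add; rule m) (use \<tau> in auto)
  also have "(\<integral>\<^sup>+t. w (?j t) * speed ?j t * indicator {0..<\<tau>} t \<partial>lborel) \<le> path_cost w \<gamma>"
    unfolding path_cost_def
  proof (rule nn_integral_mono)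
    fix t
    show "w (?j t) * speed ?j t * indicator {0..<\<tau>} t \<le> w (\<gamma> t) * speed \<gamma> t * indicator {0..} t"
    proof (cases "t \<in> {0..<\<tau>}")
      case True
      then have "speed ?j t = speed \<gamma> t" by (intro speed_cong[of t \<tau>]) (auto simp: join_curves_def)
      then show ?thesis using True by (simp add: join_curves_def)
    qed simp
  qed
  also have "(\<integral>\<^sup>+t. w (?j t) * speed ?j t * indicator {\<tau>..} t \<partial>lborel) = path_cost w \<eta>"
  proof -
    have "(\<lambda>t. w (?j t) * speed ?j t * indicator {\<tau>..} t) \<in> borel_measurable lborel"
      by (rule m) (use \<tau> in auto)
    then have m2: "(\<lambda>t. w (?j t) * speed ?j t * indicator {\<tau>..} t) \<in> borel_measurable borel"
      by (simp only: measurable_def sets_lborel space_lborel space_borel)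
    have "(\<integral>\<^sup>+t. w (?j t) * speed ?j t * indicator {\<tau>..} t \<partial>lborel)
      = (\<integral>\<^sup>+t. w (?j (\<tau> + t)) * speed ?j (\<tau> + t) * indicator {\<tau>..} (\<tau> + t) \<partial>lborel)"
      using nn_integral_real_affine[OF m2, of 1 \<tau>] by simp
    also have "\<dots> = path_cost w \<eta>"
      unfolding path_cost_def
    proof (rule nn_integral_cong)
      fix t :: real
      show "w (?j (\<tau> + t)) * speed ?j (\<tau> + t) * indicator {\<tau>..} (\<tau> + t) = w (\<eta> t) * speed \<eta> t * indicator {0..} t"
      proof (cases "0 \<le> t")
        case True
        have "?j (\<tau> + t) = \<eta> t" "\<And>n. ?j (\<tau> + t + 1 / real (Suc n)) = \<eta> (t + 1 / real (Suc n))"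
          using True by (simp_all add: join_after[of \<gamma> \<tau> \<eta>, OF eq])
        then show ?thesis using True by (simp add: speed_def)
      qed simp
    qed
    finally show ?thesis .
  qed
  finally show ?thesis by (simp add: add_mono)
qed

text \<open>
  Jensen's inequality for a concave power. Young's inequality is the tangent line at the mean \<open>a\<close>.
\<close>

lemma sum_powr_le:
  fixes x :: "'j \<Rightarrow> real"
  assumes S: "finite S" and x: "\<And>j. j \<in> S \<Longrightarrow> 0 \<le> x j" and \<alpha>: "0 < \<alpha>" "\<alpha> < 1"
  shows "(\<Sum>j\<in>S. x j powr \<alpha>) \<le> real (card S) powr (1 - \<alpha>) * (\<Sum>j\<in>S. x j) powr \<alpha>"
proof (cases "(\<Sum>j\<in>S. x j) = 0")
  case True
  then have "\<forall>j\<in>S. x j = 0" using S x by (simp add: sum_nonneg_eq_0_iff)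
  then show ?thesis by simp
next
  case False
  define n where "n = real (card S)"
  define s where "s = (\<Sum>j\<in>S. x j)"
  have s: "s > 0" using False x by (simp add: s_def less_le sum_nonneg)
  have "S \<noteq> {}" using False by auto
  then have n: "n > 0" using S by (simp add: n_def card_gt_0_iff)
  define a where "a = s / n"
  have a: "a > 0" using s n by (simp add: a_def)
  have tangent: "x j powr \<alpha> * a powr (1 - \<alpha>) \<le> \<alpha> * x j + (1 - \<alpha>) * a" if "j \<in> S" for j
  proof (cases "x j = 0")
    case True
    then show ?thesis using a \<alpha> by simp
  next
    case False
    then show ?thesis using Youngs_inequality_0[of \<alpha> "1 - \<alpha>" "x j" a] x[OF that] a \<alpha> by simp
  qed
  have "(\<Sum>j\<in>S. x j powr \<alpha>) * a powr (1 - \<alpha>) \<le> (\<Sum>j\<in>S. \<alpha> * x j + (1 - \<alpha>) * a)"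
    unfolding sum_distrib_right by (rule sum_mono) (rule tangent)
  also have "\<dots> = \<alpha> * s + (1 - \<alpha>) * (n * a)" by (simp add: sum.distrib sum_distrib_left[symmetric] s_def n_def)
  also have "n * a = s" using n by (simp add: a_def)
  finally have "(\<Sum>j\<in>S. x j powr \<alpha>) * a powr (1 - \<alpha>) \<le> s" by (simp add: algebra_simps)
  then have "(\<Sum>j\<in>S. x j powr \<alpha>) \<le> s / a powr (1 - \<alpha>)" using a by (simp add: pos_le_divide_eq)
  also have "\<dots> = n powr (1 - \<alpha>) * s powr \<alpha>"
  proof -
    have "s / s powr (1 - \<alpha>) = s powr \<alpha>" using powr_diff[of s 1 "1 - \<alpha>"] s by simp
    moreover have "s / a powr (1 - \<alpha>) = n powr (1 - \<alpha>) * (s / s powr (1 - \<alpha>))"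
      using s n by (simp add: a_def powr_divide)
    ultimately show ?thesis by simp
  qed
  finally show ?thesis by (simp add: n_def s_def)
qed

lemma mult_power_times_mass:
  assumes "0 \<le> x"
  shows "mult_power \<alpha> x * ennreal x = ennreal (x powr \<alpha>)"
proof (cases "x = 0")
  case False
  then have "x powr (\<alpha> - 1) * x = x powr \<alpha>" using assms by (simp add: powr_diff)
  then show ?thesis using False assms by (simp add: mult_power_def ennreal_mult[symmetric])
qed (simp add: mult_power_def)

text \<open>
  During the times \<open>I\<close> the position depends only on the value of \<open>J\<close>. So all the curves with the same
  value travel together, and their total mass \<open>\<mu>\<^sub>j\<close> is a lower bound of the multiplicity on their way.
  They pay at most \<open>L * \<mu>\<^sub>j powr (\<alpha> - 1)\<close> each, in total \<open>L * \<mu>\<^sub>j powr \<alpha>\<close>, and concavity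
  bounds the sum over \<open>j\<close>. This holds wherever the curves come from or go to at other times.
\<close>

proposition branching_cost:
  fixes p :: "'w \<Rightarrow> real \<Rightarrow> 'a::euclidean_space" and J :: "'w \<Rightarrow> 'j"
  assumes fin: "finite_measure \<mu>" and A: "A \<in> sets \<mu>"
    and p: "p \<in> measurable \<mu> (borel_of (Lip1_topology X))"
    and m: "\<And>z. measure \<mu> {\<omega> \<in> A. hits (p \<omega>) z} \<le> m z"
    and I: "I \<in> sets borel" "I \<subseteq> {0..}" "emeasure lborel I \<le> ennreal L" "0 \<le> L"
    and S: "finite S" "\<And>\<omega>. \<omega> \<in> A \<Longrightarrow> J \<omega> \<in> S" and J: "\<And>j. j \<in> S \<Longrightarrow> {\<omega> \<in> A. J \<omega> = j} \<in> sets \<mu>"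
    and dep: "\<And>\<omega> \<omega>' t. \<omega> \<in> A \<Longrightarrow> \<omega>' \<in> A \<Longrightarrow> J \<omega> = J \<omega>' \<Longrightarrow> t \<in> I \<Longrightarrow> p \<omega> t = p \<omega>' t"
    and \<alpha>: "0 < \<alpha>" "\<alpha> < 1"
  shows "(\<integral>\<^sup>+\<omega>\<in>A. (\<integral>\<^sup>+t\<in>I. mult_power \<alpha> (m (p \<omega> t)) * speed (p \<omega>) t \<partial>lborel) \<partial>\<mu>)
    \<le> ennreal (L * (real (card S) powr (1 - \<alpha>) * measure \<mu> A powr \<alpha>))"
proof -
  interpret finite_measure \<mu> by fact
  let ?Aj = "\<lambda>j. {\<omega> \<in> A. J \<omega> = j}"
  let ?c = "\<lambda>j. mult_power \<alpha> (measure \<mu> (?Aj j)) * ennreal L"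
  have Asub: "A \<subseteq> space \<mu>" using A sets.sets_into_space by blast
  have inner: "(\<integral>\<^sup>+t\<in>I. mult_power \<alpha> (m (p \<omega> t)) * speed (p \<omega>) t \<partial>lborel) \<le> ?c (J \<omega>)" if w: "\<omega> \<in> A" for \<omega>
  proof -
    have pL: "p \<omega> \<in> Lip1 X" using measurable_Lip1_in[OF p] w Asub by blast
    have "(\<integral>\<^sup>+t\<in>I. mult_power \<alpha> (m (p \<omega> t)) * speed (p \<omega>) t \<partial>lborel) \<le> (\<integral>\<^sup>+t. mult_power \<alpha> (measure \<mu> (?Aj (J \<omega>))) * indicator I t \<partial>lborel)"
    proof (rule nn_integral_mono)
      fix t
      show "mult_power \<alpha> (m (p \<omega> t)) * speed (p \<omega>) t * indicator I t \<le> mult_power \<alpha> (measure \<mu> (?Aj (J \<omega>))) * indicator I t"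
      proof (cases "t \<in> I")
        case True
        have "Measurable.pred \<mu> (\<lambda>\<omega>'. hits (p \<omega>') (p \<omega> t))" by (rule hits_measurable[OF p]) simp
        then have "{\<omega>' \<in> space \<mu>. hits (p \<omega>') (p \<omega> t)} \<inter> A \<in> sets \<mu>" using A by (intro sets.Int predE)
        moreover have "{\<omega>' \<in> space \<mu>. hits (p \<omega>') (p \<omega> t)} \<inter> A = {\<omega>' \<in> A. hits (p \<omega>') (p \<omega> t)}" using Asub by auto
        ultimately have meas: "{\<omega>' \<in> A. hits (p \<omega>') (p \<omega> t)} \<in> sets \<mu>" by simp
        have "?Aj (J \<omega>) \<subseteq> {\<omega>' \<in> A. hits (p \<omega>') (p \<omega> t)}"
          using dep[OF _ w _ True] True I(2) by (auto simp: hits_def)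
        then have "measure \<mu> (?Aj (J \<omega>)) \<le> measure \<mu> {\<omega>' \<in> A. hits (p \<omega>') (p \<omega> t)}"
          using meas by (rule finite_measure_mono)
        also have "\<dots> \<le> m (p \<omega> t)" by (rule m)
        finally have "mult_power \<alpha> (m (p \<omega> t)) \<le> mult_power \<alpha> (measure \<mu> (?Aj (J \<omega>)))"
          using \<alpha> by (intro mult_power_antimono) auto
        moreover have "speed (p \<omega>) t \<le> 1" using Lip1_speed_le_1[OF pL] True I(2) by auto
        ultimately have "mult_power \<alpha> (m (p \<omega> t)) * speed (p \<omega>) t \<le> mult_power \<alpha> (measure \<mu> (?Aj (J \<omega>))) * 1"
          by (intro mult_mono) auto
        then show ?thesis using True by simp
      qed simp
    qed
    also have "\<dots> = mult_power \<alpha> (measure \<mu> (?Aj (J \<omega>))) * emeasure lborel I"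
      using I(1) by (simp add: nn_integral_cmult)
    also have "\<dots> \<le> ?c (J \<omega>)" using I(3) by (intro mult_left_mono) auto
    finally show ?thesis .
  qed
  have "(\<integral>\<^sup>+\<omega>\<in>A. (\<integral>\<^sup>+t\<in>I. mult_power \<alpha> (m (p \<omega> t)) * speed (p \<omega>) t \<partial>lborel) \<partial>\<mu>)
    \<le> (\<integral>\<^sup>+\<omega>. (\<Sum>j\<in>S. ?c j * indicator (?Aj j) \<omega>) \<partial>\<mu>)"
  proof (rule nn_integral_mono)
    fix \<omega>
    show "(\<integral>\<^sup>+t\<in>I. mult_power \<alpha> (m (p \<omega> t)) * speed (p \<omega>) t \<partial>lborel) * indicator A \<omega> \<le> (\<Sum>j\<in>S. ?c j * indicator (?Aj j) \<omega>)"
    proof (cases "\<omega> \<in> A")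
      case True
      have "?c (J \<omega>) * indicator (?Aj (J \<omega>)) \<omega> \<le> (\<Sum>j\<in>S. ?c j * indicator (?Aj j) \<omega>)"
        by (rule member_le_sum[OF S(2)[OF True]]) (use S in auto)
      then show ?thesis using True inner[OF True] order_trans by fastforce
    qed simp
  qed
  also have "\<dots> = (\<Sum>j\<in>S. ?c j * emeasure \<mu> (?Aj j))"
    using J by (subst nn_integral_sum) (auto simp: nn_integral_cmult)
  also have "\<dots> = (\<Sum>j\<in>S. ennreal (L * measure \<mu> (?Aj j) powr \<alpha>))"
  proof (rule sum.cong[OF refl])
    fix j
    have "?c j * emeasure \<mu> (?Aj j) = ennreal L * (mult_power \<alpha> (measure \<mu> (?Aj j)) * ennreal (measure \<mu> (?Aj j)))"
      by (simp add: emeasure_eq_measure mult_ac)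
    then show "?c j * emeasure \<mu> (?Aj j) = ennreal (L * measure \<mu> (?Aj j) powr \<alpha>)"
      using I(4) by (simp add: mult_power_times_mass ennreal_mult)
  qed
  also have "\<dots> = ennreal (L * (\<Sum>j\<in>S. measure \<mu> (?Aj j) powr \<alpha>))"
    using I(4) by (subst sum_ennreal) (auto simp: sum_distrib_left)
  also have "\<dots> \<le> ennreal (L * (real (card S) powr (1 - \<alpha>) * measure \<mu> A powr \<alpha>))"
  proof (intro ennreal_leI mult_left_mono)
    have "measure \<mu> (\<Union>j\<in>S. ?Aj j) = (\<Sum>j\<in>S. measure \<mu> (?Aj j))"
      using S(1) J by (intro finite_measure_finite_Union) (auto simp: disjoint_family_on_def)
    moreover have "(\<Union>j\<in>S. ?Aj j) = A" using S(2) by auto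
    ultimately have "(\<Sum>j\<in>S. measure \<mu> (?Aj j)) = measure \<mu> A" by simp
    then show "(\<Sum>j\<in>S. measure \<mu> (?Aj j) powr \<alpha>) \<le> real (card S) powr (1 - \<alpha>) * measure \<mu> A powr \<alpha>"
      using sum_powr_le[OF S(1) _ \<alpha>, of "\<lambda>j. measure \<mu> (?Aj j)"] by simp
  qed (rule I(4))
  finally show ?thesis .
qed

section \<open>Dyadic zooming\<close>

lemma minus_max_le: "a \<le> r \<Longrightarrow> a - 2 * max 0 x \<le> (r::real)"
  by linarith

lemma minus_max_shift: "a - 2 * max 0 (t - c) \<le> z \<Longrightarrow> a - 2 * max 0 (s - c) \<le> z + 2 * \<bar>s - t\<bar>" for a :: real
  by (auto simp: max_def abs_if split: if_splits)

text \<open>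
  A path that starts at \<open>r\<close> and gradually forgets its binary digits: at time \<open>0\<close> it is at \<open>r\<close>, and from time
  \<open>(1/2)^k\<close> on it depends only on \<open>\<lfloor>2^k * r\<rfloor>\<close>. The term \<open>k\<close> is the truncation of \<open>r\<close> to \<open>k\<close> digits, and
  it decreases from time \<open>(1/2)^k\<close> on with slope 2. This is fast enough for a truncation to fall below the
  next coarser one by the time at which the coarser one starts to decrease, and the supremum of functions
  with Lipschitz constant 2 has the same Lipschitz constant.
\<close>

definition zoom1 :: "real \<Rightarrow> real \<Rightarrow> real" where
  "zoom1 r t = (SUP k::nat. of_int \<lfloor>2^k * r\<rfloor> * (1/2)^k - 2 * max 0 (t - (1/2)^k))"

lemma floor_scaled: "of_int \<lfloor>2^k * r\<rfloor> * (1/2)^k \<le> (r::real)" "r - (1/2)^k < of_int \<lfloor>2^k * r\<rfloor> * (1/2)^k"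
proof -
  have "of_int \<lfloor>2^k * r\<rfloor> * (1/2)^k \<le> (2^k * r) * (1/2)^k" by (intro mult_right_mono) auto
  then show "of_int \<lfloor>2^k * r\<rfloor> * (1/2)^k \<le> r" by (simp add: power_divide)
  have "(2^k * r - 1) * (1/2)^k < of_int \<lfloor>2^k * r\<rfloor> * (1/2)^k" by (intro mult_strict_right_mono) (linarith, simp)
  then show "r - (1/2)^k < of_int \<lfloor>2^k * r\<rfloor> * (1/2)^k" by (simp add: power_divide field_simps)
qed

lemma zoom1_bdd:
  fixes r t :: real
  shows "bdd_above (range (\<lambda>k::nat. of_int \<lfloor>2^k * r\<rfloor> * (1/2)^k - 2 * max 0 (t - (1/2)^k)))"
proof (rule bdd_aboveI2[where M=r])
  fix k :: nat
  show "of_int \<lfloor>2^k * r\<rfloor> * (1/2)^k - 2 * max 0 (t - (1/2)^k) \<le> r" by (rule minus_max_le[OF floor_scaled(1)])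
qed

lemma zoom1_upper: "of_int \<lfloor>2^k * r\<rfloor> * (1/2)^k - 2 * max 0 (t - (1/2)^k) \<le> zoom1 r t"
  unfolding zoom1_def by (rule cSUP_upper[OF _ zoom1_bdd]) simp

lemma zoom1_least: "(\<And>k. of_int \<lfloor>2^k * r\<rfloor> * (1/2)^k - 2 * max 0 (t - (1/2)^k) \<le> B) \<Longrightarrow> zoom1 r t \<le> B"
  unfolding zoom1_def by (rule cSUP_least) auto

lemma zoom1_le: "zoom1 r t \<le> r"
  by (rule zoom1_least, rule minus_max_le, rule floor_scaled(1))

lemma zoom1_0: "zoom1 r 0 = r"
proof (rule antisym[OF zoom1_le])
  have "r \<le> zoom1 r 0 + e" if e: "e > 0" for e
  proof -
    obtain k where k: "(1/2)^k < e" using real_arch_pow_inv[OF e, of "1/2"] by auto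
    have "of_int \<lfloor>2^k * r\<rfloor> * (1/2)^k \<le> zoom1 r 0" using zoom1_upper[of k r 0] by simp
    then show ?thesis using floor_scaled(2)[of r k] k by linarith
  qed
  then show "r \<le> zoom1 r 0" by (rule field_le_epsilon)
qed

lemma zoom1_lipschitz: "\<bar>zoom1 r s - zoom1 r t\<bar> \<le> 2 * \<bar>s - t\<bar>"
proof -
  have "zoom1 r s \<le> zoom1 r t + 2 * \<bar>s - t\<bar>" for s t
    by (rule zoom1_least, rule minus_max_shift, rule zoom1_upper)
  from this[of s t] this[of t s] show ?thesis by (simp add: abs_le_iff abs_minus_commute)
qed

lemma zoom1_nonneg:
  assumes "0 \<le> r" "t \<le> 1" shows "0 \<le> zoom1 r t"
proof -
  have "(0::real) \<le> of_int \<lfloor>2^0 * r\<rfloor> * (1/2)^0 - 2 * max 0 (t - (1/2)^0)" using assms by simp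
  then show ?thesis using zoom1_upper[of 0 r t] by linarith
qed

lemma floor_coarser:
  fixes r r' :: real
  assumes "\<lfloor>2^k * r\<rfloor> = \<lfloor>2^k * r'\<rfloor>" "j \<le> k"
  shows "\<lfloor>2^j * r\<rfloor> = \<lfloor>2^j * r'\<rfloor>"
proof -
  have "\<lfloor>2^j * x\<rfloor> = \<lfloor>2^k * x\<rfloor> div 2^(k - j)" for x :: real
  proof -
    have "(2::real)^k = 2^j * 2^(k-j)" using assms(2) by (simp add: power_add[symmetric])
    then have eq: "2^j * x = 2^k * x / real_of_int (2^(k - j))" by simp
    show ?thesis unfolding eq by (rule floor_divide_real_eq_div) simp
  qed
  then show ?thesis using assms(1) by simp
qed

text \<open>
  The coarser truncations are the same for \<open>r\<close> and \<open>r'\<close>, and at time \<open>t\<close> the finer ones are below the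
  truncation to \<open>k\<close> digits.
\<close>

lemma zoom1_cong:
  assumes eq: "\<lfloor>2^k * r\<rfloor> = \<lfloor>2^k * r'\<rfloor>" and t: "(1/2)^k \<le> t"
  shows "zoom1 r t = zoom1 r' t"
proof -
  have "zoom1 r t \<le> zoom1 r' t" if eq: "\<lfloor>2^k * r\<rfloor> = \<lfloor>2^k * r'\<rfloor>" for r r'
  proof (rule zoom1_least)
    fix j :: nat
    show "of_int \<lfloor>2^j * r\<rfloor> * (1/2)^j - 2 * max 0 (t - (1/2)^j) \<le> zoom1 r' t"
    proof (cases "j \<le> k")
      case True
      then show ?thesis using floor_coarser[OF eq True] zoom1_upper[of j r' t] by simp
    next
      case False
      then have "(1/2)^j \<le> ((1/2)^Suc k :: real)" by (intro power_decreasing) auto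
      then have j: "(1/2)^j \<le> (1/2)^k / (2::real)" by simp
      moreover have "(0::real) \<le> (1/2)^j" by simp
      ultimately have "(1/2)^j \<le> t" using t by linarith
      then have "max 0 (t - (1/2)^j) = t - (1/2)^j" "max 0 (t - (1/2)^k) = t - (1/2)^k"
        using t by (auto simp: max_def)
      then show ?thesis
        using floor_scaled(1)[of j r] floor_scaled(2)[of r k] zoom1_upper[of k r' t] j eq by simp
    qed
  qed
  from this[OF eq] this[OF eq[symmetric]] show ?thesis by simp
qed

lemma zoom1_measurable [measurable]: "(\<lambda>r. zoom1 r t) \<in> borel_measurable borel"
  unfolding zoom1_def by (rule borel_measurable_cSUP) (use zoom1_bdd in auto)

text \<open>
  Zooming towards zero on both sides of the origin keeps the absolute value below the initial one, so
  that the paths below stay in a ball around the origin.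
\<close>

definition szoom :: "real \<Rightarrow> real \<Rightarrow> real" where
  "szoom s t = sgn s * zoom1 \<bar>s\<bar> t"

definition trunc_index :: "nat \<Rightarrow> real \<Rightarrow> int" where
  "trunc_index k s = (if 0 \<le> s then \<lfloor>2^k * s\<rfloor> else - \<lfloor>2^k * (- s)\<rfloor>)"

lemma szoom_abs_le: "t \<le> 1 \<Longrightarrow> \<bar>szoom s t\<bar> \<le> \<bar>s\<bar>"
  using zoom1_le[of "\<bar>s\<bar>" t] zoom1_nonneg[of "\<bar>s\<bar>" t] by (auto simp: szoom_def abs_mult sgn_if)

lemma szoom_0: "szoom s 0 = s"
  by (simp add: szoom_def zoom1_0 sgn_mult_abs)

lemma szoom_lipschitz: "\<bar>szoom s t - szoom s u\<bar> \<le> 2 * \<bar>t - u\<bar>"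
  using zoom1_lipschitz[of "\<bar>s\<bar>" t u] by (auto simp: szoom_def sgn_if)

lemma szoom_measurable [measurable]: "(\<lambda>s. szoom s t) \<in> borel_measurable borel"
  unfolding szoom_def by measurable

lemma szoom_cong:
  assumes eq: "trunc_index k s = trunc_index k s'" and t: "(1/2)^k \<le> t" "t \<le> 1"
  shows "szoom s t = szoom s' t"
proof -
  have pos: "0 \<le> \<lfloor>2^k * \<bar>s\<bar>\<rfloor>" for s :: real by simp
  have ti: "trunc_index k s = (if 0 \<le> s then \<lfloor>2^k * \<bar>s\<bar>\<rfloor> else - \<lfloor>2^k * \<bar>s\<bar>\<rfloor>)" for s
    by (simp add: trunc_index_def)
  (* Both sides of the origin share the index 0, and the path of such points is already at 0. *)
  have z0: "szoom s t = 0" if "\<lfloor>2^k * \<bar>s\<bar>\<rfloor> = 0" for s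
  proof -
    have "zoom1 \<bar>s\<bar> t = zoom1 0 t" using that by (intro zoom1_cong[OF _ t(1)]) simp
    then have "zoom1 \<bar>s\<bar> t = 0" using zoom1_le[of 0 t] zoom1_nonneg[of 0 t] t(2) by simp
    then show ?thesis by (simp add: szoom_def)
  qed
  show ?thesis
  proof (cases "trunc_index k s = 0")
    case True
    then have "\<lfloor>2^k * \<bar>s\<bar>\<rfloor> = 0" "\<lfloor>2^k * \<bar>s'\<bar>\<rfloor> = 0" using eq unfolding ti by (auto split: if_splits)
    then show ?thesis using z0 by simp
  next
    case False
    have "F = F' \<and> p = p'" if "(if p then F else - F) = (if p' then F' else - F')" "(if p then F else - F) \<noteq> 0"
      "0 \<le> F" "0 \<le> F'" for p p' and F F' :: int
      using that by (auto split: if_splits)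
    from this[OF eq[unfolded ti] False[unfolded ti] pos pos]
    have f: "\<lfloor>2^k * \<bar>s\<bar>\<rfloor> = \<lfloor>2^k * \<bar>s'\<bar>\<rfloor>" "(0 \<le> s) = (0 \<le> s')" by auto
    have "s \<noteq> 0" "s' \<noteq> 0" using False eq by (auto simp: trunc_index_def)
    then have "sgn s = sgn s'" using f(2) by (auto simp: sgn_if)
    then show ?thesis using zoom1_cong[OF f(1) t(1)] by (simp add: szoom_def)
  qed
qed

lemma trunc_index_bound:
  assumes "\<bar>s\<bar> \<le> R" shows "trunc_index k s \<in> {- \<lfloor>2^k * R\<rfloor>..\<lfloor>2^k * R\<rfloor>}"
proof -
  have "\<lfloor>2^k * \<bar>s\<bar>\<rfloor> \<le> \<lfloor>2^k * R\<rfloor>" by (intro floor_mono mult_left_mono assms) auto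
  moreover have "0 \<le> \<lfloor>2^k * \<bar>s\<bar>\<rfloor>" by simp
  moreover have "trunc_index k s = \<lfloor>2^k * \<bar>s\<bar>\<rfloor> \<or> trunc_index k s = - \<lfloor>2^k * \<bar>s\<bar>\<rfloor>"
    by (auto simp: trunc_index_def abs_if)
  ultimately show ?thesis unfolding atLeastAtMost_iff by linarith
qed

lemma round_to_zero_diff:
  fixes u v :: real
  assumes "\<bar>u - v\<bar> \<le> 1"
  shows "(if 0 \<le> u then \<lfloor>u\<rfloor> else - \<lfloor>- u\<rfloor>) - (if 0 \<le> v then \<lfloor>v\<rfloor> else - \<lfloor>- v\<rfloor>) \<in> {-1..1}"
proof -
  have fl: "\<lfloor>x\<rfloor> \<le> \<lfloor>y\<rfloor> + 1" if "x \<le> y + 1" for x y :: real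
    using floor_mono[OF that] by simp
  have fs: "\<lfloor>x\<rfloor> + \<lfloor>y\<rfloor> \<le> 1" if "x + y \<le> 1" for x y :: real
    using le_floor_add[of x y] floor_mono[OF that, unfolded floor_one] by (rule order_trans)
  have d: "u \<le> v + 1" "v \<le> u + 1" "- u \<le> - v + 1" "- v \<le> - u + 1" "u + - v \<le> 1" "- u + v \<le> 1"
    using assms by linarith+
  note f = fl[OF d(1)] fl[OF d(2)] fl[OF d(3)] fl[OF d(4)] fs[OF d(5)] fs[OF d(6)]
  consider "0 \<le> u" "0 \<le> v" | "0 \<le> u" "v < 0" | "u < 0" "0 \<le> v" | "u < 0" "v < 0" by linarith
  then show ?thesis
  proof cases
    case 1
    then show ?thesis using f by simp
  next
    case 2
    then have "0 \<le> \<lfloor>u\<rfloor>" "0 \<le> \<lfloor>- v\<rfloor>" by auto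
    then show ?thesis using f 2 by (simp del: zero_le_floor)
  next
    case 3
    then have "0 \<le> \<lfloor>- u\<rfloor>" "0 \<le> \<lfloor>v\<rfloor>" by auto
    then show ?thesis using f 3 by (simp del: zero_le_floor)
  next
    case 4
    then show ?thesis using f by simp
  qed
qed

lemma trunc_index_neighbours:
  assumes "\<bar>s - s'\<bar> \<le> (1/2)^k" shows "trunc_index k s - trunc_index k s' \<in> {-1..1}"
proof -
  have "2^k * \<bar>s - s'\<bar> \<le> 2^k * (1/2)^k" using assms by (intro mult_left_mono) auto
  then have "\<bar>2^k * s - 2^k * s'\<bar> \<le> 1" by (simp add: power_divide abs_mult right_diff_distrib[symmetric])
  then have "(if 0 \<le> 2^k * s then \<lfloor>2^k * s\<rfloor> else - \<lfloor>- (2^k * s)\<rfloor>) - (if 0 \<le> 2^k * s' then \<lfloor>2^k * s'\<rfloor> else - \<lfloor>- (2^k * s')\<rfloor>) \<in> {-1..1}"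
    by (rule round_to_zero_diff)
  moreover have "0 \<le> 2^k * x \<longleftrightarrow> 0 \<le> x" for x :: real
    using mult_le_cancel_left_pos[of "2^k" 0 x] by simp
  ultimately show ?thesis by (simp only: trunc_index_def mult_minus_right)
qed

definition zoom :: "'a::euclidean_space \<Rightarrow> real \<Rightarrow> 'a" where
  "zoom x t = (\<Sum>b\<in>Basis. szoom (x \<bullet> b) t *\<^sub>R b)"

lemma zoom_inner: "b \<in> Basis \<Longrightarrow> zoom x t \<bullet> b = szoom (x \<bullet> b) t"
  by (simp add: zoom_def)

lemma zoom_0: "zoom x 0 = x"
  by (simp add: zoom_def szoom_0 euclidean_representation)

lemma norm_zoom_le: "t \<le> 1 \<Longrightarrow> norm (zoom x t) \<le> norm x"
  by (rule norm_le_componentwise) (simp add: zoom_inner szoom_abs_le)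

lemma zoom_lipschitz:
  fixes x :: "'a::euclidean_space"
  shows "dist (zoom x s) (zoom x t) \<le> 2 * real DIM('a) * \<bar>s - t\<bar>"
proof -
  have "norm (zoom x s - zoom x t) \<le> (\<Sum>b\<in>Basis. \<bar>(zoom x s - zoom x t) \<bullet> b\<bar>)" by (rule norm_le_l1)
  also have "\<dots> \<le> (\<Sum>b\<in>(Basis::'a set). 2 * \<bar>s - t\<bar>)"
    by (rule sum_mono) (simp add: inner_diff_left zoom_inner szoom_lipschitz)
  finally show ?thesis by (simp add: dist_norm mult.commute mult.left_commute)
qed

lemma zoom_measurable [measurable]: "(\<lambda>x::'a::euclidean_space. zoom x t) \<in> borel_measurable borel"
  unfolding zoom_def by measurable

text \<open>
  Names the dyadic cell of side \<open>(1/2)^k\<close> that contains \<open>x\<close>; cells at the coordinate hyperplanes are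
  larger because of the truncation towards zero.
\<close>

definition cell_index :: "nat \<Rightarrow> 'a::euclidean_space \<Rightarrow> 'a \<Rightarrow> int" where
  "cell_index k x = (\<lambda>b\<in>Basis. trunc_index k (x \<bullet> b))"

lemma zoom_cong:
  assumes "cell_index k x = cell_index k y" "(1/2)^k \<le> t" "t \<le> 1"
  shows "zoom x t = zoom y t"
proof -
  have "trunc_index k (x \<bullet> b) = trunc_index k (y \<bullet> b)" if "b \<in> Basis" for b
    using fun_cong[OF assms(1), of b] that by (simp add: cell_index_def)
  then show ?thesis unfolding zoom_def using assms by (intro sum.cong refl) (metis szoom_cong)
qed

definition cells :: "nat \<Rightarrow> real \<Rightarrow> ('a::euclidean_space \<Rightarrow> int) set" where
  "cells k R = (\<Pi>\<^sub>E b\<in>Basis. {- \<lfloor>2^k * R\<rfloor>..\<lfloor>2^k * R\<rfloor>})"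

lemma finite_cells: "finite (cells k R)"
  unfolding cells_def by (intro finite_PiE) auto

lemma card_cells_le:
  assumes "0 \<le> R"
  shows "real (card (cells k R :: ('a::euclidean_space \<Rightarrow> int) set)) \<le> (2^k * (2 * R + 1)) ^ DIM('a)"
proof -
  have "card (cells k R :: ('a \<Rightarrow> int) set) = nat (2 * \<lfloor>2^k * R\<rfloor> + 1) ^ DIM('a)"
    unfolding cells_def by (simp add: card_PiE)
  moreover have "real (nat (2 * \<lfloor>2^k * R\<rfloor> + 1)) \<le> 2^k * (2 * R + 1)"
  proof -
    have "0 \<le> \<lfloor>2^k * R\<rfloor>" using assms by simp
    then have "real (nat (2 * \<lfloor>2^k * R\<rfloor> + 1)) = 2 * of_int \<lfloor>2^k * R\<rfloor> + 1" by simp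
    also have "\<dots> \<le> 2 * (2^k * R) + 2^k" using of_int_floor_le[of "2^k * R"] one_le_power[of "2::real" k] by linarith
    finally show ?thesis by (simp add: algebra_simps)
  qed
  ultimately show ?thesis by (simp add: power_mono)
qed

lemma cell_index_in_cells:
  assumes "x \<in> cball 0 R" shows "cell_index k x \<in> cells k R"
proof -
  have "\<bar>x \<bullet> b\<bar> \<le> R" if "b \<in> Basis" for b
    using Basis_le_norm[OF that, of x] assms by simp
  then show ?thesis unfolding cells_def cell_index_def using trunc_index_bound by auto
qed

lemma trunc_index_measurable [measurable]: "trunc_index k \<in> measurable borel (count_space UNIV)"
  unfolding trunc_index_def by measurable

lemma cell_index_measurable:
  fixes x :: "'w \<Rightarrow> 'a::euclidean_space"
  assumes [measurable]: "x \<in> borel_measurable N" and j: "j \<in> cells k R"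
  shows "{\<omega> \<in> space N. cell_index k (x \<omega>) = j} \<in> sets N"
proof -
  have "cell_index k y = j \<longleftrightarrow> (\<forall>b\<in>Basis. trunc_index k (y \<bullet> b) = j b)" for y
    using j unfolding cells_def cell_index_def PiE_def extensional_def by (auto simp: fun_eq_iff restrict_def)
  then have "{\<omega> \<in> space N. cell_index k (x \<omega>) = j} = {\<omega> \<in> space N. \<forall>b\<in>Basis. trunc_index k (x \<omega> \<bullet> b) = j b}" by simp
  also have "\<dots> \<in> sets N"
  proof (rule sets.sets_Collect_finite_All)
    fix b :: 'a
    have "(\<lambda>\<omega>. trunc_index k (x \<omega> \<bullet> b)) \<in> measurable N (count_space UNIV)" by measurable
    then have "(\<lambda>\<omega>. trunc_index k (x \<omega> \<bullet> b)) -` {j b} \<inter> space N \<in> sets N" by (rule measurable_sets) simp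
    moreover have "(\<lambda>\<omega>. trunc_index k (x \<omega> \<bullet> b)) -` {j b} \<inter> space N = {\<omega> \<in> space N. trunc_index k (x \<omega> \<bullet> b) = j b}" by auto
    ultimately show "{\<omega> \<in> space N. trunc_index k (x \<omega> \<bullet> b) = j b} \<in> sets N" by simp
  qed simp
  finally show ?thesis .
qed

text \<open>
  Every cell has at most \<open>3^d\<close> neighbours, hence there are not many more pairs of neighbouring cells than
  cells. This is why close points are cheaper to connect than arbitrary ones.
\<close>

definition neighbour_cells :: "nat \<Rightarrow> real \<Rightarrow> (('a::euclidean_space \<Rightarrow> int) \<times> ('a \<Rightarrow> int)) set" where
  "neighbour_cells k R = (\<lambda>(i, e). (i, \<lambda>b\<in>Basis. i b + e b)) ` (cells k R \<times> (\<Pi>\<^sub>E b\<in>Basis. {-1..1}))"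

lemma finite_neighbour_cells: "finite (neighbour_cells k R)"
  unfolding neighbour_cells_def by (intro finite_imageI finite_cartesian_product finite_cells finite_PiE) auto

lemma card_neighbour_cells_le:
  assumes "0 \<le> R"
  shows "real (card (neighbour_cells k R :: (('a::euclidean_space \<Rightarrow> int) \<times> ('a \<Rightarrow> int)) set)) \<le> (3 * (2^k * (2 * R + 1))) ^ DIM('a)"
proof -
  let ?E = "(\<Pi>\<^sub>E b\<in>(Basis::'a set). {-1..1::int})"
  have "card (neighbour_cells k R :: (('a \<Rightarrow> int) \<times> ('a \<Rightarrow> int)) set) \<le> card ((cells k R :: ('a \<Rightarrow> int) set) \<times> ?E)"
    unfolding neighbour_cells_def by (intro card_image_le finite_cartesian_product finite_cells finite_PiE) auto
  also have "\<dots> = card (cells k R :: ('a \<Rightarrow> int) set) * 3 ^ DIM('a)" by (simp add: card_cartesian_product card_PiE)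
  finally have "real (card (neighbour_cells k R :: (('a \<Rightarrow> int) \<times> ('a \<Rightarrow> int)) set)) \<le> real (card (cells k R :: ('a \<Rightarrow> int) set) * 3 ^ DIM('a))"
    by (simp only: of_nat_le_iff)
  also have "\<dots> \<le> (2^k * (2 * R + 1)) ^ DIM('a) * 3 ^ DIM('a)"
    using mult_right_mono[OF card_cells_le[OF assms, of k, where 'a='a], of "3 ^ DIM('a)"] by simp
  finally show ?thesis by (simp add: power_mult_distrib mult.commute)
qed

lemma cell_index_neighbours:
  assumes "x \<in> cball 0 R" "dist x y \<le> (1/2)^k"
  shows "(cell_index k x, cell_index k y) \<in> neighbour_cells k R"
proof -
  let ?e = "\<lambda>b\<in>Basis. cell_index k y b - cell_index k x b"
  have "trunc_index k (y \<bullet> b) - trunc_index k (x \<bullet> b) \<in> {-1..1}" if "b \<in> Basis" for b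
  proof (rule trunc_index_neighbours)
    have "\<bar>(y - x) \<bullet> b\<bar> \<le> norm (y - x)" using that by (rule Basis_le_norm)
    then show "\<bar>y \<bullet> b - x \<bullet> b\<bar> \<le> (1/2)^k" using assms(2) by (simp add: inner_diff_left dist_norm norm_minus_commute)
  qed
  then have "?e \<in> (\<Pi>\<^sub>E b\<in>Basis. {-1..1})" by (auto simp: cell_index_def)
  moreover have "(cell_index k x, cell_index k y) = (\<lambda>(i, e). (i, \<lambda>b\<in>Basis. i b + e b)) (cell_index k x, ?e)"
    by (auto simp: cell_index_def fun_eq_iff restrict_def)
  ultimately show ?thesis
    unfolding neighbour_cells_def using cell_index_in_cells[OF assms(1)]
    by (intro image_eqI[of _ _ "(cell_index k x, ?e)"] SigmaI)
qed

text \<open>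
  The scale \<open>\<sigma> t\<close> of the zoom at time \<open>t\<close> may increase (leaving \<open>x\<close>) or decrease (arriving at \<open>x\<close>).
\<close>

definition zoom_path :: "(real \<Rightarrow> real) \<Rightarrow> 'a::euclidean_space \<Rightarrow> real \<Rightarrow> 'a" where
  "zoom_path \<sigma> x t = (if t < 0 then undefined else zoom x (\<sigma> t))"

text \<open>
  The zoom in dimension \<open>d\<close> has Lipschitz constant \<open>2 * d\<close>, so the scale has to move slowly by this factor.
\<close>

definition admissible_scale :: "nat \<Rightarrow> (real \<Rightarrow> real) \<Rightarrow> bool" where
  "admissible_scale d \<sigma> \<longleftrightarrow> (\<forall>t\<ge>0. 0 \<le> \<sigma> t \<and> \<sigma> t \<le> 1) \<and> (\<forall>s t. 2 * real d * \<bar>\<sigma> s - \<sigma> t\<bar> \<le> \<bar>s - t\<bar>)"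

lemma zoom_path_in_Lip1:
  fixes x :: "'a::euclidean_space"
  assumes \<sigma>: "admissible_scale DIM('a) \<sigma>" and x: "x \<in> cball 0 R"
  shows "zoom_path \<sigma> x \<in> Lip1 (cball 0 R)"
proof (rule Lip1I)
  show "zoom_path \<sigma> x t = undefined" if "t < 0" for t using that by (simp add: zoom_path_def)
  show "zoom_path \<sigma> x t \<in> cball 0 R" if "0 \<le> t" for t
    using that norm_zoom_le[of "\<sigma> t" x] \<sigma> x by (simp add: zoom_path_def admissible_scale_def)
  fix s t :: real assume st: "0 \<le> s" "s \<le> t"
  have "dist (zoom x (\<sigma> s)) (zoom x (\<sigma> t)) \<le> 2 * real DIM('a) * \<bar>\<sigma> s - \<sigma> t\<bar>" by (rule zoom_lipschitz)
  also have "\<dots> \<le> \<bar>s - t\<bar>" using \<sigma> by (simp add: admissible_scale_def)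
  finally show "dist (zoom_path \<sigma> x s) (zoom_path \<sigma> x t) \<le> t - s" using st by (simp add: zoom_path_def)
qed

lemma zoom_path_constant_from:
  assumes "\<And>t. T \<le> t \<Longrightarrow> \<sigma> t = \<sigma> T" "0 \<le> T"
  shows "constant_from T (zoom_path \<sigma> x)"
  unfolding constant_from_def
proof (intro allI impI)
  fix t assume "T \<le> t"
  then show "zoom_path \<sigma> x t = zoom_path \<sigma> x T" using assms(1)[of t] assms(2) by (simp add: zoom_path_def)
qed

lemma zoom_path_measurable:
  fixes x :: "'w \<Rightarrow> 'a::euclidean_space"
  assumes "admissible_scale DIM('a) \<sigma>" "\<And>\<omega>. \<omega> \<in> space N \<Longrightarrow> x \<omega> \<in> cball 0 R"
    and [measurable]: "x \<in> borel_measurable N"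
  shows "(\<lambda>\<omega>. zoom_path \<sigma> (x \<omega>)) \<in> measurable N (borel_of (Lip1_topology (cball 0 R)))"
proof (rule measurable_into_Lip1)
  show "\<And>\<omega>. \<omega> \<in> space N \<Longrightarrow> zoom_path \<sigma> (x \<omega>) \<in> Lip1 (cball 0 R)" using assms zoom_path_in_Lip1 by blast
  show "(\<lambda>\<omega>. zoom_path \<sigma> (x \<omega>) t) \<in> borel_measurable N" if "0 \<le> t" for t
    using that by (simp add: zoom_path_def)
qed

lemma path_cost_up_to:
  assumes "constant_from T \<gamma>"
  shows "path_cost w \<gamma> = (\<integral>\<^sup>+t\<in>{0..T}. w (\<gamma> t) * speed \<gamma> t \<partial>lborel)"
  unfolding path_cost_def
  by (rule nn_integral_cong) (use speed_constant[OF assms] in \<open>auto split: split_indicator\<close>)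

lemma dyadic_scale_exists:
  fixes s :: real
  assumes "0 < s" "s \<le> (1/2)^h"
  shows "\<exists>k\<ge>h. (1/2)^Suc k < s \<and> s \<le> (1/2)^k"
proof -
  define n where "n = (LEAST n. (1/2)^n < s)"
  have "\<exists>n. (1/2)^n < s" using real_arch_pow_inv[OF assms(1), of "1/2"] by auto
  then have n: "(1/2)^n < s" unfolding n_def by (rule LeastI_ex)
  have "n > h"
  proof (rule ccontr)
    assume "\<not> n > h"
    then have "(1/2)^h \<le> ((1/2)^n :: real)" by (intro power_decreasing) auto
    then show False using n assms by linarith
  qed
  then obtain k where k: "n = Suc k" "h \<le> k" by (cases n) auto
  have "\<not> (1/2)^k < s" using not_less_Least[of k "\<lambda>n. (1/2)^n < s"] k unfolding n_def by simp
  then show ?thesis using n k by (intro exI[of _ k]) auto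
qed

text \<open>
  The ratio of the costs of two consecutive scales. It is less than 1 if and only if \<open>\<alpha>\<close> is larger than
  \<open>1 - 1 / d\<close>.
\<close>

definition scale_ratio :: "'a::euclidean_space itself \<Rightarrow> real \<Rightarrow> real" where
  "scale_ratio _ \<alpha> = 2 powr (real DIM('a) * (1 - \<alpha>) - 1)"

definition cell_factor :: "'a::euclidean_space itself \<Rightarrow> real \<Rightarrow> real \<Rightarrow> real" where
  "cell_factor _ R \<alpha> = (2 * R + 1) powr (real DIM('a) * (1 - \<alpha>))"

lemma cells_powr:
  assumes "0 \<le> R" "0 < c" "real N \<le> (c * (2^k * (2 * R + 1))) ^ DIM('a::euclidean_space)" "\<alpha> < 1"
  shows "(1/2)^k * real N powr (1 - \<alpha>)
    \<le> c powr (real DIM('a) * (1 - \<alpha>)) * cell_factor TYPE('a) R \<alpha> * scale_ratio TYPE('a) \<alpha> ^ k"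
proof -
  let ?e = "real DIM('a) * (1 - \<alpha>)"
  have "real N powr (1 - \<alpha>) \<le> ((c * (2^k * (2 * R + 1))) ^ DIM('a)) powr (1 - \<alpha>)"
    using assms by (intro powr_mono2) auto
  also have "\<dots> = (c * (2^k * (2 * R + 1))) powr ?e"
    using assms by (simp add: powr_realpow[symmetric] powr_powr)
  also have "\<dots> = c powr ?e * ((2^k) powr ?e * (2 * R + 1) powr ?e)"
    using assms by (simp add: powr_mult)
  finally have "(1/2)^k * real N powr (1 - \<alpha>) \<le> (1/2)^k * (c powr ?e * ((2^k) powr ?e * (2 * R + 1) powr ?e))"
    by (intro mult_left_mono) auto
  also have "\<dots> = c powr ?e * cell_factor TYPE('a) R \<alpha> * ((1/2)^k * (2^k) powr ?e)"
    by (simp add: cell_factor_def mult_ac)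
  also have "(1/2)^k * (2^k) powr ?e = scale_ratio TYPE('a) \<alpha> ^ k"
  proof -
    have "(1/2::real)^k = 2 powr (- real k)" by (simp add: powr_minus powr_realpow power_one_over inverse_eq_divide)
    moreover have "(2^k :: real) powr ?e = 2 powr (real k * ?e)" by (simp add: powr_realpow[symmetric] powr_powr)
    moreover have "scale_ratio TYPE('a) \<alpha> ^ k = 2 powr ((?e - 1) * real k)"
      by (simp add: scale_ratio_def powr_realpow[symmetric] powr_powr)
    ultimately show ?thesis by (simp add: powr_add[symmetric] algebra_simps)
  qed
  finally show ?thesis .
qed

text \<open>
  While the scale is between \<open>(1/2)^Suc k\<close> and \<open>(1/2)^k\<close>, the position depends only on the cell of index
  \<open>Suc k\<close>. Thus \<open>branching_cost\<close> applies at each scale, and the costs form a geometric series that starts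
  at the scale \<open>h\<close>.
\<close>

lemma zoom_path_cost:
  fixes x :: "'w \<Rightarrow> 'a::euclidean_space"
  assumes fin: "finite_measure \<mu>" and A: "A \<in> sets \<mu>" and R: "0 \<le> R"
    and x: "x \<in> borel_measurable \<mu>" "\<And>\<omega>. \<omega> \<in> space \<mu> \<Longrightarrow> x \<omega> \<in> cball 0 R"
    and \<sigma>: "admissible_scale DIM('a) \<sigma>" "\<sigma> \<in> borel_measurable borel" "\<And>t. T \<le> t \<Longrightarrow> \<sigma> t = \<sigma> T" "0 \<le> T"
      "\<And>t. t \<in> {0..T} \<Longrightarrow> \<sigma> t \<le> (1/2)^h" "AE t in lborel. t \<in> {0..T} \<longrightarrow> \<sigma> t \<noteq> 0"
    and len: "\<And>k. emeasure lborel {t\<in>{0..T}. (1/2)^Suc k < \<sigma> t \<and> \<sigma> t \<le> (1/2)^k} \<le> ennreal (2 * real DIM('a) * (1/2)^Suc k)"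
    and m: "\<And>z. measure \<mu> {\<omega>\<in>A. hits (zoom_path \<sigma> (x \<omega>)) z} \<le> m z" "m \<in> borel_measurable borel"
    and \<alpha>: "0 < \<alpha>" "1 - 1 / real DIM('a) < \<alpha>" "\<alpha> < 1"
  shows "(\<integral>\<^sup>+\<omega>\<in>A. path_cost (\<lambda>z. mult_power \<alpha> (m z)) (zoom_path \<sigma> (x \<omega>)) \<partial>\<mu>)
    \<le> ennreal (2 * real DIM('a) * cell_factor TYPE('a) R \<alpha> * scale_ratio TYPE('a) \<alpha> ^ h / (1 - scale_ratio TYPE('a) \<alpha>) * measure \<mu> A powr \<alpha>)"
proof -
  let ?p = "\<lambda>\<omega>. zoom_path \<sigma> (x \<omega>)" and ?w = "\<lambda>z. mult_power \<alpha> (m z)"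
  let ?q = "scale_ratio TYPE('a) \<alpha>" and ?K = "2 * real DIM('a) * cell_factor TYPE('a) R \<alpha>"
  define I where "I k = {t\<in>{0..T}. (1/2)^Suc k < \<sigma> t \<and> \<sigma> t \<le> (1/2)^k}" for k
  have pm: "?p \<in> measurable \<mu> (borel_of (Lip1_topology (cball 0 R)))"
    by (rule zoom_path_measurable[OF \<sigma>(1) x(2) x(1)])
  have w: "?w \<in> borel_measurable borel" using m(2) by measurable
  note [measurable] = \<sigma>(2)
  have Ib: "I k \<in> sets borel" for k unfolding I_def by measurable
  have I0: "I k \<subseteq> {0..}" for k by (auto simp: I_def)
  have q0: "0 < ?q" by (simp add: scale_ratio_def)
  have "real DIM('a) * (1 - \<alpha>) < 1" using \<alpha>(2) by (simp add: field_simps)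
  then have q1: "?q < 1" unfolding scale_ratio_def by (simp add: powr_less_one)
  have piece: "(\<integral>\<^sup>+\<omega>\<in>A. (\<integral>\<^sup>+t\<in>I k. ?w (?p \<omega> t) * speed (?p \<omega>) t \<partial>lborel) \<partial>\<mu>) \<le> ennreal (?K * ?q ^ k * measure \<mu> A powr \<alpha>)" for k
  proof -
    have "(\<integral>\<^sup>+\<omega>\<in>A. (\<integral>\<^sup>+t\<in>I k. ?w (?p \<omega> t) * speed (?p \<omega>) t \<partial>lborel) \<partial>\<mu>)
      \<le> ennreal (2 * real DIM('a) * (1/2)^Suc k * (real (card (cells (Suc k) R :: ('a \<Rightarrow> int) set)) powr (1 - \<alpha>) * measure \<mu> A powr \<alpha>))"
    proof (rule branching_cost[OF fin A pm m(1) Ib I0 len[folded I_def] _ finite_cells, where J="\<lambda>\<omega>. cell_index (Suc k) (x \<omega>)"])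
      show "cell_index (Suc k) (x \<omega>) \<in> cells (Suc k) R" if "\<omega> \<in> A" for \<omega>
        using that x(2) sets.sets_into_space[OF A] by (intro cell_index_in_cells) auto
      show "{\<omega> \<in> A. cell_index (Suc k) (x \<omega>) = j} \<in> sets \<mu>" if "j \<in> cells (Suc k) R" for j
      proof -
        have "{\<omega> \<in> A. cell_index (Suc k) (x \<omega>) = j} = A \<inter> {\<omega> \<in> space \<mu>. cell_index (Suc k) (x \<omega>) = j}"
          using sets.sets_into_space[OF A] by auto
        then show ?thesis using cell_index_measurable[OF x(1) that] A by auto
      qed
      show "?p \<omega> t = ?p \<omega>' t" if "cell_index (Suc k) (x \<omega>) = cell_index (Suc k) (x \<omega>')" "t \<in> I k" for \<omega> \<omega>' t
      proof -
        have "\<sigma> t \<le> 1" using that(2) \<sigma>(1) by (simp add: I_def admissible_scale_def)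
        then have "zoom (x \<omega>) (\<sigma> t) = zoom (x \<omega>') (\<sigma> t)" using that(2) by (intro zoom_cong[OF that(1)]) (auto simp: I_def)
        then show ?thesis by (simp add: zoom_path_def)
      qed
    qed (use \<alpha> in auto)
    also have "\<dots> \<le> ennreal (?K * ?q ^ k * measure \<mu> A powr \<alpha>)"
    proof (rule ennreal_leI)
      have "(1/2)^Suc k * real (card (cells (Suc k) R :: ('a \<Rightarrow> int) set)) powr (1 - \<alpha>)
        \<le> 1 powr (real DIM('a) * (1 - \<alpha>)) * cell_factor TYPE('a) R \<alpha> * ?q ^ Suc k"
        using card_cells_le[OF R, of "Suc k", where 'a='a] \<alpha> R by (intro cells_powr) auto
      also have "\<dots> \<le> cell_factor TYPE('a) R \<alpha> * ?q ^ k"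
        using q0 q1 by (simp add: cell_factor_def mult_left_le_one_le mult_left_mono)
      finally have "2 * real DIM('a) * ((1/2)^Suc k * real (card (cells (Suc k) R :: ('a \<Rightarrow> int) set)) powr (1 - \<alpha>)) * measure \<mu> A powr \<alpha>
         \<le> 2 * real DIM('a) * (cell_factor TYPE('a) R \<alpha> * ?q ^ k) * measure \<mu> A powr \<alpha>"
        by (intro mult_right_mono mult_left_mono) auto
      then show "2 * real DIM('a) * (1/2)^Suc k * (real (card (cells (Suc k) R :: ('a \<Rightarrow> int) set)) powr (1 - \<alpha>) * measure \<mu> A powr \<alpha>)
         \<le> ?K * ?q ^ k * measure \<mu> A powr \<alpha>" by (simp only: mult.assoc)
    qed
    finally show ?thesis .
  qed
  have Asub: "\<omega> \<in> space \<mu>" if "\<omega> \<in> A" for \<omega> using that sets.sets_into_space[OF A] by blast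
  have split: "path_cost ?w (?p \<omega>) \<le> (\<Sum>i. \<integral>\<^sup>+t\<in>I (i + h). ?w (?p \<omega> t) * speed (?p \<omega>) t \<partial>lborel)" if "\<omega> \<in> A" for \<omega>
  proof -
    have pL: "?p \<omega> \<in> Lip1 (cball 0 R)" by (rule zoom_path_in_Lip1[OF \<sigma>(1) x(2)[OF Asub[OF that]]])
    have "constant_from T (?p \<omega>)" by (intro zoom_path_constant_from \<sigma>(3,4))
    then have "path_cost ?w (?p \<omega>) = (\<integral>\<^sup>+t\<in>{0..T}. ?w (?p \<omega> t) * speed (?p \<omega>) t \<partial>lborel)" by (rule path_cost_up_to)
    also have "\<dots> \<le> (\<integral>\<^sup>+t. (\<Sum>i. ?w (?p \<omega> t) * speed (?p \<omega>) t * indicator (I (i + h)) t) \<partial>lborel)"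
    proof (rule nn_integral_mono_AE)
      show "AE t in lborel. ?w (?p \<omega> t) * speed (?p \<omega>) t * indicator {0..T} t
         \<le> (\<Sum>i. ?w (?p \<omega> t) * speed (?p \<omega>) t * indicator (I (i + h)) t)"
        using \<sigma>(6)
      proof eventually_elim
        case (elim t)
        show ?case
        proof (cases "t \<in> {0..T}")
          case True
          then have "0 < \<sigma> t" using elim \<sigma>(1) by (simp add: admissible_scale_def less_le)
          then obtain k where k: "h \<le> k" "(1/2)^Suc k < \<sigma> t" "\<sigma> t \<le> (1/2)^k"
            using dyadic_scale_exists \<sigma>(5)[OF True] by blast
          then have "t \<in> I ((k - h) + h)" using True by (simp add: I_def)
          then have "?w (?p \<omega> t) * speed (?p \<omega>) t * indicator {0..T} t = (\<Sum>i\<in>{k - h}. ?w (?p \<omega> t) * speed (?p \<omega>) t * indicator (I (i + h)) t)"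
            using True by simp
          also have "\<dots> \<le> (\<Sum>i. ?w (?p \<omega> t) * speed (?p \<omega>) t * indicator (I (i + h)) t)"
            by (rule sum_le_suminf) auto
          finally show ?thesis .
        qed simp
      qed
    qed
    also have "\<dots> = (\<Sum>i. \<integral>\<^sup>+t\<in>I (i + h). ?w (?p \<omega> t) * speed (?p \<omega>) t \<partial>lborel)"
      by (rule nn_integral_suminf) (rule integrand_measurable_fixed[OF pL w Ib I0])
    finally show ?thesis .
  qed
  have "(\<integral>\<^sup>+\<omega>\<in>A. path_cost ?w (?p \<omega>) \<partial>\<mu>)
     \<le> (\<integral>\<^sup>+\<omega>. (\<Sum>i. (\<integral>\<^sup>+t\<in>I (i + h). ?w (?p \<omega> t) * speed (?p \<omega>) t \<partial>lborel) * indicator A \<omega>) \<partial>\<mu>)"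
    by (rule nn_integral_mono) (use split in \<open>auto split: split_indicator\<close>)
  also have "\<dots> = (\<Sum>i. \<integral>\<^sup>+\<omega>\<in>A. (\<integral>\<^sup>+t\<in>I (i + h). ?w (?p \<omega> t) * speed (?p \<omega>) t \<partial>lborel) \<partial>\<mu>)"
    by (rule nn_integral_suminf) (use set_cost_measurable[OF pm w Ib I0] A in measurable)
  also have "\<dots> \<le> (\<Sum>i. ennreal (?K * ?q ^ (i + h) * measure \<mu> A powr \<alpha>))"
    by (rule suminf_le) (use piece in auto)
  also have "\<dots> = ennreal (?K * ?q ^ h / (1 - ?q) * measure \<mu> A powr \<alpha>)"
  proof (rule suminf_ennreal_eq)
    show "0 \<le> ?K * ?q ^ (i + h) * measure \<mu> A powr \<alpha>" for i using q0 by (simp add: cell_factor_def)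
    have "(\<lambda>i. ?q ^ i) sums (1 / (1 - ?q))" using q0 q1 by (intro geometric_sums) simp
    then have "(\<lambda>i. (?K * ?q ^ h * measure \<mu> A powr \<alpha>) * ?q ^ i) sums ((?K * ?q ^ h * measure \<mu> A powr \<alpha>) * (1 / (1 - ?q)))"
      by (rule sums_mult)
    then show "(\<lambda>i. ?K * ?q ^ (i + h) * measure \<mu> A powr \<alpha>) sums (?K * ?q ^ h / (1 - ?q) * measure \<mu> A powr \<alpha>)"
      by (simp add: power_add mult_ac)
  qed
  finally show ?thesis .
qed

section \<open>Bridges\<close>

definition scale_out :: "nat \<Rightarrow> nat \<Rightarrow> real \<Rightarrow> real" where
  "scale_out d h t = min (t / (2 * real d)) ((1/2)^h)"

definition scale_in :: "nat \<Rightarrow> nat \<Rightarrow> real \<Rightarrow> real" where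
  "scale_in d h t = max 0 ((1/2)^h - t / (2 * real d))"

definition zoom_time :: "nat \<Rightarrow> nat \<Rightarrow> real" where
  "zoom_time d h = 2 * real d * (1/2)^h"

lemma zoom_time_nonneg [simp]: "0 \<le> zoom_time d h"
  by (simp add: zoom_time_def)

lemma scaled_difference:
  assumes "d > 0" "\<bar>a - b\<bar> \<le> \<bar>s / (2 * real d) - t / (2 * real d)\<bar>"
  shows "2 * real d * \<bar>a - b\<bar> \<le> \<bar>s - t\<bar>"
  using assms by (simp add: diff_divide_distrib[symmetric] abs_divide field_simps)

lemma scale_out_admissible: "d > 0 \<Longrightarrow> admissible_scale d (scale_out d h)"
  unfolding admissible_scale_def
proof (intro conjI allI impI)
  fix t :: real assume d: "d > 0" and "0 \<le> t"
  then have "0 \<le> t / (2 * real d)" by simp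
  then show "0 \<le> scale_out d h t" by (simp add: scale_out_def)
  have "(1/2)^h \<le> (1::real)" by (rule power_le_one) auto
  then show "scale_out d h t \<le> 1" unfolding scale_out_def by linarith
next
  fix s t :: real assume d: "d > 0"
  have "\<bar>min a c - min b c\<bar> \<le> \<bar>a - b\<bar>" for a b c :: real by (auto simp: min_def abs_if split: if_splits)
  then show "2 * real d * \<bar>scale_out d h s - scale_out d h t\<bar> \<le> \<bar>s - t\<bar>"
    unfolding scale_out_def by (intro scaled_difference d)
qed

lemma scale_in_admissible: "d > 0 \<Longrightarrow> admissible_scale d (scale_in d h)"
  unfolding admissible_scale_def
proof (intro conjI allI impI)
  fix t :: real assume d: "d > 0" and "0 \<le> t"
  then have "0 \<le> t / (2 * real d)" by simp
  moreover have "(1/2)^h \<le> (1::real)" by (rule power_le_one) auto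
  ultimately show "scale_in d h t \<le> 1" unfolding scale_in_def by linarith
  show "0 \<le> scale_in d h t" by (simp add: scale_in_def)
next
  fix s t :: real assume d: "d > 0"
  have "\<bar>max 0 (c - a) - max 0 (c - b)\<bar> \<le> \<bar>a - b\<bar>" for a b c :: real by (auto simp: max_def abs_if split: if_splits)
  then show "2 * real d * \<bar>scale_in d h s - scale_in d h t\<bar> \<le> \<bar>s - t\<bar>"
    unfolding scale_in_def by (intro scaled_difference d)
qed

lemma scale_values:
  assumes "d > 0"
  shows "scale_out d h 0 = 0" "zoom_time d h \<le> t \<Longrightarrow> scale_out d h t = (1/2)^h"
    "scale_in d h 0 = (1/2)^h" "zoom_time d h \<le> t \<Longrightarrow> scale_in d h t = 0"
proof -
  show "scale_out d h 0 = 0" "scale_in d h 0 = (1/2)^h" by (simp_all add: scale_out_def scale_in_def)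
  have "(1/2)^h \<le> t / (2 * real d)" if "zoom_time d h \<le> t"
    using that assms by (simp add: zoom_time_def pos_le_divide_eq mult.commute)
  then show "zoom_time d h \<le> t \<Longrightarrow> scale_out d h t = (1/2)^h" "zoom_time d h \<le> t \<Longrightarrow> scale_in d h t = 0"
    by (simp_all add: scale_out_def scale_in_def)
qed

lemma scale_measurable [measurable]: "scale_out d h \<in> borel_measurable borel" "scale_in d h \<in> borel_measurable borel"
  unfolding scale_out_def[abs_def] scale_in_def[abs_def] by measurable

lemma scale_level_length:
  assumes d: "d > 0"
  shows "emeasure lborel {t\<in>{0..zoom_time d h}. (1/2)^Suc k < scale_out d h t \<and> scale_out d h t \<le> (1/2)^k} \<le> ennreal (2 * real d * (1/2)^Suc k)"
    and "emeasure lborel {t\<in>{0..zoom_time d h}. (1/2)^Suc k < scale_in d h t \<and> scale_in d h t \<le> (1/2)^k} \<le> ennreal (2 * real d * (1/2)^Suc k)"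
proof -
  let ?D = "2 * real d" and ?T = "zoom_time d h"
  have D: "?D > 0" using d by simp
  have len: "?D * (1/2)^k - ?D * (1/2)^Suc k = ?D * (1/2)^Suc k" by simp
  have le: "?D * (1/2)^Suc k \<le> ?D * (1/2)^k" using D by simp
  have "{t\<in>{0..?T}. (1/2)^Suc k < scale_out d h t \<and> scale_out d h t \<le> (1/2)^k} \<subseteq> {?D * (1/2)^Suc k..?D * (1/2)^k}"
  proof
    fix t assume t: "t \<in> {t\<in>{0..?T}. (1/2)^Suc k < scale_out d h t \<and> scale_out d h t \<le> (1/2)^k}"
    then have "t / ?D \<le> (1/2)^h" using D by (simp add: zoom_time_def pos_divide_le_eq mult.commute)
    then have "scale_out d h t = t / ?D" by (simp add: scale_out_def)
    then have "(1/2)^Suc k < t / ?D" "t / ?D \<le> (1/2)^k" using t by auto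
    then show "t \<in> {?D * (1/2)^Suc k..?D * (1/2)^k}" using D
      by (simp only: pos_less_divide_eq pos_divide_le_eq atLeastAtMost_iff mult.commute[of ?D]) simp
  qed
  then have "emeasure lborel {t\<in>{0..?T}. (1/2)^Suc k < scale_out d h t \<and> scale_out d h t \<le> (1/2)^k} \<le> emeasure lborel {?D * (1/2)^Suc k..?D * (1/2)^k}"
    by (rule emeasure_mono) simp
  also have "\<dots> = ennreal (?D * (1/2)^Suc k)" using le len by (simp only: emeasure_lborel_Icc)
  finally show "emeasure lborel {t\<in>{0..?T}. (1/2)^Suc k < scale_out d h t \<and> scale_out d h t \<le> (1/2)^k} \<le> ennreal (?D * (1/2)^Suc k)" .
  have "{t\<in>{0..?T}. (1/2)^Suc k < scale_in d h t \<and> scale_in d h t \<le> (1/2)^k} \<subseteq> {?T - ?D * (1/2)^k..?T - ?D * (1/2)^Suc k}"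
  proof
    fix t assume t: "t \<in> {t\<in>{0..?T}. (1/2)^Suc k < scale_in d h t \<and> scale_in d h t \<le> (1/2)^k}"
    then have "t / ?D \<le> (1/2)^h" using D by (simp add: zoom_time_def pos_divide_le_eq mult.commute)
    then have "scale_in d h t = (1/2)^h - t / ?D" by (simp add: scale_in_def)
    also have "\<dots> = (?T - t) / ?D" using D by (simp add: zoom_time_def diff_divide_distrib)
    finally have "(1/2)^Suc k < (?T - t) / ?D" "(?T - t) / ?D \<le> (1/2)^k" using t by auto
    then have "(1/2)^Suc k * ?D < ?T - t" "?T - t \<le> (1/2)^k * ?D"
      using D by (simp_all only: pos_less_divide_eq pos_divide_le_eq)
    then show "t \<in> {?T - ?D * (1/2)^k..?T - ?D * (1/2)^Suc k}"
      by (simp only: atLeastAtMost_iff mult.commute[of ?D]) linarith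
  qed
  then have "emeasure lborel {t\<in>{0..?T}. (1/2)^Suc k < scale_in d h t \<and> scale_in d h t \<le> (1/2)^k} \<le> emeasure lborel {?T - ?D * (1/2)^k..?T - ?D * (1/2)^Suc k}"
    by (rule emeasure_mono) simp
  also have "\<dots> = ennreal (?D * (1/2)^Suc k)"
  proof -
    have "?T - ?D * (1/2)^k \<le> ?T - ?D * (1/2)^Suc k" using le by linarith
    moreover have "(?T - ?D * (1/2)^Suc k) - (?T - ?D * (1/2)^k) = ?D * (1/2)^Suc k" using len by linarith
    ultimately show ?thesis by (simp only: emeasure_lborel_Icc)
  qed
  finally show "emeasure lborel {t\<in>{0..?T}. (1/2)^Suc k < scale_in d h t \<and> scale_in d h t \<le> (1/2)^k} \<le> ennreal (?D * (1/2)^Suc k)" .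
qed

definition tree_cost :: "'a::euclidean_space itself \<Rightarrow> real \<Rightarrow> real \<Rightarrow> real" where
  "tree_cost T R \<alpha> = 2 * real DIM('a) * cell_factor T R \<alpha> / (1 - scale_ratio T \<alpha>)"

lemma
  fixes x :: "'w \<Rightarrow> 'a::euclidean_space"
  assumes fin: "finite_measure \<mu>" and A: "A \<in> sets \<mu>" and R: "0 \<le> R"
    and x: "x \<in> borel_measurable \<mu>" "\<And>\<omega>. \<omega> \<in> space \<mu> \<Longrightarrow> x \<omega> \<in> cball 0 R"
    and m: "m \<in> borel_measurable borel"
    and \<alpha>: "0 < \<alpha>" "1 - 1 / real DIM('a) < \<alpha>" "\<alpha> < 1"
  shows zoom_out_cost: "(\<And>z. measure \<mu> {\<omega>\<in>A. hits (zoom_path (scale_out DIM('a) h) (x \<omega>)) z} \<le> m z) \<Longrightarrow>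
      (\<integral>\<^sup>+\<omega>\<in>A. path_cost (\<lambda>z. mult_power \<alpha> (m z)) (zoom_path (scale_out DIM('a) h) (x \<omega>)) \<partial>\<mu>)
      \<le> ennreal (tree_cost TYPE('a) R \<alpha> * scale_ratio TYPE('a) \<alpha> ^ h * measure \<mu> A powr \<alpha>)"
    and zoom_in_cost: "(\<And>z. measure \<mu> {\<omega>\<in>A. hits (zoom_path (scale_in DIM('a) h) (x \<omega>)) z} \<le> m z) \<Longrightarrow>
      (\<integral>\<^sup>+\<omega>\<in>A. path_cost (\<lambda>z. mult_power \<alpha> (m z)) (zoom_path (scale_in DIM('a) h) (x \<omega>)) \<partial>\<mu>)
      \<le> ennreal (tree_cost TYPE('a) R \<alpha> * scale_ratio TYPE('a) \<alpha> ^ h * measure \<mu> A powr \<alpha>)"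
proof -
  let ?d = "DIM('a)" and ?T = "zoom_time DIM('a) h"
  have d: "?d > 0" by simp
  have eq: "2 * real ?d * cell_factor TYPE('a) R \<alpha> * scale_ratio TYPE('a) \<alpha> ^ h / (1 - scale_ratio TYPE('a) \<alpha>) * measure \<mu> A powr \<alpha>
    = tree_cost TYPE('a) R \<alpha> * scale_ratio TYPE('a) \<alpha> ^ h * measure \<mu> A powr \<alpha>"
    by (simp add: tree_cost_def)
  show "(\<integral>\<^sup>+\<omega>\<in>A. path_cost (\<lambda>z. mult_power \<alpha> (m z)) (zoom_path (scale_out ?d h) (x \<omega>)) \<partial>\<mu>)
      \<le> ennreal (tree_cost TYPE('a) R \<alpha> * scale_ratio TYPE('a) \<alpha> ^ h * measure \<mu> A powr \<alpha>)"
    if "\<And>z. measure \<mu> {\<omega>\<in>A. hits (zoom_path (scale_out ?d h) (x \<omega>)) z} \<le> m z"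
    unfolding eq[symmetric]
  proof (rule zoom_path_cost[OF fin A R x scale_out_admissible[OF d] _ _ zoom_time_nonneg _ _ scale_level_length(1)[OF d] that m \<alpha>])
    show "AE t in lborel. t \<in> {0..?T} \<longrightarrow> scale_out ?d h t \<noteq> 0"
      using AE_lborel_singleton[of "0::real"] by eventually_elim (auto simp: scale_out_def min_def)
    show "scale_out ?d h t = scale_out ?d h ?T" if "?T \<le> t" for t using that by (simp add: scale_values(2)[OF d])
    show "scale_out ?d h t \<le> (1/2)^h" for t by (simp add: scale_out_def)
  qed measurable
  show "(\<integral>\<^sup>+\<omega>\<in>A. path_cost (\<lambda>z. mult_power \<alpha> (m z)) (zoom_path (scale_in ?d h) (x \<omega>)) \<partial>\<mu>)
      \<le> ennreal (tree_cost TYPE('a) R \<alpha> * scale_ratio TYPE('a) \<alpha> ^ h * measure \<mu> A powr \<alpha>)"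
    if "\<And>z. measure \<mu> {\<omega>\<in>A. hits (zoom_path (scale_in ?d h) (x \<omega>)) z} \<le> m z"
    unfolding eq[symmetric]
  proof (rule zoom_path_cost[OF fin A R x scale_in_admissible[OF d] _ _ zoom_time_nonneg _ _ scale_level_length(2)[OF d] that m \<alpha>])
    show "AE t in lborel. t \<in> {0..?T} \<longrightarrow> scale_in ?d h t \<noteq> 0"
      using AE_lborel_singleton[of ?T]
    proof eventually_elim
      case (elim t)
      show ?case
      proof
        assume "t \<in> {0..?T}"
        then have "t < 2 * real ?d * (1/2)^h" using elim by (simp add: zoom_time_def)
        then have "t / (2 * real ?d) < (1/2)^h" using d by (simp add: pos_divide_less_eq mult.commute)
        then show "scale_in ?d h t \<noteq> 0" by (simp add: scale_in_def)
      qed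
    qed
    show "scale_in ?d h t = scale_in ?d h ?T" if "?T \<le> t" for t using that by (simp add: scale_values(4)[OF d])
    show "scale_in ?d h t \<le> (1/2)^h" if "t \<in> {0..?T}" for t
    proof -
      have "0 \<le> t / (2 * real ?d)" using that by simp
      moreover have "0 \<le> (1/2::real)^h" by simp
      ultimately show ?thesis unfolding scale_in_def by linarith
    qed
  qed measurable
qed

definition segment :: "'a::euclidean_space \<Rightarrow> 'a \<Rightarrow> real \<Rightarrow> 'a" where
  "segment u v t = (if t < 0 then undefined else u + (min t (dist u v) / dist u v) *\<^sub>R (v - u))"

lemma segment_ends: "segment u v 0 = u" "segment u v (dist u v) = v"
  by (auto simp: segment_def)

lemma segment_constant_from: "constant_from (dist u v) (segment u v)"
  unfolding constant_from_def
proof (intro allI impI)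
  fix t assume t: "dist u v \<le> t"
  then have "\<not> t < 0" using zero_le_dist[of u v] by linarith
  then show "segment u v t = segment u v (dist u v)" using t by (simp add: segment_def)
qed

lemma segment_in_Lip1:
  fixes u v :: "'a::euclidean_space"
  assumes X: "convex X" and uv: "u \<in> X" "v \<in> X"
  shows "segment u v \<in> Lip1 X"
proof (rule Lip1I)
  let ?c = "\<lambda>t. min t (dist u v) / dist u v"
  show "segment u v t = undefined" if "t < 0" for t using that by (simp add: segment_def)
  show "segment u v t \<in> X" if "0 \<le> t" for t
  proof -
    have c: "0 \<le> ?c t" "?c t \<le> 1" using that by (auto simp: divide_le_eq_1)
    have "(1 - ?c t) *\<^sub>R u + ?c t *\<^sub>R v \<in> X" using X uv c by (intro convexD) auto
    moreover have "(1 - ?c t) *\<^sub>R u + ?c t *\<^sub>R v = segment u v t" using that by (simp add: segment_def algebra_simps)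
    ultimately show ?thesis by simp
  qed
  fix s t :: real assume st: "0 \<le> s" "s \<le> t"
  show "dist (segment u v s) (segment u v t) \<le> t - s"
  proof (cases "u = v")
    case True
    then show ?thesis using st by (simp add: segment_def)
  next
    case False
    have "segment u v s - segment u v t = ((min s (dist u v) - min t (dist u v)) / dist u v) *\<^sub>R (v - u)"
      using st by (simp add: segment_def diff_divide_distrib scaleR_diff_left)
    then have "dist (segment u v s) (segment u v t) = \<bar>min s (dist u v) - min t (dist u v)\<bar> / dist u v * norm (v - u)"
      by (simp add: dist_norm[of "segment u v s"])
    also have "\<dots> = \<bar>min s (dist u v) - min t (dist u v)\<bar>" using False by (simp add: dist_norm norm_minus_commute)
    also have "\<dots> \<le> t - s" using st by (auto simp: min_def abs_if split: if_splits)
    finally show ?thesis .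
  qed
qed

lemma segment_measurable:
  fixes u v :: "'w \<Rightarrow> 'a::euclidean_space"
  assumes X: "convex X" and [measurable]: "u \<in> borel_measurable N" "v \<in> borel_measurable N"
    and uv: "\<And>\<omega>. \<omega> \<in> space N \<Longrightarrow> u \<omega> \<in> X \<and> v \<omega> \<in> X"
  shows "(\<lambda>\<omega>. segment (u \<omega>) (v \<omega>)) \<in> measurable N (borel_of (Lip1_topology X))"
proof (rule measurable_into_Lip1)
  show "(\<lambda>\<omega>. segment (u \<omega>) (v \<omega>) t) \<in> borel_measurable N" if "0 \<le> t" for t
    using that by (simp add: segment_def)
qed (use segment_in_Lip1[OF X] uv in blast)

text \<open>
  The path from \<open>x\<close> leaves to the scale \<open>(1/2)^h\<close>, crosses to the path of \<open>y\<close> at this scale along a segment,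
  and arrives at \<open>y\<close>.
\<close>

definition bridge :: "nat \<Rightarrow> 'a::euclidean_space \<Rightarrow> 'a \<Rightarrow> real \<Rightarrow> 'a" where
  "bridge h x y = (let u = zoom x ((1/2)^h); v = zoom y ((1/2)^h) in
     join_curves (zoom_path (scale_out DIM('a) h) x) (zoom_time DIM('a) h)
       (join_curves (segment u v) (dist u v) (zoom_path (scale_in DIM('a) h) y)))"

definition bridge_time :: "nat \<Rightarrow> 'a::euclidean_space \<Rightarrow> 'a \<Rightarrow> real" where
  "bridge_time h x y = zoom_time DIM('a) h + (dist (zoom x ((1/2)^h)) (zoom y ((1/2)^h)) + zoom_time DIM('a) h)"

lemma bridge_time_nonneg [simp]: "0 \<le> bridge_time h x y"
  by (simp add: bridge_time_def)

context
  fixes R :: real and h :: nat and x y :: "'a::euclidean_space"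
  assumes x: "x \<in> cball 0 R" and y: "y \<in> cball 0 R"
begin

private abbreviation "X \<equiv> cball (0::'a) R"
private abbreviation "u \<equiv> zoom x ((1/2)^h)"
private abbreviation "v \<equiv> zoom y ((1/2)^h)"
private abbreviation "out \<equiv> zoom_path (scale_out DIM('a) h) x"
private abbreviation "inn \<equiv> zoom_path (scale_in DIM('a) h) y"
private abbreviation "tail \<equiv> join_curves (segment u v) (dist u v) inn"

lemma bridge_pieces:
  "out \<in> Lip1 X" "segment u v \<in> Lip1 X" "inn \<in> Lip1 X" "tail \<in> Lip1 X"
  "out (zoom_time DIM('a) h) = tail 0" "segment u v (dist u v) = inn 0"
  "constant_from (zoom_time DIM('a) h) out" "constant_from (zoom_time DIM('a) h) inn"
  "inn (zoom_time DIM('a) h) = y" "out 0 = x"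
proof -
  have d: "DIM('a) > 0" by simp
  have h1: "(1/2)^h \<le> (1::real)" by (rule power_le_one) auto
  have uv: "u \<in> X" "v \<in> X" using norm_zoom_le[OF h1, of x] norm_zoom_le[OF h1, of y] x y by auto
  show L: "out \<in> Lip1 X" "segment u v \<in> Lip1 X" "inn \<in> Lip1 X"
    by (auto intro!: zoom_path_in_Lip1 scale_out_admissible scale_in_admissible segment_in_Lip1 x y uv convex_cball)
  show eq: "segment u v (dist u v) = inn 0" by (simp add: segment_ends zoom_path_def scale_values[OF d])
  show "tail \<in> Lip1 X" by (rule join_in_Lip1[OF L(2,3) _ eq]) simp
  show "out (zoom_time DIM('a) h) = tail 0"
    by (simp add: join_start segment_ends zoom_path_def scale_values[OF d] leD[OF zoom_time_nonneg])
  show "constant_from (zoom_time DIM('a) h) out" "constant_from (zoom_time DIM('a) h) inn"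
    by (auto intro!: zoom_path_constant_from simp: scale_values[OF d])
  show "inn (zoom_time DIM('a) h) = y" "out 0 = x"
    by (simp_all add: zoom_path_def scale_values[OF d] zoom_0 leD[OF zoom_time_nonneg])
qed

lemma bridge_eq: "bridge h x y = join_curves out (zoom_time DIM('a) h) tail"
  by (simp add: bridge_def Let_def)

lemma bridge_in_Lip1: "bridge h x y \<in> Lip1 X"
  unfolding bridge_eq by (rule join_in_Lip1[OF bridge_pieces(1,4) zoom_time_nonneg bridge_pieces(5)])

lemma bridge_start: "bridge h x y 0 = x"
  unfolding bridge_eq by (simp add: join_start bridge_pieces(10))

lemma bridge_constant_from: "constant_from (bridge_time h x y) (bridge h x y)"
  unfolding bridge_eq bridge_time_def
  by (intro join_constant_from bridge_pieces) (auto intro!: add_nonneg_nonneg)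

lemma bridge_end: "bridge h x y (bridge_time h x y) = y"
proof -
  have "bridge h x y (bridge_time h x y) = tail (dist u v + zoom_time DIM('a) h)"
    unfolding bridge_eq bridge_time_def
    by (subst join_after[of out _ tail, OF bridge_pieces(5)]) (auto intro!: add_nonneg_nonneg simp: add.commute)
  also have "\<dots> = y"
    by (subst join_after[of "segment u v" _ inn, OF bridge_pieces(6)]) (auto simp: bridge_pieces(9))
  finally show ?thesis .
qed

lemma bridge_hits:
  assumes "hits out z \<or> hits (segment u v) z \<or> hits inn z"
  shows "hits (bridge h x y) z"
proof -
  have "hits tail z" if "hits (segment u v) z \<or> hits inn z"
    using that join_hits_left[OF _ _ segment_constant_from, of u v z inn] join_hits_right[of inn z "dist u v" "segment u v", OF _ _ bridge_pieces(6)]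
    by auto
  then show ?thesis
    unfolding bridge_eq using assms join_hits_left[OF _ zoom_time_nonneg bridge_pieces(7)]
      join_hits_right[of tail z _ out, OF _ zoom_time_nonneg bridge_pieces(5)] by blast
qed

lemma bridge_path_cost_le:
  assumes "w \<in> borel_measurable borel"
  shows "path_cost w (bridge h x y) \<le> path_cost w out + (path_cost w (segment u v) + path_cost w inn)"
proof -
  have "path_cost w (bridge h x y) \<le> path_cost w out + path_cost w tail"
    unfolding bridge_eq by (rule path_cost_join_le[OF bridge_pieces(1,4) zoom_time_nonneg bridge_pieces(5) assms])
  also have "\<dots> \<le> path_cost w out + (path_cost w (segment u v) + path_cost w inn)"
    by (intro add_left_mono path_cost_join_le[OF bridge_pieces(2,3) _ bridge_pieces(6) assms]) simp
  finally show ?thesis .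
qed

end

lemma bridge_pieces_measurable:
  fixes x y :: "'w \<Rightarrow> 'a::euclidean_space"
  assumes [measurable]: "x \<in> borel_measurable N" "y \<in> borel_measurable N"
    and xy: "\<And>\<omega>. \<omega> \<in> space N \<Longrightarrow> x \<omega> \<in> cball 0 R" "\<And>\<omega>. \<omega> \<in> space N \<Longrightarrow> y \<omega> \<in> cball 0 R"
  shows "(\<lambda>\<omega>. zoom_path (scale_out DIM('a) h) (x \<omega>)) \<in> measurable N (borel_of (Lip1_topology (cball 0 R)))"
    "(\<lambda>\<omega>. segment (zoom (x \<omega>) ((1/2)^h)) (zoom (y \<omega>) ((1/2)^h))) \<in> measurable N (borel_of (Lip1_topology (cball 0 R)))"
    "(\<lambda>\<omega>. zoom_path (scale_in DIM('a) h) (y \<omega>)) \<in> measurable N (borel_of (Lip1_topology (cball 0 R)))"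
    "(\<lambda>\<omega>. bridge h (x \<omega>) (y \<omega>)) \<in> measurable N (borel_of (Lip1_topology (cball 0 R)))"
    "(\<lambda>\<omega>. bridge_time h (x \<omega>) (y \<omega>)) \<in> borel_measurable N"
proof -
  let ?LM = "borel_of (Lip1_topology (cball (0::'a) R))"
  have h1: "(1/2)^h \<le> (1::real)" by (rule power_le_one) auto
  show out: "(\<lambda>\<omega>. zoom_path (scale_out DIM('a) h) (x \<omega>)) \<in> measurable N ?LM"
    and inn: "(\<lambda>\<omega>. zoom_path (scale_in DIM('a) h) (y \<omega>)) \<in> measurable N ?LM"
    by (auto intro!: zoom_path_measurable scale_out_admissible scale_in_admissible xy simp del: mem_cball)
  show seg: "(\<lambda>\<omega>. segment (zoom (x \<omega>) ((1/2)^h)) (zoom (y \<omega>) ((1/2)^h))) \<in> measurable N ?LM"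
  proof (rule segment_measurable)
    fix \<omega> assume w: "\<omega> \<in> space N"
    then have "norm (x \<omega>) \<le> R" "norm (y \<omega>) \<le> R" using xy[OF w] by simp_all
    then show "zoom (x \<omega>) ((1/2)^h) \<in> cball 0 R \<and> zoom (y \<omega>) ((1/2)^h) \<in> cball 0 R"
      using norm_zoom_le[OF h1, of "x \<omega>"] norm_zoom_le[OF h1, of "y \<omega>"] by simp
  qed (auto intro: convex_cball)
  show "(\<lambda>\<omega>. bridge h (x \<omega>) (y \<omega>)) \<in> measurable N ?LM"
    unfolding bridge_def Let_def
  proof (rule join_measurable[OF out join_measurable[OF seg inn]])
    fix \<omega> assume w: "\<omega> \<in> space N"
    show "segment (zoom (x \<omega>) ((1/2)^h)) (zoom (y \<omega>) ((1/2)^h)) (dist (zoom (x \<omega>) ((1/2)^h)) (zoom (y \<omega>) ((1/2)^h)))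
      = zoom_path (scale_in DIM('a) h) (y \<omega>) 0" by (rule bridge_pieces(6)[OF xy(1)[OF w] xy(2)[OF w]])
    show "zoom_path (scale_out DIM('a) h) (x \<omega>) (zoom_time DIM('a) h)
      = join_curves (segment (zoom (x \<omega>) ((1/2)^h)) (zoom (y \<omega>) ((1/2)^h))) (dist (zoom (x \<omega>) ((1/2)^h)) (zoom (y \<omega>) ((1/2)^h)))
         (zoom_path (scale_in DIM('a) h) (y \<omega>)) 0" by (rule bridge_pieces(5)[OF xy(1)[OF w] xy(2)[OF w]])
  qed auto
  show "(\<lambda>\<omega>. bridge_time h (x \<omega>) (y \<omega>)) \<in> borel_measurable N" unfolding bridge_time_def by measurable
qed

text \<open>
  The two zooms are paid by \<open>zoom_path_cost\<close>. The crossing is determined by the two cells at the scale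
  \<open>(1/2)^h\<close>, and \<open>S\<close> bounds the number of pairs of cells that occur.
\<close>

proposition bridge_cost:
  fixes x y :: "'w \<Rightarrow> 'a::euclidean_space"
  assumes fin: "finite_measure \<mu>" and A: "A \<in> sets \<mu>" and R: "0 \<le> R"
    and x: "x \<in> borel_measurable \<mu>" "\<And>\<omega>. \<omega> \<in> space \<mu> \<Longrightarrow> x \<omega> \<in> cball 0 R"
    and y: "y \<in> borel_measurable \<mu>" "\<And>\<omega>. \<omega> \<in> space \<mu> \<Longrightarrow> y \<omega> \<in> cball 0 R"
    and S: "finite S" "\<And>\<omega>. \<omega> \<in> A \<Longrightarrow> (cell_index h (x \<omega>), cell_index h (y \<omega>)) \<in> S"
    and L: "0 \<le> L" "\<And>\<omega>. \<omega> \<in> A \<Longrightarrow> dist (zoom (x \<omega>) ((1/2)^h)) (zoom (y \<omega>) ((1/2)^h)) \<le> L"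
    and m: "m \<in> borel_measurable borel" "\<And>z. measure \<mu> {\<omega>\<in>A. hits (bridge h (x \<omega>) (y \<omega>)) z} \<le> m z"
    and \<alpha>: "0 < \<alpha>" "1 - 1 / real DIM('a) < \<alpha>" "\<alpha> < 1"
  shows "(\<integral>\<^sup>+\<omega>\<in>A. path_cost (\<lambda>z. mult_power \<alpha> (m z)) (bridge h (x \<omega>) (y \<omega>)) \<partial>\<mu>)
    \<le> ennreal ((2 * tree_cost TYPE('a) R \<alpha> * scale_ratio TYPE('a) \<alpha> ^ h + L * real (card S) powr (1 - \<alpha>)) * measure \<mu> A powr \<alpha>)"
proof -
  interpret finite_measure \<mu> by fact
  let ?w = "\<lambda>z. mult_power \<alpha> (m z)"
  let ?out = "\<lambda>\<omega>. zoom_path (scale_out DIM('a) h) (x \<omega>)" and ?inn = "\<lambda>\<omega>. zoom_path (scale_in DIM('a) h) (y \<omega>)"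
  let ?seg = "\<lambda>\<omega>. segment (zoom (x \<omega>) ((1/2)^h)) (zoom (y \<omega>) ((1/2)^h))"
  note meas = bridge_pieces_measurable[OF x(1) y(1) x(2) y(2), of h]
  have w: "?w \<in> borel_measurable borel" using m(1) by measurable
  have Asub: "\<omega> \<in> space \<mu>" if "\<omega> \<in> A" for \<omega> using that sets.sets_into_space[OF A] by blast
  have hitm: "{\<omega>\<in>A. hits (f \<omega>) z} \<in> sets \<mu>" if "f \<in> measurable \<mu> (borel_of (Lip1_topology (cball (0::'a) R)))" for f z
  proof -
    have "Measurable.pred \<mu> (\<lambda>\<omega>. hits (f \<omega>) z)" by (rule hits_measurable[OF that]) simp
    then have "A \<inter> {\<omega> \<in> space \<mu>. hits (f \<omega>) z} \<in> sets \<mu>" using A by (intro sets.Int predE)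
    moreover have "A \<inter> {\<omega> \<in> space \<mu>. hits (f \<omega>) z} = {\<omega>\<in>A. hits (f \<omega>) z}" using Asub by auto
    ultimately show ?thesis by simp
  qed
  have sub: "measure \<mu> {\<omega>\<in>A. hits (f \<omega>) z} \<le> m z"
    if "\<And>\<omega>. \<omega> \<in> A \<Longrightarrow> hits (f \<omega>) z \<Longrightarrow> hits (bridge h (x \<omega>) (y \<omega>)) z" for f z
  proof -
    have "measure \<mu> {\<omega>\<in>A. hits (f \<omega>) z} \<le> measure \<mu> {\<omega>\<in>A. hits (bridge h (x \<omega>) (y \<omega>)) z}"
      by (rule finite_measure_mono[OF _ hitm[OF meas(4)]]) (use that in auto)
    then show ?thesis using m(2) order_trans by blast
  qed
  have bh: "hits (bridge h (x \<omega>) (y \<omega>)) z" if "\<omega> \<in> A" "hits (?out \<omega>) z \<or> hits (?seg \<omega>) z \<or> hits (?inn \<omega>) z" for \<omega> z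
    by (rule bridge_hits[OF x(2)[OF Asub[OF that(1)]] y(2)[OF Asub[OF that(1)]] that(2)])
  let ?E = "tree_cost TYPE('a) R \<alpha> * scale_ratio TYPE('a) \<alpha> ^ h * measure \<mu> A powr \<alpha>"
  have 1: "(\<integral>\<^sup>+\<omega>\<in>A. path_cost ?w (?out \<omega>) \<partial>\<mu>) \<le> ennreal ?E"
    by (rule zoom_out_cost[OF fin A R x m(1) \<alpha>]) (assumption, rule sub, use bh in blast)
  have 3: "(\<integral>\<^sup>+\<omega>\<in>A. path_cost ?w (?inn \<omega>) \<partial>\<mu>) \<le> ennreal ?E"
    by (rule zoom_in_cost[OF fin A R y m(1) \<alpha>]) (assumption, rule sub, use bh in blast)
  have 2: "(\<integral>\<^sup>+\<omega>\<in>A. path_cost ?w (?seg \<omega>) \<partial>\<mu>) \<le> ennreal (L * (real (card S) powr (1 - \<alpha>) * measure \<mu> A powr \<alpha>))"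
  proof -
    have "(\<integral>\<^sup>+\<omega>\<in>A. path_cost ?w (?seg \<omega>) \<partial>\<mu>) = (\<integral>\<^sup>+\<omega>\<in>A. (\<integral>\<^sup>+t\<in>{0..L}. ?w (?seg \<omega> t) * speed (?seg \<omega>) t \<partial>lborel) \<partial>\<mu>)"
    proof (rule nn_integral_cong)
      fix \<omega>
      show "path_cost ?w (?seg \<omega>) * indicator A \<omega> = (\<integral>\<^sup>+t\<in>{0..L}. ?w (?seg \<omega> t) * speed (?seg \<omega>) t \<partial>lborel) * indicator A \<omega>"
        using path_cost_up_to[OF constant_from_mono[OF segment_constant_from L(2)], of \<omega> ?w] by (auto split: split_indicator)
    qed
    also have "\<dots> \<le> ennreal (L * (real (card S) powr (1 - \<alpha>) * measure \<mu> A powr \<alpha>))"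
    proof (rule branching_cost[OF fin A meas(2) _ _ _ _ L(1) S(1), where J="\<lambda>\<omega>. (cell_index h (x \<omega>), cell_index h (y \<omega>))"])
      show "measure \<mu> {\<omega> \<in> A. hits (?seg \<omega>) z} \<le> m z" for z by (rule sub) (use bh in blast)
      show "{\<omega> \<in> A. (cell_index h (x \<omega>), cell_index h (y \<omega>)) = j} \<in> sets \<mu>" for j
      proof (cases "fst j \<in> cells h R \<and> snd j \<in> cells h R")
        case True
        have "{\<omega> \<in> A. (cell_index h (x \<omega>), cell_index h (y \<omega>)) = j}
          = A \<inter> ({\<omega> \<in> space \<mu>. cell_index h (x \<omega>) = fst j} \<inter> {\<omega> \<in> space \<mu>. cell_index h (y \<omega>) = snd j})"
          using Asub by auto
        then show ?thesis using cell_index_measurable[OF x(1)] cell_index_measurable[OF y(1)] True A by auto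
      next
        case False
        then have "{\<omega> \<in> A. (cell_index h (x \<omega>), cell_index h (y \<omega>)) = j} = {}"
          using cell_index_in_cells[OF x(2)[OF Asub]] cell_index_in_cells[OF y(2)[OF Asub]] by auto
        then show ?thesis by (simp only: sets.empty_sets)
      qed
      show "?seg \<omega> t = ?seg \<omega>' t"
        if "(cell_index h (x \<omega>), cell_index h (y \<omega>)) = (cell_index h (x \<omega>'), cell_index h (y \<omega>'))" for \<omega> \<omega>' t
      proof -
        have h1: "(1/2)^h \<le> (1::real)" by (rule power_le_one) auto
        show ?thesis using that zoom_cong[OF _ order_refl h1, of "x \<omega>" "x \<omega>'"] zoom_cong[OF _ order_refl h1, of "y \<omega>" "y \<omega>'"] by simp
      qed
    qed (use S(2) \<alpha> L(1) in auto)
    finally show ?thesis .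
  qed
  have pm: "(\<lambda>\<omega>. path_cost ?w (f \<omega>) * indicator A \<omega>) \<in> borel_measurable \<mu>"
    if "f \<in> measurable \<mu> (borel_of (Lip1_topology (cball (0::'a) R)))" for f
    using path_cost_measurable[OF that w] A by measurable
  have "(\<integral>\<^sup>+\<omega>\<in>A. path_cost ?w (bridge h (x \<omega>) (y \<omega>)) \<partial>\<mu>)
    \<le> (\<integral>\<^sup>+\<omega>. path_cost ?w (?out \<omega>) * indicator A \<omega> + (path_cost ?w (?seg \<omega>) * indicator A \<omega> + path_cost ?w (?inn \<omega>) * indicator A \<omega>) \<partial>\<mu>)"
  proof (rule nn_integral_mono)
    fix \<omega> assume w': "\<omega> \<in> space \<mu>"
    show "path_cost ?w (bridge h (x \<omega>) (y \<omega>)) * indicator A \<omega>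
      \<le> path_cost ?w (?out \<omega>) * indicator A \<omega> + (path_cost ?w (?seg \<omega>) * indicator A \<omega> + path_cost ?w (?inn \<omega>) * indicator A \<omega>)"
      using bridge_path_cost_le[OF x(2)[OF w'] y(2)[OF w'] w, of h] by (auto split: split_indicator)
  qed
  also have "\<dots> = (\<integral>\<^sup>+\<omega>\<in>A. path_cost ?w (?out \<omega>) \<partial>\<mu>) + ((\<integral>\<^sup>+\<omega>\<in>A. path_cost ?w (?seg \<omega>) \<partial>\<mu>) + (\<integral>\<^sup>+\<omega>\<in>A. path_cost ?w (?inn \<omega>) \<partial>\<mu>))"
    using pm[OF meas(1)] pm[OF meas(2)] pm[OF meas(3)] by (simp add: nn_integral_add)
  also have "\<dots> \<le> ennreal ?E + (ennreal (L * (real (card S) powr (1 - \<alpha>) * measure \<mu> A powr \<alpha>)) + ennreal ?E)"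
    by (intro add_mono 1 2 3)
  also have "\<dots> = ennreal ((2 * tree_cost TYPE('a) R \<alpha> * scale_ratio TYPE('a) \<alpha> ^ h + L * real (card S) powr (1 - \<alpha>)) * measure \<mu> A powr \<alpha>)"
  proof -
    have "real DIM('a) * (1 - \<alpha>) < 1" using \<alpha>(2) by (simp add: field_simps)
    then have "scale_ratio TYPE('a) \<alpha> < 1" unfolding scale_ratio_def by (simp add: powr_less_one)
    then have E0: "0 \<le> ?E" by (simp add: tree_cost_def cell_factor_def scale_ratio_def)
    then show ?thesis using L(1) by (simp add: ennreal_plus[symmetric] algebra_simps del: ennreal_plus)
  qed
  finally show ?thesis .
qed

definition bridge_factor :: "'a::euclidean_space itself \<Rightarrow> real \<Rightarrow> real \<Rightarrow> real" where
  "bridge_factor T R \<alpha> = 2 * tree_cost T R \<alpha> + (1 + 4 * real DIM('a)) * (3 powr (real DIM('a) * (1 - \<alpha>)) * cell_factor T R \<alpha>)"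

text \<open>
  Close points are in neighbouring cells. The bound tends to zero with the scale \<open>(1/2)^h\<close>.
\<close>

corollary short_bridge_cost:
  fixes x y :: "'w \<Rightarrow> 'a::euclidean_space"
  assumes fin: "finite_measure \<mu>" and A: "A \<in> sets \<mu>" and R: "0 \<le> R"
    and x: "x \<in> borel_measurable \<mu>" "\<And>\<omega>. \<omega> \<in> space \<mu> \<Longrightarrow> x \<omega> \<in> cball 0 R"
    and y: "y \<in> borel_measurable \<mu>" "\<And>\<omega>. \<omega> \<in> space \<mu> \<Longrightarrow> y \<omega> \<in> cball 0 R"
    and close: "\<And>\<omega>. \<omega> \<in> A \<Longrightarrow> dist (x \<omega>) (y \<omega>) \<le> (1/2)^h"
    and m: "m \<in> borel_measurable borel" "\<And>z. measure \<mu> {\<omega>\<in>A. hits (bridge h (x \<omega>) (y \<omega>)) z} \<le> m z"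
    and \<alpha>: "0 < \<alpha>" "1 - 1 / real DIM('a) < \<alpha>" "\<alpha> < 1"
  shows "(\<integral>\<^sup>+\<omega>\<in>A. path_cost (\<lambda>z. mult_power \<alpha> (m z)) (bridge h (x \<omega>) (y \<omega>)) \<partial>\<mu>)
    \<le> ennreal (bridge_factor TYPE('a) R \<alpha> * scale_ratio TYPE('a) \<alpha> ^ h * measure \<mu> A powr \<alpha>)"
proof -
  let ?d = "real DIM('a)" and ?q = "scale_ratio TYPE('a) \<alpha>"
  let ?N = "neighbour_cells h R :: (('a \<Rightarrow> int) \<times> ('a \<Rightarrow> int)) set"
  (* The zoom to the scale (1/2)^h moves each of the two points by at most 2 * d * (1/2)^h. *)
  let ?L = "(1 + 4 * ?d) * (1/2)^h"
  have Asub: "\<omega> \<in> space \<mu>" if "\<omega> \<in> A" for \<omega> using that sets.sets_into_space[OF A] by blast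
  have dist: "dist (zoom (x \<omega>) ((1/2)^h)) (zoom (y \<omega>) ((1/2)^h)) \<le> ?L" if "\<omega> \<in> A" for \<omega>
  proof -
    have z: "dist (zoom z ((1/2)^h)) z \<le> 2 * ?d * (1/2)^h" for z :: 'a
      using zoom_lipschitz[of z "(1/2)^h" 0] by (simp add: zoom_0)
    have "dist (zoom (x \<omega>) ((1/2)^h)) (zoom (y \<omega>) ((1/2)^h))
      \<le> dist (zoom (x \<omega>) ((1/2)^h)) (x \<omega>) + dist (x \<omega>) (y \<omega>) + dist (zoom (y \<omega>) ((1/2)^h)) (y \<omega>)" by metric
    also have "\<dots> \<le> 2 * ?d * (1/2)^h + (1/2)^h + 2 * ?d * (1/2)^h" by (intro add_mono z close that)
    finally show ?thesis by (simp add: algebra_simps)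
  qed
  have "(\<integral>\<^sup>+\<omega>\<in>A. path_cost (\<lambda>z. mult_power \<alpha> (m z)) (bridge h (x \<omega>) (y \<omega>)) \<partial>\<mu>)
    \<le> ennreal ((2 * tree_cost TYPE('a) R \<alpha> * ?q ^ h + ?L * real (card ?N) powr (1 - \<alpha>)) * measure \<mu> A powr \<alpha>)"
    by (rule bridge_cost[OF fin A R x y finite_neighbour_cells _ _ dist m \<alpha>])
       (auto intro!: cell_index_neighbours x(2) Asub close simp del: mem_cball)
  also have "\<dots> \<le> ennreal (bridge_factor TYPE('a) R \<alpha> * ?q ^ h * measure \<mu> A powr \<alpha>)"
  proof (intro ennreal_leI mult_right_mono)
    have "(1/2)^h * real (card ?N) powr (1 - \<alpha>) \<le> 3 powr (?d * (1 - \<alpha>)) * cell_factor TYPE('a) R \<alpha> * ?q ^ h"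
      by (rule cells_powr[OF R _ card_neighbour_cells_le[OF R] \<alpha>(3)]) simp
    then have "(1 + 4 * ?d) * ((1/2)^h * real (card ?N) powr (1 - \<alpha>)) \<le> (1 + 4 * ?d) * (3 powr (?d * (1 - \<alpha>)) * cell_factor TYPE('a) R \<alpha> * ?q ^ h)"
      by (rule mult_left_mono) simp
    then show "2 * tree_cost TYPE('a) R \<alpha> * ?q ^ h + ?L * real (card ?N) powr (1 - \<alpha>) \<le> bridge_factor TYPE('a) R \<alpha> * ?q ^ h"
      by (simp add: bridge_factor_def distrib_right mult.assoc)
  qed simp
  finally show ?thesis .
qed

definition long_bridge_factor :: "'a::euclidean_space itself \<Rightarrow> real \<Rightarrow> real \<Rightarrow> real" where
  "long_bridge_factor T R \<alpha> = 2 * tree_cost T R \<alpha>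
     + 2 * R * real (card ((cells 0 R :: ('a \<Rightarrow> int) set) \<times> (cells 0 R :: ('a \<Rightarrow> int) set))) powr (1 - \<alpha>)"

text \<open>
  For arbitrary points all pairs of cells of side 1 may occur. The bound tends to zero with the mass.
\<close>

corollary long_bridge_cost:
  fixes x y :: "'w \<Rightarrow> 'a::euclidean_space"
  assumes fin: "finite_measure \<mu>" and A: "A \<in> sets \<mu>" and R: "0 \<le> R"
    and x: "x \<in> borel_measurable \<mu>" "\<And>\<omega>. \<omega> \<in> space \<mu> \<Longrightarrow> x \<omega> \<in> cball 0 R"
    and y: "y \<in> borel_measurable \<mu>" "\<And>\<omega>. \<omega> \<in> space \<mu> \<Longrightarrow> y \<omega> \<in> cball 0 R"
    and m: "m \<in> borel_measurable borel" "\<And>z. measure \<mu> {\<omega>\<in>A. hits (bridge 0 (x \<omega>) (y \<omega>)) z} \<le> m z"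
    and \<alpha>: "0 < \<alpha>" "1 - 1 / real DIM('a) < \<alpha>" "\<alpha> < 1"
  shows "(\<integral>\<^sup>+\<omega>\<in>A. path_cost (\<lambda>z. mult_power \<alpha> (m z)) (bridge 0 (x \<omega>) (y \<omega>)) \<partial>\<mu>)
    \<le> ennreal (long_bridge_factor TYPE('a) R \<alpha> * measure \<mu> A powr \<alpha>)"
proof -
  have Asub: "\<omega> \<in> space \<mu>" if "\<omega> \<in> A" for \<omega> using that sets.sets_into_space[OF A] by blast
  have dist: "dist (zoom (x \<omega>) ((1/2)^0)) (zoom (y \<omega>) ((1/2)^0)) \<le> 2 * R" if "\<omega> \<in> A" for \<omega>
  proof -
    have "norm (zoom (x \<omega>) 1) \<le> norm (x \<omega>)" "norm (zoom (y \<omega>) 1) \<le> norm (y \<omega>)" by (auto intro: norm_zoom_le)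
    then have "norm (zoom (x \<omega>) 1) \<le> R" "norm (zoom (y \<omega>) 1) \<le> R" using x(2)[OF Asub[OF that]] y(2)[OF Asub[OF that]] by auto
    then show ?thesis using norm_triangle_ineq4[of "zoom (x \<omega>) 1" "zoom (y \<omega>) 1"] by (simp add: dist_norm)
  qed
  have "(\<integral>\<^sup>+\<omega>\<in>A. path_cost (\<lambda>z. mult_power \<alpha> (m z)) (bridge 0 (x \<omega>) (y \<omega>)) \<partial>\<mu>)
    \<le> ennreal ((2 * tree_cost TYPE('a) R \<alpha> * scale_ratio TYPE('a) \<alpha> ^ 0
        + 2 * R * real (card ((cells 0 R :: ('a \<Rightarrow> int) set) \<times> (cells 0 R :: ('a \<Rightarrow> int) set))) powr (1 - \<alpha>)) * measure \<mu> A powr \<alpha>)"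
    by (rule bridge_cost[OF fin A R x y _ _ _ dist m \<alpha>])
       (use R in \<open>auto intro!: cell_index_in_cells x(2) y(2) Asub finite_cells simp del: mem_cball\<close>)
  then show ?thesis by (simp add: long_bridge_factor_def)
qed

section \<open>Rerouting a plan to a nearby coupling\<close>

text \<open>
  Agrees with the pair of \<open>e_0\<close> and \<open>e_infty\<close> on the curves that settle, and is an evaluation of the curve
  on all curves.
\<close>

definition ends :: "(real \<Rightarrow> 'a) \<Rightarrow> 'a \<times> 'a" where
  "ends \<gamma> = (\<gamma> 0, \<gamma> (settling_time \<gamma>))"

lemma ends_in: "\<gamma> \<in> Lip1 X \<Longrightarrow> ends \<gamma> \<in> X \<times> X"
  by (simp add: ends_def Lip1_in)

lemma ends_eq:
  fixes \<gamma> :: "real \<Rightarrow> 'a::euclidean_space"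
  assumes "\<gamma> \<in> Lip1 X" "stopping_time \<gamma> < \<infinity>"
  shows "ends \<gamma> = (e_0 \<gamma>, e_infty \<gamma>)"
  using finite_stopping_time_settles(2)[OF assms] by (simp add: ends_def e_0_def)

lemma end_measurable:
  fixes f :: "'w \<Rightarrow> real \<Rightarrow> 'a::euclidean_space"
  assumes f: "f \<in> measurable N (borel_of (Lip1_topology X))"
  shows "(\<lambda>\<omega>. f \<omega> 0) \<in> borel_measurable N" "(\<lambda>\<omega>. f \<omega> (settling_time (f \<omega>))) \<in> borel_measurable N"
    "(\<lambda>\<omega>. ends (f \<omega>)) \<in> borel_measurable N"
proof -
  show 1: "(\<lambda>\<omega>. f \<omega> 0) \<in> borel_measurable N" by (rule measurable_compose[OF f eval_measurable]) simp
  show 2: "(\<lambda>\<omega>. f \<omega> (settling_time (f \<omega>))) \<in> borel_measurable N"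
    by (rule eval_at_random_time_measurable[OF f settling_time_measurable[OF f]]) simp
  show "(\<lambda>\<omega>. ends (f \<omega>)) \<in> borel_measurable N"
    unfolding ends_def using 1 2 by (rule borel_measurable_Pair)
qed

definition rerouted :: "nat \<Rightarrow> (real \<Rightarrow> 'a::euclidean_space) \<Rightarrow> 'a \<times> 'a \<Rightarrow> real \<Rightarrow> 'a" where
  "rerouted h \<gamma> z = join_curves (bridge h (fst z) (\<gamma> 0)) (bridge_time h (fst z) (\<gamma> 0))
     (join_curves \<gamma> (settling_time \<gamma>) (bridge h (\<gamma> (settling_time \<gamma>)) (snd z)))"

context
  fixes R :: real and h :: nat and \<gamma> :: "real \<Rightarrow> 'a::euclidean_space" and z :: "'a \<times> 'a"
  assumes g: "\<gamma> \<in> Lip1 (cball 0 R)" and z: "z \<in> cball 0 R \<times> cball 0 R"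
begin

private abbreviation "\<tau> \<equiv> settling_time \<gamma>"
private abbreviation "entry \<equiv> bridge h (fst z) (\<gamma> 0)"
private abbreviation "exit \<equiv> bridge h (\<gamma> \<tau>) (snd z)"
private abbreviation "rest \<equiv> join_curves \<gamma> \<tau> exit"

lemma rerouted_points:
  "fst z \<in> cball 0 R" "snd z \<in> cball 0 R" "\<gamma> 0 \<in> cball 0 R" "\<gamma> \<tau> \<in> cball 0 R"
  using z Lip1_in[OF g, of 0] Lip1_in[OF g, of \<tau>] by (auto simp: mem_Times_iff)

lemma rerouted_pieces:
  "entry \<in> Lip1 (cball 0 R)" "exit \<in> Lip1 (cball 0 R)" "rest \<in> Lip1 (cball 0 R)"
  "\<gamma> \<tau> = exit 0" "entry (bridge_time h (fst z) (\<gamma> 0)) = rest 0"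
proof -
  note p = rerouted_points
  show 1: "entry \<in> Lip1 (cball 0 R)" by (rule bridge_in_Lip1[OF p(1,3)])
  show 2: "exit \<in> Lip1 (cball 0 R)" by (rule bridge_in_Lip1[OF p(4,2)])
  show 3: "\<gamma> \<tau> = exit 0" by (simp add: bridge_start[OF p(4,2)])
  show "rest \<in> Lip1 (cball 0 R)" by (rule join_in_Lip1[OF g 2 settling_time_nonneg 3])
  show "entry (bridge_time h (fst z) (\<gamma> 0)) = rest 0"
    by (simp add: bridge_end[OF p(1,3)] join_start)
qed

lemma rerouted_constant_from:
  "constant_from (bridge_time h (fst z) (\<gamma> 0) + (\<tau> + bridge_time h (\<gamma> \<tau>) (snd z))) (rerouted h \<gamma> z)"
proof -
  have "constant_from (\<tau> + bridge_time h (\<gamma> \<tau>) (snd z)) rest"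
    by (rule join_constant_from[of _ exit \<gamma> \<tau>, OF bridge_constant_from[OF rerouted_points(4,2)] bridge_time_nonneg rerouted_pieces(4)])
  then show ?thesis
    unfolding rerouted_def
    by (rule join_constant_from[of _ rest entry, OF _ _ rerouted_pieces(5)]) (intro add_nonneg_nonneg settling_time_nonneg bridge_time_nonneg)
qed

lemma rerouted_start: "rerouted h \<gamma> z 0 = fst z"
  unfolding rerouted_def by (simp add: join_start bridge_start[OF rerouted_points(1,3)])

lemma rerouted_end:
  "rerouted h \<gamma> z (bridge_time h (fst z) (\<gamma> 0) + (\<tau> + bridge_time h (\<gamma> \<tau>) (snd z))) = snd z"
proof -
  have "rerouted h \<gamma> z (bridge_time h (fst z) (\<gamma> 0) + (\<tau> + bridge_time h (\<gamma> \<tau>) (snd z)))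
    = rest (\<tau> + bridge_time h (\<gamma> \<tau>) (snd z))"
    unfolding rerouted_def
    by (subst join_after[of entry _ rest, OF rerouted_pieces(5)]) (auto intro!: add_nonneg_nonneg)
  also have "\<dots> = snd z"
    by (subst join_after[of \<gamma> _ exit, OF rerouted_pieces(4)]) (auto simp: bridge_end[OF rerouted_points(4,2)])
  finally show ?thesis .
qed

lemma rerouted_hits:
  shows "hits entry x \<Longrightarrow> hits (rerouted h \<gamma> z) x" "hits exit x \<Longrightarrow> hits (rerouted h \<gamma> z) x"
    "constant_from \<tau> \<gamma> \<Longrightarrow> hits \<gamma> x \<Longrightarrow> hits (rerouted h \<gamma> z) x"
proof -
  have t: "hits (rerouted h \<gamma> z) x" if "hits rest x"
    unfolding rerouted_def by (rule join_hits_right[of rest x _ entry, OF that bridge_time_nonneg rerouted_pieces(5)])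
  show "hits entry x \<Longrightarrow> hits (rerouted h \<gamma> z) x"
    unfolding rerouted_def by (rule join_hits_left[OF _ bridge_time_nonneg bridge_constant_from[OF rerouted_points(1,3)]])
  show "hits exit x \<Longrightarrow> hits (rerouted h \<gamma> z) x"
    by (rule t, rule join_hits_right[of exit x \<tau> \<gamma>, OF _ settling_time_nonneg rerouted_pieces(4)])
  show "constant_from \<tau> \<gamma> \<Longrightarrow> hits \<gamma> x \<Longrightarrow> hits (rerouted h \<gamma> z) x"
    by (rule t, rule join_hits_left[OF _ settling_time_nonneg])
qed

lemma rerouted_path_cost_le:
  assumes "w \<in> borel_measurable borel"
  shows "path_cost w (rerouted h \<gamma> z) \<le> path_cost w entry + (path_cost w \<gamma> + path_cost w exit)"
proof -
  have "path_cost w (rerouted h \<gamma> z) \<le> path_cost w entry + path_cost w rest"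
    unfolding rerouted_def by (rule path_cost_join_le[OF rerouted_pieces(1,3) bridge_time_nonneg rerouted_pieces(5) assms])
  also have "\<dots> \<le> path_cost w entry + (path_cost w \<gamma> + path_cost w exit)"
    by (intro add_left_mono path_cost_join_le[OF g rerouted_pieces(2) settling_time_nonneg rerouted_pieces(4) assms])
  finally show ?thesis .
qed

end

text \<open>
  A plan \<open>Q\<close> is modified into a plan with coupling \<open>\<nu>\<close>. The functions \<open>\<phi> i\<close> form a partition of unity
  subordinate to small sets, and \<open>\<nu>\<close> has at least the fraction \<open>\<theta>\<close> of the mass of the coupling of \<open>Q\<close> on
  each of them.

  A random curve is drawn from \<open>Q\<close>, end points from \<open>\<nu>\<close>, and a coin; their joint law has the density
  \<open>W\<close> with respect to the product. If the coin shows \<^const>\<open>True\<close>, the curve is rerouted to the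
  end points; the density \<open>wT\<close> pairs curves and end points independently within each \<open>\<phi> i\<close>, so that both
  pairs of end points are close, and leaves the curve with the law \<open>\<theta> * Q\<close>. If the coin shows
  \<^const>\<open>False\<close>, a long bridge joins the end points; the density \<open>wF\<close> is what is missing in order that
  the end points have the law \<open>\<nu>\<close>.
\<close>

locale reroute =
  fixes R \<alpha> \<theta> :: real and h :: nat and Q :: "(real \<Rightarrow> 'a::euclidean_space) measure"
    and \<nu> :: "('a \<times> 'a) measure" and I :: "'i set" and \<phi> :: "'i \<Rightarrow> 'a \<times> 'a \<Rightarrow> real"
  assumes R: "R > 0" and \<alpha>: "0 < \<alpha>" "1 - 1 / real DIM('a) < \<alpha>" "\<alpha> < 1"
    and tp: "traffic_plan (cball 0 R) Q" and \<nu>: "borel_prob (top_of_set (cball 0 R \<times> cball 0 R)) \<nu>"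
    and I: "finite I" and \<phi>m [measurable]: "\<And>i. \<phi> i \<in> borel_measurable borel" and \<phi>0: "\<And>i z. 0 \<le> \<phi> i z"
    and \<phi>1: "\<And>z. z \<in> cball 0 R \<times> cball 0 R \<Longrightarrow> (\<Sum>i\<in>I. \<phi> i z) = 1"
    and supp: "\<And>i z z'. i \<in> I \<Longrightarrow> \<phi> i z \<noteq> 0 \<Longrightarrow> \<phi> i z' \<noteq> 0 \<Longrightarrow> dist z z' \<le> (1/2)^h"
    and \<theta>: "0 < \<theta>" "\<theta> \<le> 1" and mass: "\<And>i. i \<in> I \<Longrightarrow> \<theta> * (\<integral>\<gamma>. \<phi> i (ends \<gamma>) \<partial>Q) \<le> (\<integral>z. \<phi> i z \<partial>\<nu>)"
begin

abbreviation "X \<equiv> cball (0::'a) R"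
abbreviation "LM \<equiv> borel_of (Lip1_topology X)"
definition "a i = (\<integral>\<gamma>. \<phi> i (ends \<gamma>) \<partial>Q)"
definition "b i = (\<integral>z. \<phi> i z \<partial>\<nu>)"
text \<open>
  On \<open>J\<close> the masses \<open>b i\<close> are positive, so that division by them is meaningful. The other functions vanish
  at the end points of almost all curves.
\<close>

definition "J = {i\<in>I. a i > 0}"
definition "M = (Q \<Otimes>\<^sub>M \<nu>) \<Otimes>\<^sub>M count_space (UNIV :: bool set)"
definition "wT \<gamma> z = \<theta> * (\<Sum>i\<in>J. \<phi> i (ends \<gamma>) * \<phi> i z / b i)"
definition "wF z = 1 - \<theta> * (\<Sum>i\<in>J. a i / b i * \<phi> i z)"
definition "W \<omega> = ennreal (if snd \<omega> then wT (fst (fst \<omega>)) (snd (fst \<omega>)) else wF (snd (fst \<omega>)))"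
definition "\<mu> = density M W"
definition "curve \<omega> = (if snd \<omega> then rerouted h (fst (fst \<omega>)) (snd (fst \<omega>)) else bridge 0 (fst (snd (fst \<omega>))) (snd (snd (fst \<omega>))))"
definition "plan = distr \<mu> LM curve"

sublocale Q: prob_space Q using traffic_planD(1)[OF tp] .
sublocale \<nu>: prob_space \<nu> using borel_probD(1)[OF \<nu>] .
sublocale Q\<nu>: pair_prob_space Q \<nu> ..

lemma spaces: "space Q = Lip1 X" "space \<nu> = X \<times> X"
  using traffic_planD(3)[OF tp] borel_probD(3)[OF \<nu>] by simp_all

lemma id_measurable [measurable]: "(\<lambda>\<gamma>. \<gamma>) \<in> measurable Q LM" "(\<lambda>z. z) \<in> measurable \<nu> borel"
proof -
  show "(\<lambda>\<gamma>. \<gamma>) \<in> measurable Q LM" by (rule traffic_planD(6)[OF tp])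
  have "(\<lambda>z. z) \<in> measurable (restrict_space borel (X \<times> X)) borel" by (rule measurable_restrict_space1) simp
  then show "(\<lambda>z. z) \<in> measurable \<nu> borel"
    using measurable_cong_sets[OF trans[OF borel_probD(2)[OF \<nu>] sets_borel_of_top_of_set] refl] by blast
qed

lemma \<phi>_\<nu>_measurable [measurable]: "\<phi> i \<in> borel_measurable \<nu>"
  using measurable_compose[OF id_measurable(2) \<phi>m] .

lemma \<phi>_ends_measurable [measurable]: "(\<lambda>\<gamma>. \<phi> i (ends \<gamma>)) \<in> borel_measurable Q"
  using measurable_compose[OF end_measurable(3)[OF id_measurable(1)] \<phi>m] .

lemma \<phi>_le_1: "i \<in> I \<Longrightarrow> z \<in> X \<times> X \<Longrightarrow> \<phi> i z \<le> 1"
  using member_le_sum[of i I "\<lambda>i. \<phi> i z"] \<phi>0 I \<phi>1[of z] by simp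

lemma integrable_\<phi>: "i \<in> I \<Longrightarrow> integrable \<nu> (\<phi> i)" "i \<in> I \<Longrightarrow> integrable Q (\<lambda>\<gamma>. \<phi> i (ends \<gamma>))"
proof -
  assume i: "i \<in> I"
  show "integrable \<nu> (\<phi> i)"
    by (rule \<nu>.integrable_const_bound[of _ 1], rule AE_I2) (use i \<phi>0 \<phi>_le_1 spaces in auto)
  show "integrable Q (\<lambda>\<gamma>. \<phi> i (ends \<gamma>))"
    by (rule Q.integrable_const_bound[of _ 1], rule AE_I2) (use i \<phi>0 \<phi>_le_1 spaces ends_in[of _ X] in auto)
qed

lemma JI: "J \<subseteq> I" "finite J" "i \<in> J \<Longrightarrow> 0 < a i" "i \<in> J \<Longrightarrow> 0 < b i" "i \<in> J \<Longrightarrow> \<theta> * a i \<le> b i"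
proof -
  show "J \<subseteq> I" "finite J" "i \<in> J \<Longrightarrow> 0 < a i" using I by (auto simp: J_def)
  show le: "i \<in> J \<Longrightarrow> \<theta> * a i \<le> b i" using mass[of i] by (auto simp: J_def a_def b_def)
  show "i \<in> J \<Longrightarrow> 0 < b i"
  proof -
    assume i: "i \<in> J"
    then have "0 < \<theta> * a i" using \<theta> by (auto simp: J_def)
    then show "0 < b i" using le[OF i] by linarith
  qed
qed

lemma a_nonneg: "0 \<le> a i"
  unfolding a_def by (rule Bochner_Integration.integral_nonneg) (rule \<phi>0)

lemma wT_nonneg: "0 \<le> wT \<gamma> z"
  unfolding wT_def using \<theta> JI(4) \<phi>0 by (intro mult_nonneg_nonneg sum_nonneg divide_nonneg_nonneg) (auto simp: less_imp_le)

lemma wF_nonneg: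
  assumes z: "z \<in> X \<times> X" shows "0 \<le> wF z"
proof -
  have "\<theta> * (\<Sum>i\<in>J. a i / b i * \<phi> i z) = (\<Sum>i\<in>J. \<theta> * a i / b i * \<phi> i z)" by (simp add: sum_distrib_left mult.assoc)
  also have "\<dots> \<le> (\<Sum>i\<in>J. \<phi> i z)"
  proof (rule sum_mono)
    fix i assume i: "i \<in> J"
    have "\<theta> * a i / b i \<le> 1" using JI(4,5)[OF i] by (simp add: divide_le_eq_1)
    then show "\<theta> * a i / b i * \<phi> i z \<le> \<phi> i z" using \<phi>0[of i z] mult_right_mono[of "\<theta> * a i / b i" 1 "\<phi> i z"] by simp
  qed
  also have "\<dots> \<le> (\<Sum>i\<in>I. \<phi> i z)" using JI(1) I \<phi>0 by (intro sum_mono2) auto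
  also have "\<dots> = 1" by (rule \<phi>1[OF z])
  finally show ?thesis by (simp add: wF_def)
qed

lemma wT_measurable [measurable]:
  "(\<lambda>x. wT (fst x) (snd x)) \<in> borel_measurable (Q \<Otimes>\<^sub>M \<nu>)"
  "wT \<gamma> \<in> borel_measurable \<nu>" "(\<lambda>\<gamma>. wT \<gamma> z) \<in> borel_measurable Q" "wF \<in> borel_measurable \<nu>"
  unfolding wT_def[abs_def] wF_def[abs_def] by measurable

lemma proj_measurable [measurable]:
  "(\<lambda>\<omega>. fst (fst \<omega>)) \<in> measurable M Q" "(\<lambda>\<omega>. snd (fst \<omega>)) \<in> measurable M \<nu>"
  "snd \<in> measurable M (count_space UNIV)" "fst \<in> measurable M (Q \<Otimes>\<^sub>M \<nu>)"
  unfolding M_def by measurable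

lemma W_measurable [measurable]: "W \<in> borel_measurable M"
proof -
  have "(\<lambda>\<omega>. wT (fst (fst \<omega>)) (snd (fst \<omega>))) \<in> borel_measurable M"
    by (rule measurable_compose[OF proj_measurable(4) wT_measurable(1)])
  then show ?thesis unfolding W_def[abs_def] by measurable
qed

lemma space_M: "space M = (Lip1 X \<times> (X \<times> X)) \<times> UNIV"
  by (simp add: M_def space_pair_measure spaces)

lemma space_\<mu>: "space \<mu> = space M" and sets_\<mu> [measurable_cong]: "sets \<mu> = sets M"
  by (simp_all add: \<mu>_def)

lemma integral_\<mu>:
  assumes F[measurable]: "F \<in> borel_measurable M"
  shows "(\<integral>\<^sup>+\<omega>. F \<omega> \<partial>\<mu>) = (\<integral>\<^sup>+\<gamma>. (\<integral>\<^sup>+z. ennreal (wT \<gamma> z) * F ((\<gamma>, z), True) + ennreal (wF z) * F ((\<gamma>, z), False) \<partial>\<nu>) \<partial>Q)"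
    and "(\<integral>\<^sup>+\<omega>. F \<omega> \<partial>\<mu>) = (\<integral>\<^sup>+z. (\<integral>\<^sup>+\<gamma>. ennreal (wT \<gamma> z) * F ((\<gamma>, z), True) + ennreal (wF z) * F ((\<gamma>, z), False) \<partial>Q) \<partial>\<nu>)"
proof -
  interpret B: sigma_finite_measure "count_space (UNIV :: bool set)" by (rule sigma_finite_measure_count_space_finite) simp
  let ?g = "\<lambda>x. ennreal (wT (fst x) (snd x)) * F (x, True) + ennreal (wF (snd x)) * F (x, False)"
  have WF: "(\<lambda>\<omega>. W \<omega> * F \<omega>) \<in> borel_measurable ((Q \<Otimes>\<^sub>M \<nu>) \<Otimes>\<^sub>M count_space UNIV)"
    using W_measurable F unfolding M_def by measurable
  have FT: "(\<lambda>x. F (x, c)) \<in> borel_measurable (Q \<Otimes>\<^sub>M \<nu>)" for c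
    using F unfolding M_def by measurable
  have g[measurable]: "?g \<in> borel_measurable (Q \<Otimes>\<^sub>M \<nu>)" using FT by measurable
  have "(\<integral>\<^sup>+\<omega>. F \<omega> \<partial>\<mu>) = (\<integral>\<^sup>+\<omega>. W \<omega> * F \<omega> \<partial>M)"
    unfolding \<mu>_def by (rule nn_integral_density[OF W_measurable F])
  also have "\<dots> = (\<integral>\<^sup>+x. (\<integral>\<^sup>+c. W (x, c) * F (x, c) \<partial>count_space UNIV) \<partial>(Q \<Otimes>\<^sub>M \<nu>))"
    unfolding M_def by (rule B.nn_integral_fst[OF WF, symmetric])
  also have "\<dots> = (\<integral>\<^sup>+x. ?g x \<partial>(Q \<Otimes>\<^sub>M \<nu>))"
    by (rule nn_integral_cong) (simp add: nn_integral_count_space_finite UNIV_bool W_def add.commute)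
  finally have *: "(\<integral>\<^sup>+\<omega>. F \<omega> \<partial>\<mu>) = (\<integral>\<^sup>+x. ?g x \<partial>(Q \<Otimes>\<^sub>M \<nu>))" .
  show "(\<integral>\<^sup>+\<omega>. F \<omega> \<partial>\<mu>) = (\<integral>\<^sup>+\<gamma>. (\<integral>\<^sup>+z. ennreal (wT \<gamma> z) * F ((\<gamma>, z), True) + ennreal (wF z) * F ((\<gamma>, z), False) \<partial>\<nu>) \<partial>Q)"
    unfolding * using \<nu>.nn_integral_fst[OF g] by simp
  show "(\<integral>\<^sup>+\<omega>. F \<omega> \<partial>\<mu>) = (\<integral>\<^sup>+z. (\<integral>\<^sup>+\<gamma>. ennreal (wT \<gamma> z) * F ((\<gamma>, z), True) + ennreal (wF z) * F ((\<gamma>, z), False) \<partial>Q) \<partial>\<nu>)"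
    unfolding * using Q\<nu>.nn_integral_snd[OF g] by simp
qed

lemma sum_\<phi>_ends_AE: "AE \<gamma> in Q. (\<Sum>i\<in>J. \<phi> i (ends \<gamma>)) = 1"
proof -
  have "AE \<gamma> in Q. \<forall>i\<in>I - J. \<phi> i (ends \<gamma>) = 0"
  proof (rule AE_finite_allI)
    fix i assume i: "i \<in> I - J"
    then have "a i = 0" using a_nonneg[of i] by (auto simp: J_def less_le)
    then show "AE \<gamma> in Q. \<phi> i (ends \<gamma>) = 0"
      using integral_nonneg_eq_0_iff_AE[OF integrable_\<phi>(2), of i] i \<phi>0 by (simp add: a_def)
  qed (use I in simp)
  with AE_space show ?thesis
  proof eventually_elim
    case (elim \<gamma>)
    have "(\<Sum>i\<in>J. \<phi> i (ends \<gamma>)) = (\<Sum>i\<in>I. \<phi> i (ends \<gamma>))"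
      using elim I JI(1) by (intro sum.mono_neutral_left) auto
    then show ?case using \<phi>1[OF ends_in[of \<gamma> X]] elim spaces by simp
  qed
qed

lemma integral_wT_\<nu>:
  "(\<integral>\<^sup>+z. ennreal (wT \<gamma> z) \<partial>\<nu>) = ennreal (\<theta> * (\<Sum>i\<in>J. \<phi> i (ends \<gamma>)))"
proof -
  have int: "integrable \<nu> (\<lambda>z. \<phi> i (ends \<gamma>) * \<phi> i z / b i)" if "i \<in> J" for i
    using integrable_\<phi>(1)[of i] that JI(1) by auto
  have "(\<integral>\<^sup>+z. ennreal (wT \<gamma> z) \<partial>\<nu>) = ennreal (\<integral>z. wT \<gamma> z \<partial>\<nu>)"
    using int wT_nonneg unfolding wT_def
    by (intro nn_integral_eq_integral integrable_mult_right Bochner_Integration.integrable_sum) auto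
  also have "(\<integral>z. wT \<gamma> z \<partial>\<nu>) = \<theta> * (\<Sum>i\<in>J. \<integral>z. \<phi> i (ends \<gamma>) * \<phi> i z / b i \<partial>\<nu>)"
    unfolding wT_def using int by (simp add: Bochner_Integration.integral_sum)
  also have "(\<Sum>i\<in>J. \<integral>z. \<phi> i (ends \<gamma>) * \<phi> i z / b i \<partial>\<nu>) = (\<Sum>i\<in>J. \<phi> i (ends \<gamma>))"
  proof (rule sum.cong[OF refl])
    fix i assume i: "i \<in> J"
    have "(\<integral>z. \<phi> i (ends \<gamma>) * \<phi> i z / b i \<partial>\<nu>) = \<phi> i (ends \<gamma>) * b i / b i" by (simp add: b_def)
    then show "(\<integral>z. \<phi> i (ends \<gamma>) * \<phi> i z / b i \<partial>\<nu>) = \<phi> i (ends \<gamma>)" using JI(4)[OF i] by simp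
  qed
  finally show ?thesis .
qed

lemma integral_wT_Q:
  "(\<integral>\<^sup>+\<gamma>. ennreal (wT \<gamma> z) \<partial>Q) = ennreal (\<theta> * (\<Sum>i\<in>J. a i / b i * \<phi> i z))"
proof -
  have int: "integrable Q (\<lambda>\<gamma>. \<phi> i (ends \<gamma>) * \<phi> i z / b i)" if "i \<in> J" for i
    using integrable_\<phi>(2)[of i] that JI(1) by auto
  have "(\<integral>\<^sup>+\<gamma>. ennreal (wT \<gamma> z) \<partial>Q) = ennreal (\<integral>\<gamma>. wT \<gamma> z \<partial>Q)"
    using int wT_nonneg unfolding wT_def
    by (intro nn_integral_eq_integral integrable_mult_right Bochner_Integration.integrable_sum) auto
  also have "(\<integral>\<gamma>. wT \<gamma> z \<partial>Q) = \<theta> * (\<Sum>i\<in>J. \<integral>\<gamma>. \<phi> i (ends \<gamma>) * \<phi> i z / b i \<partial>Q)"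
    unfolding wT_def using int by (simp add: Bochner_Integration.integral_sum)
  also have "(\<Sum>i\<in>J. \<integral>\<gamma>. \<phi> i (ends \<gamma>) * \<phi> i z / b i \<partial>Q) = (\<Sum>i\<in>J. a i / b i * \<phi> i z)"
    by (rule sum.cong[OF refl]) (simp add: a_def)
  finally show ?thesis .
qed

lemma endpoint_marginal:
  assumes F[measurable]: "F \<in> borel_measurable \<nu>"
  shows "(\<integral>\<^sup>+\<omega>. F (snd (fst \<omega>)) \<partial>\<mu>) = (\<integral>\<^sup>+z. F z \<partial>\<nu>)"
proof -
  have "(\<integral>\<^sup>+\<omega>. F (snd (fst \<omega>)) \<partial>\<mu>) = (\<integral>\<^sup>+z. (\<integral>\<^sup>+\<gamma>. ennreal (wT \<gamma> z) * F z + ennreal (wF z) * F z \<partial>Q) \<partial>\<nu>)"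
    by (subst integral_\<mu>(2)) simp_all
  also have "\<dots> = (\<integral>\<^sup>+z. F z \<partial>\<nu>)"
  proof (rule nn_integral_cong)
    fix z assume "z \<in> space \<nu>"
    then have z: "z \<in> X \<times> X" using spaces by simp
    have "(\<integral>\<^sup>+\<gamma>. ennreal (wT \<gamma> z) * F z + ennreal (wF z) * F z \<partial>Q) = (\<integral>\<^sup>+\<gamma>. ennreal (wT \<gamma> z) * F z \<partial>Q) + ennreal (wF z) * F z"
      by (subst nn_integral_add) (auto simp: Q.emeasure_space_1)
    also have "\<dots> = ennreal (\<theta> * (\<Sum>i\<in>J. a i / b i * \<phi> i z)) * F z + ennreal (wF z) * F z"
      by (simp add: nn_integral_multc integral_wT_Q)
    also have "\<dots> = (ennreal (\<theta> * (\<Sum>i\<in>J. a i / b i * \<phi> i z)) + ennreal (wF z)) * F z" by (simp add: distrib_right)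
    also have "ennreal (\<theta> * (\<Sum>i\<in>J. a i / b i * \<phi> i z)) + ennreal (wF z) = 1"
    proof -
      have "0 \<le> \<theta> * (\<Sum>i\<in>J. a i / b i * \<phi> i z)"
        using \<theta> JI(3,4) \<phi>0 by (intro mult_nonneg_nonneg sum_nonneg divide_nonneg_nonneg) (auto simp: less_imp_le)
      then show ?thesis using wF_nonneg[OF z] by (simp add: ennreal_plus[symmetric] wF_def del: ennreal_plus)
    qed
    finally show "(\<integral>\<^sup>+\<gamma>. ennreal (wT \<gamma> z) * F z + ennreal (wF z) * F z \<partial>Q) = F z" by simp
  qed
  finally show ?thesis .
qed

lemma curve_marginal:
  assumes F[measurable]: "F \<in> borel_measurable Q"
  shows "(\<integral>\<^sup>+\<omega>. F (fst (fst \<omega>)) * indicator {\<omega>. snd \<omega>} \<omega> \<partial>\<mu>) = ennreal \<theta> * (\<integral>\<^sup>+\<gamma>. F \<gamma> \<partial>Q)"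
proof -
  have [measurable]: "(\<lambda>\<omega>. F (fst (fst \<omega>)) * indicator {\<omega>. snd \<omega>} \<omega>) \<in> borel_measurable M"
  proof -
    have "Measurable.pred M snd" by (rule proj_measurable(3))
    then have "(\<lambda>\<omega>. F (fst (fst \<omega>)) * (if snd \<omega> then 1 else 0)) \<in> borel_measurable M" by measurable
    then show ?thesis by (simp add: indicator_def of_bool_def)
  qed
  have "(\<integral>\<^sup>+\<omega>. F (fst (fst \<omega>)) * indicator {\<omega>. snd \<omega>} \<omega> \<partial>\<mu>) = (\<integral>\<^sup>+\<gamma>. (\<integral>\<^sup>+z. ennreal (wT \<gamma> z) * F \<gamma> \<partial>\<nu>) \<partial>Q)"
    by (subst integral_\<mu>(1)) simp_all
  also have "\<dots> = (\<integral>\<^sup>+\<gamma>. ennreal \<theta> * F \<gamma> \<partial>Q)"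
  proof (rule nn_integral_cong_AE)
    show "AE \<gamma> in Q. (\<integral>\<^sup>+z. ennreal (wT \<gamma> z) * F \<gamma> \<partial>\<nu>) = ennreal \<theta> * F \<gamma>"
      using sum_\<phi>_ends_AE by eventually_elim (simp add: nn_integral_multc integral_wT_\<nu>)
  qed
  also have "\<dots> = ennreal \<theta> * (\<integral>\<^sup>+\<gamma>. F \<gamma> \<partial>Q)" by (simp add: nn_integral_cmult)
  finally show ?thesis .
qed

lemma prob_\<mu>: "prob_space \<mu>"
proof
  have "emeasure \<mu> (space \<mu>) = (\<integral>\<^sup>+\<omega>. 1 \<partial>\<mu>)" by simp
  also have "\<dots> = 1" using endpoint_marginal[of "\<lambda>_. 1"] by (simp add: \<nu>.emeasure_space_1)
  finally show "emeasure \<mu> (space \<mu>) = 1" .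
qed

sublocale \<mu>: prob_space \<mu> by (rule prob_\<mu>)

text \<open>
  The events of the two outcomes of the coin. The first one includes that the end points are close,
  which is almost surely the case.
\<close>

definition "AT = {\<omega> \<in> space M. snd \<omega> \<and> dist (snd (fst \<omega>)) (ends (fst (fst \<omega>))) \<le> (1/2)^h}"
definition "AF = {\<omega> \<in> space M. \<not> snd \<omega>}"

lemma ends_M_measurable [measurable]:
  "(\<lambda>\<omega>. fst (fst \<omega>)) \<in> measurable M LM"
  "(\<lambda>\<omega>. fst (fst \<omega>) 0) \<in> borel_measurable M" "(\<lambda>\<omega>. fst (fst \<omega>) (settling_time (fst (fst \<omega>)))) \<in> borel_measurable M"
  "(\<lambda>\<omega>. ends (fst (fst \<omega>))) \<in> borel_measurable M" "(\<lambda>\<omega>. snd (fst \<omega>)) \<in> borel_measurable M"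
  "(\<lambda>\<omega>. fst (snd (fst \<omega>))) \<in> borel_measurable M" "(\<lambda>\<omega>. snd (snd (fst \<omega>))) \<in> borel_measurable M"
proof -
  show 1: "(\<lambda>\<omega>. fst (fst \<omega>)) \<in> measurable M LM" by (rule measurable_compose[OF proj_measurable(1) id_measurable(1)])
  show "(\<lambda>\<omega>. fst (fst \<omega>) 0) \<in> borel_measurable M" "(\<lambda>\<omega>. fst (fst \<omega>) (settling_time (fst (fst \<omega>)))) \<in> borel_measurable M"
    "(\<lambda>\<omega>. ends (fst (fst \<omega>))) \<in> borel_measurable M" using end_measurable[OF 1] .
  show 2: "(\<lambda>\<omega>. snd (fst \<omega>)) \<in> borel_measurable M" by (rule measurable_compose[OF proj_measurable(2) id_measurable(2)])
  show "(\<lambda>\<omega>. fst (snd (fst \<omega>))) \<in> borel_measurable M" "(\<lambda>\<omega>. snd (snd (fst \<omega>))) \<in> borel_measurable M"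
    using measurable_compose[OF 2 borel_measurable_continuous_onI[of fst]] measurable_compose[OF 2 borel_measurable_continuous_onI[of snd]]
    by (simp_all add: continuous_on_fst continuous_on_snd)
qed

lemma A_sets: "AT \<in> sets \<mu>" "AF \<in> sets \<mu>"
proof -
  have [measurable]: "Measurable.pred M snd" by (rule proj_measurable(3))
  show "AT \<in> sets \<mu>" "AF \<in> sets \<mu>" unfolding sets_\<mu> AT_def AF_def by measurable
qed

lemma A_cover: "AE \<omega> in \<mu>. \<omega> \<in> AT \<union> AF"
proof -
  have "AE \<omega> in M. 0 < W \<omega> \<longrightarrow> \<omega> \<in> AT \<union> AF"
  proof (rule AE_I2, rule impI)
    fix \<omega> assume w: "\<omega> \<in> space M" and pos: "0 < W \<omega>"
    show "\<omega> \<in> AT \<union> AF"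
    proof (cases "snd \<omega>")
      case True
      then have "wT (fst (fst \<omega>)) (snd (fst \<omega>)) \<noteq> 0" using pos by (auto simp: W_def)
      then have "(\<Sum>i\<in>J. \<phi> i (ends (fst (fst \<omega>))) * \<phi> i (snd (fst \<omega>)) / b i) \<noteq> 0" by (auto simp: wT_def)
      then obtain i where i: "i \<in> J" "\<phi> i (ends (fst (fst \<omega>))) * \<phi> i (snd (fst \<omega>)) / b i \<noteq> 0"
        by (meson sum.neutral)
      then have "dist (snd (fst \<omega>)) (ends (fst (fst \<omega>))) \<le> (1/2)^h" using JI(1) by (intro supp[of i]) auto
      then show ?thesis using w True by (simp add: AT_def)
    qed (use w in \<open>simp add: AF_def\<close>)
  qed
  then show ?thesis unfolding \<mu>_def by (simp add: AE_density)
qed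

lemma measure_AF: "measure \<mu> AF = 1 - \<theta>"
proof -
  have AFm: "(\<lambda>\<omega>. indicator AF \<omega> :: ennreal) \<in> borel_measurable M"
    using A_sets(2) unfolding sets_\<mu> by measurable
  have "emeasure \<mu> (space \<mu> - AF) = (\<integral>\<^sup>+\<omega>. indicator (space \<mu> - AF) \<omega> \<partial>\<mu>)"
    using A_sets(2) by (subst nn_integral_indicator) auto
  also have "\<dots> = (\<integral>\<^sup>+\<omega>. 1 * indicator {\<omega>. snd \<omega>} \<omega> \<partial>\<mu>)"
    by (rule nn_integral_cong) (auto simp: AF_def space_\<mu> split: split_indicator)
  also have "\<dots> = ennreal \<theta> * (\<integral>\<^sup>+\<gamma>. 1 \<partial>Q)" by (rule curve_marginal[of "\<lambda>_. 1"]) simp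
  also have "\<dots> = ennreal \<theta>" by (simp add: Q.emeasure_space_1)
  finally have "measure \<mu> (space \<mu> - AF) = \<theta>" using \<theta> by (simp add: measure_def)
  then show ?thesis using \<mu>.prob_compl[OF A_sets(2)] by simp
qed

lemma points_in:
  assumes "\<omega> \<in> space M"
  shows "fst (fst \<omega>) \<in> Lip1 X" "snd (fst \<omega>) \<in> X \<times> X" "fst (snd (fst \<omega>)) \<in> X" "snd (snd (fst \<omega>)) \<in> X"
    "fst (fst \<omega>) 0 \<in> X" "fst (fst \<omega>) (settling_time (fst (fst \<omega>))) \<in> X"
proof -
  show 1: "fst (fst \<omega>) \<in> Lip1 X" and "snd (fst \<omega>) \<in> X \<times> X" "fst (snd (fst \<omega>)) \<in> X" "snd (snd (fst \<omega>)) \<in> X"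
    using assms unfolding space_M by (auto simp: mem_Times_iff)
  show "fst (fst \<omega>) 0 \<in> X" "fst (fst \<omega>) (settling_time (fst (fst \<omega>))) \<in> X" using Lip1_in[OF 1] by auto
qed

lemma bridges_measurable:
  "(\<lambda>\<omega>. bridge h (fst (snd (fst \<omega>))) (fst (fst \<omega>) 0)) \<in> measurable M LM"
  "(\<lambda>\<omega>. bridge h (fst (fst \<omega>) (settling_time (fst (fst \<omega>)))) (snd (snd (fst \<omega>)))) \<in> measurable M LM"
  "(\<lambda>\<omega>. bridge 0 (fst (snd (fst \<omega>))) (snd (snd (fst \<omega>)))) \<in> measurable M LM"
  using points_in by (auto intro!: bridge_pieces_measurable(4) ends_M_measurable simp del: mem_cball)

lemma rerouted_measurable: "(\<lambda>\<omega>. rerouted h (fst (fst \<omega>)) (snd (fst \<omega>))) \<in> measurable M LM"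
  unfolding rerouted_def
proof (rule join_measurable[OF bridges_measurable(1) join_measurable[OF ends_M_measurable(1) bridges_measurable(2)]])
  show "(\<lambda>\<omega>. settling_time (fst (fst \<omega>))) \<in> borel_measurable M" by (rule settling_time_measurable[OF ends_M_measurable(1)])
  show "(\<lambda>\<omega>. bridge_time h (fst (snd (fst \<omega>))) (fst (fst \<omega>) 0)) \<in> borel_measurable M"
    using points_in by (intro bridge_pieces_measurable(5)[where R=R] ends_M_measurable) (auto simp del: mem_cball)
qed (use rerouted_pieces(4,5)[OF points_in(1,2)] in auto)

lemma curve_measurable: "curve \<in> measurable M LM"
  unfolding curve_def[abs_def]
  by (rule measurable_If[OF rerouted_measurable bridges_measurable(3)]) (use proj_measurable(3) in \<open>simp add: pred_def\<close>)

lemma curve_measurable_\<mu>: "curve \<in> measurable \<mu> LM"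
  using curve_measurable measurable_cong_sets[OF sets_\<mu> refl] by blast

lemma curve_ends:
  assumes w: "\<omega> \<in> space M"
  shows "stopping_time (curve \<omega>) < \<infinity>" "(e_0 (curve \<omega>), e_infty (curve \<omega>)) = snd (fst \<omega>)"
proof -
  note p = points_in[OF w]
  have "\<exists>c\<ge>0. constant_from c (curve \<omega>) \<and> curve \<omega> c = snd (snd (fst \<omega>)) \<and> curve \<omega> 0 = fst (snd (fst \<omega>))"
  proof (cases "snd \<omega>")
    case True
    let ?\<gamma> = "fst (fst \<omega>)" and ?z = "snd (fst \<omega>)"
    let ?c = "bridge_time h (fst ?z) (?\<gamma> 0) + (settling_time ?\<gamma> + bridge_time h (?\<gamma> (settling_time ?\<gamma>)) (snd ?z))"
    have "0 \<le> ?c" by (intro add_nonneg_nonneg) auto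
    then show ?thesis
      using True rerouted_constant_from[OF p(1,2), of h] rerouted_end[OF p(1,2), of h] rerouted_start[OF p(1,2), of h]
      by (intro exI[of _ ?c]) (simp add: curve_def)
  next
    case False
    then show ?thesis
      using bridge_constant_from[OF p(3,4), of 0] bridge_end[OF p(3,4), of 0] bridge_start[OF p(3,4), of 0]
      by (intro exI[of _ "bridge_time 0 (fst (snd (fst \<omega>))) (snd (snd (fst \<omega>)))"]) (simp add: curve_def)
  qed
  then obtain c where c: "0 \<le> c" "constant_from c (curve \<omega>)" "curve \<omega> c = snd (snd (fst \<omega>))" "curve \<omega> 0 = fst (snd (fst \<omega>))"
    by blast
  show "stopping_time (curve \<omega>) < \<infinity>" using stopping_time_le[OF c(2,1)] by (simp add: le_less_trans)
  show "(e_0 (curve \<omega>), e_infty (curve \<omega>)) = snd (fst \<omega>)" using e_infty_eq[OF c(2,1)] c by (simp add: e_0_def)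
qed

lemma plan_traffic_plan: "traffic_plan X plan"
proof -
  have "prob_space plan" unfolding plan_def by (rule \<mu>.prob_space_distr[OF curve_measurable_\<mu>])
  moreover have "AE \<gamma> in plan. stopping_time \<gamma> < \<infinity>"
  proof -
    have "Measurable.pred LM (\<lambda>\<gamma>. stopping_time \<gamma> < \<infinity>)" by (rule finite_stopping_time_measurable) (rule measurable_ident_sets[OF refl])
    then have "{\<gamma> \<in> space LM. stopping_time \<gamma> < \<infinity>} \<in> sets LM" by (rule predE)
    then show ?thesis unfolding plan_def
      by (subst AE_distr_iff[OF curve_measurable_\<mu>]) (use curve_ends(1) in \<open>auto simp: space_\<mu> intro!: AE_I2\<close>)
  qed
  moreover have "sets plan = sets LM" by (simp add: plan_def)
  ultimately show ?thesis by (simp add: traffic_plan_def borel_prob_def)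
qed

lemma plan_coupling: "has_coupling X plan \<nu>"
proof -
  let ?N = "borel_of (top_of_set (X \<times> X))" and ?e = "\<lambda>\<gamma>::real \<Rightarrow> 'a. (e_0 \<gamma>, e_infty \<gamma>)"
  have em: "?e \<in> measurable LM ?N" using endpoints_measurable[OF measurable_ident] by simp
  have setsN: "sets ?N = sets \<nu>" using borel_probD(2)[OF \<nu>] by simp
  have "distr plan ?N ?e = distr \<mu> ?N (?e \<circ> curve)"
    unfolding plan_def by (rule distr_distr[OF em curve_measurable_\<mu>])
  also have "\<dots> = \<nu>"
  proof (rule measure_eqI)
    fix A assume "A \<in> sets (distr \<mu> ?N (?e \<circ> curve))"
    then have A: "A \<in> sets ?N" "A \<in> sets \<nu>" using setsN by auto
    have cm: "?e \<circ> curve \<in> measurable \<mu> ?N" using curve_measurable_\<mu> em by (rule measurable_comp)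
    have "emeasure (distr \<mu> ?N (?e \<circ> curve)) A = (\<integral>\<^sup>+\<omega>. indicator A ((?e \<circ> curve) \<omega>) \<partial>\<mu>)"
      using A(1) cm by (subst nn_integral_distr[symmetric, OF cm]) (auto simp: nn_integral_indicator)
    also have "\<dots> = (\<integral>\<^sup>+\<omega>. indicator A (snd (fst \<omega>)) \<partial>\<mu>)"
      by (rule nn_integral_cong) (simp add: curve_ends(2) space_\<mu>)
    also have "\<dots> = (\<integral>\<^sup>+z. indicator A z \<partial>\<nu>)" using A(2) by (intro endpoint_marginal) auto
    also have "\<dots> = emeasure \<nu> A" using A(2) by simp
    finally show "emeasure (distr \<mu> ?N (?e \<circ> curve)) A = emeasure \<nu> A" .
  qed (use setsN in simp)
  finally show ?thesis by (simp add: has_coupling_def)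
qed

abbreviation "m \<equiv> multiplicity_at plan"

lemma hits_curve_sets: "f \<in> measurable M LM \<Longrightarrow> {\<omega> \<in> space M. hits (f \<omega>) x} \<in> sets M"
  using hits_measurable[of f M X "\<lambda>_. x"] by (simp add: pred_def)

lemma m_eq: "m x = measure \<mu> {\<omega> \<in> space M. hits (curve \<omega>) x}"
proof -
  have "{\<gamma> \<in> space LM. hits \<gamma> x} \<in> sets LM"
    using hits_measurable[OF measurable_ident, of "\<lambda>_. x" X] by (simp add: pred_def)
  then have "measure plan {\<gamma> \<in> space LM. hits \<gamma> x} = measure \<mu> (curve -` {\<gamma> \<in> space LM. hits \<gamma> x} \<inter> space \<mu>)"
    unfolding plan_def by (rule measure_distr[OF curve_measurable_\<mu>])
  moreover have "curve -` {\<gamma> \<in> space LM. hits \<gamma> x} \<inter> space \<mu> = {\<omega> \<in> space M. hits (curve \<omega>) x}"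
    using measurable_space[OF curve_measurable] by (auto simp: space_\<mu>)
  ultimately show ?thesis by (simp add: multiplicity_at_def hits_def plan_def)
qed

lemma m_ge:
  assumes "\<And>\<omega>. \<omega> \<in> A \<Longrightarrow> hits (f \<omega>) x \<Longrightarrow> \<omega> \<in> space M \<and> hits (curve \<omega>) x"
  shows "measure \<mu> {\<omega> \<in> A. hits (f \<omega>) x} \<le> m x"
  unfolding m_eq
  by (rule \<mu>.finite_measure_mono) (use assms hits_curve_sets[OF curve_measurable] in \<open>auto simp: sets_\<mu>\<close>)

lemma m_measurable: "m \<in> borel_measurable borel"
proof (rule multiplicity_at_measurable[where X=X])
  show "finite_measure plan" using plan_traffic_plan traffic_planD(1) prob_space.finite_measure by blast
qed (simp add: plan_def)

text \<open>
  Rerouting a curve that settles keeps all its points, and the original curves occur with the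
  law \<open>\<theta> * Q\<close>.
\<close>

lemma m_ge_multiplicity: "\<theta> * multiplicity_at Q x \<le> m x"
proof -
  have H: "{\<gamma> \<in> space Q. hits \<gamma> x} \<in> sets Q"
    using hits_measurable[OF id_measurable(1), of "\<lambda>_. x"] by (simp add: pred_def)
  have N: "AE \<gamma> in Q. constant_from (settling_time \<gamma>) \<gamma>"
    using traffic_planD(4)[OF tp] AE_space by eventually_elim (use finite_stopping_time_settles(1) spaces in auto)
  (* Curves that never settle are cut off by the final bridge, so they have to be discarded. *)
  obtain N where N: "N \<in> null_sets Q" "{\<gamma> \<in> space Q. \<not> constant_from (settling_time \<gamma>) \<gamma>} \<subseteq> N"
    using AE_E[OF N] by (metis (no_types, lifting) null_setsI)
  let ?H = "{\<gamma> \<in> space Q. hits \<gamma> x} - N"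
  have HN: "?H \<in> sets Q" using H N by auto
  have "ennreal \<theta> * emeasure Q ?H = (\<integral>\<^sup>+\<omega>. indicator ?H (fst (fst \<omega>)) * indicator {\<omega>. snd \<omega>} \<omega> \<partial>\<mu>)"
    using HN by (subst curve_marginal) auto
  also have "\<dots> \<le> (\<integral>\<^sup>+\<omega>. indicator {\<omega> \<in> space M. hits (curve \<omega>) x} \<omega> \<partial>\<mu>)"
  proof (rule nn_integral_mono)
    fix \<omega> assume "\<omega> \<in> space \<mu>"
    then have w: "\<omega> \<in> space M" by (simp add: space_\<mu>)
    have "hits (curve \<omega>) x" if "snd \<omega>" "fst (fst \<omega>) \<in> ?H"
      using rerouted_hits(3)[OF points_in(1,2)[OF w], of x h] that N(2) by (auto simp: curve_def)
    then show "indicator ?H (fst (fst \<omega>)) * indicator {\<omega>. snd \<omega>} \<omega> \<le> (indicator {\<omega> \<in> space M. hits (curve \<omega>) x} \<omega> :: ennreal)"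
      using w by (auto split: split_indicator)
  qed
  also have "\<dots> = ennreal (m x)"
    using hits_curve_sets[OF curve_measurable, of x] unfolding m_eq
    by (subst nn_integral_indicator) (auto simp: sets_\<mu> \<mu>.emeasure_eq_measure)
  finally have "ennreal \<theta> * emeasure Q ?H \<le> ennreal (m x)" .
  moreover have "emeasure Q ?H = emeasure Q {\<gamma> \<in> space Q. hits \<gamma> x}" using N(1) H by (rule emeasure_Diff_null_set)
  ultimately have "ennreal (\<theta> * multiplicity_at Q x) \<le> ennreal (m x)"
    using \<theta> by (simp add: multiplicity_at_def hits_def Q.emeasure_eq_measure ennreal_mult)
  then show ?thesis by (simp add: multiplicity_at_def)
qed

lemma dist_components: "dist (fst z) (fst z') \<le> dist z z'" "dist (snd z) (snd z') \<le> dist z z'" for z z' :: "'a \<times> 'a"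
  by (rule dist_fst_le, rule dist_snd_le)

text \<open>
  The costs of the two bridges, of the original curve and of the long bridge are added. The original
  curves see a multiplicity of at least \<open>\<theta>\<close> times the original one but have only the mass \<open>\<theta>\<close>, which
  changes their cost by the factor \<open>\<theta> * \<theta> powr (\<alpha> - 1) \<le> 1\<close>.
\<close>

theorem plan_energy:
  "energy \<alpha> plan \<le> energy \<alpha> Q + (2 * ennreal (bridge_factor TYPE('a) R \<alpha> * scale_ratio TYPE('a) \<alpha> ^ h)
     + ennreal (long_bridge_factor TYPE('a) R \<alpha> * (1 - \<theta>) powr \<alpha>))"
proof -
  let ?w = "\<lambda>x. mult_power \<alpha> (m x)"
  let ?\<gamma> = "\<lambda>\<omega> :: ((real \<Rightarrow> 'a) \<times> 'a \<times> 'a) \<times> bool. fst (fst \<omega>)"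
  let ?z = "\<lambda>\<omega> :: ((real \<Rightarrow> 'a) \<times> 'a \<times> 'a) \<times> bool. snd (fst \<omega>)"
  let ?f = "\<lambda>\<omega>. bridge h (fst (?z \<omega>)) (?\<gamma> \<omega> 0)" and ?l = "\<lambda>\<omega>. bridge h (?\<gamma> \<omega> (settling_time (?\<gamma> \<omega>))) (snd (?z \<omega>))"
  let ?r = "\<lambda>\<omega>. bridge 0 (fst (?z \<omega>)) (snd (?z \<omega>))"
  let ?B = "bridge_factor TYPE('a) R \<alpha> * scale_ratio TYPE('a) \<alpha> ^ h"
  have wm: "?w \<in> borel_measurable borel" using m_measurable by measurable
  have pm: "(\<lambda>\<omega>. path_cost ?w (f \<omega>)) \<in> borel_measurable \<mu>" if "f \<in> measurable M LM" for f
    using path_cost_measurable[OF that wm] measurable_cong_sets[OF sets_\<mu> refl] by blast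
  note ATs = A_sets(1) and AFs = A_sets(2)
  have fin: "finite_measure \<mu>" by unfold_locales
  have bm: "f \<in> borel_measurable M \<Longrightarrow> f \<in> borel_measurable \<mu>" for f :: "_ \<Rightarrow> 'a"
    using measurable_cong_sets[OF sets_\<mu> refl] by blast
  note \<mu>m = ends_M_measurable(2,3,6,7)[THEN bm]
  note pin = points_in[folded space_\<mu>]
  have B0: "0 \<le> ?B"
  proof -
    have "real DIM('a) * (1 - \<alpha>) < 1" using \<alpha>(2) by (simp add: field_simps)
    then have "scale_ratio TYPE('a) \<alpha> < 1" unfolding scale_ratio_def by (simp add: powr_less_one)
    then show ?thesis by (simp add: bridge_factor_def tree_cost_def cell_factor_def scale_ratio_def)
  qed
  have short: "ennreal (?B * measure \<mu> AT powr \<alpha>) \<le> ennreal ?B"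
    using B0 \<alpha> powr_mono2[of \<alpha> "measure \<mu> AT" 1] by (intro ennreal_leI mult_left_le) auto
  have ATclose: "dist (fst (?z \<omega>)) (?\<gamma> \<omega> 0) \<le> (1/2)^h" "dist (?\<gamma> \<omega> (settling_time (?\<gamma> \<omega>))) (snd (?z \<omega>)) \<le> (1/2)^h"
    if "\<omega> \<in> AT" for \<omega>
  proof -
    have "dist (?z \<omega>) (ends (?\<gamma> \<omega>)) \<le> (1/2)^h" using that by (simp add: AT_def)
    then show "dist (fst (?z \<omega>)) (?\<gamma> \<omega> 0) \<le> (1/2)^h" "dist (?\<gamma> \<omega> (settling_time (?\<gamma> \<omega>))) (snd (?z \<omega>)) \<le> (1/2)^h"
      using dist_components[of "?z \<omega>" "ends (?\<gamma> \<omega>)"] by (auto simp: ends_def dist_commute)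
  qed
  have 1: "(\<integral>\<^sup>+\<omega>\<in>AT. path_cost ?w (?f \<omega>) \<partial>\<mu>) \<le> ennreal ?B"
  proof (rule order_trans[OF short_bridge_cost[OF fin ATs less_imp_le[OF R] \<mu>m(3) _ \<mu>m(1) _ ATclose(1) m_measurable _ \<alpha>] short])
    show "measure \<mu> {\<omega> \<in> AT. hits (?f \<omega>) x} \<le> m x" for x
      using rerouted_hits(1)[OF points_in(1,2)] by (intro m_ge) (auto simp: AT_def curve_def)
  qed (use pin in auto)
  have 3: "(\<integral>\<^sup>+\<omega>\<in>AT. path_cost ?w (?l \<omega>) \<partial>\<mu>) \<le> ennreal ?B"
  proof (rule order_trans[OF short_bridge_cost[OF fin ATs less_imp_le[OF R] \<mu>m(2) _ \<mu>m(4) _ ATclose(2) m_measurable _ \<alpha>] short])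
    show "measure \<mu> {\<omega> \<in> AT. hits (?l \<omega>) x} \<le> m x" for x
      using rerouted_hits(2)[OF points_in(1,2)] by (intro m_ge) (auto simp: AT_def curve_def)
  qed (use pin in auto)
  have 4: "(\<integral>\<^sup>+\<omega>\<in>AF. path_cost ?w (?r \<omega>) \<partial>\<mu>) \<le> ennreal (long_bridge_factor TYPE('a) R \<alpha> * (1 - \<theta>) powr \<alpha>)"
    unfolding measure_AF[symmetric]
  proof (rule long_bridge_cost[OF fin AFs less_imp_le[OF R] \<mu>m(3) _ \<mu>m(4) _ m_measurable _ \<alpha>])
    show "measure \<mu> {\<omega> \<in> AF. hits (?r \<omega>) x} \<le> m x" for x
      by (intro m_ge) (auto simp: AF_def curve_def)
  qed (use pin in auto)
  have 2: "(\<integral>\<^sup>+\<omega>\<in>AT. path_cost ?w (?\<gamma> \<omega>) \<partial>\<mu>) \<le> energy \<alpha> Q"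
  proof -
    let ?v = "\<lambda>x. mult_power \<alpha> (multiplicity_at Q x)"
    have vm: "?v \<in> borel_measurable borel"
      using multiplicity_at_measurable[OF Q.finite_measure_axioms traffic_planD(2)[OF tp]] by measurable
    have wv: "?w x \<le> ennreal (\<theta> powr (\<alpha> - 1)) * ?v x" for x
    proof (cases "multiplicity_at Q x = 0")
      case True
      then show ?thesis using \<theta> by (simp add: mult_power_def ennreal_mult_top)
    next
      case False
      then have pos: "0 < multiplicity_at Q x" by (simp add: multiplicity_at_def less_le)
      have "?w x \<le> mult_power \<alpha> (\<theta> * multiplicity_at Q x)"
        using m_ge_multiplicity[of x] pos \<theta> \<alpha> by (intro mult_power_antimono) auto
      also have "\<dots> = ennreal (\<theta> powr (\<alpha> - 1)) * ?v x"
        using pos \<theta> by (simp add: mult_power_def powr_mult ennreal_mult)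
      finally show ?thesis .
    qed
    have pc: "path_cost ?w \<gamma> \<le> ennreal (\<theta> powr (\<alpha> - 1)) * path_cost ?v \<gamma>" if g: "\<gamma> \<in> Lip1 X" for \<gamma>
    proof -
      have "path_cost ?w \<gamma> \<le> (\<integral>\<^sup>+t. ennreal (\<theta> powr (\<alpha> - 1)) * (?v (\<gamma> t) * speed \<gamma> t * indicator {0..} t) \<partial>lborel)"
        unfolding path_cost_def
        by (rule nn_integral_mono) (use wv in \<open>auto simp: mult.assoc[symmetric] intro!: mult_right_mono split: split_indicator\<close>)
      also have "\<dots> = ennreal (\<theta> powr (\<alpha> - 1)) * path_cost ?v \<gamma>"
        unfolding path_cost_def by (rule nn_integral_cmult) (rule integrand_measurable_fixed[OF g vm], auto)
      finally show ?thesis .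
    qed
    have vQ: "(\<lambda>\<gamma>. path_cost ?v \<gamma>) \<in> borel_measurable Q" by (rule path_cost_measurable[OF id_measurable(1) vm])
    then have vQ': "(\<lambda>\<gamma>. ennreal (\<theta> powr (\<alpha> - 1)) * path_cost ?v \<gamma>) \<in> borel_measurable Q" by measurable
    have "(\<integral>\<^sup>+\<omega>\<in>AT. path_cost ?w (?\<gamma> \<omega>) \<partial>\<mu>)
      \<le> (\<integral>\<^sup>+\<omega>. (ennreal (\<theta> powr (\<alpha> - 1)) * path_cost ?v (?\<gamma> \<omega>)) * indicator {\<omega>. snd \<omega>} \<omega> \<partial>\<mu>)"
      by (rule nn_integral_mono) (use pc points_in(1) in \<open>auto simp: AT_def split: split_indicator\<close>)
    also have "\<dots> = ennreal \<theta> * (\<integral>\<^sup>+\<gamma>. ennreal (\<theta> powr (\<alpha> - 1)) * path_cost ?v \<gamma> \<partial>Q)"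
      by (rule curve_marginal[OF vQ'])
    also have "\<dots> = (ennreal \<theta> * ennreal (\<theta> powr (\<alpha> - 1))) * energy \<alpha> Q"
      using vQ by (simp add: nn_integral_cmult energy_eq_path_cost[OF spaces(1)] mult.assoc)
    also have "ennreal \<theta> * ennreal (\<theta> powr (\<alpha> - 1)) \<le> 1"
    proof -
      have "\<theta> * \<theta> powr (\<alpha> - 1) = \<theta> powr \<alpha>" using \<theta> by (simp add: powr_diff)
      also have "\<dots> \<le> 1" using \<theta> \<alpha> powr_mono2[of \<alpha> \<theta> 1] by simp
      finally show ?thesis using \<theta> by (simp add: ennreal_mult[symmetric])
    qed
    finally show ?thesis by (simp add: mult_right_mono)
  qed
  have "energy \<alpha> plan = (\<integral>\<^sup>+\<gamma>. path_cost ?w \<gamma> \<partial>plan)"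
    by (rule energy_eq_path_cost[where X=X]) (simp add: plan_def)
  also have "\<dots> = (\<integral>\<^sup>+\<omega>. path_cost ?w (curve \<omega>) \<partial>\<mu>)"
  proof -
    have "(\<lambda>\<gamma>. path_cost ?w \<gamma>) \<in> borel_measurable LM" using path_cost_measurable[OF measurable_ident wm] by simp
    then have "(\<integral>\<^sup>+\<gamma>. path_cost ?w \<gamma> \<partial>distr \<mu> LM curve) = (\<integral>\<^sup>+\<omega>. path_cost ?w (curve \<omega>) \<partial>\<mu>)"
      by (intro nn_integral_distr[OF curve_measurable_\<mu>]) simp
    then show ?thesis unfolding plan_def[symmetric] .
  qed
  also have "\<dots> \<le> (\<integral>\<^sup>+\<omega>. path_cost ?w (?f \<omega>) * indicator AT \<omega> + (path_cost ?w (?\<gamma> \<omega>) * indicator AT \<omega>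
     + (path_cost ?w (?l \<omega>) * indicator AT \<omega> + path_cost ?w (?r \<omega>) * indicator AF \<omega>)) \<partial>\<mu>)"
  proof (rule nn_integral_mono_AE)
    show "AE \<omega> in \<mu>. path_cost ?w (curve \<omega>) \<le> path_cost ?w (?f \<omega>) * indicator AT \<omega> + (path_cost ?w (?\<gamma> \<omega>) * indicator AT \<omega>
     + (path_cost ?w (?l \<omega>) * indicator AT \<omega> + path_cost ?w (?r \<omega>) * indicator AF \<omega>))"
      using A_cover
    proof eventually_elim
      case (elim \<omega>)
      show ?case
      proof (cases "\<omega> \<in> AT")
        case True
        then have "\<omega> \<in> space M" "snd \<omega>" "\<omega> \<notin> AF" by (auto simp: AT_def AF_def)
        then show ?thesis using True rerouted_path_cost_le[OF points_in(1,2)[of \<omega>] wm, where h=h] by (simp add: curve_def)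
      next
        case False
        then have "\<omega> \<in> AF" using elim by simp
        then show ?thesis using False by (simp add: AF_def curve_def)
      qed
    qed
  qed
  also have "\<dots> = (\<integral>\<^sup>+\<omega>\<in>AT. path_cost ?w (?f \<omega>) \<partial>\<mu>) + ((\<integral>\<^sup>+\<omega>\<in>AT. path_cost ?w (?\<gamma> \<omega>) \<partial>\<mu>)
     + ((\<integral>\<^sup>+\<omega>\<in>AT. path_cost ?w (?l \<omega>) \<partial>\<mu>) + (\<integral>\<^sup>+\<omega>\<in>AF. path_cost ?w (?r \<omega>) \<partial>\<mu>)))"
    using pm[OF bridges_measurable(1)] pm[OF ends_M_measurable(1)] pm[OF bridges_measurable(2)] pm[OF bridges_measurable(3)] ATs AFs
    by (simp add: nn_integral_add)
  also have "\<dots> \<le> ennreal ?B + (energy \<alpha> Q + (ennreal ?B + ennreal (long_bridge_factor TYPE('a) R \<alpha> * (1 - \<theta>) powr \<alpha>)))"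
    by (intro add_mono 1 2 3 4)
  also have "\<dots> = energy \<alpha> Q + (2 * ennreal ?B + ennreal (long_bridge_factor TYPE('a) R \<alpha> * (1 - \<theta>) powr \<alpha>))"
    by (simp add: mult_2 add_ac)
  finally show ?thesis .
qed

end

section \<open>Stability of optimal plans\<close>

text \<open>
  The tent functions around the centres of a finite cover by small balls, divided by their sum.
\<close>

lemma fine_partition_of_unity:
  fixes K :: "'b::metric_space set"
  assumes K: "compact K" and r: "r > 0"
  obtains I :: "'b set" and \<phi> :: "'b \<Rightarrow> 'b \<Rightarrow> real"
  where "finite I" "\<And>i. continuous_on K (\<phi> i)" "\<And>i z. 0 \<le> \<phi> i z" "\<And>i z. z \<notin> K \<Longrightarrow> \<phi> i z = 0"
    "\<And>z. z \<in> K \<Longrightarrow> (\<Sum>i\<in>I. \<phi> i z) = 1"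
    "\<And>i z z'. \<phi> i z \<noteq> 0 \<Longrightarrow> \<phi> i z' \<noteq> 0 \<Longrightarrow> dist z z' \<le> r"
proof -
  obtain I where I: "finite I" "K \<subseteq> (\<Union>i\<in>I. ball i (r / 2))"
    using K r unfolding compact_eq_totally_bounded by (meson half_gt_zero)
  define \<psi> where "\<psi> i z = max 0 (r / 2 - dist i z)" for i z :: 'b
  define s where "s z = (\<Sum>i\<in>I. \<psi> i z)" for z
  define \<phi> where "\<phi> i z = (if z \<in> K then \<psi> i z / s z else 0)" for i z
  have \<psi>0: "0 \<le> \<psi> i z" for i z by (simp add: \<psi>_def)
  have s: "s z > 0" if z: "z \<in> K" for z
  proof -
    obtain i where i: "i \<in> I" "dist i z < r / 2" using I(2) z by (meson UN_E mem_ball subsetD)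
    then have "0 < \<psi> i z" by (simp add: \<psi>_def)
    also have "\<dots> \<le> s z" unfolding s_def by (rule member_le_sum) (use i I \<psi>0 in auto)
    finally show ?thesis .
  qed
  show thesis
  proof (rule that[of I \<phi>])
    show "finite I" by fact
    show "continuous_on K (\<phi> i)" for i
    proof -
      have "continuous_on K (\<lambda>z. \<psi> i z / s z)"
        unfolding s_def \<psi>_def
        by (intro continuous_intros) (use s in \<open>force simp: s_def \<psi>_def\<close>)
      then show ?thesis by (rule continuous_on_eq) (simp add: \<phi>_def)
    qed
    show "0 \<le> \<phi> i z" for i z using \<psi>0 s[of z] by (auto simp: \<phi>_def intro!: divide_nonneg_pos)
    show "z \<notin> K \<Longrightarrow> \<phi> i z = 0" for i z by (simp add: \<phi>_def)
    show "(\<Sum>i\<in>I. \<phi> i z) = 1" if "z \<in> K" for z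
      using s[OF that] that by (simp add: \<phi>_def sum_divide_distrib[symmetric] s_def[symmetric])
    show "dist z z' \<le> r" if "\<phi> i z \<noteq> 0" "\<phi> i z' \<noteq> 0" for i z z'
    proof -
      have "\<psi> i z \<noteq> 0" "\<psi> i z' \<noteq> 0" using that by (auto simp: \<phi>_def split: if_splits)
      then have "dist i z < r / 2" "dist i z' < r / 2" by (auto simp: \<psi>_def max_def split: if_splits)
      then show ?thesis using dist_triangle3[of z z' i] by linarith
    qed
  qed
qed

text \<open>
  First the scale \<open>h\<close> of the short bridges is chosen, then a partition of unity that is finer than this
  scale, then \<open>\<theta>\<close> so close to 1 that the long bridges are cheap. As \<open>\<theta> < 1\<close>, weak convergence
  gives the condition on the masses for all large \<open>n\<close>.
\<close>

proposition recovery_sequence: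
  fixes Q :: "(real \<Rightarrow> 'a::euclidean_space) measure" and R :: real
  defines "X \<equiv> cball (0::'a) R"
  assumes R: "R > 0" and \<alpha>: "0 < \<alpha>" "1 - 1 / real DIM('a) < \<alpha>" "\<alpha> < 1"
    and tp: "traffic_plan X Q" and coup: "has_coupling X Q \<pi>"
    and \<pi>n: "\<And>n. borel_prob (top_of_set (X \<times> X)) (\<pi>n n)" and conv: "weak_star_conv (top_of_set (X \<times> X)) \<pi>n \<pi>"
    and e: "e > 0"
  shows "\<forall>\<^sub>F n in sequentially. \<exists>P'. traffic_plan X P' \<and> has_coupling X P' (\<pi>n n) \<and> energy \<alpha> P' \<le> energy \<alpha> Q + ennreal e"
proof -
  let ?bf = "bridge_factor TYPE('a) R \<alpha>" and ?q = "scale_ratio TYPE('a) \<alpha>" and ?lf = "long_bridge_factor TYPE('a) R \<alpha>"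
  have "real DIM('a) * (1 - \<alpha>) < 1" using \<alpha>(2) by (simp add: field_simps)
  then have q: "0 < ?q" "?q < 1" unfolding scale_ratio_def by (simp_all add: powr_less_one)
  have "(\<lambda>h. ?bf * ?q ^ h) \<longlonglongrightarrow> ?bf * 0" using q by (intro tendsto_intros LIMSEQ_power_zero) simp
  then have "\<forall>\<^sub>F h in sequentially. ?bf * ?q ^ h < e / 4" using e by (intro order_tendstoD) auto
  then obtain h where h: "?bf * ?q ^ h < e / 4" by (auto simp: eventually_sequentially)
  obtain I :: "('a \<times> 'a) set" and \<phi> :: "'a \<times> 'a \<Rightarrow> 'a \<times> 'a \<Rightarrow> real" where I: "finite I" and \<phi>: "\<And>i. continuous_on (X \<times> X) (\<phi> i)" "\<And>i z. 0 \<le> \<phi> i z"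
    "\<And>i z. z \<notin> X \<times> X \<Longrightarrow> \<phi> i z = 0"
    "\<And>z. z \<in> X \<times> X \<Longrightarrow> (\<Sum>i\<in>I. \<phi> i z) = 1" "\<And>i z z'. \<phi> i z \<noteq> 0 \<Longrightarrow> \<phi> i z' \<noteq> 0 \<Longrightarrow> dist z z' \<le> (1/2)^h"
  proof -
    have "compact (X \<times> X)" by (simp add: X_def compact_Times)
    then show ?thesis
    proof (rule fine_partition_of_unity[where r="(1/2)^h"])
      fix J :: "('a \<times> 'a) set" and \<psi> :: "'a \<times> 'a \<Rightarrow> 'a \<times> 'a \<Rightarrow> real"
      assume "finite J" "\<And>i. continuous_on (X \<times> X) (\<psi> i)" "\<And>i z. 0 \<le> \<psi> i z" "\<And>i z. z \<notin> X \<times> X \<Longrightarrow> \<psi> i z = 0"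
        "\<And>z. z \<in> X \<times> X \<Longrightarrow> (\<Sum>i\<in>J. \<psi> i z) = 1" "\<And>i z z'. \<psi> i z \<noteq> 0 \<Longrightarrow> \<psi> i z' \<noteq> 0 \<Longrightarrow> dist z z' \<le> (1/2)^h"
      from that[of J \<psi>, OF this] show ?thesis .
    qed simp
  qed
  have \<phi>m: "\<phi> i \<in> borel_measurable borel" for i
  proof -
    have "closed (X \<times> X)" by (simp add: X_def closed_Times)
    then have "(\<lambda>z. if z \<in> X \<times> X then \<phi> i z else 0) \<in> borel_measurable borel"
      using \<phi>(1) by (intro borel_measurable_continuous_on_if) auto
    moreover have "(\<lambda>z. if z \<in> X \<times> X then \<phi> i z else 0) = \<phi> i" by (rule ext) (metis \<phi>(3))
    ultimately show ?thesis by simp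
  qed
  define a where "a i = (\<integral>\<gamma>. \<phi> i (ends \<gamma>) \<partial>Q)" for i
  define b where "b n i = (\<integral>z. \<phi> i z \<partial>\<pi>n n)" for n i
  have a_eq: "a i = (\<integral>z. \<phi> i z \<partial>\<pi>)" for i
  proof -
    have "a i = (\<integral>\<gamma>. \<phi> i (e_0 \<gamma>, e_infty \<gamma>) \<partial>Q)"
      unfolding a_def
    proof (rule integral_cong_AE)
      show "(\<lambda>\<gamma>. \<phi> i (ends \<gamma>)) \<in> borel_measurable Q"
        by (rule measurable_compose[OF end_measurable(3)[OF traffic_planD(6)[OF tp]] \<phi>m])
      have "(\<lambda>\<gamma>. (e_0 \<gamma>, e_infty \<gamma>)) \<in> borel_measurable Q"
        unfolding e_0_def by (intro borel_measurable_Pair end_measurable(1)[OF traffic_planD(6)[OF tp]] e_infty_measurable[OF traffic_planD(6)[OF tp]])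
      then show "(\<lambda>\<gamma>. \<phi> i (e_0 \<gamma>, e_infty \<gamma>)) \<in> borel_measurable Q" by (rule measurable_compose[OF _ \<phi>m])
      show "AE \<gamma> in Q. \<phi> i (ends \<gamma>) = \<phi> i (e_0 \<gamma>, e_infty \<gamma>)"
        using traffic_planD(4)[OF tp] AE_space by eventually_elim (simp add: ends_eq[where X=X] traffic_planD(3)[OF tp])
    qed
    then show ?thesis using coupling_integral[OF tp coup \<phi>(1)] by simp
  qed
  have \<phi>le: "\<bar>\<phi> i z\<bar> \<le> 1" if "i \<in> I" "z \<in> X \<times> X" for i z
    using member_le_sum[of i I "\<lambda>i. \<phi> i z"] that \<phi>(2) \<phi>(4)[OF that(2)] I by simp
  have b_lim: "(\<lambda>n. b n i) \<longlonglongrightarrow> a i" if "i \<in> I" for i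
    unfolding a_eq b_def
    by (rule weak_star_convD[OF conv, where B=1]) (use \<phi>(1) \<phi>le[OF that] in \<open>auto simp: continuous_map_iff_continuous\<close>)
  obtain \<theta> where \<theta>: "0 < \<theta>" "\<theta> < 1" and rest_small: "?lf * (1 - \<theta>) powr \<alpha> < e / 2"
  proof -
    have "((\<lambda>s. ?lf * s powr \<alpha>) \<longlongrightarrow> ?lf * 0) (at_right 0)"
      using \<alpha>(1) by (intro tendsto_intros) (real_asymp)
    then have "\<forall>\<^sub>F s in at_right 0. ?lf * s powr \<alpha> < e / 2" using e by (intro order_tendstoD) auto
    moreover have "\<forall>\<^sub>F s in at_right (0::real). s \<in> {0<..<1}" by (rule eventually_at_right_real) simp
    ultimately have "\<forall>\<^sub>F s in at_right 0. ?lf * s powr \<alpha> < e / 2 \<and> s \<in> {0<..<1}" by (rule eventually_conj)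
    then obtain s where "?lf * s powr \<alpha> < e / 2" "s \<in> {0<..<1}" using eventually_happens'[OF trivial_limit_at_right_real] by blast
    then show ?thesis by (intro that[of "1 - s"]) auto
  qed
  have "\<forall>\<^sub>F n in sequentially. \<forall>i\<in>I. \<theta> * a i \<le> b n i"
  proof (rule eventually_ball_finite[OF I], rule ballI)
    fix i assume i: "i \<in> I"
    have "0 \<le> a i" unfolding a_def by (rule Bochner_Integration.integral_nonneg) (rule \<phi>(2))
    then consider "a i = 0" | "a i > 0" by linarith
    then show "\<forall>\<^sub>F n in sequentially. \<theta> * a i \<le> b n i"
    proof cases
      case 1
      have "0 \<le> b n i" for n unfolding b_def by (rule Bochner_Integration.integral_nonneg) (rule \<phi>(2))
      then show ?thesis using 1 by simp
    next
      case 2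
      then have "\<theta> * a i < a i" using \<theta> by simp
      then have "\<forall>\<^sub>F n in sequentially. \<theta> * a i < b n i" by (rule order_tendstoD(1)[OF b_lim[OF i]])
      then show ?thesis by eventually_elim simp
    qed
  qed
  then show ?thesis
  proof eventually_elim
    case (elim n)
    interpret reroute R \<alpha> \<theta> h Q "\<pi>n n" I \<phi>
    proof
      show "traffic_plan (cball 0 R) Q" "borel_prob (top_of_set (cball 0 R \<times> cball 0 R)) (\<pi>n n)"
        using tp \<pi>n[of n] by (simp_all add: X_def)
      show "\<theta> * (\<integral>\<gamma>. \<phi> i (ends \<gamma>) \<partial>Q) \<le> (\<integral>z. \<phi> i z \<partial>\<pi>n n)" if "i \<in> I" for i
        using elim that by (auto simp: a_def b_def)
    qed (use R \<alpha> I \<phi>m \<phi> \<theta> in \<open>auto simp: X_def\<close>)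
    have "energy \<alpha> plan \<le> energy \<alpha> Q + (2 * ennreal (?bf * ?q ^ h) + ennreal (?lf * (1 - \<theta>) powr \<alpha>))"
      by (rule plan_energy)
    also have "\<dots> \<le> energy \<alpha> Q + (2 * ennreal (e / 4) + ennreal (e / 2))"
      using h rest_small by (intro add_left_mono add_mono mult_left_mono ennreal_leI) auto
    also have "2 * ennreal (e / 4) + ennreal (e / 2) = ennreal e"
    proof -
      have "2 * ennreal (e / 4) = ennreal (2 * (e / 4))" using e by (subst ennreal_mult) auto
      then show ?thesis using e by (simp add: ennreal_plus[symmetric] del: ennreal_plus)
    qed
    finally show ?case using plan_traffic_plan plan_coupling unfolding X_def by blast
  qed
qed

theorem theorem1p1:
  fixes X :: "'a::euclidean_space set"
    and R \<alpha> C :: real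
    and \<pi> :: "('a \<times> 'a) measure" and \<pi>n :: "nat \<Rightarrow> ('a \<times> 'a) measure"
    and P :: "(real \<Rightarrow> 'a) measure" and Pn :: "nat \<Rightarrow> (real \<Rightarrow> 'a) measure"
  assumes "R > 0" and "X = cball 0 R"
    and "1 - 1 / real DIM('a) < \<alpha>" and "\<alpha> < 1" and "C > 0"
    and "borel_prob (top_of_set (X \<times> X)) \<pi>"
    and "\<And>n. borel_prob (top_of_set (X \<times> X)) (\<pi>n n)"
    and "weak_star_conv (top_of_set (X \<times> X)) \<pi>n \<pi>"
    and "\<And>n. Pn n \<in> OTP X \<alpha> (\<pi>n n)"
    and "\<And>n. Pn n \<in> TP X C"
    and "traffic_plan X P"
    and "weak_star_conv (Lip1_topology X) Pn P"
  shows "P \<in> OTP X \<alpha> \<pi> \<and> (\<lambda>n. energy \<alpha> (Pn n)) \<longlonglongrightarrow> energy \<alpha> P"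
proof -
  have X: "compact X" using assms(2) by simp
  have "1 / real DIM('a) \<le> 1" using DIM_positive[where 'a='a] by (simp add: divide_le_eq_1)
  then have \<alpha>: "0 < \<alpha>" using assms(3) by linarith
  have coupn: "has_coupling X (Pn n) (\<pi>n n)" and
    opt: "\<And>P'. traffic_plan X P' \<Longrightarrow> has_coupling X P' (\<pi>n n) \<Longrightarrow> energy \<alpha> (Pn n) \<le> energy \<alpha> P'" for n
    using assms(9)[of n] by (auto simp: OTP_def)
  have coup: "has_coupling X P \<pi>"
    by (rule coupling_of_limit[OF X assms(5,6,8,11,10) coupn assms(12)])
  have lsc: "energy \<alpha> P \<le> liminf (\<lambda>n. energy \<alpha> (Pn n))"
    by (rule energy_lsc[OF X assms(4,5,11,10,12)])
  have upper: "limsup (\<lambda>n. energy \<alpha> (Pn n)) \<le> energy \<alpha> P'" if tp: "traffic_plan X P'" and c: "has_coupling X P' \<pi>" for P'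
  proof (rule ennreal_le_epsilon)
    fix e :: real assume e: "e > 0"
    have "\<forall>\<^sub>F n in sequentially. \<exists>P''. traffic_plan X P'' \<and> has_coupling X P'' (\<pi>n n) \<and> energy \<alpha> P'' \<le> energy \<alpha> P' + ennreal e"
      unfolding assms(2)
      by (rule recovery_sequence[OF assms(1) \<alpha> assms(3,4) _ _ _ _ e])
         (use tp c assms(7,8) in \<open>simp_all add: assms(2)\<close>)
    then have "\<forall>\<^sub>F n in sequentially. energy \<alpha> (Pn n) \<le> energy \<alpha> P' + ennreal e"
      by eventually_elim (meson opt order_trans)
    then show "limsup (\<lambda>n. energy \<alpha> (Pn n)) \<le> energy \<alpha> P' + ennreal e" by (rule Limsup_bounded)
  qed
  have ll: "liminf (\<lambda>n. energy \<alpha> (Pn n)) \<le> limsup (\<lambda>n. energy \<alpha> (Pn n))" by (rule Liminf_le_Limsup) simp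
  have "P \<in> OTP X \<alpha> \<pi>"
    unfolding OTP_def
  proof (intro CollectI conjI allI impI)
    fix P' assume "traffic_plan X P' \<and> has_coupling X P' \<pi>"
    then have "limsup (\<lambda>n. energy \<alpha> (Pn n)) \<le> energy \<alpha> P'" using upper by blast
    then show "energy \<alpha> P \<le> energy \<alpha> P'" using order_trans[OF lsc ll] by (rule order_trans[rotated])
  qed (fact assms(11), fact coup)
  moreover have "(\<lambda>n. energy \<alpha> (Pn n)) \<longlonglongrightarrow> energy \<alpha> P"
  proof (rule Liminf_eq_Limsup)
    show "liminf (\<lambda>n. energy \<alpha> (Pn n)) = energy \<alpha> P"
      using lsc order_trans[OF ll upper[OF assms(11) coup]] by simp
    show "limsup (\<lambda>n. energy \<alpha> (Pn n)) = energy \<alpha> P"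
      using upper[OF assms(11) coup] order_trans[OF lsc ll] by simp
  qed simp
  ultimately show ?thesis ..
qed

end
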